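(* Over $\mathsf{RCA}_0^{\omega}$, each of the following statements (a)--(c) is equivalent to $(\exists^2)$. (a) For any closed $C\subset\mathbb{R}$, the boundary $\partial C$ exists. (b) For any open $O\subset\mathbb{R}$, the boundary $\partial O$ exists. (c) There exists $\mathfrak{B}:(\mathbb{R}\to\mathbb{R})\to(\mathbb{R}\to\mathbb{R})$ such that for any closed $C\subset\mathbb{R}$, $\mathfrak{B}(C)$ equals the boundary $\partial C$. Moreover, the following statements are provable in $\mathsf{RCA}_0^{\omega}+(\exists^2)$. (d) For any open $O\subset\mathbb{R}$, the closure $\overline{O}$ exists and is RM-closed. (e) For any closed $C\subset\mathbb{R}$, the interior $\mathrm{int}(C)$ exists and is RM-open. (f) For any open $O\subset\mathbb{R}$, the distance function $d(x,O)=\inf_{y\in O}|x-y|$ exists.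
   Context: $\mathsf{RCA}_0^{\omega}$ is Kohlenbach's base theory of higher-order Reverse Mathematics: classical logic in the language of all finite types, primitive recursive arithmetic in all finite types (combinators, recursor for type $0$, quantifier-free induction, axiom of extensionality) plus $\mathsf{QF\text{-}AC}^{1,0}$, i.e. for quantifier-free $\varphi$: $(\forall f\in\mathbb{N}^{\mathbb{N}})(\exists n\in\mathbb{N})\varphi(f,n)\to(\exists\Phi:\mathbb{N}^{\mathbb{N}}\to\mathbb{N})(\forall f)\varphi(f,\Phi(f))$. The axiom $(\exists^2)$ is: $(\exists E:\mathbb{N}^{\mathbb{N}}\to\{0,1\})(\forall f\in\mathbb{N}^{\mathbb{N}})\big(E(f)=0\leftrightarrow(\exists n\in\mathbb{N})(f(n)=0)\big)$. Reals are fast-converging Cauchy sequences of rationals with the usual equality $=_{\mathbb{R}}$. A function $F:\mathbb{R}\to\mathbb{R}$ is given by $\Phi:\mathbb{N}^{\mathbb{N}}\to\mathbb{N}^{\mathbb{N}}$ respecting $=_{\mathbb{R}}$. Sets. A set of reals $A$ and its complement $A^c$ are given by a representation function $F_A:\mathbb{R}\to\mathbb{R}^{+}\cup\{0\}$; '$x\in A$' means $F_A(x)>_{\mathbb{R}}0$ and '$x\in A^c$' means $F_A(x)=_{\mathbb{R}}0$. That a set such as $\partial C$, $\overline{O}$ or $\mathrm{int}(C)$ exists means that there is a representation function which is positive exactly on that set. A set $O\subseteq\mathbb{R}$ is open if $x\in O$ implies $B(x,2^{-k})\subseteq O$ for some $k\in\mathbb{N}$, where $B(x,r)$ is the open ball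 with centre $x$ and radius $r$; closed sets are complements of open sets. $O$ is RM-open if there are sequences of reals $(a_n)_{n\in\mathbb{N}},(b_n)_{n\in\mathbb{N}}$ with $x\in O\leftrightarrow x\in\bigcup_n(a_n,b_n)$ for all $x\in\mathbb{R}$; RM-closed sets are complements of RM-open sets. For $E\subset\mathbb{R}$: $x$ is a limit point of $E$ if $(\forall k\in\mathbb{N})(\exists y\in B(x,2^{-k}))(y\neq x\wedge y\in E)$; the closure $\overline{E}$ is $E$ together with all its limit points; $\mathrm{int}(E)=\{x\in E:(\exists N\in\mathbb{N})(B(x,2^{-N})\subset E)\}$; the boundary is $\partial E=\overline{E}\setminus\mathrm{int}(E)$. In (c), $\mathfrak{B}$ takes as input a representation function of (the set) $C$ and outputs a representation function of $\partial C$. *)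

theory Defs
  imports Main
begin

section \<open>Finite types, terms and formulas\<close>

text \<open>
  \<open>RCA\<^sub>0\<^sup>\<omega>\<close> is formalised as a deductive system: many-sorted classical first-order logic, one sort
  for every finite type, with the combinators, application, the recursor for type 0, and equality
  of type 0 as the only predicate.  A variable is a name together with its type.
\<close>

datatype ty = TN | TFun ty ty  (infixr "\<leadsto>" 70)

abbreviation T1 :: ty where "T1 \<equiv> TN \<leadsto> TN"
abbreviation T2 :: ty where "T2 \<equiv> T1 \<leadsto> TN"

datatype tm =
    Var nat ty
  | Zero
  | Succ
  | Comb_K ty ty
  | Comb_S ty ty ty
  | Rec
  | App tm tm  (infixl "\<cdot>" 90)

text \<open>On ill-typed terms the value of \<open>ty_of\<close> is irrelevant.\<close>

fun ty_of :: "tm \<Rightarrow> ty" where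
  "ty_of (Var n \<sigma>) = \<sigma>"
| "ty_of Zero = TN"
| "ty_of Succ = TN \<leadsto> TN"
| "ty_of (Comb_K \<sigma> \<tau>) = \<sigma> \<leadsto> \<tau> \<leadsto> \<sigma>"
| "ty_of (Comb_S \<rho> \<sigma> \<tau>) = (\<rho> \<leadsto> \<sigma> \<leadsto> \<tau>) \<leadsto> (\<rho> \<leadsto> \<sigma>) \<leadsto> \<rho> \<leadsto> \<tau>"
| "ty_of Rec = TN \<leadsto> TN \<leadsto> (TN \<leadsto> TN \<leadsto> TN) \<leadsto> TN"
| "ty_of (s \<cdot> t) = (case ty_of s of \<sigma> \<leadsto> \<tau> \<Rightarrow> \<tau> | TN \<Rightarrow> TN)"

primrec well_typed :: "tm \<Rightarrow> bool" where
  "well_typed (Var n \<sigma>) \<longleftrightarrow> True"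
| "well_typed Zero \<longleftrightarrow> True"
| "well_typed Succ \<longleftrightarrow> True"
| "well_typed (Comb_K \<sigma> \<tau>) \<longleftrightarrow> True"
| "well_typed (Comb_S \<rho> \<sigma> \<tau>) \<longleftrightarrow> True"
| "well_typed Rec \<longleftrightarrow> True"
| "well_typed (s \<cdot> t) \<longleftrightarrow>
     well_typed s \<and> well_typed t \<and> (\<exists>\<tau>. ty_of s = ty_of t \<leadsto> \<tau>)"

primrec tm_vars :: "tm \<Rightarrow> (nat \<times> ty) set" where
  "tm_vars (Var n \<sigma>) = {(n, \<sigma>)}"
| "tm_vars Zero = {}"
| "tm_vars Succ = {}"
| "tm_vars (Comb_K \<sigma> \<tau>) = {}"
| "tm_vars (Comb_S \<rho> \<sigma> \<tau>) = {}"
| "tm_vars Rec = {}"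
| "tm_vars (s \<cdot> t) = tm_vars s \<union> tm_vars t"

primrec tm_subst :: "nat \<Rightarrow> ty \<Rightarrow> tm \<Rightarrow> tm \<Rightarrow> tm" where
  "tm_subst n \<sigma> r (Var m \<tau>) = (if m = n \<and> \<tau> = \<sigma> then r else Var m \<tau>)"
| "tm_subst n \<sigma> r Zero = Zero"
| "tm_subst n \<sigma> r Succ = Succ"
| "tm_subst n \<sigma> r (Comb_K \<tau> \<tau>') = Comb_K \<tau> \<tau>'"
| "tm_subst n \<sigma> r (Comb_S \<rho> \<tau> \<tau>') = Comb_S \<rho> \<tau> \<tau>'"
| "tm_subst n \<sigma> r Rec = Rec"
| "tm_subst n \<sigma> r (s \<cdot> t) = tm_subst n \<sigma> r s \<cdot> tm_subst n \<sigma> r t"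

datatype fm = Bot | Eq tm tm | Imp fm fm | Forall nat ty fm

definition Neg :: "fm \<Rightarrow> fm" where "Neg \<phi> = Imp \<phi> Bot"
definition And :: "fm \<Rightarrow> fm \<Rightarrow> fm" where "And \<phi> \<psi> = Neg (Imp \<phi> (Neg \<psi>))"
definition Or :: "fm \<Rightarrow> fm \<Rightarrow> fm" where "Or \<phi> \<psi> = Imp (Neg \<phi>) \<psi>"
definition Iff :: "fm \<Rightarrow> fm \<Rightarrow> fm" where "Iff \<phi> \<psi> = And (Imp \<phi> \<psi>) (Imp \<psi> \<phi>)"
definition Exists :: "nat \<Rightarrow> ty \<Rightarrow> fm \<Rightarrow> fm" where "Exists n \<sigma> \<phi> = Neg (Forall n \<sigma> (Neg \<phi>))"

primrec wf_fm :: "fm \<Rightarrow> bool" where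
  "wf_fm Bot \<longleftrightarrow> True"
| "wf_fm (Eq s t) \<longleftrightarrow> well_typed s \<and> well_typed t \<and> ty_of s = TN \<and> ty_of t = TN"
| "wf_fm (Imp \<phi> \<psi>) \<longleftrightarrow> wf_fm \<phi> \<and> wf_fm \<psi>"
| "wf_fm (Forall n \<sigma> \<phi>) \<longleftrightarrow> wf_fm \<phi>"

primrec quantifier_free :: "fm \<Rightarrow> bool" where
  "quantifier_free Bot \<longleftrightarrow> True"
| "quantifier_free (Eq s t) \<longleftrightarrow> True"
| "quantifier_free (Imp \<phi> \<psi>) \<longleftrightarrow> quantifier_free \<phi> \<and> quantifier_free \<psi>"
| "quantifier_free (Forall n \<sigma> \<phi>) \<longleftrightarrow> False"

primrec free_vars :: "fm \<Rightarrow> (nat \<times> ty) set" where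
  "free_vars Bot = {}"
| "free_vars (Eq s t) = tm_vars s \<union> tm_vars t"
| "free_vars (Imp \<phi> \<psi>) = free_vars \<phi> \<union> free_vars \<psi>"
| "free_vars (Forall n \<sigma> \<phi>) = free_vars \<phi> - {(n, \<sigma>)}"

text \<open>Naive substitution; it is only used where \<open>free_for\<close> rules out variable capture.\<close>

primrec fm_subst :: "nat \<Rightarrow> ty \<Rightarrow> tm \<Rightarrow> fm \<Rightarrow> fm" where
  "fm_subst n \<sigma> r Bot = Bot"
| "fm_subst n \<sigma> r (Eq s t) = Eq (tm_subst n \<sigma> r s) (tm_subst n \<sigma> r t)"
| "fm_subst n \<sigma> r (Imp \<phi> \<psi>) = Imp (fm_subst n \<sigma> r \<phi>) (fm_subst n \<sigma> r \<psi>)"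
| "fm_subst n \<sigma> r (Forall m \<tau> \<phi>) =
     Forall m \<tau> (if m = n \<and> \<tau> = \<sigma> then \<phi> else fm_subst n \<sigma> r \<phi>)"

primrec free_for :: "tm \<Rightarrow> nat \<Rightarrow> ty \<Rightarrow> fm \<Rightarrow> bool" where
  "free_for r n \<sigma> Bot \<longleftrightarrow> True"
| "free_for r n \<sigma> (Eq s t) \<longleftrightarrow> True"
| "free_for r n \<sigma> (Imp \<phi> \<psi>) \<longleftrightarrow> free_for r n \<sigma> \<phi> \<and> free_for r n \<sigma> \<psi>"
| "free_for r n \<sigma> (Forall m \<tau> \<phi>) \<longleftrightarrow>
     (n, \<sigma>) \<notin> free_vars (Forall m \<tau> \<phi>) \<or> (m, \<tau>) \<notin> tm_vars r \<and> free_for r n \<sigma> \<phi>"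


section \<open>Classical natural deduction over a set of axioms\<close>

text \<open>
  Axioms may be open formulas; since \<open>AllI\<close> only restricts the variables of the assumptions,
  an axiom is as strong as its universal closure.
\<close>

inductive derives :: "fm set \<Rightarrow> fm set \<Rightarrow> fm \<Rightarrow> bool" for T :: "fm set" where
  Axiom: "\<phi> \<in> T \<Longrightarrow> derives T \<Gamma> \<phi>"
| Assm: "\<phi> \<in> \<Gamma> \<Longrightarrow> derives T \<Gamma> \<phi>"
| ImpI: "wf_fm \<phi> \<Longrightarrow> derives T (insert \<phi> \<Gamma>) \<psi> \<Longrightarrow> derives T \<Gamma> (Imp \<phi> \<psi>)"
| ImpE: "derives T \<Gamma> (Imp \<phi> \<psi>) \<Longrightarrow> derives T \<Gamma> \<phi> \<Longrightarrow> derives T \<Gamma> \<psi>"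
| Classical: "wf_fm \<phi> \<Longrightarrow> derives T (insert (Neg \<phi>) \<Gamma>) Bot \<Longrightarrow> derives T \<Gamma> \<phi>"
| AllI: "derives T \<Gamma> \<phi> \<Longrightarrow> (\<forall>\<psi>\<in>\<Gamma>. (n, \<sigma>) \<notin> free_vars \<psi>) \<Longrightarrow> derives T \<Gamma> (Forall n \<sigma> \<phi>)"
| AllE: "derives T \<Gamma> (Forall n \<sigma> \<phi>) \<Longrightarrow> well_typed t \<Longrightarrow> ty_of t = \<sigma> \<Longrightarrow> free_for t n \<sigma> \<phi> \<Longrightarrow>
     derives T \<Gamma> (fm_subst n \<sigma> t \<phi>)"

definition provable :: "fm set \<Rightarrow> fm \<Rightarrow> bool"  (infix "\<turnstile>" 50) where
  "T \<turnstile> \<phi> \<longleftrightarrow> derives T {} \<phi>"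


section \<open>Higher-order notation for formulas\<close>

text \<open>
  A formula is written as a function of the number \<open>d\<close> of enclosing quantifiers, and the
  quantifier at depth \<open>d\<close> binds the variable with name \<open>d\<close>.  Hence nested quantifiers always
  have distinct names and arguments of defined predicates are never captured.
\<close>

type_synonym dfm = "nat \<Rightarrow> fm"

definition sentence :: "dfm \<Rightarrow> fm" where "sentence \<phi> = \<phi> 0"

definition eq0 :: "tm \<Rightarrow> tm \<Rightarrow> dfm"  (infix "\<^bold>=" 50) where
  "(s \<^bold>= t) = (\<lambda>d. Eq s t)"
definition d_neg :: "dfm \<Rightarrow> dfm"  ("\<^bold>\<not> _" [40] 40) where
  "(\<^bold>\<not> \<phi>) = (\<lambda>d. Neg (\<phi> d))"
definition d_and :: "dfm \<Rightarrow> dfm \<Rightarrow> dfm"  (infixr "\<^bold>\<and>" 35) where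
  "(\<phi> \<^bold>\<and> \<psi>) = (\<lambda>d. And (\<phi> d) (\<psi> d))"
definition d_or :: "dfm \<Rightarrow> dfm \<Rightarrow> dfm"  (infixr "\<^bold>\<or>" 30) where
  "(\<phi> \<^bold>\<or> \<psi>) = (\<lambda>d. Or (\<phi> d) (\<psi> d))"
definition d_imp :: "dfm \<Rightarrow> dfm \<Rightarrow> dfm"  (infixr "\<^bold>\<longrightarrow>" 25) where
  "(\<phi> \<^bold>\<longrightarrow> \<psi>) = (\<lambda>d. Imp (\<phi> d) (\<psi> d))"
definition d_iff :: "dfm \<Rightarrow> dfm \<Rightarrow> dfm"  (infixr "\<^bold>\<longleftrightarrow>" 25) where
  "(\<phi> \<^bold>\<longleftrightarrow> \<psi>) = (\<lambda>d. Iff (\<phi> d) (\<psi> d))"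
definition all_ty :: "ty \<Rightarrow> (tm \<Rightarrow> dfm) \<Rightarrow> dfm" where
  "all_ty \<sigma> P = (\<lambda>d. Forall d \<sigma> (P (Var d \<sigma>) (Suc d)))"
definition ex_ty :: "ty \<Rightarrow> (tm \<Rightarrow> dfm) \<Rightarrow> dfm" where
  "ex_ty \<sigma> P = (\<lambda>d. Exists d \<sigma> (P (Var d \<sigma>) (Suc d)))"
definition all_nat :: "(tm \<Rightarrow> dfm) \<Rightarrow> dfm"  (binder "\<^bold>\<forall>" 10) where
  "(\<^bold>\<forall>n. P n) = all_ty TN P"
definition ex_nat :: "(tm \<Rightarrow> dfm) \<Rightarrow> dfm"  (binder "\<^bold>\<exists>" 10) where
  "(\<^bold>\<exists>n. P n) = ex_ty TN P"

text \<open>Equality of higher type is pointwise equality.\<close>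

primrec eq_ty :: "ty \<Rightarrow> tm \<Rightarrow> tm \<Rightarrow> dfm" where
  "eq_ty TN s t = (s \<^bold>= t)"
| "eq_ty (\<sigma> \<leadsto> \<tau>) s t = all_ty \<sigma> (\<lambda>x. eq_ty \<tau> (s \<cdot> x) (t \<cdot> x))"


section \<open>The base theory\<close>

inductive_set RCA0_omega :: "fm set" where
  eq_refl: "sentence (\<^bold>\<forall>x. x \<^bold>= x) \<in> RCA0_omega"
| eq_sym: "sentence (\<^bold>\<forall>x. \<^bold>\<forall>y. x \<^bold>= y \<^bold>\<longrightarrow> y \<^bold>= x) \<in> RCA0_omega"
| eq_trans: "sentence (\<^bold>\<forall>x. \<^bold>\<forall>y. \<^bold>\<forall>z. x \<^bold>= y \<^bold>\<longrightarrow> y \<^bold>= z \<^bold>\<longrightarrow> x \<^bold>= z) \<in> RCA0_omega"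
| Succ_nonzero: "sentence (\<^bold>\<forall>x. \<^bold>\<not> Succ \<cdot> x \<^bold>= Zero) \<in> RCA0_omega"
| Succ_inj: "sentence (\<^bold>\<forall>x. \<^bold>\<forall>y. Succ \<cdot> x \<^bold>= Succ \<cdot> y \<^bold>\<longrightarrow> x \<^bold>= y) \<in> RCA0_omega"
| Comb_K: "sentence (all_ty \<sigma> (\<lambda>x. all_ty \<tau> (\<lambda>y.
     eq_ty \<sigma> (Comb_K \<sigma> \<tau> \<cdot> x \<cdot> y) x))) \<in> RCA0_omega"
| Comb_S: "sentence (all_ty (\<rho> \<leadsto> \<sigma> \<leadsto> \<tau>) (\<lambda>x. all_ty (\<rho> \<leadsto> \<sigma>) (\<lambda>y. all_ty \<rho> (\<lambda>z.
     eq_ty \<tau> (Comb_S \<rho> \<sigma> \<tau> \<cdot> x \<cdot> y \<cdot> z) (x \<cdot> z \<cdot> (y \<cdot> z)))))) \<in> RCA0_omega"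
| Rec_Zero: "sentence (\<^bold>\<forall>y. all_ty (TN \<leadsto> TN \<leadsto> TN) (\<lambda>z.
     Rec \<cdot> Zero \<cdot> y \<cdot> z \<^bold>= y)) \<in> RCA0_omega"
| Rec_Succ: "sentence (\<^bold>\<forall>x. \<^bold>\<forall>y. all_ty (TN \<leadsto> TN \<leadsto> TN) (\<lambda>z.
     Rec \<cdot> (Succ \<cdot> x) \<cdot> y \<cdot> z \<^bold>= z \<cdot> (Rec \<cdot> x \<cdot> y \<cdot> z) \<cdot> x)) \<in> RCA0_omega"
| extensionality: "sentence (all_ty (\<sigma> \<leadsto> \<tau>) (\<lambda>z. all_ty \<sigma> (\<lambda>x. all_ty \<sigma> (\<lambda>y.
     eq_ty \<sigma> x y \<^bold>\<longrightarrow> eq_ty \<tau> (z \<cdot> x) (z \<cdot> y))))) \<in> RCA0_omega"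
| QF_induction: "wf_fm \<phi> \<Longrightarrow> quantifier_free \<phi> \<Longrightarrow>
     Imp (fm_subst n TN Zero \<phi>)
       (Imp (Forall n TN (Imp \<phi> (fm_subst n TN (Succ \<cdot> Var n TN) \<phi>)))
         (Forall n TN \<phi>)) \<in> RCA0_omega"
| QF_AC_1_0: "wf_fm \<phi> \<Longrightarrow> quantifier_free \<phi> \<Longrightarrow> (k, T2) \<notin> free_vars \<phi> \<Longrightarrow>
     Imp (Forall i T1 (Exists j TN \<phi>))
       (Exists k T2 (Forall i T1 (fm_subst j TN (Var k T2 \<cdot> Var i T1) \<phi>))) \<in> RCA0_omega"

definition exists_two :: dfm where
  "exists_two =
     ex_ty T2 (\<lambda>E. all_ty T1 (\<lambda>f.
       (E \<cdot> f \<^bold>= Zero \<^bold>\<or> E \<cdot> f \<^bold>= Succ \<cdot> Zero) \<^bold>\<and>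
       (E \<cdot> f \<^bold>= Zero \<^bold>\<longleftrightarrow> (\<^bold>\<exists>n. f \<cdot> n \<^bold>= Zero))))"


section \<open>Primitive recursive arithmetic\<close>

text \<open>
  \<open>lam n \<sigma> t\<close> is the term for the function mapping the variable with name \<open>n\<close> and type \<open>\<sigma>\<close>
  to \<open>t\<close>, obtained by the usual bracket abstraction.  The last case below is the variable itself.
\<close>

fun lam :: "nat \<Rightarrow> ty \<Rightarrow> tm \<Rightarrow> tm" where
  "lam n \<sigma> t =
     (if (n, \<sigma>) \<notin> tm_vars t then Comb_K (ty_of t) \<sigma> \<cdot> t
      else case t of
        r \<cdot> s \<Rightarrow> Comb_S \<sigma> (ty_of s) (ty_of t) \<cdot> lam n \<sigma> r \<cdot> lam n \<sigma> s
      | _ \<Rightarrow> Comb_S \<sigma> (\<sigma> \<leadsto> \<sigma>) \<sigma> \<cdot> Comb_K \<sigma> (\<sigma> \<leadsto> \<sigma>) \<cdot> Comb_K \<sigma> \<sigma>)"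

declare lam.simps [simp del]

abbreviation V :: "nat \<Rightarrow> tm" where "V n \<equiv> Var n TN"
abbreviation V1 :: "nat \<Rightarrow> tm" where "V1 n \<equiv> Var n T1"
abbreviation lamN :: "nat \<Rightarrow> tm \<Rightarrow> tm" where "lamN n t \<equiv> lam n TN t"

text \<open>
  Each operation is a closed term, with a notation for its application.  In the step function of
  the recursor the first argument is the previous value and the second one the index.
\<close>

definition pred_tm :: tm where
  "pred_tm = lamN 0 (Rec \<cdot> V 0 \<cdot> Zero \<cdot> lamN 1 (lamN 2 (V 2)))"
abbreviation npred :: "tm \<Rightarrow> tm" where "npred s \<equiv> pred_tm \<cdot> s"

definition add_tm :: tm where
  "add_tm = lamN 0 (lamN 1 (Rec \<cdot> V 1 \<cdot> V 0 \<cdot> lamN 2 (lamN 3 (Succ \<cdot> V 2))))"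
abbreviation nadd :: "tm \<Rightarrow> tm \<Rightarrow> tm"  (infixl "\<^bold>+" 65) where "s \<^bold>+ t \<equiv> add_tm \<cdot> s \<cdot> t"

definition mult_tm :: tm where
  "mult_tm = lamN 0 (lamN 1 (Rec \<cdot> V 1 \<cdot> Zero \<cdot> lamN 2 (lamN 3 (V 2 \<^bold>+ V 0))))"
abbreviation nmult :: "tm \<Rightarrow> tm \<Rightarrow> tm"  (infixl "\<^bold>*" 70) where "s \<^bold>* t \<equiv> mult_tm \<cdot> s \<cdot> t"

text \<open>Truncated subtraction\<close>

definition monus_tm :: tm where
  "monus_tm = lamN 0 (lamN 1 (Rec \<cdot> V 1 \<cdot> V 0 \<cdot> lamN 2 (lamN 3 (npred (V 2)))))"
abbreviation nmonus :: "tm \<Rightarrow> tm \<Rightarrow> tm"  (infixl "\<^bold>-" 65) where "s \<^bold>- t \<equiv> monus_tm \<cdot> s \<cdot> t"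

definition pow2_tm :: tm where
  "pow2_tm = lamN 0 (Rec \<cdot> V 0 \<cdot> (Succ \<cdot> Zero) \<cdot> lamN 1 (lamN 2 (V 1 \<^bold>+ V 1)))"

definition le_nat :: "tm \<Rightarrow> tm \<Rightarrow> dfm" where "le_nat s t = (s \<^bold>- t \<^bold>= Zero)"
definition less_nat :: "tm \<Rightarrow> tm \<Rightarrow> dfm" where "less_nat s t = ((Succ \<cdot> s) \<^bold>- t \<^bold>= Zero)"

text \<open>
  Cantor pairing: the code of \<open>(a, b)\<close> is \<open>triangle (a + b) + a\<close>, and \<open>root\<close> computes the largest
  \<open>s\<close> with \<open>triangle s \<le> c\<close>.
\<close>

definition triangle_tm :: tm where
  "triangle_tm = lamN 0 (Rec \<cdot> V 0 \<cdot> Zero \<cdot> lamN 1 (lamN 2 (V 1 \<^bold>+ (Succ \<cdot> V 2))))"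

definition pair_tm :: tm where
  "pair_tm = lamN 0 (lamN 1 ((triangle_tm \<cdot> (V 0 \<^bold>+ V 1)) \<^bold>+ V 0))"
abbreviation npair :: "tm \<Rightarrow> tm \<Rightarrow> tm" where "npair s t \<equiv> pair_tm \<cdot> s \<cdot> t"

definition root_tm :: tm where
  "root_tm = lamN 0 (Rec \<cdot> V 0 \<cdot> Zero \<cdot> lamN 1 (lamN 2
     (V 1 \<^bold>+ ((Succ \<cdot> Zero) \<^bold>- ((triangle_tm \<cdot> (Succ \<cdot> V 1)) \<^bold>- (Succ \<cdot> V 2))))))"

definition fst_tm :: tm where
  "fst_tm = lamN 0 (V 0 \<^bold>- (triangle_tm \<cdot> (root_tm \<cdot> V 0)))"
abbreviation nfst :: "tm \<Rightarrow> tm" where "nfst s \<equiv> fst_tm \<cdot> s"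

definition snd_tm :: tm where
  "snd_tm = lamN 0 ((root_tm \<cdot> V 0) \<^bold>- nfst (V 0))"
abbreviation nsnd :: "tm \<Rightarrow> tm" where "nsnd s \<equiv> snd_tm \<cdot> s"


section \<open>Rational and real numbers\<close>

text \<open>
  Every natural number codes a rational: the code \<open>\<langle>\<langle>a, b\<rangle>, c\<rangle>\<close> stands for \<open>(a - b) / (c + 1)\<close>.
\<close>

abbreviation qpos :: "tm \<Rightarrow> tm" where "qpos q \<equiv> nfst (nfst q)"
abbreviation qneg :: "tm \<Rightarrow> tm" where "qneg q \<equiv> nsnd (nfst q)"
abbreviation qden :: "tm \<Rightarrow> tm" where "qden q \<equiv> Succ \<cdot> nsnd q"

definition qadd_tm :: tm where
  "qadd_tm = lamN 0 (lamN 1 (npair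
     (npair ((qpos (V 0) \<^bold>* qden (V 1)) \<^bold>+ (qpos (V 1) \<^bold>* qden (V 0)))
            ((qneg (V 0) \<^bold>* qden (V 1)) \<^bold>+ (qneg (V 1) \<^bold>* qden (V 0))))
     (npred (qden (V 0) \<^bold>* qden (V 1)))))"
abbreviation qadd :: "tm \<Rightarrow> tm \<Rightarrow> tm" where "qadd p q \<equiv> qadd_tm \<cdot> p \<cdot> q"

definition quminus_tm :: tm where
  "quminus_tm = lamN 0 (npair (npair (qneg (V 0)) (qpos (V 0))) (nsnd (V 0)))"
abbreviation qsub :: "tm \<Rightarrow> tm \<Rightarrow> tm" where "qsub p q \<equiv> qadd p (quminus_tm \<cdot> q)"

definition qabs_tm :: tm where
  "qabs_tm = lamN 0 (npair
     (npair ((qpos (V 0) \<^bold>- qneg (V 0)) \<^bold>+ (qneg (V 0) \<^bold>- qpos (V 0))) Zero) (nsnd (V 0)))"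
abbreviation qabs :: "tm \<Rightarrow> tm" where "qabs q \<equiv> qabs_tm \<cdot> q"

definition qle :: "tm \<Rightarrow> tm \<Rightarrow> dfm" where
  "qle p q = le_nat ((qpos p \<^bold>* qden q) \<^bold>+ (qneg q \<^bold>* qden p)) ((qpos q \<^bold>* qden p) \<^bold>+ (qneg p \<^bold>* qden q))"
definition qless :: "tm \<Rightarrow> tm \<Rightarrow> dfm" where
  "qless p q = less_nat ((qpos p \<^bold>* qden q) \<^bold>+ (qneg q \<^bold>* qden p)) ((qpos q \<^bold>* qden p) \<^bold>+ (qneg p \<^bold>* qden q))"

text \<open>The rationals \<open>0\<close>, \<open>2\<^sup>-\<^sup>n\<close> and \<open>2 \<cdot> 2\<^sup>-\<^sup>n\<close>\<close>

definition qzero :: tm where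
  "qzero = npair (npair Zero Zero) Zero"
definition qinvpow2 :: "tm \<Rightarrow> tm" where
  "qinvpow2 n = npair (npair (Succ \<cdot> Zero) Zero) (npred (pow2_tm \<cdot> n))"
definition qtwice_invpow2 :: "tm \<Rightarrow> tm" where
  "qtwice_invpow2 n = npair (npair (Succ \<cdot> (Succ \<cdot> Zero)) Zero) (npred (pow2_tm \<cdot> n))"

text \<open>
  Reals are the sequences \<open>x\<close> of rationals with \<open>\<bar>x\<^sub>n - x\<^sub>n\<^sub>+\<^sub>i\<bar> < 2\<^sup>-\<^sup>n\<close>.  Equality is
  \<open>\<bar>x\<^sub>n - y\<^sub>n\<bar> \<le> 2\<^sup>-\<^sup>n\<^sup>+\<^sup>1\<close> for all \<open>n\<close>, and \<open>x \<le> y\<close> is \<open>x\<^sub>n \<le> y\<^sub>n + 2\<^sup>-\<^sup>n\<^sup>+\<^sup>1\<close> for all \<open>n\<close>.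
\<close>

definition is_real :: "tm \<Rightarrow> dfm" where
  "is_real x = (\<^bold>\<forall>n. \<^bold>\<forall>i. qless (qabs (qsub (x \<cdot> n) (x \<cdot> (n \<^bold>+ i)))) (qinvpow2 n))"
definition req :: "tm \<Rightarrow> tm \<Rightarrow> dfm"  (infix "=\<^sub>R" 50) where
  "(x =\<^sub>R y) = (\<^bold>\<forall>n. qle (qabs (qsub (x \<cdot> n) (y \<cdot> n))) (qtwice_invpow2 n))"
definition rle :: "tm \<Rightarrow> tm \<Rightarrow> dfm"  (infix "\<le>\<^sub>R" 50) where
  "(x \<le>\<^sub>R y) = (\<^bold>\<forall>n. qle (x \<cdot> n) (qadd (y \<cdot> n) (qtwice_invpow2 n)))"
definition rless :: "tm \<Rightarrow> tm \<Rightarrow> dfm"  (infix "<\<^sub>R" 50) where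
  "(x <\<^sub>R y) = (\<^bold>\<not> y \<le>\<^sub>R x)"

text \<open>
  Constant sequences, and the operations \<open>(x - y)\<^sub>n = x\<^sub>n\<^sub>+\<^sub>1 - y\<^sub>n\<^sub>+\<^sub>1\<close> and \<open>\<bar>x\<bar>\<^sub>n = \<bar>x\<^sub>n\<bar>\<close>; the shift
  of the index keeps the rate of convergence.
\<close>

definition rconst_tm :: tm where
  "rconst_tm = lamN 0 (lamN 1 (V 0))"
abbreviation rconst :: "tm \<Rightarrow> tm" where "rconst q \<equiv> rconst_tm \<cdot> q"

definition rsub_tm :: tm where
  "rsub_tm = lam 0 T1 (lam 1 T1 (lamN 2 (qsub (V1 0 \<cdot> (Succ \<cdot> V 2)) (V1 1 \<cdot> (Succ \<cdot> V 2)))))"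
abbreviation rsub :: "tm \<Rightarrow> tm \<Rightarrow> tm" where "rsub x y \<equiv> rsub_tm \<cdot> x \<cdot> y"

definition rabs_tm :: tm where
  "rabs_tm = lam 0 T1 (lamN 1 (qabs (V1 0 \<cdot> V 1)))"
abbreviation rabs :: "tm \<Rightarrow> tm" where "rabs x \<equiv> rabs_tm \<cdot> x"

abbreviation rzero :: tm where "rzero \<equiv> rconst qzero"
abbreviation rinvpow2 :: "tm \<Rightarrow> tm" where "rinvpow2 k \<equiv> rconst (qinvpow2 k)"
definition rdist :: "tm \<Rightarrow> tm \<Rightarrow> tm" where
  "rdist x y = rabs (rsub x y)"

definition all_real :: "(tm \<Rightarrow> dfm) \<Rightarrow> dfm"  (binder "\<^bold>\<forall>\<^sub>R" 10) where
  "(\<^bold>\<forall>\<^sub>Rx. P x) = all_ty T1 (\<lambda>x. is_real x \<^bold>\<longrightarrow> P x)"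
definition ex_real :: "(tm \<Rightarrow> dfm) \<Rightarrow> dfm"  (binder "\<^bold>\<exists>\<^sub>R" 10) where
  "(\<^bold>\<exists>\<^sub>Rx. P x) = ex_ty T1 (\<lambda>x. is_real x \<^bold>\<and> P x)"

abbreviation TRR :: ty where "TRR \<equiv> T1 \<leadsto> T1"

definition is_real_fun :: "tm \<Rightarrow> dfm" where
  "is_real_fun F =
     ((\<^bold>\<forall>\<^sub>Rx. is_real (F \<cdot> x)) \<^bold>\<and> (\<^bold>\<forall>\<^sub>Rx. \<^bold>\<forall>\<^sub>Ry. x =\<^sub>R y \<^bold>\<longrightarrow> F \<cdot> x =\<^sub>R F \<cdot> y))"
definition real_fun_eq :: "tm \<Rightarrow> tm \<Rightarrow> dfm" where
  "real_fun_eq F G = (\<^bold>\<forall>\<^sub>Rx. F \<cdot> x =\<^sub>R G \<cdot> x)"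
definition all_real_fun :: "(tm \<Rightarrow> dfm) \<Rightarrow> dfm"  (binder "\<^bold>\<forall>\<^sub>F" 10) where
  "(\<^bold>\<forall>\<^sub>FF. P F) = all_ty TRR (\<lambda>F. is_real_fun F \<^bold>\<longrightarrow> P F)"
definition ex_real_fun :: "(tm \<Rightarrow> dfm) \<Rightarrow> dfm"  (binder "\<^bold>\<exists>\<^sub>F" 10) where
  "(\<^bold>\<exists>\<^sub>FF. P F) = ex_ty TRR (\<lambda>F. is_real_fun F \<^bold>\<and> P F)"


section \<open>Sets of reals\<close>

text \<open>
  Predicates on reals are functions from terms to formulas.  A function with values in
  \<open>\<real>\<^sup>+ \<union> {0}\<close> represents the set where it is positive and, at the same time, the complement of
  that set, where it vanishes.
\<close>

type_synonym rpred = "tm \<Rightarrow> dfm"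

definition nonneg_fun :: "tm \<Rightarrow> dfm" where
  "nonneg_fun F = (\<^bold>\<forall>\<^sub>Rx. rzero \<le>\<^sub>R F \<cdot> x)"
definition pos_set :: "tm \<Rightarrow> rpred" where
  "pos_set F x = (rzero <\<^sub>R F \<cdot> x)"
definition zero_set :: "tm \<Rightarrow> rpred" where
  "zero_set F x = (F \<cdot> x =\<^sub>R rzero)"

definition represents :: "tm \<Rightarrow> rpred \<Rightarrow> dfm" where
  "represents G P = (nonneg_fun G \<^bold>\<and> (\<^bold>\<forall>\<^sub>Rx. pos_set G x \<^bold>\<longleftrightarrow> P x))"
definition set_exists :: "rpred \<Rightarrow> dfm" where
  "set_exists P = (\<^bold>\<exists>\<^sub>FG. represents G P)"

definition in_ball :: "tm \<Rightarrow> tm \<Rightarrow> rpred" where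
  "in_ball x r y = (rdist x y <\<^sub>R r)"

definition limit_point :: "rpred \<Rightarrow> rpred" where
  "limit_point P x =
     (\<^bold>\<forall>k. \<^bold>\<exists>\<^sub>Ry. in_ball x (rinvpow2 k) y \<^bold>\<and> (\<^bold>\<not> y =\<^sub>R x) \<^bold>\<and> P y)"
definition closure_set :: "rpred \<Rightarrow> rpred" where
  "closure_set P x = (P x \<^bold>\<or> limit_point P x)"
definition ball_inside :: "rpred \<Rightarrow> rpred" where
  "ball_inside P x = (\<^bold>\<exists>k. \<^bold>\<forall>\<^sub>Ry. in_ball x (rinvpow2 k) y \<^bold>\<longrightarrow> P y)"
definition interior_set :: "rpred \<Rightarrow> rpred" where
  "interior_set P x = (P x \<^bold>\<and> ball_inside P x)"
definition boundary_set :: "rpred \<Rightarrow> rpred" where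
  "boundary_set P x = (closure_set P x \<^bold>\<and> (\<^bold>\<not> interior_set P x))"

definition is_open_set :: "rpred \<Rightarrow> dfm" where
  "is_open_set P = (\<^bold>\<forall>\<^sub>Rx. P x \<^bold>\<longrightarrow> ball_inside P x)"

text \<open>Sequences of reals have type \<open>TN \<leadsto> T1\<close>.\<close>

definition RM_open :: "rpred \<Rightarrow> dfm" where
  "RM_open P =
     ex_ty (TN \<leadsto> T1) (\<lambda>a. ex_ty (TN \<leadsto> T1) (\<lambda>b.
       (\<^bold>\<forall>n. is_real (a \<cdot> n) \<^bold>\<and> is_real (b \<cdot> n)) \<^bold>\<and>
       (\<^bold>\<forall>\<^sub>Rx. P x \<^bold>\<longleftrightarrow> (\<^bold>\<exists>n. a \<cdot> n <\<^sub>R x \<^bold>\<and> x <\<^sub>R b \<cdot> n))))"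
definition RM_closed :: "rpred \<Rightarrow> dfm" where
  "RM_closed P = RM_open (\<lambda>x. \<^bold>\<not> P x)"

definition open_rep :: "tm \<Rightarrow> dfm" where
  "open_rep F = (nonneg_fun F \<^bold>\<and> is_open_set (pos_set F))"

text \<open>
  An open set is given by a representation function that is positive exactly on it.  A closed set
  is the complement of an open set \<open>O\<close> and is given by the same function as \<open>O\<close>, i.e. it is the
  zero set of that function.  (Requiring a function positive exactly on the closed set would be a
  different notion over the base theory: when \<open>(\<exists>\<^sup>2)\<close> fails all functions on the reals are
  continuous, so such a set is clopen and its boundary is trivially the empty set.)
\<close>

definition for_all_open :: "(rpred \<Rightarrow> dfm) \<Rightarrow> dfm" where
  "for_all_open Q = (\<^bold>\<forall>\<^sub>FF. open_rep F \<^bold>\<longrightarrow> Q (pos_set F))"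
definition for_all_closed :: "(rpred \<Rightarrow> dfm) \<Rightarrow> dfm" where
  "for_all_closed Q = (\<^bold>\<forall>\<^sub>FF. open_rep F \<^bold>\<longrightarrow> Q (zero_set F))"


section \<open>The statements\<close>

definition stmt_a :: dfm where
  "stmt_a = for_all_closed (\<lambda>C. set_exists (boundary_set C))"

definition stmt_b :: dfm where
  "stmt_b = for_all_open (\<lambda>U. set_exists (boundary_set U))"

text \<open>A map on functions on the reals has to respect equality of such functions.\<close>

definition is_real_functional :: "tm \<Rightarrow> dfm" where
  "is_real_functional B =
     ((\<^bold>\<forall>\<^sub>FF. is_real_fun (B \<cdot> F)) \<^bold>\<and>
      (\<^bold>\<forall>\<^sub>FF. \<^bold>\<forall>\<^sub>FG. real_fun_eq F G \<^bold>\<longrightarrow> real_fun_eq (B \<cdot> F) (B \<cdot> G)))"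

definition stmt_c :: dfm where
  "stmt_c =
     ex_ty (TRR \<leadsto> TRR) (\<lambda>B. is_real_functional B \<^bold>\<and>
       (\<^bold>\<forall>\<^sub>FF. open_rep F \<^bold>\<longrightarrow> represents (B \<cdot> F) (boundary_set (zero_set F))))"

definition stmt_d :: dfm where
  "stmt_d = for_all_open (\<lambda>U. set_exists (closure_set U) \<^bold>\<and> RM_closed (closure_set U))"

definition stmt_e :: dfm where
  "stmt_e = for_all_closed (\<lambda>C. set_exists (interior_set C) \<^bold>\<and> RM_open (interior_set C))"

text \<open>\<open>r\<close> is the infimum of \<open>\<bar>x - y\<bar>\<close> for \<open>y\<close> in \<open>P\<close>.\<close>

definition is_inf_dist :: "tm \<Rightarrow> rpred \<Rightarrow> tm \<Rightarrow> dfm" where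
  "is_inf_dist x P r =
     ((\<^bold>\<forall>\<^sub>Ry. P y \<^bold>\<longrightarrow> r \<le>\<^sub>R rdist x y) \<^bold>\<and>
      (\<^bold>\<forall>\<^sub>Rz. (\<^bold>\<forall>\<^sub>Ry. P y \<^bold>\<longrightarrow> z \<le>\<^sub>R rdist x y) \<^bold>\<longrightarrow> z \<le>\<^sub>R r))"

text \<open>The infimum over the empty set is not a real number, so the open set is assumed nonempty.\<close>

definition stmt_f :: dfm where
  "stmt_f = for_all_open (\<lambda>U. (\<^bold>\<exists>\<^sub>Ry. U y) \<^bold>\<longrightarrow>
     (\<^bold>\<exists>\<^sub>FD. \<^bold>\<forall>\<^sub>Rx. is_inf_dist x U (D \<cdot> x)))"

end

theory Submission
  imports Defs "HOL-Library.Countable" "HOL-Computational_Algebra.Fraction_Field"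
begin

text \<open>Provability is reduced to truth in Henkin models whose elements are classes of terms. In such a
  model the objects of type \<open>0\<close> form an ordered semiring satisfying induction; its field of fractions
  contains the internal rationals, and limits of internal Cauchy sequences form an ordered ring
  extending it, in which the statements can be read as ordinary mathematics. Given \<open>E\<close> as in the axiom
  \<open>(\<exists>\<^sup>2)\<close>, every formula with only number quantifiers has an internal characteristic function. An open
  set is determined by the rationals it contains and a closed set by those of its complement, so
  boundary, closure, interior and distance are arithmetical. Conversely the boundary of the closed set
  \<open>{0}\<close> has a representation \<open>G\<close> positive exactly at \<open>0\<close>. Let \<open>x\<close> be the limit of \<open>2\<^sup>-\<^sup>m\<close>, where \<open>m\<close> is the
  minimum of \<open>n + 1\<close> and the first zero of \<open>f\<close>. Then \<open>G x\<close> is \<open>0\<close> if \<open>f\<close> has a zero and the positive number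
  \<open>G 0\<close> otherwise, so one rational approximation of \<open>G x\<close> decides which.\<close>

text \<open>Arguing in models avoids writing derivations in the calculus. The price comes from the
  naming discipline of the formulas: a quantifier is named by its depth, so \<open>eq_ty\<close> at
  a type with many arguments uses large names, while the truth lemma covers only formulas whose
  names stay below those of the witnesses. Hence the axioms for combinators and extensionality are
  available only for types of bounded arity. The margin is spent in steps: names below 400, axioms
  up to arity 300, terms with still smaller bounds, because every bracket abstraction may raise the
  bound by three.

  The second obstacle is that the numbers of the model are to be a type with class instances,
  although the existence of a countermodel is only a hypothesis for contradiction. So the type has a
  fallback, the standard numbers, and the laws of arithmetic are proved for both versions.

  The type of limits is formed from all Cauchy sequences, internal or not; quantifiers of the object
  language still range over the internal sequences in \<open>Reals\<close>. An ordered ring is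
  enough, because reals are never divided.\<close>

section \<open>A Henkin construction\<close>

instance ty :: countable by countable_datatype
instance tm :: countable by countable_datatype
instance fm :: countable by countable_datatype

text \<open>Names below \<open>400\<close> are reserved for bound variables, names above for witnesses, so that substituting
  witnesses never captures.\<close>

definition low_bound :: nat where "low_bound = 400"

primrec bound_names :: "fm \<Rightarrow> nat set" where
  "bound_names Bot = {}"
| "bound_names (Eq s t) = {}"
| "bound_names (Imp \<phi> \<psi>) = bound_names \<phi> \<union> bound_names \<psi>"
| "bound_names (Forall n \<sigma> \<phi>) = insert n (bound_names \<phi>)"

definition nice :: "fm \<Rightarrow> bool" where
  "nice \<phi> \<longleftrightarrow> wf_fm \<phi> \<and> (\<forall>v\<in>free_vars \<phi>. low_bound \<le> fst v) \<and> (\<forall>n\<in>bound_names \<phi>. n < low_bound)"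

text \<open>The elements of the term model may contain variables: the witnesses are variables with
  high names, so the language is not extended by new constants.\<close>

definition Obj :: "ty \<Rightarrow> tm set" where
  "Obj \<sigma> = {t. well_typed t \<and> ty_of t = \<sigma> \<and> (\<forall>v\<in>tm_vars t. low_bound \<le> fst v)}"

lemma finite_tm_vars [simp]: "finite (tm_vars t)"
  by (induction t) auto
lemma finite_free_vars [simp]: "finite (free_vars \<phi>)"
  by (induction \<phi>) auto

lemma well_typed_tm_subst:
  "well_typed t \<Longrightarrow> well_typed r \<Longrightarrow> ty_of r = \<sigma> \<Longrightarrow>
   well_typed (tm_subst n \<sigma> r t) \<and> ty_of (tm_subst n \<sigma> r t) = ty_of t"
  by (induction t) (auto split: ty.splits)

lemma wf_fm_subst: "wf_fm \<phi> \<Longrightarrow> well_typed r \<Longrightarrow> ty_of r = \<sigma> \<Longrightarrow> wf_fm (fm_subst n \<sigma> r \<phi>)"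
  by (induction \<phi>) (auto simp: well_typed_tm_subst)

lemma bound_names_subst [simp]: "bound_names (fm_subst n \<sigma> r \<phi>) = bound_names \<phi>"
  by (induction \<phi>) auto

lemma tm_vars_subst: "tm_vars (tm_subst n \<sigma> r t) \<subseteq> (tm_vars t - {(n,\<sigma>)}) \<union> tm_vars r"
  by (induction t) auto

lemma free_vars_subst: "free_vars (fm_subst n \<sigma> r \<phi>) \<subseteq> (free_vars \<phi> - {(n,\<sigma>)}) \<union> tm_vars r"
proof (induction \<phi>)
  case (Eq s t) then show ?case using tm_vars_subst[of n \<sigma> r s] tm_vars_subst[of n \<sigma> r t] by auto
qed auto

lemma tm_subst_back: "(y,\<sigma>) \<notin> tm_vars t \<Longrightarrow> tm_subst y \<sigma> (Var m \<sigma>) (tm_subst m \<sigma> (Var y \<sigma>) t) = t"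
  by (induction t) auto

lemma tm_subst_id: "(y,\<sigma>) \<notin> tm_vars t \<Longrightarrow> tm_subst y \<sigma> r t = t"
  by (induction t) auto

lemma fm_subst_id: "(y,\<sigma>) \<notin> free_vars \<phi> \<Longrightarrow> fm_subst y \<sigma> r \<phi> = \<phi>"
  by (induction \<phi>) (auto simp: tm_subst_id)

text \<open>Serves the witness step: after generalising over the fresh name, instantiation with the
  old variable must give back the original formula.\<close>

lemma fm_subst_back:
  "(y,\<sigma>) \<notin> free_vars \<phi> \<Longrightarrow> y \<notin> bound_names \<phi> \<Longrightarrow>
   fm_subst y \<sigma> (Var m \<sigma>) (fm_subst m \<sigma> (Var y \<sigma>) \<phi>) = \<phi>"
  by (induction \<phi>) (auto simp: tm_subst_back fm_subst_id)

lemma free_for_back: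
  "(y,\<sigma>) \<notin> free_vars \<phi> \<Longrightarrow> y \<notin> bound_names \<phi> \<Longrightarrow>
   free_for (Var m \<sigma>) y \<sigma> (fm_subst m \<sigma> (Var y \<sigma>) \<phi>)"
proof (induction \<phi>)
  case (Forall k \<tau> \<phi>)
  then show ?case by auto
qed auto

lemma free_for_high:
  "\<forall>v\<in>tm_vars r. low_bound \<le> fst v \<Longrightarrow> \<forall>n\<in>bound_names \<phi>. n < low_bound \<Longrightarrow> free_for r n \<sigma> \<phi>"
  by (induction \<phi>) force+

section \<open>Completion of a consistent set with witnesses\<close>

locale henkin_stages =
  fixes T :: "fm set" and \<phi>0 :: fm
  assumes not_prov: "\<not> T \<turnstile> \<phi>0" and wf0: "wf_fm \<phi>0" and closed0: "free_vars \<phi>0 = {}"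
    and low0: "\<forall>n\<in>bound_names \<phi>0. n < low_bound"
begin

abbreviation der (infix "\<tturnstile>" 50) where "\<Gamma> \<tturnstile> \<phi> \<equiv> derives T \<Gamma> \<phi>"

definition con :: "fm set \<Rightarrow> bool" where "con \<Gamma> \<longleftrightarrow> \<not> \<Gamma> \<tturnstile> Bot"

definition fresh :: "fm set \<Rightarrow> ty \<Rightarrow> nat" where
  "fresh \<Gamma> \<sigma> = (SOME y. low_bound \<le> y \<and> (\<forall>\<chi>\<in>\<Gamma>. (y,\<sigma>) \<notin> free_vars \<chi>))"

fun witness :: "fm set \<Rightarrow> fm \<Rightarrow> fm set" where
  "witness \<Gamma> (Forall m \<sigma> \<psi>) = {Neg (fm_subst m \<sigma> (Var (fresh (insert (Forall m \<sigma> \<psi>) \<Gamma>) \<sigma>) \<sigma>) \<psi>)}"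
| "witness \<Gamma> \<psi> = {}"

text \<open>Every formula is enumerated by \<open>from_nat\<close>, so each nice formula is decided
  at the stage after its code. A rejected universal formula receives its counterexample in the same
  step, hence no separate saturation is needed.\<close>

primrec stage :: "nat \<Rightarrow> fm set" where
  "stage 0 = {Neg \<phi>0}"
| "stage (Suc n) = (let \<psi> = from_nat n; \<Gamma> = stage n in
     if \<not> nice \<psi> then \<Gamma> else if con (insert \<psi> \<Gamma>) then insert \<psi> \<Gamma>
     else witness \<Gamma> \<psi> \<union> insert (Neg \<psi>) \<Gamma>)"

lemma fresh:
  assumes "finite \<Gamma>"
  shows "low_bound \<le> fresh \<Gamma> \<sigma> \<and> (\<forall>\<chi>\<in>\<Gamma>. (fresh \<Gamma> \<sigma>,\<sigma>) \<notin> free_vars \<chi>)"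
proof -
  have "finite (fst ` (\<Union>\<chi>\<in>\<Gamma>. free_vars \<chi>) \<union> {..<low_bound})" using assms by simp
  then obtain y where "y \<notin> fst ` (\<Union>\<chi>\<in>\<Gamma>. free_vars \<chi>) \<union> {..<low_bound}"
    using ex_new_if_finite[OF infinite_UNIV_nat] by metis
  then have "low_bound \<le> y" "\<forall>\<chi>\<in>\<Gamma>. (y,\<sigma>) \<notin> free_vars \<chi>" by (simp_all add: image_iff not_less) force
  then have "low_bound \<le> y \<and> (\<forall>\<chi>\<in>\<Gamma>. (y,\<sigma>) \<notin> free_vars \<chi>)" ..
  then show ?thesis unfolding fresh_def by (rule someI)
qed

lemma nice_Neg: "nice \<psi> \<Longrightarrow> nice (Neg \<psi>)"
  by (auto simp: nice_def Neg_def)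

lemma NegI: "wf_fm \<psi> \<Longrightarrow> \<not> con (insert \<psi> \<Gamma>) \<Longrightarrow> \<Gamma> \<tturnstile> Neg \<psi>"
  unfolding con_def Neg_def by (auto intro: derives.ImpI)

lemma NegE: "\<Gamma> \<tturnstile> Neg \<psi> \<Longrightarrow> \<Gamma> \<tturnstile> \<psi> \<Longrightarrow> \<Gamma> \<tturnstile> Bot"
  unfolding Neg_def by (rule derives.ImpE)

text \<open>If the negated instance were inconsistent, the instance at the fresh name would be
  derivable and could be generalised. Renaming back gives the body \<open>a\<close> itself, and
  since all free names of the stage are high while \<open>m\<close> is low, \<open>a\<close> can be
  generalised over \<open>m\<close>, against the rejection of \<psi>.\<close>

lemma witness_ok:
  assumes G: "\<forall>\<chi>\<in>\<Gamma>. nice \<chi>" "finite \<Gamma>" and \<psi>: "nice \<psi>" and c: "con (insert (Neg \<psi>) \<Gamma>)"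
  shows "con (witness \<Gamma> \<psi> \<union> insert (Neg \<psi>) \<Gamma>) \<and> (\<forall>\<chi>\<in>witness \<Gamma> \<psi>. nice \<chi>) \<and> finite (witness \<Gamma> \<psi>)"
proof (cases \<psi>)
  case (Forall m \<sigma> a)
  let ?y = "fresh (insert (Forall m \<sigma> a) \<Gamma>) \<sigma>"
  let ?G = "insert (Neg \<psi>) \<Gamma>"
  have y: "low_bound \<le> ?y" "\<And>\<chi>. \<chi> \<in> insert \<psi> \<Gamma> \<Longrightarrow> (?y,\<sigma>) \<notin> free_vars \<chi>"
    using fresh[of "insert (Forall m \<sigma> a) \<Gamma>" \<sigma>] G Forall by auto
  have m: "m < low_bound" "\<forall>n\<in>bound_names a. n < low_bound" "wf_fm a"
    using \<psi> Forall by (auto simp: nice_def)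
  have ya1: "(?y,\<sigma>) \<notin> free_vars a"
    using y(2)[of \<psi>] y(1) m(1) by (simp add: Forall)
  have ya2: "?y \<notin> bound_names a" using y(1) m(2) leD by blast
  note ya = ya1 ya2
  have fv: "\<forall>v\<in>free_vars (fm_subst m \<sigma> (Var ?y \<sigma>) a). low_bound \<le> fst v"
    using free_vars_subst[of m \<sigma> "Var ?y \<sigma>" a] y(1) \<psi> Forall by (auto simp: nice_def)
  have n1: "nice (fm_subst m \<sigma> (Var ?y \<sigma>) a)"
    unfolding nice_def using fv m by (simp add: wf_fm_subst)
  have "con (insert (Neg (fm_subst m \<sigma> (Var ?y \<sigma>) a)) ?G)"
  proof (rule ccontr)
    assume "\<not> ?thesis"
    then have "?G \<tturnstile> fm_subst m \<sigma> (Var ?y \<sigma>) a"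
      using n1 by (auto simp: con_def nice_def intro: derives.Classical)
    moreover have "\<forall>\<chi>\<in>?G. (?y,\<sigma>) \<notin> free_vars \<chi>" using y(2) by (auto simp: Neg_def)
    ultimately have "?G \<tturnstile> Forall ?y \<sigma> (fm_subst m \<sigma> (Var ?y \<sigma>) a)"
      by (rule derives.AllI)
    then have "?G \<tturnstile> fm_subst ?y \<sigma> (Var m \<sigma>) (fm_subst m \<sigma> (Var ?y \<sigma>) a)"
      by (rule derives.AllE) (simp_all add: free_for_back[OF ya])
    then have "?G \<tturnstile> a" using fm_subst_back[OF ya] by simp
    moreover have "\<forall>\<chi>\<in>?G. (m,\<sigma>) \<notin> free_vars \<chi>"
    proof
      fix \<chi> assume "\<chi> \<in> ?G"
      then have "nice \<chi>" using G(1) nice_Neg[OF \<psi>] by blast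
      then show "(m,\<sigma>) \<notin> free_vars \<chi>" using m(1) unfolding nice_def by (metis fst_conv leD)
    qed
    ultimately have "?G \<tturnstile> \<psi>" unfolding Forall by (rule derives.AllI)
    moreover have "?G \<tturnstile> Neg \<psi>" by (rule derives.Assm) simp
    ultimately show False using c NegE by (auto simp: con_def)
  qed
  then show ?thesis using n1 nice_Neg Forall by (simp add: insert_commute)
qed (use c in auto)

lemma stage_ok: "con (stage n) \<and> (\<forall>\<chi>\<in>stage n. nice \<chi>) \<and> finite (stage n)"
proof (induction n)
  case 0
  have "con {Neg \<phi>0}" using not_prov wf0 unfolding con_def provable_def
    by (auto intro: derives.Classical)
  then show ?case using wf0 closed0 low0 by (auto simp: nice_def Neg_def)
next
  case (Suc n)
  define \<psi> :: fm where "\<psi> = from_nat n"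
  define \<Gamma> where "\<Gamma> = stage n"
  have s: "stage (Suc n) = (if \<not> nice \<psi> then \<Gamma> else if con (insert \<psi> \<Gamma>) then insert \<psi> \<Gamma>
     else witness \<Gamma> \<psi> \<union> insert (Neg \<psi>) \<Gamma>)" by (simp add: \<psi>_def \<Gamma>_def Let_def)
  show ?case
  proof (cases "nice \<psi> \<and> \<not> con (insert \<psi> \<Gamma>)")
    case True
    have wf: "wf_fm \<psi>" using True by (simp add: nice_def)
    have c: "con (insert (Neg \<psi>) \<Gamma>)"
    proof (rule ccontr)
      assume "\<not> ?thesis"
      then have "\<Gamma> \<tturnstile> \<psi>" using wf by (auto simp: con_def intro: derives.Classical)
      moreover have "\<Gamma> \<tturnstile> Neg \<psi>" using NegI wf True by blast
      ultimately show False using Suc NegE by (auto simp: con_def \<Gamma>_def)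
    qed
    show ?thesis using witness_ok[OF _ _ _ c] Suc True s nice_Neg[of \<psi>] by (auto simp: \<Gamma>_def)
  next
    case False
    then show ?thesis using Suc s by (auto simp: \<Gamma>_def)
  qed
qed

definition H :: "fm set" where "H = (\<Union>n. stage n)"

lemma stage_mono: "n \<le> m \<Longrightarrow> stage n \<subseteq> stage m"
proof (induction m)
  case (Suc m)
  have "stage m \<subseteq> stage (Suc m)" by (auto simp: Let_def)
  then show ?case using Suc by (cases "n = Suc m") auto
qed simp

lemma H_stage: "\<phi> \<in> H \<Longrightarrow> \<exists>n. \<forall>m\<ge>n. \<phi> \<in> stage m"
  unfolding H_def using stage_mono by blast

lemma H_cases:
  assumes "nice \<psi>" shows "\<psi> \<in> H \<or> Neg \<psi> \<in> H \<and> (\<forall>m \<sigma> a. \<psi> = Forall m \<sigma> a \<longrightarrow>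
    (\<exists>y\<ge>low_bound. Neg (fm_subst m \<sigma> (Var y \<sigma>) a) \<in> H))"
proof -
  let ?n = "to_nat \<psi>"
  have s: "stage (Suc ?n) = (if con (insert \<psi> (stage ?n)) then insert \<psi> (stage ?n)
     else witness (stage ?n) \<psi> \<union> insert (Neg \<psi>) (stage ?n))" using assms by (simp add: Let_def)
  show ?thesis
  proof (cases "\<psi> \<in> stage (Suc ?n)")
    case True then show ?thesis unfolding H_def by blast
  next
    case False
    then have "stage (Suc ?n) = witness (stage ?n) \<psi> \<union> insert (Neg \<psi>) (stage ?n)"
      using s by (auto split: if_splits)
    then have "Neg \<psi> \<in> stage (Suc ?n)" "witness (stage ?n) \<psi> \<subseteq> stage (Suc ?n)" by blast+
    moreover have "stage (Suc ?n) \<subseteq> H" unfolding H_def by (rule UN_upper) simp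
    ultimately have N: "Neg \<psi> \<in> H" and W: "witness (stage ?n) \<psi> \<subseteq> H" by (blast del: equalityI)+
    have F: "low_bound \<le> fresh (insert \<psi> (stage ?n)) \<sigma>" for \<sigma>
      using fresh[of "insert \<psi> (stage ?n)" \<sigma>] stage_ok by simp
    have "\<exists>y\<ge>low_bound. Neg (fm_subst m \<sigma> (Var y \<sigma>) a) \<in> H" if "\<psi> = Forall m \<sigma> a" for m \<sigma> a
      using W F[of \<sigma>] unfolding that witness.simps by (intro exI[of _ "fresh (insert \<psi> (stage ?n)) \<sigma>"]) (simp add: that)
    then show ?thesis using N by (intro disjI2) simp
  qed
qed

lemma H_con: "\<psi> \<in> H \<Longrightarrow> Neg \<psi> \<in> H \<Longrightarrow> False"
proof -
  assume h: "\<psi> \<in> H" "Neg \<psi> \<in> H"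
  obtain n1 where "\<forall>m\<ge>n1. \<psi> \<in> stage m" using H_stage[OF h(1)] ..
  moreover obtain n2 where "\<forall>m\<ge>n2. Neg \<psi> \<in> stage m" using H_stage[OF h(2)] ..
  ultimately have "stage (max n1 n2) \<tturnstile> \<psi>" "stage (max n1 n2) \<tturnstile> Neg \<psi>"
    by (auto intro: derives.Assm)
  then show False using stage_ok NegE by (auto simp: con_def)
qed

text \<open>If \<psi> were rejected, its negation and a derivation of \<psi> would meet at a late
  stage. Asking for derivability from all late stages replaces the usual passage to finite subsets
  of \<open>H\<close>.\<close>

lemma H_derI:
  assumes "nice \<psi>" "\<And>m. m \<ge> n \<Longrightarrow> stage m \<tturnstile> \<psi>" shows "\<psi> \<in> H"
proof (rule ccontr)
  assume "\<psi> \<notin> H"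
  then have "Neg \<psi> \<in> H" using H_cases assms by blast
  then obtain k where "\<forall>m\<ge>k. Neg \<psi> \<in> stage m" using H_stage by blast
  then have "stage (max n k) \<tturnstile> \<psi>" "stage (max n k) \<tturnstile> Neg \<psi>"
    using assms by (auto intro: derives.Assm)
  then show False using stage_ok NegE by (auto simp: con_def)
qed

lemma H_Bot: "Bot \<notin> H"
proof
  assume "Bot \<in> H"
  then obtain n where "Bot \<in> stage n" by (auto simp: H_def)
  then show False using stage_ok by (auto simp: con_def intro: derives.Assm)
qed

lemma nice_Imp [simp]: "nice (Imp a b) \<longleftrightarrow> nice a \<and> nice b"
  by (auto simp: nice_def)

lemma H_Imp:
  assumes "nice a" "nice b" shows "Imp a b \<in> H \<longleftrightarrow> (a \<in> H \<longrightarrow> b \<in> H)"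
proof
  assume i: "Imp a b \<in> H"
  show "a \<in> H \<longrightarrow> b \<in> H"
  proof
    assume "a \<in> H"
    obtain n1 where n1: "\<forall>m\<ge>n1. a \<in> stage m" using H_stage[OF \<open>a \<in> H\<close>] ..
    obtain n2 where n2: "\<forall>m\<ge>n2. Imp a b \<in> stage m" using H_stage[OF i] ..
    have "stage m \<tturnstile> b" if "max n1 n2 \<le> m" for m
      using that n1 n2 by (intro derives.ImpE[where \<phi>=a and \<psi>=b]) (simp_all add: derives.Assm)
    then show "b \<in> H" by (intro H_derI[where n="max n1 n2"] assms)
  qed
next
  assume r: "a \<in> H \<longrightarrow> b \<in> H"
  have wf: "wf_fm a" "wf_fm b" using assms by (auto simp: nice_def)
  show "Imp a b \<in> H"
  proof (cases "b \<in> H")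
    case True
    then obtain n where "\<forall>m\<ge>n. b \<in> stage m" using H_stage by blast
    then have "stage m \<tturnstile> Imp a b" if "m \<ge> n" for m
      using that by (intro derives.ImpI[OF wf(1) derives.Assm]) simp
    then show ?thesis using assms by (intro H_derI[where n=n]) simp_all
  next
    case False
    then have "Neg a \<in> H" using r H_cases assms by blast
    then obtain n where n: "\<forall>m\<ge>n. Neg a \<in> stage m" using H_stage by blast
    have "insert (Neg b) (insert a (stage m)) \<tturnstile> Bot" if "m \<ge> n" for m
      using n that by (intro NegE[where \<psi>=a, OF derives.Assm derives.Assm]) simp_all
    then have "stage m \<tturnstile> Imp a b" if "m \<ge> n" for m
      using that by (intro derives.ImpI[OF wf(1) derives.Classical[OF wf(2)]]) simp
    then show ?thesis using assms by (intro H_derI[where n=n]) simp_all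
  qed
qed

lemma nice_subst:
  assumes "nice (Forall m \<sigma> a)" "t \<in> Obj \<sigma>" shows "nice (fm_subst m \<sigma> t a)"
  using assms free_vars_subst[of m \<sigma> t a] unfolding nice_def Obj_def
  by (auto simp: wf_fm_subst)

text \<open>The witness of a rejected universal formula is a high variable, hence itself one of the
  objects over which the right side ranges.\<close>

lemma H_Forall:
  assumes n: "nice (Forall m \<sigma> a)"
  shows "Forall m \<sigma> a \<in> H \<longleftrightarrow> (\<forall>t\<in>Obj \<sigma>. fm_subst m \<sigma> t a \<in> H)"
proof
  assume i: "Forall m \<sigma> a \<in> H"
  show "\<forall>t\<in>Obj \<sigma>. fm_subst m \<sigma> t a \<in> H"
  proof
    fix t assume t: "t \<in> Obj \<sigma>"
    obtain k where k: "\<forall>m'\<ge>k. Forall m \<sigma> a \<in> stage m'" using i H_stage by meson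
    show "fm_subst m \<sigma> t a \<in> H"
    proof (rule H_derI[where n=k])
      show "nice (fm_subst m \<sigma> t a)" using nice_subst n t by blast
      fix m' assume "k \<le> m'"
      then have "stage m' \<tturnstile> Forall m \<sigma> a" using k by (auto intro: derives.Assm)
      then show "stage m' \<tturnstile> fm_subst m \<sigma> t a"
        by (rule derives.AllE) (use t n in \<open>auto simp: Obj_def nice_def intro: free_for_high\<close>)
    qed
  qed
next
  assume r: "\<forall>t\<in>Obj \<sigma>. fm_subst m \<sigma> t a \<in> H"
  show "Forall m \<sigma> a \<in> H"
  proof (rule ccontr)
    assume "Forall m \<sigma> a \<notin> H"
    then obtain y where y: "low_bound \<le> y" "Neg (fm_subst m \<sigma> (Var y \<sigma>) a) \<in> H"
      using H_cases[OF n] by blast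
    then have "Var y \<sigma> \<in> Obj \<sigma>" by (auto simp: Obj_def)
    then show False using r y H_con by blast
  qed
qed

end

section \<open>Truth in the term model\<close>

type_synonym env = "nat \<times> ty \<Rightarrow> tm"

primrec tsub :: "env \<Rightarrow> tm \<Rightarrow> tm" where
  "tsub e (Var n \<sigma>) = e (n, \<sigma>)"
| "tsub e Zero = Zero"
| "tsub e Succ = Succ"
| "tsub e (Comb_K \<sigma> \<tau>) = Comb_K \<sigma> \<tau>"
| "tsub e (Comb_S \<rho> \<sigma> \<tau>) = Comb_S \<rho> \<sigma> \<tau>"
| "tsub e Rec = Rec"
| "tsub e (s \<cdot> t) = tsub e s \<cdot> tsub e t"

primrec fsub :: "env \<Rightarrow> fm \<Rightarrow> fm" where
  "fsub e Bot = Bot"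
| "fsub e (Eq s t) = Eq (tsub e s) (tsub e t)"
| "fsub e (Imp \<phi> \<psi>) = Imp (fsub e \<phi>) (fsub e \<psi>)"
| "fsub e (Forall n \<sigma> \<phi>) = Forall n \<sigma> (fsub (e((n,\<sigma>) := Var n \<sigma>)) \<phi>)"

definition valn :: "env \<Rightarrow> bool" where "valn e \<longleftrightarrow> (\<forall>n \<sigma>. e (n,\<sigma>) \<in> Obj \<sigma>)"

primrec tsat :: "(tm \<Rightarrow> tm \<Rightarrow> bool) \<Rightarrow> env \<Rightarrow> fm \<Rightarrow> bool" where
  "tsat R e Bot \<longleftrightarrow> False"
| "tsat R e (Eq s t) \<longleftrightarrow> R (tsub e s) (tsub e t)"
| "tsat R e (Imp \<phi> \<psi>) \<longleftrightarrow> (tsat R e \<phi> \<longrightarrow> tsat R e \<psi>)"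
| "tsat R e (Forall n \<sigma> \<phi>) \<longleftrightarrow> (\<forall>u\<in>Obj \<sigma>. tsat R (e((n,\<sigma>) := u)) \<phi>)"

definition low_tm :: "tm \<Rightarrow> bool" where "low_tm t \<longleftrightarrow> (\<forall>v\<in>tm_vars t. fst v < low_bound)"

text \<open>Axioms and targets carry low names even where they are free; a valuation replaces these
  by terms with high names, and this turns a low formula into a nice one.\<close>

primrec low_fm :: "fm \<Rightarrow> bool" where
  "low_fm Bot \<longleftrightarrow> True"
| "low_fm (Eq s t) \<longleftrightarrow> low_tm s \<and> low_tm t"
| "low_fm (Imp \<phi> \<psi>) \<longleftrightarrow> low_fm \<phi> \<and> low_fm \<psi>"
| "low_fm (Forall n \<sigma> \<phi>) \<longleftrightarrow> n < low_bound \<and> low_fm \<phi>"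

lemma low_fm_bound: "low_fm \<phi> \<Longrightarrow> \<forall>n\<in>bound_names \<phi>. n < low_bound"
  by (induction \<phi>) auto

lemma low_fm_free: "low_fm \<phi> \<Longrightarrow> \<forall>v\<in>free_vars \<phi>. fst v < low_bound"
  by (induction \<phi>) (auto simp: low_tm_def)

lemma valn_upd: "valn e \<Longrightarrow> u \<in> Obj \<sigma> \<Longrightarrow> valn (e((n,\<sigma>) := u))"
  by (auto simp: valn_def)

lemma bound_names_fsub [simp]: "bound_names (fsub e \<phi>) = bound_names \<phi>"
  by (induction \<phi> arbitrary: e) auto

lemma tm_vars_tsub: "tm_vars (tsub e t) = (\<Union>v\<in>tm_vars t. tm_vars (e v))"
  by (induction t) auto

lemma free_vars_fsub: "free_vars (fsub e \<phi>) \<subseteq> (\<Union>v\<in>free_vars \<phi>. tm_vars (e v))"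
proof (induction \<phi> arbitrary: e)
  case (Forall n \<sigma> \<phi>)
  show ?case
  proof
    fix v assume v: "v \<in> free_vars (fsub e (Forall n \<sigma> \<phi>))"
    then have "v \<in> (\<Union>w\<in>free_vars \<phi>. tm_vars ((e((n, \<sigma>) := Var n \<sigma>)) w))" "v \<noteq> (n,\<sigma>)"
      using Forall[of "e((n, \<sigma>) := Var n \<sigma>)"] by (simp_all del: fun_upd_apply) blast
    then show "v \<in> (\<Union>v\<in>free_vars (Forall n \<sigma> \<phi>). tm_vars (e v))"
      by (auto split: if_splits)
  qed
qed (fastforce simp: tm_vars_tsub)+

lemma tsub_typed:
  "well_typed t \<Longrightarrow> \<forall>v. well_typed (e v) \<and> ty_of (e v) = snd v \<Longrightarrow>
   well_typed (tsub e t) \<and> ty_of (tsub e t) = ty_of t"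
  by (induction t) (auto split: ty.splits)

lemma wf_fsub: "wf_fm \<phi> \<Longrightarrow> \<forall>v. well_typed (e v) \<and> ty_of (e v) = snd v \<Longrightarrow> wf_fm (fsub e \<phi>)"
  by (induction \<phi> arbitrary: e) (auto simp: tsub_typed)

lemma nice_fsub:
  assumes "wf_fm \<phi>" "low_fm \<phi>" "valn e" shows "nice (fsub e \<phi>)"
proof -
  have "\<forall>v\<in>free_vars (fsub e \<phi>). low_bound \<le> fst v"
    using free_vars_fsub[of e \<phi>] assms(3) unfolding valn_def Obj_def by fastforce
  moreover have "wf_fm (fsub e \<phi>)" using assms wf_fsub by (auto simp: valn_def Obj_def)
  ultimately show ?thesis using assms low_fm_bound by (simp add: nice_def)
qed

text \<open>Turns the instance of a quantified formula into an update of the environment. The second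
  hypothesis keeps the values of other variables free of the bound one; valuations satisfy it for
  low \<open>n\<close>, since their values contain only high names.\<close>

lemma tm_subst_tsub:
  "e (n,\<sigma>) = Var n \<sigma> \<Longrightarrow> \<forall>v. v \<noteq> (n,\<sigma>) \<longrightarrow> (n,\<sigma>) \<notin> tm_vars (e v) \<Longrightarrow>
   tm_subst n \<sigma> t (tsub e s) = tsub (e((n,\<sigma>) := t)) s"
  by (induction s) (auto simp: tm_subst_id)

lemma fm_subst_fsub:
  "e (n,\<sigma>) = Var n \<sigma> \<Longrightarrow> \<forall>v. v \<noteq> (n,\<sigma>) \<longrightarrow> (n,\<sigma>) \<notin> tm_vars (e v) \<Longrightarrow>
   fm_subst n \<sigma> t (fsub e \<phi>) = fsub (e((n,\<sigma>) := t)) \<phi>"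
proof (induction \<phi> arbitrary: e)
  case (Forall k \<tau> \<phi>)
  show ?case
  proof (cases "(k,\<tau>) = (n,\<sigma>)")
    case False
    have "fm_subst n \<sigma> t (fsub (e((k,\<tau>) := Var k \<tau>)) \<phi>) = fsub (e((k,\<tau>) := Var k \<tau>, (n,\<sigma>) := t)) \<phi>"
      using False Forall by (intro Forall.IH) auto
    moreover have "e((k,\<tau>) := Var k \<tau>, (n,\<sigma>) := t) = e((n,\<sigma>) := t, (k,\<tau>) := Var k \<tau>)"
      using False by (auto intro: fun_upd_twist)
    ultimately show ?thesis using False by (simp only: fsub.simps fm_subst.simps prod.inject if_False)
  qed (simp del: fun_upd_apply)
qed (auto simp: tm_subst_tsub)

context henkin_stages begin

lemma truth:
  "wf_fm \<phi> \<Longrightarrow> low_fm \<phi> \<Longrightarrow> valn e \<Longrightarrow> fsub e \<phi> \<in> H \<longleftrightarrow> tsat (\<lambda>s t. Eq s t \<in> H) e \<phi>"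
proof (induction \<phi> arbitrary: e)
  case Bot then show ?case using H_Bot by simp
next
  case (Imp a b)
  then show ?case using H_Imp[of "fsub e a" "fsub e b"] nice_fsub by auto
next
  case (Forall n \<sigma> a)
  have "fsub e (Forall n \<sigma> a) \<in> H \<longleftrightarrow> (\<forall>t\<in>Obj \<sigma>. fm_subst n \<sigma> t (fsub (e((n,\<sigma>) := Var n \<sigma>)) a) \<in> H)"
    using H_Forall nice_fsub[OF Forall.prems] by auto
  also have "\<dots> \<longleftrightarrow> (\<forall>t\<in>Obj \<sigma>. fsub (e((n,\<sigma>) := t)) a \<in> H)"
  proof -
    have "\<forall>v. v \<noteq> (n,\<sigma>) \<longrightarrow> (n,\<sigma>) \<notin> tm_vars (e v)"
      using Forall.prems unfolding valn_def Obj_def by fastforce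
    then have "fm_subst n \<sigma> t (fsub (e((n,\<sigma>) := Var n \<sigma>)) a) = fsub (e((n,\<sigma>) := t)) a" for t
      by (subst fm_subst_fsub) auto
    then show ?thesis by simp
  qed
  also have "\<dots> \<longleftrightarrow> (\<forall>t\<in>Obj \<sigma>. tsat (\<lambda>s t. Eq s t \<in> H) (e((n,\<sigma>) := t)) a)"
    using Forall valn_upd by auto
  finally show ?case by simp
qed auto

lemma fsub_closed: "(\<forall>v\<in>free_vars \<phi>. e v = Var (fst v) (snd v)) \<Longrightarrow> fsub e \<phi> = \<phi>"
proof (induction \<phi> arbitrary: e)
  case (Eq s t)
  have "(\<forall>v\<in>tm_vars s. e v = Var (fst v) (snd v)) \<Longrightarrow> tsub e s = s" for s
    by (induction s) auto
  then show ?case using Eq by auto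
qed auto

text \<open>The axiom may be open, as those of induction and choice are. Its universal closure is
  derivable at every stage, because stages have only high free names and \<open>AllI\<close>
  applies; so the closure lies in \<open>H\<close>, is true, and is instantiated with the values of
  \<open>e\<close>.\<close>

lemma axiom_sat:
  assumes "\<alpha> \<in> T" "wf_fm \<alpha>" "low_fm \<alpha>" "valn e"
  shows "tsat (\<lambda>s t. Eq s t \<in> H) e \<alpha>"
proof -
  define cl where "cl xs = foldr (\<lambda>v. Forall (fst v) (snd v)) xs \<alpha>" for xs
  have wf: "wf_fm (cl xs)" for xs using assms by (induction xs) (auto simp: cl_def)
  have clC: "cl (v # xs) = Forall (fst v) (snd v) (cl xs)" for v xs by (simp add: cl_def)
  have fv: "free_vars (cl xs) = free_vars \<alpha> - set xs" for xs
  proof (induction xs)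
    case (Cons v xs)
    show ?case unfolding clC free_vars.simps Cons prod.collapse list.set by blast
  qed (simp add: cl_def)
  obtain xs where xs: "set xs = free_vars \<alpha>" using finite_list[OF finite_free_vars[of \<alpha>]] ..
  have low: "\<forall>v\<in>set xs. fst v < low_bound" using low_fm_free[OF assms(3)] xs by simp
  have d: "stage n \<tturnstile> cl ys" if "set ys \<subseteq> set xs" for n ys using that
  proof (induction ys)
    case Nil then show ?case using assms(1) by (simp add: cl_def derives.Axiom)
  next
    case (Cons v ys)
    have "fst v < low_bound" using low Cons.prems by simp
    then have "\<forall>\<chi>\<in>stage n. (fst v, snd v) \<notin> free_vars \<chi>"
      using stage_ok[of n] unfolding nice_def by (metis leD prod.collapse)
    then have "stage n \<tturnstile> Forall (fst v) (snd v) (cl ys)" using Cons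
      by (intro derives.AllI) simp_all
    then show ?case by (simp add: clC)
  qed
  have lowcl: "low_fm (cl ys)" if "set ys \<subseteq> set xs" for ys
    using that
  proof (induction ys)
    case Nil then show ?case using assms(3) by (simp add: cl_def)
  next
    case (Cons v ys) then show ?case using low by (simp add: clC)
  qed
  have fs: "fsub e (cl xs) = cl xs" by (rule fsub_closed) (simp add: fv xs)
  then have "nice (cl xs)" using nice_fsub[OF wf lowcl[OF subset_refl] assms(4)] by simp
  then have "cl xs \<in> H" by (rule H_derI[OF _ d[OF subset_refl]])
  then have "tsat (\<lambda>s t. Eq s t \<in> H) e (cl xs)"
    using truth[OF wf lowcl[OF subset_refl] assms(4)] fs by simp
  moreover have "tsat (\<lambda>s t. Eq s t \<in> H) e (cl ys) \<Longrightarrow> tsat (\<lambda>s t. Eq s t \<in> H) e \<alpha>" for ys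
  proof (induction ys)
    case (Cons v ys)
    have "e v \<in> Obj (snd v)" using assms by (cases v) (auto simp: valn_def)
    moreover have "\<forall>u\<in>Obj (snd v). tsat (\<lambda>s t. Eq s t \<in> H) (e(v := u)) (cl ys)"
      using Cons.prems by (simp add: clC)
    ultimately have "tsat (\<lambda>s t. Eq s t \<in> H) (e(v := e v)) (cl ys)" by (rule bspec[rotated])
    then show ?case using Cons.IH by simp
  qed (simp add: cl_def)
  ultimately show ?thesis by blast
qed

end

theorem henkin_model:
  assumes "\<not> T \<turnstile> \<phi>" "wf_fm \<phi>" "low_fm \<phi>" "free_vars \<phi> = {}"
  shows "\<exists>R. (\<forall>\<alpha>\<in>T. wf_fm \<alpha> \<longrightarrow> low_fm \<alpha> \<longrightarrow> (\<forall>e. valn e \<longrightarrow> tsat R e \<alpha>)) \<and>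
             (\<forall>e. valn e \<longrightarrow> \<not> tsat R e \<phi>)"
proof -
  interpret henkin_stages T \<phi> using assms low_fm_bound by unfold_locales auto
  have "\<not> tsat (\<lambda>s t. Eq s t \<in> H) e \<phi>" if "valn e" for e
  proof
    assume "tsat (\<lambda>s t. Eq s t \<in> H) e \<phi>"
    then have "fsub e \<phi> \<in> H" using truth that assms by blast
    moreover have "fsub e \<phi> = \<phi>" by (rule fsub_closed) (simp add: assms)
    moreover have "Neg \<phi> \<in> H" using stage.simps(1) unfolding H_def by blast
    ultimately show False using H_con by simp
  qed
  then show ?thesis using axiom_sat by blast
qed

section \<open>Extensional models\<close>

lemma fm_derived [simp]:
  "wf_fm (Neg \<phi>) \<longleftrightarrow> wf_fm \<phi>" "wf_fm (And \<phi> \<psi>) \<longleftrightarrow> wf_fm \<phi> \<and> wf_fm \<psi>"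
  "wf_fm (Or \<phi> \<psi>) \<longleftrightarrow> wf_fm \<phi> \<and> wf_fm \<psi>" "wf_fm (Iff \<phi> \<psi>) \<longleftrightarrow> wf_fm \<phi> \<and> wf_fm \<psi>"
  "wf_fm (Exists n \<sigma> \<phi>) \<longleftrightarrow> wf_fm \<phi>"
  "low_fm (Neg \<phi>) \<longleftrightarrow> low_fm \<phi>" "low_fm (And \<phi> \<psi>) \<longleftrightarrow> low_fm \<phi> \<and> low_fm \<psi>"
  "low_fm (Or \<phi> \<psi>) \<longleftrightarrow> low_fm \<phi> \<and> low_fm \<psi>" "low_fm (Iff \<phi> \<psi>) \<longleftrightarrow> low_fm \<phi> \<and> low_fm \<psi>"
  "low_fm (Exists n \<sigma> \<phi>) \<longleftrightarrow> n < low_bound \<and> low_fm \<phi>"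
  "quantifier_free (Neg \<phi>) \<longleftrightarrow> quantifier_free \<phi>"
  "quantifier_free (And \<phi> \<psi>) \<longleftrightarrow> quantifier_free \<phi> \<and> quantifier_free \<psi>"
  by (auto simp: Neg_def And_def Or_def Iff_def Exists_def)

lemma tsat_derived [simp]:
  "tsat R e (Neg \<phi>) \<longleftrightarrow> \<not> tsat R e \<phi>"
  "tsat R e (And \<phi> \<psi>) \<longleftrightarrow> tsat R e \<phi> \<and> tsat R e \<psi>"
  "tsat R e (Or \<phi> \<psi>) \<longleftrightarrow> tsat R e \<phi> \<or> tsat R e \<psi>"
  "tsat R e (Iff \<phi> \<psi>) \<longleftrightarrow> (tsat R e \<phi> \<longleftrightarrow> tsat R e \<psi>)"
  "tsat R e (Exists n \<sigma> \<phi>) \<longleftrightarrow> (\<exists>u\<in>Obj \<sigma>. tsat R (e((n,\<sigma>) := u)) \<phi>)"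
  by (auto simp: Neg_def And_def Or_def Iff_def Exists_def)

text \<open>The number of quantifiers that \<open>eq_ty\<close> prefixes, hence the number of names
  that an equality of this type uses up.\<close>

primrec arity :: "ty \<Rightarrow> nat" where
  "arity TN = 0"
| "arity (TFun \<sigma> \<tau>) = Suc (arity \<tau>)"

definition targets :: "fm set" where
  "targets = {sentence (stmt_a \<^bold>\<longleftrightarrow> exists_two), sentence (stmt_b \<^bold>\<longleftrightarrow> exists_two),
     sentence (stmt_c \<^bold>\<longleftrightarrow> exists_two), sentence (exists_two \<^bold>\<longrightarrow> stmt_d),
     sentence (exists_two \<^bold>\<longrightarrow> stmt_e), sentence (exists_two \<^bold>\<longrightarrow> stmt_f)}"

text \<open>Axioms whose names reach the range of the witnesses are exempt, since
  \<open>henkin_model\<close> gives no information about them.\<close>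

definition model :: "(tm \<Rightarrow> tm \<Rightarrow> bool) \<Rightarrow> bool" where
  "model R \<longleftrightarrow> (\<forall>\<alpha>\<in>RCA0_omega. wf_fm \<alpha> \<longrightarrow> low_fm \<alpha> \<longrightarrow> (\<forall>e. valn e \<longrightarrow> tsat R e \<alpha>))"

text \<open>The numbers and reals of a countermodel are to become types, and type definitions cannot depend on
  a local parameter; so one countermodel is fixed globally by choice.\<close>

definition M0 :: "tm \<Rightarrow> tm \<Rightarrow> bool" where
  "M0 = (SOME R. model R \<and> (\<exists>\<phi>\<in>targets. \<forall>e. valn e \<longrightarrow> \<not> tsat R e \<phi>))"

definition ok_model :: bool where "ok_model \<longleftrightarrow> model M0"

primrec eqv :: "ty \<Rightarrow> tm \<Rightarrow> tm \<Rightarrow> bool" where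
  "eqv TN s t \<longleftrightarrow> M0 s t"
| "eqv (TFun \<sigma> \<tau>) s t \<longleftrightarrow> (\<forall>w\<in>Obj \<sigma>. eqv \<tau> (s \<cdot> w) (t \<cdot> w))"

lemma Obj_App: "u \<in> Obj (\<sigma> \<leadsto> \<tau>) \<Longrightarrow> w \<in> Obj \<sigma> \<Longrightarrow> u \<cdot> w \<in> Obj \<tau>"
  by (auto simp: Obj_def)

lemma Obj_consts [simp]:
  "Zero \<in> Obj \<sigma> \<longleftrightarrow> \<sigma> = TN" "Succ \<in> Obj \<sigma> \<longleftrightarrow> \<sigma> = TN \<leadsto> TN"
  "Comb_K \<rho> \<tau> \<in> Obj \<sigma> \<longleftrightarrow> \<sigma> = \<rho> \<leadsto> \<tau> \<leadsto> \<rho>"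
  "Comb_S \<rho> \<rho>' \<tau> \<in> Obj \<sigma> \<longleftrightarrow> \<sigma> = (\<rho> \<leadsto> \<rho>' \<leadsto> \<tau>) \<leadsto> (\<rho> \<leadsto> \<rho>') \<leadsto> \<rho> \<leadsto> \<tau>"
  "Rec \<in> Obj \<sigma> \<longleftrightarrow> \<sigma> = TN \<leadsto> TN \<leadsto> (TN \<leadsto> TN \<leadsto> TN) \<leadsto> TN"
  by (auto simp: Obj_def)

lemma Var_high: "low_bound \<le> n \<Longrightarrow> Var n \<sigma> \<in> Obj \<sigma>"
  by (simp add: Obj_def)

lemma tsub_cong: "(\<And>v. v \<in> tm_vars t \<Longrightarrow> e v = e' v) \<Longrightarrow> tsub e t = tsub e' t"
  by (induction t) auto

definition below :: "nat \<Rightarrow> tm \<Rightarrow> bool" where "below d t \<longleftrightarrow> (\<forall>v\<in>tm_vars t. fst v < d)"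

lemma below_simps [simp]:
  "below d (Var n \<sigma>) \<longleftrightarrow> n < d" "below d Zero" "below d Succ" "below d (Comb_K \<sigma> \<tau>)"
  "below d (Comb_S \<rho> \<sigma> \<tau>)" "below d Rec" "below d (s \<cdot> t) \<longleftrightarrow> below d s \<and> below d t"
  by (auto simp: below_def)

lemma below_mono: "below d t \<Longrightarrow> d \<le> d' \<Longrightarrow> below d' t"
  by (auto simp: below_def)

lemma tsub_upd: "below d t \<Longrightarrow> tsub (e((d,\<sigma>) := u)) t = tsub e t"
  by (rule tsub_cong) (auto simp: below_def)

lemma tsat_eq_ty [simp]:
  "below d s \<Longrightarrow> below d t \<Longrightarrow> tsat M0 e (eq_ty \<tau> s t d) \<longleftrightarrow> eqv \<tau> (tsub e s) (tsub e t)"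
proof (induction \<tau> arbitrary: s t d e)
  case TN then show ?case by (simp add: eq0_def)
next
  case (TFun \<sigma> \<tau>)
  have "below (Suc d) s" "below (Suc d) t" using TFun.prems below_mono by auto
  then show ?case using TFun by (simp add: all_ty_def tsub_upd del: fun_upd_apply) simp
qed

lemma low_eq_ty:
  "low_tm s \<Longrightarrow> low_tm t \<Longrightarrow> d + arity \<tau> \<le> low_bound \<Longrightarrow> low_fm (eq_ty \<tau> s t d)"
  by (induction \<tau> arbitrary: s t d) (auto simp: eq0_def all_ty_def low_tm_def)

lemma wf_eq_ty:
  "well_typed s \<Longrightarrow> well_typed t \<Longrightarrow> ty_of s = \<tau> \<Longrightarrow> ty_of t = \<tau> \<Longrightarrow> wf_fm (eq_ty \<tau> s t d)"
  by (induction \<tau> arbitrary: s t d) (auto simp: eq0_def all_ty_def)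

definition e_high :: env where "e_high v = Var (low_bound + fst v) (snd v)"

lemma valn_e_high: "valn e_high"
  by (simp add: valn_def e_high_def Var_high)

lemmas dfm_defs = sentence_def all_nat_def ex_nat_def all_ty_def ex_ty_def eq0_def d_neg_def
  d_and_def d_or_def d_imp_def d_iff_def

locale henkin = assumes ok: ok_model
begin

lemma ax_sat: "\<alpha> \<in> RCA0_omega \<Longrightarrow> wf_fm \<alpha> \<Longrightarrow> low_fm \<alpha> \<Longrightarrow> valn e \<Longrightarrow> tsat M0 e \<alpha>"
  using ok by (simp add: ok_model_def model_def)

lemma M0_refl: "u \<in> Obj TN \<Longrightarrow> M0 u u"
  using ax_sat[OF eq_refl _ _ valn_e_high] by (simp add: dfm_defs low_tm_def low_bound_def)

lemma M0_sym: "u \<in> Obj TN \<Longrightarrow> v \<in> Obj TN \<Longrightarrow> M0 u v \<Longrightarrow> M0 v u"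
  using ax_sat[OF eq_sym _ _ valn_e_high] by (simp add: dfm_defs low_tm_def low_bound_def)

lemma M0_trans: "u \<in> Obj TN \<Longrightarrow> v \<in> Obj TN \<Longrightarrow> w \<in> Obj TN \<Longrightarrow> M0 u v \<Longrightarrow> M0 v w \<Longrightarrow> M0 u w"
proof -
  have "tsat M0 e_high (sentence (\<^bold>\<forall>x. \<^bold>\<forall>y. \<^bold>\<forall>z. x \<^bold>= y \<^bold>\<longrightarrow> y \<^bold>= z \<^bold>\<longrightarrow> x \<^bold>= z))"
    by (rule ax_sat[OF RCA0_omega.eq_trans _ _ valn_e_high]) (simp_all add: dfm_defs low_tm_def low_bound_def)
  then have *: "\<forall>u\<in>Obj TN. \<forall>v\<in>Obj TN. \<forall>w\<in>Obj TN. M0 u v \<longrightarrow> M0 v w \<longrightarrow> M0 u w"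
    by (simp (no_asm_use) add: dfm_defs)
  show "u \<in> Obj TN \<Longrightarrow> v \<in> Obj TN \<Longrightarrow> w \<in> Obj TN \<Longrightarrow> M0 u v \<Longrightarrow> M0 v w \<Longrightarrow> M0 u w"
    by (rule *[rule_format, of u v w])
qed

lemma M0_Succ: "u \<in> Obj TN \<Longrightarrow> \<not> M0 (Succ \<cdot> u) Zero"
  using ax_sat[OF Succ_nonzero _ _ valn_e_high] by (simp add: dfm_defs low_tm_def low_bound_def)

lemma M0_Succ_inj: "u \<in> Obj TN \<Longrightarrow> v \<in> Obj TN \<Longrightarrow> M0 (Succ \<cdot> u) (Succ \<cdot> v) \<Longrightarrow> M0 u v"
  using ax_sat[OF Succ_inj _ _ valn_e_high] by (simp add: dfm_defs low_tm_def low_bound_def)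

lemma M0_Rec_Zero: "y \<in> Obj TN \<Longrightarrow> z \<in> Obj (TN \<leadsto> TN \<leadsto> TN) \<Longrightarrow> M0 (Rec \<cdot> Zero \<cdot> y \<cdot> z) y"
  using ax_sat[OF Rec_Zero _ _ valn_e_high] by (simp add: dfm_defs low_tm_def low_bound_def)

lemma M0_Rec_Succ: "x \<in> Obj TN \<Longrightarrow> y \<in> Obj TN \<Longrightarrow> z \<in> Obj (TN \<leadsto> TN \<leadsto> TN) \<Longrightarrow>
  M0 (Rec \<cdot> (Succ \<cdot> x) \<cdot> y \<cdot> z) (z \<cdot> (Rec \<cdot> x \<cdot> y \<cdot> z) \<cdot> x)"
  using ax_sat[OF Rec_Succ _ _ valn_e_high] by (simp add: dfm_defs low_tm_def low_bound_def)

text \<open>The bound 300 keeps all names below 400: \<open>eq_ty\<close> starts at depth 2 here,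
  and at depth 3 in the axioms for \<open>Comb_S\<close> and for extensionality.\<close>

lemma eqv_K: "arity \<sigma> \<le> 300 \<Longrightarrow> x \<in> Obj \<sigma> \<Longrightarrow> y \<in> Obj \<tau> \<Longrightarrow> eqv \<sigma> (Comb_K \<sigma> \<tau> \<cdot> x \<cdot> y) x"
proof -
  assume a: "arity \<sigma> \<le> 300" and xy: "x \<in> Obj \<sigma>" "y \<in> Obj \<tau>"
  have "tsat M0 e_high (sentence (all_ty \<sigma> (\<lambda>x. all_ty \<tau> (\<lambda>y. eq_ty \<sigma> (Comb_K \<sigma> \<tau> \<cdot> x \<cdot> y) x))))"
    by (rule ax_sat[OF RCA0_omega.Comb_K _ _ valn_e_high])
      (use a in \<open>auto simp: sentence_def all_ty_def low_bound_def low_tm_def intro!: wf_eq_ty low_eq_ty\<close>)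
  then show ?thesis using xy by (simp add: sentence_def all_ty_def)
qed

lemma eqv_S: "arity \<tau> \<le> 300 \<Longrightarrow> x \<in> Obj (\<rho> \<leadsto> \<sigma> \<leadsto> \<tau>) \<Longrightarrow> y \<in> Obj (\<rho> \<leadsto> \<sigma>) \<Longrightarrow> z \<in> Obj \<rho> \<Longrightarrow>
  eqv \<tau> (Comb_S \<rho> \<sigma> \<tau> \<cdot> x \<cdot> y \<cdot> z) (x \<cdot> z \<cdot> (y \<cdot> z))"
proof -
  assume a: "arity \<tau> \<le> 300" and xy: "x \<in> Obj (\<rho> \<leadsto> \<sigma> \<leadsto> \<tau>)" "y \<in> Obj (\<rho> \<leadsto> \<sigma>)" "z \<in> Obj \<rho>"
  have "tsat M0 e_high (sentence (all_ty (\<rho> \<leadsto> \<sigma> \<leadsto> \<tau>) (\<lambda>x. all_ty (\<rho> \<leadsto> \<sigma>) (\<lambda>y. all_ty \<rho> (\<lambda>z.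
     eq_ty \<tau> (Comb_S \<rho> \<sigma> \<tau> \<cdot> x \<cdot> y \<cdot> z) (x \<cdot> z \<cdot> (y \<cdot> z)))))))"
    by (rule ax_sat[OF RCA0_omega.Comb_S _ _ valn_e_high])
      (use a in \<open>auto simp: sentence_def all_ty_def low_bound_def low_tm_def intro!: wf_eq_ty low_eq_ty\<close>)
  then have *: "\<forall>x\<in>Obj (\<rho> \<leadsto> \<sigma> \<leadsto> \<tau>). \<forall>y\<in>Obj (\<rho> \<leadsto> \<sigma>). \<forall>z\<in>Obj \<rho>. eqv \<tau> (Comb_S \<rho> \<sigma> \<tau> \<cdot> x \<cdot> y \<cdot> z) (x \<cdot> z \<cdot> (y \<cdot> z))"
    by (simp add: sentence_def all_ty_def)
  then show ?thesis using xy by blast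
qed

lemma eqv_ext: "arity \<sigma> \<le> 300 \<Longrightarrow> arity \<tau> \<le> 300 \<Longrightarrow> z \<in> Obj (\<sigma> \<leadsto> \<tau>) \<Longrightarrow> x \<in> Obj \<sigma> \<Longrightarrow> y \<in> Obj \<sigma> \<Longrightarrow>
  eqv \<sigma> x y \<Longrightarrow> eqv \<tau> (z \<cdot> x) (z \<cdot> y)"
proof -
  assume a: "arity \<sigma> \<le> 300" "arity \<tau> \<le> 300" and xy: "z \<in> Obj (\<sigma> \<leadsto> \<tau>)" "x \<in> Obj \<sigma>" "y \<in> Obj \<sigma>"
    and eq: "eqv \<sigma> x y"
  have "tsat M0 e_high (sentence (all_ty (\<sigma> \<leadsto> \<tau>) (\<lambda>z. all_ty \<sigma> (\<lambda>x. all_ty \<sigma> (\<lambda>y.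
     eq_ty \<sigma> x y \<^bold>\<longrightarrow> eq_ty \<tau> (z \<cdot> x) (z \<cdot> y))))))"
    by (rule ax_sat[OF extensionality _ _ valn_e_high])
      (use a in \<open>auto simp: d_imp_def sentence_def all_ty_def low_bound_def low_tm_def intro!: wf_eq_ty low_eq_ty\<close>)
  then have *: "\<forall>z\<in>Obj (\<sigma> \<leadsto> \<tau>). \<forall>x\<in>Obj \<sigma>. \<forall>y\<in>Obj \<sigma>. eqv \<sigma> x y \<longrightarrow> eqv \<tau> (z \<cdot> x) (z \<cdot> y)"
    by (simp add: sentence_def all_ty_def d_imp_def)
  then show ?thesis using xy eq by blast
qed

lemma eqv_refl: "u \<in> Obj \<sigma> \<Longrightarrow> eqv \<sigma> u u"
  by (induction \<sigma> arbitrary: u) (auto intro: M0_refl Obj_App)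
lemma eqv_sym: "u \<in> Obj \<sigma> \<Longrightarrow> v \<in> Obj \<sigma> \<Longrightarrow> eqv \<sigma> u v \<Longrightarrow> eqv \<sigma> v u"
proof (induction \<sigma> arbitrary: u v)
  case TN then show ?case using M0_sym by simp
next
  case (TFun \<sigma> \<tau>)
  show ?case unfolding eqv.simps
  proof
    fix x assume x: "x \<in> Obj \<sigma>"
    show "eqv \<tau> (v \<cdot> x) (u \<cdot> x)"
      using TFun.IH(2)[of "u \<cdot> x" "v \<cdot> x"] TFun.prems x by (simp add: Obj_App)
  qed
qed
lemma eqv_trans:
  "u \<in> Obj \<sigma> \<Longrightarrow> v \<in> Obj \<sigma> \<Longrightarrow> w \<in> Obj \<sigma> \<Longrightarrow> eqv \<sigma> u v \<Longrightarrow> eqv \<sigma> v w \<Longrightarrow> eqv \<sigma> u w"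
proof (induction \<sigma> arbitrary: u v w)
  case TN then show ?case using M0_trans[of u v w] by simp
next
  case (TFun \<sigma> \<tau>)
  show ?case unfolding eqv.simps
  proof
    fix x assume x: "x \<in> Obj \<sigma>"
    show "eqv \<tau> (u \<cdot> x) (w \<cdot> x)"
      using TFun.IH(2)[of "u \<cdot> x" "v \<cdot> x" "w \<cdot> x"] TFun.prems x by (simp add: Obj_App)
  qed
qed

end

section \<open>The quotient by pointwise equality\<close>

definition cl :: "tm \<Rightarrow> tm set" where "cl u = {v \<in> Obj (ty_of u). eqv (ty_of u) u v}"
definition Dq :: "ty \<Rightarrow> tm set set" where "Dq \<sigma> = cl ` Obj \<sigma>"
text \<open>Representatives are picked by choice. Only the extensionality axiom makes pointwise
  equality a congruence, so independence of the choice, \<open>ap_cl\<close>, comes with arity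
  bounds.\<close>

definition ap :: "tm set \<Rightarrow> tm set \<Rightarrow> tm set" where "ap X Y = cl ((SOME x. x \<in> X) \<cdot> (SOME y. y \<in> Y))"

lemma DqE: "X \<in> Dq \<sigma> \<Longrightarrow> (\<And>x. x \<in> Obj \<sigma> \<Longrightarrow> X = cl x \<Longrightarrow> P) \<Longrightarrow> P"
  by (auto simp: Dq_def)

lemma cl_Dq: "x \<in> Obj \<sigma> \<Longrightarrow> cl x \<in> Dq \<sigma>"
  by (simp add: Dq_def)

type_synonym qenv = "nat \<times> ty \<Rightarrow> tm set"

definition vq :: "qenv \<Rightarrow> bool" where "vq e \<longleftrightarrow> (\<forall>n \<sigma>. e (n,\<sigma>) \<in> Dq \<sigma>)"

primrec ev :: "qenv \<Rightarrow> tm \<Rightarrow> tm set" where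
  "ev e (Var n \<sigma>) = e (n,\<sigma>)"
| "ev e Zero = cl Zero"
| "ev e Succ = cl Succ"
| "ev e (Comb_K \<sigma> \<tau>) = cl (Comb_K \<sigma> \<tau>)"
| "ev e (Comb_S \<rho> \<sigma> \<tau>) = cl (Comb_S \<rho> \<sigma> \<tau>)"
| "ev e Rec = cl Rec"
| "ev e (s \<cdot> t) = ap (ev e s) (ev e t)"

text \<open>For a well-typed term this bounds the arity of the type of every subterm, so that the
  bounded axioms are available throughout its evaluation. The numbers added for the combinators are
  their own argument places: \<open>Comb_S\<close> takes three arguments before the result of type
  \<tau>.\<close>

primrec bnd :: "nat \<Rightarrow> tm \<Rightarrow> bool" where
  "bnd k (Var n \<sigma>) \<longleftrightarrow> arity \<sigma> \<le> k"
| "bnd k Zero \<longleftrightarrow> True"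
| "bnd k Succ \<longleftrightarrow> 1 \<le> k"
| "bnd k (Comb_K \<sigma> \<tau>) \<longleftrightarrow> arity \<sigma> + 2 \<le> k"
| "bnd k (Comb_S \<rho> \<sigma> \<tau>) \<longleftrightarrow> arity \<tau> + 3 \<le> k"
| "bnd k Rec \<longleftrightarrow> 3 \<le> k"
| "bnd k (s \<cdot> t) \<longleftrightarrow> bnd k s \<and> bnd k t"

primrec bfm :: "fm \<Rightarrow> bool" where
  "bfm Bot \<longleftrightarrow> True"
| "bfm (Eq s t) \<longleftrightarrow> bnd 290 s \<and> bnd 290 t"
| "bfm (Imp \<phi> \<psi>) \<longleftrightarrow> bfm \<phi> \<and> bfm \<psi>"
| "bfm (Forall n \<sigma> \<phi>) \<longleftrightarrow> bfm \<phi>"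

primrec sat :: "qenv \<Rightarrow> fm \<Rightarrow> bool" where
  "sat e Bot \<longleftrightarrow> False"
| "sat e (Eq s t) \<longleftrightarrow> ev e s = ev e t"
| "sat e (Imp \<phi> \<psi>) \<longleftrightarrow> (sat e \<phi> \<longrightarrow> sat e \<psi>)"
| "sat e (Forall n \<sigma> \<phi>) \<longleftrightarrow> (\<forall>u\<in>Dq \<sigma>. sat (e((n,\<sigma>) := u)) \<phi>)"

lemma sat_derived [simp]:
  "sat e (Neg \<phi>) \<longleftrightarrow> \<not> sat e \<phi>"
  "sat e (And \<phi> \<psi>) \<longleftrightarrow> sat e \<phi> \<and> sat e \<psi>"
  "sat e (Or \<phi> \<psi>) \<longleftrightarrow> sat e \<phi> \<or> sat e \<psi>"
  "sat e (Iff \<phi> \<psi>) \<longleftrightarrow> (sat e \<phi> \<longleftrightarrow> sat e \<psi>)"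
  "sat e (Exists n \<sigma> \<phi>) \<longleftrightarrow> (\<exists>u\<in>Dq \<sigma>. sat (e((n,\<sigma>) := u)) \<phi>)"
  by (auto simp: Neg_def And_def Or_def Iff_def Exists_def)

lemma bfm_derived [simp]:
  "bfm (Neg \<phi>) \<longleftrightarrow> bfm \<phi>" "bfm (And \<phi> \<psi>) \<longleftrightarrow> bfm \<phi> \<and> bfm \<psi>"
  "bfm (Or \<phi> \<psi>) \<longleftrightarrow> bfm \<phi> \<and> bfm \<psi>" "bfm (Iff \<phi> \<psi>) \<longleftrightarrow> bfm \<phi> \<and> bfm \<psi>"
  "bfm (Exists n \<sigma> \<phi>) \<longleftrightarrow> bfm \<phi>"
  by (auto simp: Neg_def And_def Or_def Iff_def Exists_def)

lemma bnd_mono: "bnd k t \<Longrightarrow> k \<le> l \<Longrightarrow> bnd l t"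
  by (induction t) auto

lemma arity_ty_of: "well_typed t \<Longrightarrow> bnd k t \<Longrightarrow> arity (ty_of t) \<le> k"
  by (induction t) auto

lemma vq_upd: "vq e \<Longrightarrow> u \<in> Dq \<sigma> \<Longrightarrow> vq (e((n,\<sigma>) := u))"
  by (auto simp: vq_def)

lemma ev_cong: "(\<And>v. v \<in> tm_vars t \<Longrightarrow> e v = e' v) \<Longrightarrow> ev e t = ev e' t"
  by (induction t) auto

lemma ty_of_Obj: "u \<in> Obj \<sigma> \<Longrightarrow> ty_of u = \<sigma>"
  by (simp add: Obj_def)

context henkin begin

lemma cl_eq_iff: "u \<in> Obj \<sigma> \<Longrightarrow> v \<in> Obj \<sigma> \<Longrightarrow> cl u = cl v \<longleftrightarrow> eqv \<sigma> u v"
proof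
  assume uv: "u \<in> Obj \<sigma>" "v \<in> Obj \<sigma>"
  { assume "cl u = cl v"
    moreover have "v \<in> cl v" using uv eqv_refl by (simp add: cl_def ty_of_Obj)
    ultimately show "eqv \<sigma> u v" using uv by (auto simp: cl_def ty_of_Obj) }
  { assume e: "eqv \<sigma> u v"
    have "w \<in> cl u \<longleftrightarrow> w \<in> cl v" for w
      using uv e eqv_trans[of v \<sigma> u w] eqv_trans[of u \<sigma> v w] eqv_sym[of u \<sigma> v]
      by (auto simp: cl_def ty_of_Obj)
    then show "cl u = cl v" by blast }
qed

lemma ap_cl:
  assumes "u \<in> Obj (\<sigma> \<leadsto> \<tau>)" "w \<in> Obj \<sigma>" "arity \<sigma> \<le> 300" "arity \<tau> \<le> 300"
  shows "ap (cl u) (cl w) = cl (u \<cdot> w)"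
proof -
  have self: "v \<in> cl v" if "v \<in> Obj \<rho>" for v \<rho> using that eqv_refl by (simp add: cl_def ty_of_Obj)
  define u' where "u' = (SOME x. x \<in> cl u)"
  define w' where "w' = (SOME x. x \<in> cl w)"
  have "u' \<in> cl u" "w' \<in> cl w" using self assms unfolding u'_def w'_def by (meson someI)+
  then have u': "u' \<in> Obj (\<sigma> \<leadsto> \<tau>)" "eqv (\<sigma> \<leadsto> \<tau>) u u'" and w': "w' \<in> Obj \<sigma>" "eqv \<sigma> w w'"
    using assms by (auto simp: cl_def ty_of_Obj)
  have "eqv \<tau> (u \<cdot> w) (u \<cdot> w')" using eqv_ext assms w' by blast
  moreover have "eqv \<tau> (u \<cdot> w') (u' \<cdot> w')" using u' w' by simp
  ultimately have "eqv \<tau> (u \<cdot> w) (u' \<cdot> w')"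
    using eqv_trans Obj_App u' w' assms by blast
  then have "cl (u \<cdot> w) = cl (u' \<cdot> w')"
    using cl_eq_iff[of "u \<cdot> w" \<tau> "u' \<cdot> w'"] Obj_App u' w' assms by blast
  then show ?thesis by (simp add: ap_def u'_def w'_def)
qed

lemma ap_Dq: "X \<in> Dq (\<sigma> \<leadsto> \<tau>) \<Longrightarrow> Y \<in> Dq \<sigma> \<Longrightarrow> arity \<sigma> \<le> 300 \<Longrightarrow> arity \<tau> \<le> 300 \<Longrightarrow> ap X Y \<in> Dq \<tau>"
  by (elim DqE) (auto simp: ap_cl intro!: cl_Dq Obj_App)

lemma ap_K:
  assumes "X \<in> Dq \<sigma>" "Y \<in> Dq \<tau>" "arity \<sigma> \<le> 290" "arity \<tau> \<le> 290"
  shows "ap (ap (cl (Comb_K \<sigma> \<tau>)) X) Y = X"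
proof -
  obtain x y where xy: "x \<in> Obj \<sigma>" "X = cl x" "y \<in> Obj \<tau>" "Y = cl y" using assms by (elim DqE)
  have "Comb_K \<sigma> \<tau> \<cdot> x \<in> Obj (\<tau> \<leadsto> \<sigma>)" "Comb_K \<sigma> \<tau> \<cdot> x \<cdot> y \<in> Obj \<sigma>"
    using xy by (auto intro!: Obj_App)
  then show ?thesis using xy assms eqv_K[of \<sigma> x y \<tau>] cl_eq_iff[of "Comb_K \<sigma> \<tau> \<cdot> x \<cdot> y" \<sigma> x]
    by (simp add: ap_cl[of _ \<sigma> "\<tau> \<leadsto> \<sigma>"] ap_cl[of _ \<tau> \<sigma>])
qed

lemma ap_S:
  assumes "X \<in> Dq (\<rho> \<leadsto> \<sigma> \<leadsto> \<tau>)" "Y \<in> Dq (\<rho> \<leadsto> \<sigma>)" "Z \<in> Dq \<rho>" "arity \<sigma> \<le> 290" "arity \<tau> \<le> 290" "arity \<rho> \<le> 290"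
  shows "ap (ap (ap (cl (Comb_S \<rho> \<sigma> \<tau>)) X) Y) Z = ap (ap X Z) (ap Y Z)"
proof -
  obtain x y z where xyz: "x \<in> Obj (\<rho> \<leadsto> \<sigma> \<leadsto> \<tau>)" "X = cl x" "y \<in> Obj (\<rho> \<leadsto> \<sigma>)" "Y = cl y" "z \<in> Obj \<rho>" "Z = cl z"
    using assms by (elim DqE)
  have o: "Comb_S \<rho> \<sigma> \<tau> \<cdot> x \<in> Obj ((\<rho> \<leadsto> \<sigma>) \<leadsto> \<rho> \<leadsto> \<tau>)" "Comb_S \<rho> \<sigma> \<tau> \<cdot> x \<cdot> y \<in> Obj (\<rho> \<leadsto> \<tau>)"
    "Comb_S \<rho> \<sigma> \<tau> \<cdot> x \<cdot> y \<cdot> z \<in> Obj \<tau>" "x \<cdot> z \<in> Obj (\<sigma> \<leadsto> \<tau>)" "y \<cdot> z \<in> Obj \<sigma>" "x \<cdot> z \<cdot> (y \<cdot> z) \<in> Obj \<tau>"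
    using xyz by (auto intro!: Obj_App)
  have "ap (ap (ap (cl (Comb_S \<rho> \<sigma> \<tau>)) X) Y) Z = cl (Comb_S \<rho> \<sigma> \<tau> \<cdot> x \<cdot> y \<cdot> z)"
    using xyz o assms
    by (simp add: ap_cl[of _ "\<rho> \<leadsto> \<sigma> \<leadsto> \<tau>" "(\<rho> \<leadsto> \<sigma>) \<leadsto> \<rho> \<leadsto> \<tau>"] ap_cl[of _ "\<rho> \<leadsto> \<sigma>" "\<rho> \<leadsto> \<tau>"] ap_cl[of _ \<rho> \<tau>])
  also have "\<dots> = cl (x \<cdot> z \<cdot> (y \<cdot> z))"
    using xyz o assms eqv_S[of \<tau> x \<rho> \<sigma> y z] cl_eq_iff by simp
  also have "\<dots> = ap (ap X Z) (ap Y Z)"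
    using xyz o assms by (simp add: ap_cl[of _ \<rho> "\<sigma> \<leadsto> \<tau>"] ap_cl[of _ \<rho> \<sigma>] ap_cl[of _ \<sigma> \<tau>])
  finally show ?thesis .
qed

lemma ev_cl: "well_typed t \<Longrightarrow> bnd 299 t \<Longrightarrow> valn e \<Longrightarrow> ev (\<lambda>v. cl (e v)) t = cl (tsub e t) \<and> tsub e t \<in> Obj (ty_of t)"
proof (induction t)
  case (App s t)
  obtain \<tau> where \<tau>: "ty_of s = ty_of t \<leadsto> \<tau>" using App.prems by auto
  have "arity (ty_of t) \<le> 299" "arity (ty_of s) \<le> 299"
    using App.prems arity_ty_of by auto
  then show ?case using App \<tau> by (auto simp: ap_cl intro!: Obj_App)
qed (auto simp: valn_def)

lemma vq_cl:
  assumes "vq e" obtains e0 where "valn e0" "e = (\<lambda>v. cl (e0 v))"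
proof -
  have "\<forall>v. \<exists>u. u \<in> Obj (snd v) \<and> e v = cl u" using assms by (fastforce simp: vq_def Dq_def)
  then obtain e0 where "\<forall>v. e0 v \<in> Obj (snd v) \<and> e v = cl (e0 v)" by metis
  then show ?thesis by (intro that[of e0]) (auto simp: valn_def)
qed

lemma ev_Dq: "well_typed t \<Longrightarrow> bnd 299 t \<Longrightarrow> vq e \<Longrightarrow> ev e t \<in> Dq (ty_of t)"
  by (elim vq_cl) (simp add: ev_cl cl_Dq)

lemma sat_cl: "wf_fm \<phi> \<Longrightarrow> bfm \<phi> \<Longrightarrow> valn e \<Longrightarrow> sat (\<lambda>v. cl (e v)) \<phi> \<longleftrightarrow> tsat M0 e \<phi>"
proof (induction \<phi> arbitrary: e)
  case (Eq s t)
  have "bnd 299 s" "bnd 299 t" using Eq bnd_mono by auto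
  then have "ev (\<lambda>v. cl (e v)) s = cl (tsub e s)" "tsub e s \<in> Obj TN"
    "ev (\<lambda>v. cl (e v)) t = cl (tsub e t)" "tsub e t \<in> Obj TN"
    using ev_cl[of s e] ev_cl[of t e] Eq by simp_all
  then show ?case using cl_eq_iff[of "tsub e s" TN "tsub e t"] by simp
next
  case (Forall n \<sigma> \<phi>)
  have "(\<lambda>v. cl (e v))((n,\<sigma>) := cl u) = (\<lambda>v. cl ((e((n,\<sigma>) := u)) v))" for u by (rule ext) simp
  then show ?case using Forall by (simp add: Dq_def valn_upd del: fun_upd_apply)
qed auto

lemma ax_qsat: "\<alpha> \<in> RCA0_omega \<Longrightarrow> wf_fm \<alpha> \<Longrightarrow> low_fm \<alpha> \<Longrightarrow> bfm \<alpha> \<Longrightarrow> vq e \<Longrightarrow> sat e \<alpha>"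
  by (elim vq_cl) (simp add: sat_cl ax_sat)

end

subsection \<open>Bracket abstraction\<close>

lemma lam_closed: "(n,\<sigma>) \<notin> tm_vars t \<Longrightarrow> lam n \<sigma> t = Comb_K (ty_of t) \<sigma> \<cdot> t"
  by (subst lam.simps) simp
lemma lam_Var: "lam n \<sigma> (Var n \<sigma>) = Comb_S \<sigma> (\<sigma> \<leadsto> \<sigma>) \<sigma> \<cdot> Comb_K \<sigma> (\<sigma> \<leadsto> \<sigma>) \<cdot> Comb_K \<sigma> \<sigma>"
  by (subst lam.simps) simp
lemma lam_App: "(n,\<sigma>) \<in> tm_vars (r \<cdot> s) \<Longrightarrow>
   lam n \<sigma> (r \<cdot> s) = Comb_S \<sigma> (ty_of s) (ty_of (r \<cdot> s)) \<cdot> lam n \<sigma> r \<cdot> lam n \<sigma> s"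
  by (subst lam.simps) simp

text \<open>Induction along the recursion of \<open>lam\<close>, which stops at every term without
  the abstracted variable; plain induction on terms would descend into those too.\<close>

lemma lam_cases:
  assumes "\<And>t. (n,\<sigma>) \<notin> tm_vars t \<Longrightarrow> P t" "P (Var n \<sigma>)"
    "\<And>r s. (n,\<sigma>) \<in> tm_vars (r \<cdot> s) \<Longrightarrow> P r \<Longrightarrow> P s \<Longrightarrow> P (r \<cdot> s)"
  shows "P t"
proof (induction t)
  case (Var m \<tau>) then show ?case using assms by (cases "(m,\<tau>) = (n,\<sigma>)") auto
next
  case (App r s) then show ?case using assms by (cases "(n,\<sigma>) \<in> tm_vars (r \<cdot> s)") blast+
qed (auto intro: assms)

lemma lam_typed: "well_typed t \<Longrightarrow> well_typed (lam n \<sigma> t) \<and> ty_of (lam n \<sigma> t) = \<sigma> \<leadsto> ty_of t"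
proof (induction t rule: lam_cases[where n=n and \<sigma>=\<sigma>])
  case (1 t) then show ?case by (simp add: lam_closed)
next
  case 2 then show ?case by (simp add: lam_Var)
next
  case (3 r s)
  then obtain \<tau> where "ty_of r = ty_of s \<leadsto> \<tau>" by auto
  then show ?case using 3 by (simp add: lam_App)
qed

lemma well_typed_lam [simp]: "well_typed t \<Longrightarrow> well_typed (lam n \<sigma> t)"
  and ty_of_lam [simp]: "well_typed t \<Longrightarrow> ty_of (lam n \<sigma> t) = \<sigma> \<leadsto> ty_of t"
  using lam_typed by auto

lemma tm_vars_lam [simp]: "tm_vars (lam n \<sigma> t) = tm_vars t - {(n,\<sigma>)}"
proof (induction t rule: lam_cases[where n=n and \<sigma>=\<sigma>])
  case (1 t) then show ?case by (simp add: lam_closed)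
next
  case 2 then show ?case by (simp add: lam_Var)
next
  case (3 r s) then show ?case by (simp add: lam_App) blast
qed

text \<open>An application is abstracted by a \<open>Comb_S\<close> at its own type, and the arity
  of that combinator exceeds the arity of the type by three. The various bounds on terms (299, 290,
  250, 240, 200) are spaced to leave room for such abstractions.\<close>

lemma bnd_lam_aux: "well_typed t \<Longrightarrow> bnd k t \<Longrightarrow> arity \<sigma> \<le> k \<Longrightarrow> bnd (k + 3) (lam n \<sigma> t)"
proof (induction t rule: lam_cases[where n=n and \<sigma>=\<sigma>])
  case (1 t) then show ?case using arity_ty_of[of t k] bnd_mono[of k t "k+3"] by (simp add: lam_closed)
next
  case 2 then show ?case by (simp add: lam_Var)
next
  case (3 r s)
  have "arity (ty_of (r \<cdot> s)) \<le> k" using 3(4-6) by (intro arity_ty_of)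
  then show ?case using 3 by (simp add: lam_App)
qed

lemma bnd_lam [simp]: "well_typed t \<Longrightarrow> 3 \<le> k \<Longrightarrow> arity \<sigma> \<le> k - 3 \<Longrightarrow> bnd (k - 3) t \<Longrightarrow> bnd k (lam n \<sigma> t)"
  using bnd_lam_aux[of t "k - 3" \<sigma> n] by simp

context henkin begin

lemma ev_lam:
  "well_typed t \<Longrightarrow> bnd 290 t \<Longrightarrow> arity \<sigma> \<le> 280 \<Longrightarrow> vq e \<Longrightarrow> u \<in> Dq \<sigma> \<Longrightarrow>
   ap (ev e (lam n \<sigma> t)) u = ev (e((n,\<sigma>) := u)) t"
proof (induction t rule: lam_cases[where n=n and \<sigma>=\<sigma>])
  case (1 t)
  have "ev e t \<in> Dq (ty_of t)" using 1 ev_Dq bnd_mono by simp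
  moreover have "arity (ty_of t) \<le> 290" using 1 arity_ty_of by blast
  moreover have "ev (e((n,\<sigma>) := u)) t = ev e t" using 1(1) by (intro ev_cong) auto
  ultimately show ?case using 1 by (simp add: lam_closed ap_K del: fun_upd_apply)
next
  case 2
  have "ap (cl (Comb_K \<sigma> (\<sigma> \<leadsto> \<sigma>))) u \<in> Dq ((\<sigma> \<leadsto> \<sigma>) \<leadsto> \<sigma>)" "ap (cl (Comb_K \<sigma> \<sigma>)) u \<in> Dq (\<sigma> \<leadsto> \<sigma>)"
    using 2 by (auto intro!: ap_Dq cl_Dq)
  then show ?case using 2 by (simp add: lam_Var ap_S[where \<rho>=\<sigma> and \<sigma>="\<sigma> \<leadsto> \<sigma>" and \<tau>=\<sigma>] cl_Dq
      ap_K[where \<sigma>=\<sigma> and \<tau>="\<sigma> \<leadsto> \<sigma>"])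
next
  case (3 r s)
  then obtain \<tau> where \<tau>: "ty_of r = ty_of s \<leadsto> \<tau>" by auto
  have ar: "arity (ty_of s) \<le> 290" "arity (ty_of r) \<le> 290" using 3 arity_ty_of by auto
  have "bnd 299 (lam n \<sigma> r)" "bnd 299 (lam n \<sigma> s)" using 3 bnd_mono[of 290 _ 296] by simp_all
  then have "ev e (lam n \<sigma> r) \<in> Dq (\<sigma> \<leadsto> ty_of s \<leadsto> \<tau>)" "ev e (lam n \<sigma> s) \<in> Dq (\<sigma> \<leadsto> ty_of s)"
    using 3 \<tau> ev_Dq[of "lam n \<sigma> r" e] ev_Dq[of "lam n \<sigma> s" e] by simp_all
  then show ?case using 3 ar \<tau> by (simp add: lam_App ap_S del: fun_upd_apply)
qed

end

section \<open>The numbers of the model\<close>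

text \<open>Without a countermodel \<open>M0\<close> is arbitrary and \<open>Dq TN\<close> obeys no
  laws. The type is then a copy of the standard numbers, with singletons of variables as codes, so
  that the class instances below hold unconditionally.\<close>

typedef hnat = "if ok_model then Dq TN else range (\<lambda>n. {Var n TN})"
  using cl_Dq[of Zero TN] by auto

abbreviation nv :: "tm set \<Rightarrow> hnat" where "nv \<equiv> Abs_hnat"
abbreviation no :: "hnat \<Rightarrow> tm set" where "no \<equiv> Rep_hnat"

definition sn :: "nat \<Rightarrow> hnat" where "sn n = nv {Var n TN}"
definition ns :: "hnat \<Rightarrow> nat" where "ns x = (THE n. no x = {Var n TN})"

lemma no_sn: "\<not> ok_model \<Longrightarrow> no (sn n) = {Var n TN}"
  by (simp add: sn_def Abs_hnat_inverse)
lemma ns_sn: "\<not> ok_model \<Longrightarrow> ns (sn n) = n"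
  by (simp add: ns_def no_sn)
lemma sn_ns: "\<not> ok_model \<Longrightarrow> sn (ns x) = x"
proof -
  assume n: "\<not> ok_model"
  obtain k where "no x = {Var k TN}" using n Rep_hnat[of x] by auto
  then have "no x = no (sn k)" using n no_sn by simp
  then have "x = sn k" by (simp only: Rep_hnat_inject)
  then show ?thesis using n ns_sn by simp
qed

definition evN :: "qenv \<Rightarrow> tm \<Rightarrow> hnat" where "evN e t = nv (ev e t)"
definition e_q :: qenv where "e_q v = cl (e_high v)"
definition un :: "tm \<Rightarrow> hnat \<Rightarrow> hnat" where "un c x = nv (ap (ev e_q c) (no x))"
definition bin :: "tm \<Rightarrow> hnat \<Rightarrow> hnat \<Rightarrow> hnat" where "bin c x y = nv (ap (ap (ev e_q c) (no x)) (no y))"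
definition hrec :: "tm set \<Rightarrow> hnat \<Rightarrow> hnat \<Rightarrow> hnat" where
  "hrec z n a = nv (ap (ap (ap (cl Rec) (no n)) (no a)) z)"
definition tN :: "tm \<Rightarrow> bool" where "tN t \<longleftrightarrow> well_typed t \<and> ty_of t = TN \<and> bnd 250 t"
definition closed_tm :: "ty \<Rightarrow> tm \<Rightarrow> bool" where
  "closed_tm \<sigma> c \<longleftrightarrow> well_typed c \<and> ty_of c = \<sigma> \<and> bnd 250 c \<and> tm_vars c = {}"

lemma vq_e_q: "vq e_q"
  using valn_e_high by (auto simp: vq_def e_q_def valn_def intro: cl_Dq)

lemma tm_facts1 [simp]:
  "well_typed pred_tm" "ty_of pred_tm = TN \<leadsto> TN" "tm_vars pred_tm = {}" "9 + 3 \<le> k \<Longrightarrow> bnd k pred_tm"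
  by (auto simp: pred_tm_def)
lemma tm_facts2 [simp]:
  "well_typed add_tm" "ty_of add_tm = TN \<leadsto> TN \<leadsto> TN" "tm_vars add_tm = {}" "15 \<le> k \<Longrightarrow> bnd k add_tm"
  by (auto simp: add_tm_def)
lemma tm_facts3 [simp]:
  "well_typed mult_tm" "ty_of mult_tm = TN \<leadsto> TN \<leadsto> TN" "tm_vars mult_tm = {}" "27 \<le> k \<Longrightarrow> bnd k mult_tm"
  by (auto simp: mult_tm_def)
lemma tm_facts4 [simp]:
  "well_typed monus_tm" "ty_of monus_tm = TN \<leadsto> TN \<leadsto> TN" "tm_vars monus_tm = {}" "24 \<le> k \<Longrightarrow> bnd k monus_tm"
  by (auto simp: monus_tm_def)
lemma tm_facts5 [simp]:
  "well_typed pow2_tm" "ty_of pow2_tm = TN \<leadsto> TN" "tm_vars pow2_tm = {}" "27 \<le> k \<Longrightarrow> bnd k pow2_tm"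
  unfolding pow2_tm_def by (simp_all split del: if_split) (auto intro!: bnd_lam)

context henkin begin

lemma no_Dq [simp]: "no x \<in> Dq TN"
  using Rep_hnat[of x] ok by simp

lemma no_nv [simp]: "X \<in> Dq TN \<Longrightarrow> no (nv X) = X"
  using ok by (simp add: Abs_hnat_inverse)

lemma vq_updN [simp]: "vq e \<Longrightarrow> vq (e((n,TN) := no x))"
  by (rule vq_upd) simp_all

lemma tN_ev: "tN t \<Longrightarrow> vq e \<Longrightarrow> ev e t = no (evN e t)"
  using ev_Dq[of t e] bnd_mono[of 250 t 299] by (simp add: tN_def evN_def)

lemma ev_closed: "closed_tm \<sigma> c \<Longrightarrow> ev e c = ev e' c"
  by (rule ev_cong) (simp add: closed_tm_def)

lemma evN_Var [simp]: "evN e (Var n \<sigma>) = nv (e (n,\<sigma>))"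
  by (simp add: evN_def)

lemma evN_un: "closed_tm T1 c \<Longrightarrow> tN t \<Longrightarrow> vq e \<Longrightarrow> evN e (c \<cdot> t) = un c (evN e t)"
  using ev_closed[of _ c e e_q] by (simp add: evN_def[of e "c \<cdot> t"] un_def tN_ev)

lemma evN_bin: "closed_tm (TN \<leadsto> T1) c \<Longrightarrow> tN s \<Longrightarrow> tN t \<Longrightarrow> vq e \<Longrightarrow> evN e (c \<cdot> s \<cdot> t) = bin c (evN e s) (evN e t)"
  using ev_closed[of _ c e e_q] by (simp add: evN_def[of e "c \<cdot> s \<cdot> t"] bin_def tN_ev)

lemma evN_rec: "tN s \<Longrightarrow> tN t \<Longrightarrow> vq e \<Longrightarrow> evN e (Rec \<cdot> s \<cdot> t \<cdot> r) = hrec (ev e r) (evN e s) (evN e t)"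
  by (simp add: evN_def[of e "Rec \<cdot> s \<cdot> t \<cdot> r"] hrec_def tN_ev)

lemma ev_lam2:
  assumes "well_typed t" "bnd 250 t" "arity \<sigma> \<le> 250" "arity \<tau> \<le> 250" "vq e" "u \<in> Dq \<sigma>" "w \<in> Dq \<tau>"
  shows "ap (ap (ev e (lam n \<sigma> (lam m \<tau> t))) u) w = ev (e((n,\<sigma>) := u, (m,\<tau>) := w)) t"
proof -
  have "bnd 290 (lam m \<tau> t)" "bnd 290 t" using assms bnd_mono[of 250 t] by simp_all
  then show ?thesis using assms by (simp add: ev_lam vq_upd del: fun_upd_apply)
qed

lemma un_lam: "tN t \<Longrightarrow> un (lamN n t) x = evN (e_q((n,TN) := no x)) t"
  using ev_lam[of t TN e_q "no x" n] bnd_mono[of 250 t 290] vq_e_q by (simp add: un_def evN_def tN_def)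

lemma bin_lam: "tN t \<Longrightarrow> bin (lamN n (lamN m t)) x y = evN (e_q((n,TN) := no x, (m,TN) := no y)) t"
  using ev_lam2[of t TN TN e_q "no x" "no y" n m] vq_e_q by (simp add: bin_def evN_def tN_def)

lemma hrec_0: "z \<in> Dq (TN \<leadsto> T1) \<Longrightarrow> hrec z (nv (cl Zero)) a = a"
proof -
  assume "z \<in> Dq (TN \<leadsto> T1)"
  moreover have "no a \<in> Dq TN" by simp
  ultimately obtain z' a' where z: "z' \<in> Obj (TN \<leadsto> T1)" "z = cl z'" "a' \<in> Obj TN" "no a = cl a'"
    by (elim DqE)
  have o: "Rec \<cdot> Zero \<in> Obj (TN \<leadsto> (TN \<leadsto> T1) \<leadsto> TN)" "Rec \<cdot> Zero \<cdot> a' \<in> Obj ((TN \<leadsto> T1) \<leadsto> TN)"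
    "Rec \<cdot> Zero \<cdot> a' \<cdot> z' \<in> Obj TN"
    using z by (auto intro!: Obj_App)
  have "ap (ap (ap (cl Rec) (cl Zero)) (no a)) z = cl (Rec \<cdot> Zero \<cdot> a' \<cdot> z')"
    using z o by (simp add: ap_cl[of _ TN "TN \<leadsto> (TN \<leadsto> T1) \<leadsto> TN"] ap_cl[of _ TN "(TN \<leadsto> T1) \<leadsto> TN"]
        ap_cl[of _ "TN \<leadsto> T1" TN])
  also have "\<dots> = cl a'" using o z M0_Rec_Zero[of a' z'] cl_eq_iff[of _ TN] by simp
  also have "\<dots> = no a" using z by simp
  finally show ?thesis by (simp add: hrec_def cl_Dq Rep_hnat_inverse)
qed

lemma hrec_Succ: "z \<in> Dq (TN \<leadsto> T1) \<Longrightarrow>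
  hrec z (nv (ap (cl Succ) (no n))) a = nv (ap (ap z (no (hrec z n a))) (no n))"
proof -
  assume zz: "z \<in> Dq (TN \<leadsto> T1)"
  moreover have "no a \<in> Dq TN" "no n \<in> Dq TN" by simp_all
  ultimately obtain z' a' n' where z: "z' \<in> Obj (TN \<leadsto> T1)" "z = cl z'" "a' \<in> Obj TN" "no a = cl a'"
    "n' \<in> Obj TN" "no n = cl n'"
    by (elim DqE)
  have o: "Succ \<cdot> n' \<in> Obj TN" "Rec \<cdot> m \<in> Obj (TN \<leadsto> (TN \<leadsto> T1) \<leadsto> TN)" "Rec \<cdot> m \<cdot> a' \<in> Obj ((TN \<leadsto> T1) \<leadsto> TN)"
    "Rec \<cdot> m \<cdot> a' \<cdot> z' \<in> Obj TN" if "m \<in> Obj TN" for m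
    using z that by (auto intro!: Obj_App)
  have r: "ap (ap (ap (cl Rec) (cl m)) (cl a')) (cl z') = cl (Rec \<cdot> m \<cdot> a' \<cdot> z')" if "m \<in> Obj TN" for m
    using z o that by (simp add: ap_cl[of _ TN "TN \<leadsto> (TN \<leadsto> T1) \<leadsto> TN"] ap_cl[of _ TN "(TN \<leadsto> T1) \<leadsto> TN"]
        ap_cl[of _ "TN \<leadsto> T1" TN])
  have s: "ap (cl Succ) (cl n') = cl (Succ \<cdot> n')" using z by (simp add: ap_cl[of _ TN TN])
  have h: "hrec z n a = nv (cl (Rec \<cdot> n' \<cdot> a' \<cdot> z'))" using r[of n'] z by (simp add: hrec_def)
  have o2: "z' \<cdot> (Rec \<cdot> n' \<cdot> a' \<cdot> z') \<in> Obj T1" "z' \<cdot> (Rec \<cdot> n' \<cdot> a' \<cdot> z') \<cdot> n' \<in> Obj TN"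
    using z o[of n'] by (auto intro!: Obj_App)
  have "ap (ap z (no (hrec z n a))) (no n) = cl (z' \<cdot> (Rec \<cdot> n' \<cdot> a' \<cdot> z') \<cdot> n')"
    using z h o[of n'] o2 by (simp add: cl_Dq ap_cl[of _ TN T1] ap_cl[of _ TN TN])
  also have "\<dots> = cl (Rec \<cdot> (Succ \<cdot> n') \<cdot> a' \<cdot> z')"
    using o[of n'] o[of "Succ \<cdot> n'"] o2 z cl_eq_iff[of _ TN] M0_sym[OF _ _ M0_Rec_Succ[of n' a' z']] by simp
  also have "\<dots> = ap (ap (ap (cl Rec) (no (nv (ap (cl Succ) (no n))))) (no a)) z"
    using z s r[of "Succ \<cdot> n'"] o by (simp add: cl_Dq)
  finally show ?thesis by (simp add: hrec_def)
qed

end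


section \<open>The arithmetical operations and the internal functions\<close>

definition hS :: "hnat \<Rightarrow> hnat" where "hS x = (if ok_model then un Succ x else sn (Suc (ns x)))"
definition hpred :: "hnat \<Rightarrow> hnat" where "hpred x = (if ok_model then un pred_tm x else sn (ns x - 1))"
definition hpow2 :: "hnat \<Rightarrow> hnat" where "hpow2 x = (if ok_model then un pow2_tm x else sn (2 ^ ns x))"

instantiation hnat :: "{zero,one,plus,minus,times,ord}" begin
definition zero_hnat_def: "0 = (if ok_model then nv (cl Zero) else sn 0)"
definition plus_hnat_def: "x + y = (if ok_model then bin add_tm x y else sn (ns x + ns y))"
definition times_hnat_def: "x * y = (if ok_model then bin mult_tm x y else sn (ns x * ns y))"
definition minus_hnat_def: "x - y = (if ok_model then bin monus_tm x y else sn (ns x - ns y))"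
definition one_hnat_def: "1 = hS 0"
text \<open>Chosen to agree with the formula \<open>le_nat\<close>; that it is a linear order has to
  be derived by induction from the laws of truncated subtraction.\<close>

definition less_eq_hnat_def: "x \<le> y \<longleftrightarrow> x - y = (0::hnat)"
definition less_hnat_def: "x < y \<longleftrightarrow> \<not> y \<le> (x::hnat)"
instance ..
end

text \<open>In a genuine model these are the internal functions; in the fallback copy of the standard
  numbers every function counts as internal.\<close>

definition Int1 :: "(hnat \<Rightarrow> hnat) \<Rightarrow> bool" where
  "Int1 f \<longleftrightarrow> \<not> ok_model \<or> (\<exists>u\<in>Dq T1. \<forall>x. f x = nv (ap u (no x)))"

lemma closed_tms:
  "closed_tm T1 Succ" "closed_tm T1 pred_tm" "closed_tm T1 pow2_tm" "closed_tm (TN \<leadsto> T1) add_tm"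
  "closed_tm (TN \<leadsto> T1) mult_tm" "closed_tm (TN \<leadsto> T1) monus_tm"
  by (auto simp: closed_tm_def)

lemma tN_simps [simp]:
  "tN Zero" "tN (V n)" "tN (Succ \<cdot> t) \<longleftrightarrow> tN t" "tN (pred_tm \<cdot> t) \<longleftrightarrow> tN t" "tN (pow2_tm \<cdot> t) \<longleftrightarrow> tN t"
  "tN (s \<^bold>+ t) \<longleftrightarrow> tN s \<and> tN t" "tN (s \<^bold>* t) \<longleftrightarrow> tN s \<and> tN t" "tN (s \<^bold>- t) \<longleftrightarrow> tN s \<and> tN t"
  "tN (V1 n \<cdot> t) \<longleftrightarrow> tN t" "tN (Var n T2 \<cdot> V1 m)"
  by (auto simp: tN_def)

context henkin begin

lemma evN_ops [simp]:
  "evN e Zero = 0"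
  "tN t \<Longrightarrow> vq e \<Longrightarrow> evN e (Succ \<cdot> t) = hS (evN e t)"
  "tN t \<Longrightarrow> vq e \<Longrightarrow> evN e (pred_tm \<cdot> t) = hpred (evN e t)"
  "tN t \<Longrightarrow> vq e \<Longrightarrow> evN e (pow2_tm \<cdot> t) = hpow2 (evN e t)"
  "tN s \<Longrightarrow> tN t \<Longrightarrow> vq e \<Longrightarrow> evN e (s \<^bold>+ t) = evN e s + evN e t"
  "tN s \<Longrightarrow> tN t \<Longrightarrow> vq e \<Longrightarrow> evN e (s \<^bold>* t) = evN e s * evN e t"
  "tN s \<Longrightarrow> tN t \<Longrightarrow> vq e \<Longrightarrow> evN e (s \<^bold>- t) = evN e s - evN e t"
  using ok by (simp_all add: evN_un evN_bin closed_tms zero_hnat_def hS_def hpred_def hpow2_def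
      plus_hnat_def times_hnat_def minus_hnat_def) (simp add: evN_def)

lemma nv_no [simp]: "nv (no x) = x" by (rule Rep_hnat_inverse)

lemma lam2_Dq: "tN t \<Longrightarrow> vq e \<Longrightarrow> ev e (lamN n (lamN m t)) \<in> Dq (TN \<leadsto> T1)"
  using ev_Dq[of "lamN n (lamN m t)" e] bnd_mono[of 250 t] by (simp add: tN_def)

lemma hrec_simps [simp]:
  "z \<in> Dq (TN \<leadsto> T1) \<Longrightarrow> hrec z 0 a = a"
  "z \<in> Dq (TN \<leadsto> T1) \<Longrightarrow> hrec z (hS n) a = nv (ap (ap z (no (hrec z n a))) (no n))"
  using ok hrec_0 hrec_Succ[of z n a] by (simp_all add: zero_hnat_def hS_def un_def)

lemma step_lam [simp]: "tN t \<Longrightarrow> vq e \<Longrightarrow>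
  nv (ap (ap (ev e (lamN n (lamN m t))) (no x)) (no y)) = evN (e((n,TN) := no x, (m,TN) := no y)) t"
  using ev_lam2[of t TN TN e "no x" "no y" n m] by (simp add: evN_def tN_def)

lemma tN_rec [simp]: "tN s \<Longrightarrow> tN t \<Longrightarrow> tN r \<Longrightarrow> bnd 240 r \<Longrightarrow> tN (Rec \<cdot> s \<cdot> t \<cdot> lamN n (lamN m r))"
  using bnd_mono[of 240 r 244] by (simp add: tN_def)

lemma op_rec:
  "hpred x = hrec (ev (e_q((0,TN) := no x)) (lamN 1 (lamN 2 (V 2)))) x 0"
  "x + y = hrec (ev (e_q((0,TN) := no x, (1,TN) := no y)) (lamN 2 (lamN 3 (Succ \<cdot> V 2)))) y x"
  "x * y = hrec (ev (e_q((0,TN) := no x, (1,TN) := no y)) (lamN 2 (lamN 3 (V 2 \<^bold>+ V 0)))) y 0"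
  "x - y = hrec (ev (e_q((0,TN) := no x, (1,TN) := no y)) (lamN 2 (lamN 3 (npred (V 2))))) y x"
  "hpow2 x = hrec (ev (e_q((0,TN) := no x)) (lamN 1 (lamN 2 (V 1 \<^bold>+ V 1)))) x (hS 0)"
  \<comment> \<open>Each term definition is unfolded only as the argument of \<open>un\<close> or
    \<open>bin\<close>. Occurrences inside another term, such as the addition in the step of
    multiplication, stay folded and are evaluated by \<open>evN_ops\<close>.\<close>
  unfolding hpred_def hpow2_def plus_hnat_def times_hnat_def minus_hnat_def
    pred_tm_def[THEN arg_cong[where f=un]] pow2_tm_def[THEN arg_cong[where f=un]]
    add_tm_def[THEN arg_cong[where f=bin]] mult_tm_def[THEN arg_cong[where f=bin]] monus_tm_def[THEN arg_cong[where f=bin]]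
  using ok vq_e_q
  by (simp_all add: un_lam bin_lam evN_rec del: fun_upd_apply) simp_all

lemma op_laws:
  "hpred 0 = 0" "hpred (hS x) = x" "x + 0 = x" "x + hS y = hS (x + y)" "x * 0 = 0" "x * hS y = x * y + x"
  "x - 0 = x" "x - hS y = hpred (x - y)" "hpow2 0 = hS 0" "hpow2 (hS x) = hpow2 x + hpow2 x"
  for x y :: hnat
proof -
  note [simp] = vq_e_q lam2_Dq
  show "hpred 0 = 0" "hpred (hS x) = x" by (simp_all add: op_rec(1) del: fun_upd_apply) simp
  show "x + 0 = x" by (simp add: op_rec(2) del: fun_upd_apply)
  show "x * 0 = 0" by (simp add: op_rec(3) del: fun_upd_apply)
  show "x - 0 = x" by (simp add: op_rec(4) del: fun_upd_apply)
  show "hpow2 0 = hS 0" by (simp add: op_rec(5) del: fun_upd_apply)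
  \<comment> \<open>The environment also stores the recursion argument. The step function does not
    mention that variable, so it has the same value at \<open>y\<close> and at
    \<open>hS y\<close>.\<close>
  have "ev (e_q((0,TN) := no x, (1,TN) := no y)) (lamN 2 (lamN 3 (Succ \<cdot> V 2))) =
        ev (e_q((0,TN) := no x, (1,TN) := no (hS y))) (lamN 2 (lamN 3 (Succ \<cdot> V 2)))"
    by (rule ev_cong) auto
  then show "x + hS y = hS (x + y)"
    unfolding op_rec(2)[of x "hS y"] op_rec(2)[of x y] by (simp del: fun_upd_apply) simp
  have "ev (e_q((0,TN) := no x, (1,TN) := no y)) (lamN 2 (lamN 3 (V 2 \<^bold>+ V 0))) =
        ev (e_q((0,TN) := no x, (1,TN) := no (hS y))) (lamN 2 (lamN 3 (V 2 \<^bold>+ V 0)))"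
    by (rule ev_cong) auto
  then show "x * hS y = x * y + x"
    unfolding op_rec(3)[of x "hS y"] op_rec(3)[of x y] by (simp del: fun_upd_apply) simp
  have "ev (e_q((0,TN) := no x, (1,TN) := no y)) (lamN 2 (lamN 3 (npred (V 2)))) =
        ev (e_q((0,TN) := no x, (1,TN) := no (hS y))) (lamN 2 (lamN 3 (npred (V 2))))"
    by (rule ev_cong) auto
  then show "x - hS y = hpred (x - y)"
    unfolding op_rec(4)[of x "hS y"] op_rec(4)[of x y] by (simp del: fun_upd_apply) simp
  have "ev (e_q((0,TN) := no x)) (lamN 1 (lamN 2 (V 1 \<^bold>+ V 1))) =
        ev (e_q((0,TN) := no (hS x))) (lamN 1 (lamN 2 (V 1 \<^bold>+ V 1)))"
    by (rule ev_cong) auto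
  then show "hpow2 (hS x) = hpow2 x + hpow2 x"
    unfolding op_rec(5)[of "hS x"] op_rec(5)[of x] by (simp del: fun_upd_apply) simp
qed

lemma hS_laws: "hS x \<noteq> 0" "hS x = hS y \<longleftrightarrow> x = y"
proof -
  have "no x \<in> Dq TN" "no y \<in> Dq TN" by simp_all
  then obtain u v where u: "u \<in> Obj TN" "no x = cl u" "v \<in> Obj TN" "no y = cl v" by (elim DqE)
  have o: "Succ \<cdot> u \<in> Obj TN" "Succ \<cdot> v \<in> Obj TN" using u by (auto intro!: Obj_App)
  have S: "hS x = nv (cl (Succ \<cdot> u))" "hS y = nv (cl (Succ \<cdot> v))"
    using ok u by (simp_all add: hS_def un_def ap_cl[of _ TN TN])
  have n: "no (hS x) = cl (Succ \<cdot> u)" "no (hS y) = cl (Succ \<cdot> v)" "no 0 = cl Zero"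
    using S o ok by (simp_all add: cl_Dq zero_hnat_def)
  have "no (hS x) \<noteq> no 0" using n cl_eq_iff[of "Succ \<cdot> u" TN Zero] M0_Succ u o by simp
  then show "hS x \<noteq> 0" by auto
  have "no (hS x) = no (hS y) \<longleftrightarrow> no x = no y"
    using n u o cl_eq_iff[of "Succ \<cdot> u" TN "Succ \<cdot> v"] cl_eq_iff[of u TN v] M0_Succ_inj
      eqv_ext[of TN TN Succ u v] by auto
  then show "hS x = hS y \<longleftrightarrow> x = y" by (simp only: Rep_hnat_inject)
qed

lemma Int1_lam: "tN t \<Longrightarrow> vq e \<Longrightarrow> Int1 (\<lambda>x. evN (e((n,TN) := no x)) t)"
  unfolding Int1_def
  by (rule disjI2, rule bexI[of _ "ev e (lamN n t)"])
    (use ev_lam[of t TN e _ n] ev_Dq[of "lamN n t" e] bnd_mono[of 250 t] in \<open>simp_all add: evN_def tN_def\<close>)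

lemma evN_V1: "tN t \<Longrightarrow> vq e \<Longrightarrow> evN e (V1 n \<cdot> t) = nv (ap (e (n,T1)) (no (evN e t)))"
  by (simp add: evN_def[of e "V1 n \<cdot> t"] tN_ev)

text \<open>With codes of \<open>f\<close> and \<open>g\<close> assigned to variables 0 and 2, the
  combined function is the value of an abstraction, hence internal.\<close>

lemma Int1_comb:
  assumes "\<And>e. vq e \<Longrightarrow> evN e (c \<cdot> (V1 0 \<cdot> V 1) \<cdot> (V1 2 \<cdot> V 1)) = op (evN e (V1 0 \<cdot> V 1)) (evN e (V1 2 \<cdot> V 1))"
    "tN (c \<cdot> (V1 0 \<cdot> V 1) \<cdot> (V1 2 \<cdot> V 1))" "Int1 f" "Int1 g"
  shows "Int1 (\<lambda>x. op (f x) (g x))"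
proof -
  obtain u v where uv: "u \<in> Dq T1" "v \<in> Dq T1" "\<And>x. f x = nv (ap u (no x))" "\<And>x. g x = nv (ap v (no x))"
    using assms(3,4) ok by (auto simp: Int1_def)
  define e where "e = e_q((0,T1) := u, (2,T1) := v)"
  have e: "vq e" using uv vq_e_q by (simp add: e_def vq_upd del: fun_upd_apply)
  then have "vq (e((1,TN) := no x))" for x by simp
  then have "evN (e((1,TN) := no x)) (c \<cdot> (V1 0 \<cdot> V 1) \<cdot> (V1 2 \<cdot> V 1)) = op (f x) (g x)" for x
    using assms(1)[of "e((1,TN) := no x)"] uv by (simp add: evN_V1) (simp add: e_def)
  then show ?thesis using Int1_lam[OF assms(2) e, of 1] by simp
qed

lemma Int1_intros_ok:
  "Int1 (\<lambda>x. x)" "Int1 (\<lambda>x. c)" "Int1 f \<Longrightarrow> Int1 g \<Longrightarrow> Int1 (\<lambda>x. f x + g x)"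
  "Int1 f \<Longrightarrow> Int1 g \<Longrightarrow> Int1 (\<lambda>x. f x * g x)" "Int1 f \<Longrightarrow> Int1 g \<Longrightarrow> Int1 (\<lambda>x. f x - g x)"
  "Int1 f \<Longrightarrow> Int1 g \<Longrightarrow> Int1 (\<lambda>x. f (g x))" "Int1 hpow2" "Int1 hS" "Int1 hpred"
proof -
  show "Int1 (\<lambda>x. x)" using Int1_lam[of "V 0" e_q 0] vq_e_q by simp
  show "Int1 (\<lambda>x. c)" using Int1_lam[of "V 0" "e_q((0,TN) := no c)" 1] vq_e_q by simp
  show "Int1 f \<Longrightarrow> Int1 g \<Longrightarrow> Int1 (\<lambda>x. f x + g x)" by (rule Int1_comb[of add_tm]) simp_all
  show "Int1 f \<Longrightarrow> Int1 g \<Longrightarrow> Int1 (\<lambda>x. f x * g x)" by (rule Int1_comb[of mult_tm]) simp_all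
  show "Int1 f \<Longrightarrow> Int1 g \<Longrightarrow> Int1 (\<lambda>x. f x - g x)" by (rule Int1_comb[of monus_tm]) simp_all
  show "Int1 hpow2" using Int1_lam[of "pow2_tm \<cdot> V 0" e_q 0] vq_e_q by simp
  show "Int1 hS" using Int1_lam[of "Succ \<cdot> V 0" e_q 0] vq_e_q by simp
  show "Int1 hpred" using Int1_lam[of "npred (V 0)" e_q 0] vq_e_q by simp
  assume "Int1 f" "Int1 g"
  then obtain u v where uv: "u \<in> Dq T1" "v \<in> Dq T1" "\<And>x. f x = nv (ap u (no x))" "\<And>x. g x = nv (ap v (no x))"
    using ok by (auto simp: Int1_def)
  define e where "e = e_q((0,T1) := u, (2,T1) := v)"
  have e: "vq e" using uv vq_e_q by (simp add: e_def vq_upd del: fun_upd_apply)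
  then have "vq (e((1,TN) := no x))" for x by simp
  then have "evN (e((1,TN) := no x)) (V1 0 \<cdot> (V1 2 \<cdot> V 1)) = f (g x)" for x
    using uv by (simp add: evN_V1) (simp add: e_def)
  then show "Int1 (\<lambda>x. f (g x))" using Int1_lam[OF _ e, of "V1 0 \<cdot> (V1 2 \<cdot> V 1)" 1] by simp
qed

lemma Dq_TN_all: "(\<forall>u\<in>Dq TN. P u) \<longleftrightarrow> (\<forall>x. P (no x))"
  by (metis no_Dq no_nv)

text \<open>One instance of quantifier-free induction, the equation between two function variables,
  suffices: assigning codes of \<open>f\<close> and \<open>g\<close> to the variables gives
  induction for every equation between internal functions.\<close>

lemma Int1_induct_ok:
  assumes "Int1 f" "Int1 g" "f 0 = g 0" "\<And>x. f x = g x \<Longrightarrow> f (hS x) = g (hS x)"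
  shows "f x = g x"
proof -
  obtain u v where uv: "u \<in> Dq T1" "v \<in> Dq T1" "\<And>x. f x = nv (ap u (no x))" "\<And>x. g x = nv (ap v (no x))"
    using assms(1,2) ok by (auto simp: Int1_def)
  let ?\<phi> = "Eq (V1 0 \<cdot> V 1) (V1 2 \<cdot> V 1)"
  let ?i = "Imp (fm_subst 1 TN Zero ?\<phi>)
       (Imp (Forall 1 TN (Imp ?\<phi> (fm_subst 1 TN (Succ \<cdot> V 1) ?\<phi>))) (Forall 1 TN ?\<phi>))"
  define e where "e = e_q((0,T1) := u, (2,T1) := v)"
  have e: "vq e" using uv vq_e_q by (simp add: e_def vq_upd del: fun_upd_apply)
  have "sat e ?i"
    by (rule ax_qsat[OF QF_induction _ _ _ e]) (simp_all add: low_tm_def low_bound_def)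
  moreover have "ap u (no x) = ap v (no x) \<longleftrightarrow> f x = g x" for x
  proof -
    have "ap u (no x) \<in> Dq TN" "ap v (no x) \<in> Dq TN" using uv by (auto intro: ap_Dq[of _ TN])
    then show ?thesis using uv ok by (simp add: Abs_hnat_inject)
  qed
  moreover have "cl Zero = no 0" "ap (cl Succ) (no x) = no (hS x)" for x
    using ok by (simp_all add: zero_hnat_def cl_Dq hS_def un_def ap_Dq[of _ TN])
  ultimately show ?thesis using assms(3,4) by (simp add: Dq_TN_all e_def)
qed

text \<open>Being a successor is an existential property; the predecessor term makes it
  quantifier-free and so accessible to induction. This replaces case distinction on standard
  numbers, which the model may exceed.\<close>

lemma zero_or_hS_ok: "x = 0 \<or> x = hS (hpred x)"
proof -
  let ?\<phi> = "Imp (Neg (Eq (V 1) Zero)) (Eq (V 1) (Succ \<cdot> (pred_tm \<cdot> V 1)))"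
  let ?i = "Imp (fm_subst 1 TN Zero ?\<phi>)
       (Imp (Forall 1 TN (Imp ?\<phi> (fm_subst 1 TN (Succ \<cdot> V 1) ?\<phi>))) (Forall 1 TN ?\<phi>))"
  have subst: "tm_subst n \<sigma> t pred_tm = pred_tm" for n \<sigma> t by (rule tm_subst_id) simp
  have "sat e_q ?i"
    by (rule ax_qsat[OF QF_induction _ _ _ vq_e_q])
      (simp_all add: low_tm_def low_bound_def Neg_def subst)
  moreover have "sat e (Eq s t) \<longleftrightarrow> evN e s = evN e t" if "tN s" "tN t" "vq e" for e s t
    using that tN_ev[of s e] tN_ev[of t e] by (simp add: Rep_hnat_inject)
  ultimately have "x \<noteq> 0 \<longrightarrow> x = hS (hpred x)"
    using vq_e_q by (simp add: Dq_TN_all Neg_def subst op_laws hS_laws del: sat.simps(2) fun_upd_apply) simp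
  then show ?thesis by blast
qed

end

section \<open>Laws shared by the model and the fallback\<close>

lemma henkin_ok: "ok_model \<Longrightarrow> henkin"
  by unfold_locales

lemma op_laws_std:
  fixes x y :: hnat assumes "\<not> ok_model" shows
  "hpred 0 = 0" "hpred (hS x) = x" "x + 0 = x" "x + hS y = hS (x + y)" "x * 0 = 0" "x * hS y = x * y + x"
  "x - 0 = x" "x - hS y = hpred (x - y)" "hpow2 0 = hS 0" "hpow2 (hS x) = hpow2 x + hpow2 x"
  using assms ns_sn[OF assms] sn_ns[OF assms]
  by (simp_all add: hpred_def hpow2_def zero_hnat_def plus_hnat_def times_hnat_def minus_hnat_def hS_def
      add.commute[of "ns x"] mult_2)

lemma hnat_op_laws [simp]:
  "hpred 0 = 0" "hpred (hS x) = x" "x + 0 = x" "x + hS y = hS (x + y)" "x * 0 = 0" "x * hS y = x * y + x"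
  "x - 0 = x" "x - hS y = hpred (x - y)" "hpow2 0 = hS 0" "hpow2 (hS x) = hpow2 x + hpow2 x"
  for x y :: hnat
  by (-, (cases ok_model, erule henkin.op_laws[OF henkin_ok], erule op_laws_std)+)

lemma hS_simps [simp]: "hS x \<noteq> 0" "0 \<noteq> hS x" "hS x = hS y \<longleftrightarrow> x = y"
proof -
  have *: "sn a = sn b \<longleftrightarrow> a = b" if "\<not> ok_model" for a b using that ns_sn by metis
  have **: "ns x = ns y \<longleftrightarrow> x = y" if "\<not> ok_model" using that sn_ns by metis
  show "hS x \<noteq> 0" "hS x = hS y \<longleftrightarrow> x = y"
    by (-, (cases ok_model; ((simp add: henkin.hS_laws[OF henkin_ok]; fail) | simp add: zero_hnat_def hS_def * **))+)
  then show "0 \<noteq> hS x" by metis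
qed

lemma Int1_intros [intro!]:
  "Int1 (\<lambda>x. x)" "Int1 (\<lambda>x. c)" "Int1 f \<Longrightarrow> Int1 g \<Longrightarrow> Int1 (\<lambda>x. f x + g x)"
  "Int1 f \<Longrightarrow> Int1 g \<Longrightarrow> Int1 (\<lambda>x. f x * g x)" "Int1 f \<Longrightarrow> Int1 g \<Longrightarrow> Int1 (\<lambda>x. f x - g x)"
  "Int1 f \<Longrightarrow> Int1 (\<lambda>x. hpow2 (f x))" "Int1 f \<Longrightarrow> Int1 (\<lambda>x. hS (f x))" "Int1 f \<Longrightarrow> Int1 (\<lambda>x. hpred (f x))"
  by (-, (cases ok_model; ((simp add: henkin.Int1_intros_ok[OF henkin_ok]; fail) | simp add: Int1_def))+)

lemma Int1_induct:
  assumes "Int1 f" "Int1 g" "f 0 = g 0" "\<And>x. f x = g x \<Longrightarrow> f (hS x) = g (hS x)"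
  shows "f x = g x"
proof (cases ok_model)
  case True then show ?thesis using henkin.Int1_induct_ok[OF henkin_ok] assms by blast
next
  case False
  have "f (sn n) = g (sn n)" for n
  proof (induction n)
    case 0 then show ?case using assms(3) False by (simp add: zero_hnat_def)
  next
    case (Suc n) then show ?case using assms(4)[of "sn n"] False by (simp add: hS_def ns_sn)
  qed
  then show ?thesis using sn_ns[OF False, of x] by metis
qed

lemma zero_or_hS: "x = 0 \<or> x = hS (hpred x)"
proof (cases ok_model)
  case True then show ?thesis using henkin.zero_or_hS_ok henkin_ok by blast
next
  case False
  have "ns x \<noteq> 0 \<Longrightarrow> x = sn (Suc (ns x - 1))" using sn_ns[OF False, of x] by simp
  then show ?thesis using False sn_ns[OF False, of x]
    by (cases "ns x = 0") (simp_all add: zero_hnat_def hS_def hpred_def ns_sn)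
qed

subsection \<open>Arithmetic\<close>

lemma hnat_cases: obtains "x = 0" | y where "x = hS y"
  using zero_or_hS by blast

lemma add_0_left': "0 + x = (x::hnat)"
  by (rule Int1_induct[where f="\<lambda>x. 0 + x"]) auto
lemma hS_add: "hS x + y = hS (x + y)"
  by (rule Int1_induct[where f="\<lambda>y. hS x + y"]) auto
lemma add_comm': "x + y = y + (x::hnat)"
  by (rule Int1_induct[where f="\<lambda>y. x + y"]) (auto simp: add_0_left' hS_add)
lemma add_assoc': "x + y + z = x + (y + (z::hnat))"
  by (rule Int1_induct[where f="\<lambda>z. x + y + z"]) auto

instance hnat :: comm_monoid_add
  by intro_classes (rule add_assoc' add_comm' add_0_left')+

lemma hS_eq: "hS x = x + 1"
  by (simp add: one_hnat_def)

lemma mult_0_left': "0 * x = (0::hnat)"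
  by (rule Int1_induct[where f="\<lambda>x. 0 * x"]) auto
lemma hS_mult: "hS x * y = x * y + y"
proof (rule Int1_induct[where f="\<lambda>y. hS x * y"])
  fix y assume "hS x * y = x * y + y"
  then show "hS x * hS y = x * hS y + hS y" by (simp add: add.assoc) (simp add: add.commute add.left_commute)
qed auto
lemma mult_comm': "x * y = y * (x::hnat)"
  by (rule Int1_induct[where f="\<lambda>y. x * y"]) (auto simp: mult_0_left' hS_mult)
lemma distrib': "x * (y + z) = x * y + x * (z::hnat)"
  by (rule Int1_induct[where f="\<lambda>z. x * (y + z)"]) (auto simp: ac_simps)
lemma mult_assoc': "x * y * z = x * (y * (z::hnat))"
  by (rule Int1_induct[where f="\<lambda>z. x * y * z"]) (auto simp: distrib')

lemma hS_monus: "hS x - hS y = x - y"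
  by (rule Int1_induct[where f="\<lambda>y. hS x - hS y"]) auto
declare hnat_op_laws(8) [simp del]
lemma add_monus: "(x + z) - z = (x::hnat)"
proof (rule Int1_induct[where f="\<lambda>z. (x + z) - z"])
  fix z :: hnat assume "(x + z) - z = x"
  then show "(x + hS z) - hS z = x" by (simp only: hnat_op_laws(4) hS_monus)
qed auto
lemma zero_monus: "0 - x = (0::hnat)"
  by (rule Int1_induct[where f="\<lambda>x. 0 - x"]) (auto simp: hnat_op_laws(8))
lemma monus_add: "x - (y + z) = x - y - (z::hnat)"
  by (rule Int1_induct[where f="\<lambda>z. x - (y + z)"]) (auto simp: hnat_op_laws(8))
lemma add_eq_0': "x + y = 0 \<Longrightarrow> y = (0::hnat)"
  by (cases y rule: hnat_cases) auto

instance hnat :: comm_semiring_1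
proof
  show "(0::hnat) \<noteq> 1" by (simp add: one_hnat_def)
  fix x y z :: hnat
  show "(x + y) * z = x * z + y * z" using distrib'[of z x y] by (simp add: mult_comm')
  show "1 * x = x" using hS_mult[of 0 x] by (simp add: mult_0_left' one_hnat_def)
  show "x * y * z = x * (y * z)" "x * y = y * x" by (rule mult_assoc' mult_comm')+
qed (auto simp: mult_0_left')

text \<open>Only induction in one variable along internal functions is available, so
  \<open>x\<close> and \<open>y\<close> stay fixed and \<open>m\<close> moves along the diagonal:
  the pair \<open>x - (x - m)\<close>, \<open>y - (x - m)\<close> starts with first entry 0 and is
  \<open>(x, y)\<close> at \<open>m = x\<close>. While both entries are positive they arise from
  their predecessors by the step hypothesis; truncation at 0 is covered by the two boundary
  hypotheses.\<close>

lemma double_induct: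
  assumes "Int1 (\<lambda>m. L (x - (x - m)) (y - (x - m)))" "Int1 (\<lambda>m. R (x - (x - m)) (y - (x - m)))"
    "\<And>b. L 0 b = R 0 b" "\<And>a. L a 0 = R a 0"
    "\<And>a b. L a b = R a b \<Longrightarrow> L (hS a) (hS b) = R (hS a) (hS b)"
  shows "L x y = R x y"
proof -
  have self: "z - z = 0" for z :: hnat using add_monus[of 0 z] by simp
  have "L (x - (x - m)) (y - (x - m)) = R (x - (x - m)) (y - (x - m))" for m
  proof (rule Int1_induct[where f="\<lambda>m. L (x - (x - m)) (y - (x - m))"], goal_cases)
    case 3 then show ?case using assms(3) by (simp add: self)
  next
    case (4 m)
    show ?case
    proof (cases "x - m" rule: hnat_cases)
      case 1 with 4 show ?thesis by (simp add: hnat_op_laws(8))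
    next
      case (2 n)
      then have n: "x - hS m = n" by (simp add: hnat_op_laws(8))
      have IH: "L (hpred (x - n)) (hpred (y - n)) = R (hpred (x - n)) (hpred (y - n))"
        using 4 2 by (simp add: hnat_op_laws(8))
      show ?thesis unfolding n using assms(3,4,5) IH
        by (cases "x - n" rule: hnat_cases; cases "y - n" rule: hnat_cases) simp_all
    qed
  qed (use assms in auto)
  from this[of x] show ?thesis by (simp add: self)
qed

text \<open>Both sides are the maximum of \<open>x\<close> and \<open>y\<close>. This symmetry
  yields antisymmetry of the order and the difference in \<open>le_iff_add'\<close>; linearity comes
  from \<open>monus_disj\<close>.\<close>

lemma max_monus: "x + (y - x) = y + (x - (y::hnat))"
  by (rule double_induct[where L="\<lambda>x y. x + (y - x)"])
    (auto simp: hS_monus hS_add zero_monus)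
lemma monus_disj: "(x - y) * (y - x) = (0::hnat)"
  by (rule double_induct[where L="\<lambda>x y. (x - y) * (y - x)" and R="\<lambda>x y. 0"])
    (auto simp: hS_monus zero_monus)

lemma mult_eq_0': "x * y = 0 \<Longrightarrow> x = 0 \<or> y = (0::hnat)"
  by (cases y rule: hnat_cases) (auto dest: add_eq_0')

lemma le_iff_add': "x \<le> y \<longleftrightarrow> (\<exists>c. y = x + (c::hnat))"
proof
  assume "x \<le> y"
  then show "\<exists>c. y = x + c" using max_monus[of x y] by (auto simp: less_eq_hnat_def intro: exI[of _ "y - x"])
next
  assume "\<exists>c. y = x + c"
  then obtain c where "y = x + c" by blast
  then show "x \<le> y" using add_monus[of 0 x] by (simp add: less_eq_hnat_def monus_add zero_monus)
qed

lemma add_cancel': "x + z = y + z \<Longrightarrow> x = (y::hnat)"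
  by (metis add_monus)

instance hnat :: linorder
proof
  fix x y z :: hnat
  show "(x < y) = (x \<le> y \<and> \<not> y \<le> x)" "x \<le> y \<or> y \<le> x"
    using mult_eq_0'[OF monus_disj[of x y]] by (auto simp: less_hnat_def less_eq_hnat_def)
  show "x \<le> x" by (auto simp: le_iff_add' intro: exI[of _ 0])
  show "x \<le> y \<Longrightarrow> y \<le> z \<Longrightarrow> x \<le> z" by (auto simp: le_iff_add' add.assoc)
  show "x \<le> y \<Longrightarrow> y \<le> x \<Longrightarrow> x = y" using max_monus[of x y] by (simp add: less_eq_hnat_def)
qed

lemma less_iff_add': "x < y \<longleftrightarrow> (\<exists>c. y = x + hS c)"
proof -
  have "x < y \<longleftrightarrow> x \<le> y \<and> x \<noteq> y" by auto
  also have "\<dots> \<longleftrightarrow> (\<exists>c. y = x + c \<and> c \<noteq> 0)"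
    using add_cancel'[of _ x 0] by (auto simp: le_iff_add' add.commute)
  also have "\<dots> \<longleftrightarrow> (\<exists>c. y = x + hS c)" by (metis hnat_cases hS_simps(1))
  finally show ?thesis .
qed

instance hnat :: linordered_semidom
proof
  fix a b c :: hnat
  show "a + b - a = b" using add_monus[of b a] by (simp add: add.commute)
  show "a - b - c = a - (b + c)" by (simp add: monus_add)
  show "a * (b - c) = a * b - a * c"
  proof (cases "c \<le> b")
    case True
    then obtain d where "b = c + d" by (auto simp: le_iff_add')
    then show ?thesis using add_monus[of d c] add_monus[of "a * d" "a * c"] by (simp add: distrib' add.commute)
  next
    case False
    then have "b \<le> c" by simp
    then obtain d where "c = b + d" by (auto simp: le_iff_add')
    then show ?thesis using add_monus[of 0 b] add_monus[of 0 "a * b"]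
      by (simp add: distrib' monus_add zero_monus)
  qed
  show "a \<le> b \<Longrightarrow> c + a \<le> c + b" by (auto simp: le_iff_add' add.assoc)
  show "a \<noteq> 0 \<Longrightarrow> b \<noteq> 0 \<Longrightarrow> a * b \<noteq> 0" using mult_eq_0' by blast
  show "(0::hnat) < 1" by (auto simp: less_iff_add' one_hnat_def)
  show "a < b \<Longrightarrow> 0 < c \<Longrightarrow> c * a < c * b"
  proof -
    assume "a < b" "0 < c"
    then obtain d e where "b = a + hS d" "c = hS e" by (auto simp: less_iff_add')
    then have "c * b = c * a + hS (c * d + e)" by (simp add: distrib' add.assoc)
    then show "c * a < c * b" by (auto simp: less_iff_add')
  qed
  show "b \<le> a \<Longrightarrow> a - b + b = a" using max_monus[of b a] by (simp add: less_eq_hnat_def add.commute)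
qed

lemma hnat_ge_0 [simp]: "0 \<le> (x::hnat)"
  by (auto simp: le_iff_add')

lemma hnat_less_iff: "x < y \<longleftrightarrow> x + 1 \<le> (y::hnat)"
  by (auto simp: less_iff_add' le_iff_add' hS_eq ac_simps)

lemma monus_eq_0 [simp]: "x - y = 0 \<longleftrightarrow> x \<le> (y::hnat)"
  by (simp add: less_eq_hnat_def)

text \<open>The semantic counterpart of a quantifier-free formula with parameters, with value 0 for
  truth. The closure properties below let induction be used for compound predicates.\<close>

definition IntP :: "(hnat \<Rightarrow> bool) \<Rightarrow> bool" where
  "IntP P \<longleftrightarrow> (\<exists>f. Int1 f \<and> (\<forall>x. P x \<longleftrightarrow> f x = 0))"

lemma hnat_add_eq_0 [simp]: "x + y = 0 \<longleftrightarrow> x = 0 \<and> y = (0::hnat)"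
  using add_eq_0'[of x y] add_eq_0'[of y x] by (auto simp: add.commute)

lemma hnat_one_le [simp]: "1 \<le> y \<longleftrightarrow> y \<noteq> (0::hnat)"
  using hnat_less_iff[of 0 y] hnat_ge_0[of y] by (auto simp: order.order_iff_strict)

lemma IntP_intros [intro!]:
  "Int1 f \<Longrightarrow> Int1 g \<Longrightarrow> IntP (\<lambda>x. f x = g x)" "Int1 f \<Longrightarrow> Int1 g \<Longrightarrow> IntP (\<lambda>x. f x \<le> g x)"
  "Int1 f \<Longrightarrow> Int1 g \<Longrightarrow> IntP (\<lambda>x. f x < g x)"
  "IntP P \<Longrightarrow> IntP (\<lambda>x. \<not> P x)" "IntP P \<Longrightarrow> IntP Q \<Longrightarrow> IntP (\<lambda>x. P x \<and> Q x)"
  "IntP P \<Longrightarrow> IntP Q \<Longrightarrow> IntP (\<lambda>x. P x \<or> Q x)" "IntP P \<Longrightarrow> IntP Q \<Longrightarrow> IntP (\<lambda>x. P x \<longrightarrow> Q x)"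
proof -
  show "Int1 f \<Longrightarrow> Int1 g \<Longrightarrow> IntP (\<lambda>x. f x = g x)" unfolding IntP_def
    by (rule exI[of _ "\<lambda>x. (f x - g x) + (g x - f x)"]) (auto simp: order.antisym)
  show "Int1 f \<Longrightarrow> Int1 g \<Longrightarrow> IntP (\<lambda>x. f x \<le> g x)" unfolding IntP_def
    by (rule exI[of _ "\<lambda>x. f x - g x"]) auto
  show "Int1 f \<Longrightarrow> Int1 g \<Longrightarrow> IntP (\<lambda>x. f x < g x)" unfolding IntP_def
    by (rule exI[of _ "\<lambda>x. f x + 1 - g x"]) (auto simp: hnat_less_iff)
  show n: "IntP P \<Longrightarrow> IntP (\<lambda>x. \<not> P x)" for P unfolding IntP_def
  proof (elim exE conjE)
    fix f assume "Int1 f" "\<forall>x. P x \<longleftrightarrow> f x = 0"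
    then show "\<exists>g. Int1 g \<and> (\<forall>x. (\<not> P x) \<longleftrightarrow> g x = 0)"
      by (intro exI[of _ "\<lambda>x. 1 - f x"]) auto
  qed
  show "IntP P \<Longrightarrow> IntP Q \<Longrightarrow> IntP (\<lambda>x. P x \<and> Q x)" unfolding IntP_def
  proof (elim exE conjE)
    fix f g assume "Int1 f" "\<forall>x. P x \<longleftrightarrow> f x = 0" "Int1 g" "\<forall>x. Q x \<longleftrightarrow> g x = 0"
    then show "\<exists>h. Int1 h \<and> (\<forall>x. (P x \<and> Q x) \<longleftrightarrow> h x = 0)" by (intro exI[of _ "\<lambda>x. f x + g x"]) auto
  qed
  show d: "IntP P \<Longrightarrow> IntP Q \<Longrightarrow> IntP (\<lambda>x. P x \<or> Q x)" for P Q unfolding IntP_def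
  proof (elim exE conjE)
    fix f g assume "Int1 f" "\<forall>x. P x \<longleftrightarrow> f x = 0" "Int1 g" "\<forall>x. Q x \<longleftrightarrow> g x = 0"
    then show "\<exists>h. Int1 h \<and> (\<forall>x. (P x \<or> Q x) \<longleftrightarrow> h x = 0)" by (intro exI[of _ "\<lambda>x. f x * g x"]) auto
  qed
  show "IntP P \<Longrightarrow> IntP Q \<Longrightarrow> IntP (\<lambda>x. P x \<longrightarrow> Q x)"
    unfolding imp_conv_disj by (rule d[OF n])
qed

lemma hnat_induct [case_names internal zero step]:
  assumes "IntP P" "P 0" "\<And>x. P x \<Longrightarrow> P (x + 1)" shows "P x"
proof -
  obtain f where "Int1 f" "\<And>x. P x \<longleftrightarrow> f x = 0" using assms(1) by (auto simp: IntP_def)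
  then show ?thesis using assms(2,3) Int1_induct[of f "\<lambda>x. 0" x] by (simp add: hS_eq Int1_intros(2))
qed

lemma hpow2_simps [simp]: "hpow2 0 = 1" "hpow2 (x + 1) = 2 * hpow2 x"
  using hnat_op_laws(9) hnat_op_laws(10)[of x] unfolding hS_eq one_hnat_def[symmetric] mult_2 by auto

declare hnat_op_laws [simp del]

lemma hpow2_gt: "x < hpow2 x"
proof (induction x rule: hnat_induct)
  case (step x)
  then have "x + 1 \<le> hpow2 x" by (simp add: hnat_less_iff)
  moreover have "1 \<le> hpow2 x" using step order.strict_trans1[OF hnat_ge_0 step] hnat_less_iff[of 0] by simp
  ultimately have "x + 1 + 1 \<le> hpow2 x + hpow2 x" by (rule add_mono)
  then show ?case by (simp add: hnat_less_iff mult_2)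
qed auto

lemma hpow2_pos [simp]: "0 < hpow2 x"
  using hpow2_gt[of x] order.strict_trans1[OF hnat_ge_0] by blast

lemma hpow2_add: "hpow2 (x + y) = hpow2 x * hpow2 y"
proof (induction y rule: hnat_induct)
  case (step y)
  have "x + (y + 1) = (x + y) + 1" by (simp add: add.assoc)
  then show ?case using step by (simp only: hpow2_simps) (simp add: ac_simps)
qed auto

subsection \<open>Rationals of the model\<close>

text \<open>The Grothendieck construction over an ordered semidomain; for \<open>hnat\<close> it
  gives the integers of the model.\<close>

definition diff_rel :: "'a::linordered_semidom \<times> 'a \<Rightarrow> 'a \<times> 'a \<Rightarrow> bool" where
  "diff_rel p q \<longleftrightarrow> fst p + snd q = fst q + snd p"

quotient_type (overloaded) 'a diff_ring = "'a::linordered_semidom \<times> 'a" / diff_rel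
proof (rule equivpI)
  show "reflp (diff_rel :: 'a \<times> 'a \<Rightarrow> _)" "symp (diff_rel :: 'a \<times> 'a \<Rightarrow> _)" by (auto simp: reflp_def symp_def diff_rel_def)
  show "transp (diff_rel :: 'a \<times> 'a \<Rightarrow> _)"
  proof (rule transpI)
    fix x y z :: "'a \<times> 'a" assume r: "diff_rel x y" "diff_rel y z"
    have "fst x + snd z + (fst y + snd y) = (fst x + snd y) + (fst y + snd z)" by (simp only: ac_simps)
    also have "\<dots> = (fst y + snd x) + (fst z + snd y)" using r by (simp only: diff_rel_def)
    also have "\<dots> = fst z + snd x + (fst y + snd y)" by (simp only: ac_simps)
    finally show "diff_rel x z" unfolding diff_rel_def by (rule add_right_imp_eq)
  qed
qed

instantiation diff_ring :: (linordered_semidom) comm_ring_1 begin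
lift_definition zero_diff_ring :: "'a diff_ring" is "(0, 0)" .
lift_definition one_diff_ring :: "'a diff_ring" is "(1, 0)" .
lift_definition plus_diff_ring :: "'a diff_ring \<Rightarrow> 'a diff_ring \<Rightarrow> 'a diff_ring"
  is "\<lambda>p q. (fst p + fst q, snd p + snd q)"
proof -
  fix p p' q q' :: "'a \<times> 'a" assume r: "diff_rel p p'" "diff_rel q q'"
  have "(fst p + fst q) + (snd p' + snd q') = (fst p + snd p') + (fst q + snd q')" by (simp only: ac_simps)
  also have "\<dots> = (fst p' + snd p) + (fst q' + snd q)" using r by (simp only: diff_rel_def)
  also have "\<dots> = (fst p' + fst q') + (snd p + snd q)" by (simp only: ac_simps)
  finally show "diff_rel (fst p + fst q, snd p + snd q) (fst p' + fst q', snd p' + snd q')"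
    by (simp add: diff_rel_def)
qed
lift_definition uminus_diff_ring :: "'a diff_ring \<Rightarrow> 'a diff_ring" is "\<lambda>p. (snd p, fst p)"
  unfolding diff_rel_def by (auto simp: add.commute)
definition "x - y = x + (- y :: 'a diff_ring)"
lift_definition times_diff_ring :: "'a diff_ring \<Rightarrow> 'a diff_ring \<Rightarrow> 'a diff_ring"
  is "\<lambda>p q. (fst p * fst q + snd p * snd q, fst p * snd q + snd p * fst q)"
proof -
  fix p p' q q' :: "'a \<times> 'a"
  obtain a b a' b' c d c' d' where v: "p = (a,b)" "p' = (a',b')" "q = (c,d)" "q' = (c',d')"
    by (metis prod.exhaust)
  assume "diff_rel p p'" "diff_rel q q'"
  then have 1: "a + b' = a' + b" and 2: "c + d' = c' + d" by (auto simp: v diff_rel_def)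
  have "(a*c + b*d) + (a'*d' + b'*c') + (a'*c + b'*c + a'*d + b'*d)
      = (a + b') * c + (b + a') * d + a' * (c + d') + b' * (c' + d)" by (simp add: algebra_simps)
  also have "\<dots> = (a' + b) * c + (a + b') * d + a' * (c' + d) + b' * (c + d')"
    using 1 2 by (simp add: add.commute)
  also have "\<dots> = (a'*c' + b'*d') + (a*d + b*c) + (a'*c + b'*c + a'*d + b'*d)" by (simp add: algebra_simps)
  finally show "diff_rel (fst p * fst q + snd p * snd q, fst p * snd q + snd p * fst q)
     (fst p' * fst q' + snd p' * snd q', fst p' * snd q' + snd p' * fst q')"
    by (simp add: diff_rel_def v)
qed
instance
  by standard (transfer; auto simp: diff_rel_def algebra_simps minus_diff_ring_def)+
end

instantiation diff_ring :: (linordered_semidom) linordered_idom begin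
lift_definition less_eq_diff_ring :: "'a diff_ring \<Rightarrow> 'a diff_ring \<Rightarrow> bool"
  is "\<lambda>p q. fst p + snd q \<le> fst q + snd p"
proof -
  fix p p' q q' :: "'a \<times> 'a"
  assume 1: "diff_rel p p'" and 2: "diff_rel q q'"
  have "fst p + snd q \<le> fst q + snd p \<longleftrightarrow> fst p + snd q + (snd p' + snd q') \<le> fst q + snd p + (snd p' + snd q')"
    by simp
  also have "\<dots> \<longleftrightarrow> (fst p + snd p') + (snd q + snd q') \<le> (fst q + snd q') + (snd p + snd p')"
    by (simp add: ac_simps)
  also have "\<dots> \<longleftrightarrow> (fst p' + snd p) + (snd q + snd q') \<le> (fst q' + snd q) + (snd p + snd p')"
    using 1 2 by (simp add: diff_rel_def)
  also have "\<dots> \<longleftrightarrow> fst p' + snd q' + (snd p + snd q) \<le> fst q' + snd p' + (snd p + snd q)"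
    by (simp add: ac_simps)
  finally show "fst p + snd q \<le> fst q + snd p \<longleftrightarrow> fst p' + snd q' \<le> fst q' + snd p'" by simp
qed
definition "x < y \<longleftrightarrow> x \<le> y \<and> \<not> y \<le> (x :: 'a diff_ring)"
definition abs_diff_ring_def2: "\<bar>x\<bar> = (if x < 0 then - x else (x :: 'a diff_ring))"
definition "sgn x = (if x = 0 then 0 else if 0 < x then 1 else (- 1 :: 'a diff_ring))"
instance
proof
  fix x y z :: "'a diff_ring"
  show "x < y \<longleftrightarrow> x \<le> y \<and> \<not> y \<le> x" by (rule less_diff_ring_def)
  show "x \<le> x" by transfer simp
  show "x \<le> y \<or> y \<le> x" by transfer auto
  show "x \<le> y \<Longrightarrow> y \<le> x \<Longrightarrow> x = y" by transfer (simp add: diff_rel_def)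
  show "x \<le> y \<Longrightarrow> y \<le> z \<Longrightarrow> x \<le> z"
  proof transfer
    fix p q r :: "'a \<times> 'a"
    assume "fst p + snd q \<le> fst q + snd p" "fst q + snd r \<le> fst r + snd q"
    then have "(fst p + snd q) + (fst q + snd r) \<le> (fst q + snd p) + (fst r + snd q)" by (rule add_mono)
    then have "fst p + snd r + (fst q + snd q) \<le> fst r + snd p + (fst q + snd q)" by (simp add: ac_simps)
    then show "fst p + snd r \<le> fst r + snd p" by simp
  qed
  show "x \<le> y \<Longrightarrow> z + x \<le> z + y"
  proof transfer
    fix p q r :: "'a \<times> 'a"
    assume "fst p + snd q \<le> fst q + snd p"
    then have "(fst r + snd r) + (fst p + snd q) \<le> (fst r + snd r) + (fst q + snd p)" by (rule add_left_mono)
    then show "fst (fst r + fst p, snd r + snd p) + snd (fst r + fst q, snd r + snd q)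
       \<le> fst (fst r + fst q, snd r + snd q) + snd (fst r + fst p, snd r + snd p)" by (simp add: ac_simps)
  qed
  show "\<bar>x\<bar> = (if x < 0 then - x else x)" by (rule abs_diff_ring_def2)
  show "sgn x = (if x = 0 then 0 else if 0 < x then 1 else - 1)" by (rule sgn_diff_ring_def)
  have less: "x < y \<longleftrightarrow> \<not> y \<le> x" for x y :: "'a diff_ring"
    unfolding less_diff_ring_def by transfer auto
  show "x < y \<Longrightarrow> 0 < z \<Longrightarrow> z * x < z * y" unfolding less
  proof (transfer)
    fix p q r :: "'a \<times> 'a"
    assume 1: "\<not> fst q + snd p \<le> fst p + snd q" and 2: "\<not> fst r + snd (0, 0::'a) \<le> fst (0::'a, 0::'a) + snd r"
    define d where "d = fst r - snd r"
    have le: "snd r \<le> fst r" using 2 by simp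
    have r1: "fst r = snd r + d" using le_add_diff_inverse2[OF le] by (simp only: d_def add.commute)
    then have "snd r + 0 < snd r + d" using 2 by simp
    then have "0 < d" by (rule add_less_imp_less_left)
    note r = r1 this
    have "d * (fst p + snd q) < d * (fst q + snd p)" using 1 r by (intro mult_strict_left_mono) simp_all
    then have "(fst r * fst p + snd r * snd p) + (fst r * snd q + snd r * fst q) <
       (fst r * fst q + snd r * snd q) + (fst r * snd p + snd r * fst p)"
    proof -
      let ?Y = "snd r * (fst p + fst q + snd p + snd q)"
      have "(fst r * fst p + snd r * snd p) + (fst r * snd q + snd r * fst q) = ?Y + d * (fst p + snd q)"
        "(fst r * fst q + snd r * snd q) + (fst r * snd p + snd r * fst p) = ?Y + d * (fst q + snd p)"
        unfolding r1 by (simp_all only: distrib_left distrib_right ac_simps)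
      then show ?thesis using \<open>d * (fst p + snd q) < d * (fst q + snd p)\<close>
        by (simp only: add_strict_left_mono)
    qed
    then show "\<not> fst (fst r * fst q + snd r * snd q, fst r * snd q + snd r * fst q) +
         snd (fst r * fst p + snd r * snd p, fst r * snd p + snd r * fst p)
         \<le> fst (fst r * fst p + snd r * snd p, fst r * snd p + snd r * fst p) +
         snd (fst r * fst q + snd r * snd q, fst r * snd q + snd r * fst q)" by simp
  qed
qed
end

lift_definition of_semi :: "'a::linordered_semidom \<Rightarrow> 'a diff_ring" is "\<lambda>x. (x, 0)" .

lemma of_semi_simps [simp]:
  "of_semi (x + y) = of_semi x + of_semi y" "of_semi (x * y) = of_semi x * of_semi y"
  "of_semi 0 = 0" "of_semi 1 = 1" "of_semi x \<le> of_semi y \<longleftrightarrow> x \<le> y"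
  by (transfer; simp add: diff_rel_def)+

lemma of_semi_less [simp]: "of_semi x < of_semi y \<longleftrightarrow> x < y"
  by (simp add: not_le[symmetric])

lemma diff_ring_cases: obtains x y where "z = of_semi x - of_semi y"
proof -
  have "\<exists>x y. z = of_semi x + (- of_semi y)"
  proof transfer
    fix z :: "'a \<times> 'a" show "\<exists>x y. diff_rel z (fst (x, 0) + fst (snd (y, 0), fst (y, 0)), snd (x, 0) + snd (snd (y, 0::'a), fst (y, 0::'a)))"
      by (rule exI[of _ "fst z"], rule exI[of _ "snd z"]) (simp add: diff_rel_def)
  qed
  then show ?thesis using that by auto
qed

type_synonym hq = "hnat diff_ring fract"

definition qn :: "hnat \<Rightarrow> hq" where "qn x = Fract (of_semi x) 1"

lemma qn_simps [simp]:
  "qn (x + y) = qn x + qn y" "qn (x * y) = qn x * qn y" "qn 0 = 0" "qn 1 = 1"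
  by (simp_all add: qn_def Zero_fract_def One_fract_def)
lemma qn_2 [simp]: "qn 2 = 2"
  by (metis one_add_one qn_simps(1,4))
lemma qn_le [simp]: "qn x \<le> qn y \<longleftrightarrow> x \<le> y"
  by (simp add: qn_def)
lemma qn_less [simp]: "qn x < qn y \<longleftrightarrow> x < y"
  using qn_le by (simp add: not_le[symmetric])
lemma qn_eq [simp]: "qn x = qn y \<longleftrightarrow> x = y"
  by (simp add: order.eq_iff)
lemma qn_ge_0 [simp]: "0 \<le> qn x"
  using qn_le[of 0 x] by (simp del: qn_le)
lemma qn_monus: "qn (x - y) = (if y \<le> x then qn x - qn y else 0)"
proof (cases "y \<le> x")
  case True
  then have "qn (x - y) + qn y = qn x" by (metis le_add_diff_inverse2 qn_simps(1))
  then show ?thesis using True by (simp add: eq_diff_eq)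
next
  case False
  then have z: "x - y = 0" by simp
  show ?thesis unfolding z using False by simp
qed

text \<open>This normal form is that of the coding of rationals by numbers, so it makes the decoding
  \<open>qv\<close> onto. A negative denominator is absorbed by the numerator, and a positive
  integer denominator has the form \<open>e + 1\<close>.\<close>

lemma hq_cases: obtains a b c where "q = (qn a - qn b) / (qn c + 1)"
proof -
  obtain u v where q: "q = Fract u v" "v \<noteq> 0" by (cases q) auto
  obtain u v where q: "q = Fract u v" "0 < v"
  proof (cases "0 < v")
    case True then show ?thesis using that q by blast
  next
    case False
    then have "q = Fract (- u) (- v)" "0 < - v" using q by (simp_all add: eq_fract)
    then show ?thesis using that by blast
  qed
  obtain a b where u: "u = of_semi a - of_semi b" by (rule diff_ring_cases)
  obtain c d where v: "v = of_semi c - of_semi d" by (rule diff_ring_cases)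
  have "\<not> of_semi c \<le> of_semi d" using q v by (simp add: not_le)
  then have cd: "d < c" by simp
  define e where "e = c - d - 1"
  have "d + 1 \<le> c" using cd by (simp add: hnat_less_iff)
  then have "c = e + 1 + d"
    unfolding e_def using le_add_diff_inverse2[of "d + 1" c] by (simp only: diff_diff_add ac_simps)
  then have "v = of_semi (e + 1)" using v by simp
  then have "q = (qn a - qn b) / (qn e + 1)"
    using q u by (simp add: qn_def One_fract_def)
  then show ?thesis by (rule that)
qed

text \<open>Archimedean relative to the numbers of the model, which may be nonstandard: the
  denominator is at least 1, so the positive part of the numerator is already a bound.\<close>

lemma hq_arch: "\<exists>n. q < qn n"
proof -
  obtain a b c where q: "q = (qn a - qn b) / (qn c + 1)" by (rule hq_cases)
  have "0 < qn c + 1" by (simp add: add_nonneg_pos)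
  moreover have "qn a - qn b \<le> qn a * (qn c + 1)"
  proof -
    have "qn a - qn b \<le> qn a" by simp
    also have "qn a \<le> qn a * (qn c + 1)" by (simp add: distrib_left)
    finally show ?thesis .
  qed
  ultimately have "q \<le> qn a" unfolding q by (simp add: divide_le_eq)
  then have "q < qn (a + 1)" by (simp add: add_strict_increasing2 le_less_trans)
  then show ?thesis ..
qed

definition i2 :: "hnat \<Rightarrow> hq" where "i2 n = 1 / qn (hpow2 n)"

lemma qn_pos [simp]: "0 < qn x \<longleftrightarrow> 0 < x"
  using qn_less[of 0 x] by (simp del: qn_less)

lemma i2_pos [simp]: "0 < i2 n"
  by (simp add: i2_def)

lemma i2_arch: "0 < r \<Longrightarrow> \<exists>n. i2 n < r"
proof -
  assume r: "0 < r"
  obtain n where n: "1 / r < qn n" using hq_arch by blast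
  also have "qn n < qn (hpow2 n)" using hpow2_gt by simp
  finally have "1 < r * qn (hpow2 n)" using r by (simp add: divide_less_eq mult.commute)
  then have "i2 n < r" using i2_def by (simp add: divide_less_eq)
  then show ?thesis ..
qed

lemma i2_Suc: "i2 (n + 1) * 2 = i2 n"
  by (simp add: i2_def)

lemma i2_0 [simp]: "i2 0 = 1" by (simp add: i2_def)

lemma i2_add: "i2 (m + n) = i2 m * i2 n"
  by (simp add: i2_def hpow2_add)

lemma i2_le_1: "i2 n \<le> 1"
proof -
  have "hpow2 n \<noteq> 0" using hpow2_pos[of n] by (metis less_irrefl)
  then have "1 \<le> qn (hpow2 n)" using qn_le[of 1 "hpow2 n"] by (simp del: qn_le)
  then show ?thesis by (simp add: i2_def divide_le_eq)
qed

lemma i2_mono: "m \<le> n \<Longrightarrow> i2 n \<le> i2 m"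
proof -
  assume "m \<le> n"
  then obtain d where "n = m + d" using le_iff_add' by blast
  then show ?thesis using mult_left_mono[OF i2_le_1[of d], of "i2 m"] i2_pos[of m] by (simp add: i2_add)
qed

subsection \<open>Limits of Cauchy sequences\<close>

text \<open>The sequences are arbitrary functions of the metatheory, but indices and tolerances
  range over the model. Standard tolerances alone would identify rationals with infinitesimal
  difference.\<close>

definition vanishes :: "(hnat \<Rightarrow> hq) \<Rightarrow> bool" where
  "vanishes X \<longleftrightarrow> (\<forall>r>0. \<exists>k. \<forall>n\<ge>k. \<bar>X n\<bar> < r)"
definition cauchy :: "(hnat \<Rightarrow> hq) \<Rightarrow> bool" where
  "cauchy X \<longleftrightarrow> (\<forall>r>0. \<exists>k. \<forall>m\<ge>k. \<forall>n\<ge>k. \<bar>X m - X n\<bar> < r)"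

lemma vanishesD: "vanishes X \<Longrightarrow> 0 < r \<Longrightarrow> \<exists>k. \<forall>n\<ge>k. \<bar>X n\<bar> < r"
  by (simp add: vanishes_def)
lemma cauchyD: "cauchy X \<Longrightarrow> 0 < r \<Longrightarrow> \<exists>k. \<forall>m\<ge>k. \<forall>n\<ge>k. \<bar>X m - X n\<bar> < r"
  by (simp add: cauchy_def)

lemma vanishes_const [simp]: "vanishes (\<lambda>n. c) \<longleftrightarrow> c = 0"
proof
  show "vanishes (\<lambda>n. c) \<Longrightarrow> c = 0" using vanishesD[of "\<lambda>n. c" "\<bar>c\<bar>"] by (cases "c = 0") auto
qed (simp add: vanishes_def)

lemma vanishes_add: "vanishes X \<Longrightarrow> vanishes Y \<Longrightarrow> vanishes (\<lambda>n. X n + Y n)"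
  unfolding vanishes_def[of "\<lambda>n. X n + Y n"]
proof (intro allI impI)
  fix r :: hq assume v: "vanishes X" "vanishes Y" and r: "0 < r"
  obtain k1 where k1: "\<forall>n\<ge>k1. \<bar>X n\<bar> < r / 2" using vanishesD[OF v(1), of "r/2"] r by auto
  obtain k2 where k2: "\<forall>n\<ge>k2. \<bar>Y n\<bar> < r / 2" using vanishesD[OF v(2), of "r/2"] r by auto
  have "\<bar>X n + Y n\<bar> < r" if "max k1 k2 \<le> n" for n
  proof -
    have "\<bar>X n\<bar> < r / 2" "\<bar>Y n\<bar> < r / 2" using k1 k2 that by auto
    then show ?thesis using abs_triangle_ineq[of "X n" "Y n"] by (simp add: field_simps) 
  qed
  then show "\<exists>k. \<forall>n\<ge>k. \<bar>X n + Y n\<bar> < r" by blast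
qed

lemma vanishes_uminus: "vanishes X \<Longrightarrow> vanishes (\<lambda>n. - X n)"
  by (simp add: vanishes_def)

lemma vanishes_mult:
  assumes "\<forall>n\<ge>k. \<bar>X n\<bar> \<le> B" "vanishes Y" shows "vanishes (\<lambda>n. X n * Y n)"
  unfolding vanishes_def
proof (intro allI impI)
  fix r :: hq assume r: "0 < r"
  have B: "0 \<le> B" using assms(1) abs_ge_zero[of "X k"] by (meson order.trans order.refl)
  then have rB: "0 < r / (B + 1)" using r by simp
  obtain j where j: "\<forall>n\<ge>j. \<bar>Y n\<bar> < r / (B + 1)" using vanishesD[OF assms(2) rB] by blast
  have "\<bar>X n * Y n\<bar> < r" if n: "max k j \<le> n" for n
  proof -
    have "\<bar>X n * Y n\<bar> \<le> B * \<bar>Y n\<bar>" using assms(1) n by (simp add: abs_mult mult_right_mono)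
    also have "\<dots> \<le> B * (r / (B + 1))" using j n B by (intro mult_left_mono) (auto intro: less_imp_le)
    also have "\<dots> < (B + 1) * (r / (B + 1))" using rB by (intro mult_strict_right_mono) auto
    also have "\<dots> = r" using B by simp
    finally show ?thesis .
  qed
  then show "\<exists>k. \<forall>n\<ge>k. \<bar>X n * Y n\<bar> < r" by blast
qed

lemma cauchy_const [simp]: "cauchy (\<lambda>n. c)"
  by (simp add: cauchy_def)

lemma cauchy_add: "cauchy X \<Longrightarrow> cauchy Y \<Longrightarrow> cauchy (\<lambda>n. X n + Y n)"
  unfolding cauchy_def[of "\<lambda>n. X n + Y n"]
proof (intro allI impI)
  fix r :: hq assume v: "cauchy X" "cauchy Y" and r: "0 < r"
  obtain k1 where k1: "\<forall>m\<ge>k1. \<forall>n\<ge>k1. \<bar>X m - X n\<bar> < r / 2" using cauchyD[OF v(1), of "r/2"] r by auto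
  obtain k2 where k2: "\<forall>m\<ge>k2. \<forall>n\<ge>k2. \<bar>Y m - Y n\<bar> < r / 2" using cauchyD[OF v(2), of "r/2"] r by auto
  have "\<bar>X m + Y m - (X n + Y n)\<bar> < r" if "max k1 k2 \<le> m" "max k1 k2 \<le> n" for m n
  proof -
    have "\<bar>X m - X n\<bar> < r / 2" "\<bar>Y m - Y n\<bar> < r / 2" using k1 k2 that by auto
    moreover have "X m + Y m - (X n + Y n) = (X m - X n) + (Y m - Y n)" by simp
    ultimately show ?thesis using abs_triangle_ineq[of "X m - X n" "Y m - Y n"] by (simp add: field_simps)
  qed
  then show "\<exists>k. \<forall>m\<ge>k. \<forall>n\<ge>k. \<bar>X m + Y m - (X n + Y n)\<bar> < r" by blast
qed

lemma cauchy_uminus: "cauchy X \<Longrightarrow> cauchy (\<lambda>n. - X n)"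
  unfolding cauchy_def by (simp add: abs_minus_commute)

lemma cauchy_bounded: "cauchy X \<Longrightarrow> \<exists>k B. \<forall>n\<ge>k. \<bar>X n\<bar> \<le> B"
proof -
  assume "cauchy X"
  then obtain k where k: "\<forall>m\<ge>k. \<forall>n\<ge>k. \<bar>X m - X n\<bar> < 1" using cauchyD[of X 1] by auto
  have "\<bar>X n\<bar> \<le> \<bar>X k\<bar> + 1" if "k \<le> n" for n
  proof -
    have "\<bar>X n - X k\<bar> < 1" using k that by simp
    then show ?thesis using abs_triangle_ineq2[of "X n" "X k"] by linarith
  qed
  then show ?thesis by blast
qed

lemma cauchy_mult: "cauchy X \<Longrightarrow> cauchy Y \<Longrightarrow> cauchy (\<lambda>n. X n * Y n)"
  unfolding cauchy_def[of "\<lambda>n. X n * Y n"]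
proof (intro allI impI)
  fix r :: hq assume v: "cauchy X" "cauchy Y" and r: "0 < r"
  obtain k1 B1 where b1: "\<forall>n\<ge>k1. \<bar>X n\<bar> \<le> B1" using cauchy_bounded v by blast
  obtain k2 B2 where b2: "\<forall>n\<ge>k2. \<bar>Y n\<bar> \<le> B2" using cauchy_bounded v by blast
  define B where "B = max 1 (max B1 B2)"
  have B: "0 < B" "B1 \<le> B" "B2 \<le> B" by (auto simp: B_def)
  \<comment> \<open>Each of the two error terms below stays under \<open>B * s\<close>, half of
    \<open>r\<close>; the 1 in the definition of \<open>B\<close> makes the divisor
    positive.\<close>
  define s where "s = r / (2 * B)"
  have s: "0 < s" using r B by (simp add: s_def)
  obtain k3 where k3: "\<forall>m\<ge>k3. \<forall>n\<ge>k3. \<bar>X m - X n\<bar> < s" using cauchyD[OF v(1) s] by auto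
  obtain k4 where k4: "\<forall>m\<ge>k4. \<forall>n\<ge>k4. \<bar>Y m - Y n\<bar> < s" using cauchyD[OF v(2) s] by auto
  define K where "K = max (max k1 k2) (max k3 k4)"
  have "\<bar>X m * Y m - X n * Y n\<bar> < r" if "K \<le> m" "K \<le> n" for m n
  proof -
    have 1: "\<bar>X m\<bar> \<le> B" "\<bar>Y n\<bar> \<le> B" using b1 b2 B that by (auto simp: K_def intro: order.trans)
    have 2: "\<bar>X m - X n\<bar> < s" "\<bar>Y m - Y n\<bar> < s" using k3 k4 that by (auto simp: K_def)
    have "X m * Y m - X n * Y n = X m * (Y m - Y n) + (X m - X n) * Y n" by (simp add: algebra_simps)
    also have "\<bar>\<dots>\<bar> \<le> \<bar>X m\<bar> * \<bar>Y m - Y n\<bar> + \<bar>X m - X n\<bar> * \<bar>Y n\<bar>"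
      using abs_triangle_ineq[of "X m * (Y m - Y n)" "(X m - X n) * Y n"] by (simp only: abs_mult)
    also have "\<dots> \<le> B * \<bar>Y m - Y n\<bar> + \<bar>X m - X n\<bar> * B"
      using 1 by (intro add_mono mult_left_mono mult_right_mono) auto
    also have "\<dots> < B * s + s * B"
      using 2 B(1) by (intro add_strict_mono mult_strict_left_mono mult_strict_right_mono)
    also have "\<dots> = r" using B(1) by (simp add: s_def field_simps)
    finally show ?thesis .
  qed
  then show "\<exists>k. \<forall>m\<ge>k. \<forall>n\<ge>k. \<bar>X m * Y m - X n * Y n\<bar> < r" by blast
qed

definition seq_rel :: "(hnat \<Rightarrow> hq) \<Rightarrow> (hnat \<Rightarrow> hq) \<Rightarrow> bool" where
  "seq_rel X Y \<longleftrightarrow> cauchy X \<and> cauchy Y \<and> vanishes (\<lambda>n. X n - Y n)"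

quotient_type hreal = "hnat \<Rightarrow> hq" / partial: seq_rel
proof (rule part_equivpI)
  show "\<exists>x. seq_rel x x" by (rule exI[of _ "\<lambda>n. 0"]) (simp add: seq_rel_def)
  show "symp seq_rel"
    by (rule sympI) (auto simp: seq_rel_def vanishes_def abs_minus_commute)
  show "transp seq_rel"
  proof (rule transpI)
    fix X Y Z assume a: "seq_rel X Y" "seq_rel Y Z"
    then have "vanishes (\<lambda>n. (X n - Y n) + (Y n - Z n))" by (intro vanishes_add) (auto simp: seq_rel_def)
    then show "seq_rel X Z" using a by (simp add: seq_rel_def)
  qed
qed

instantiation hreal :: comm_ring_1 begin
lift_definition zero_hreal :: hreal is "\<lambda>n. 0" by (simp add: seq_rel_def)
lift_definition one_hreal :: hreal is "\<lambda>n. 1" by (simp add: seq_rel_def)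
lift_definition plus_hreal :: "hreal \<Rightarrow> hreal \<Rightarrow> hreal" is "\<lambda>X Y n. X n + Y n"
proof -
  fix X X' Y Y' assume a: "seq_rel X X'" "seq_rel Y Y'"
  then have "vanishes (\<lambda>n. (X n - X' n) + (Y n - Y' n))" by (intro vanishes_add) (auto simp: seq_rel_def)
  then show "seq_rel (\<lambda>n. X n + Y n) (\<lambda>n. X' n + Y' n)"
    using a by (simp add: seq_rel_def cauchy_add algebra_simps)
qed
lift_definition uminus_hreal :: "hreal \<Rightarrow> hreal" is "\<lambda>X n. - X n"
proof -
  fix X Y assume a: "seq_rel X Y"
  then have "vanishes (\<lambda>n. - (X n - Y n))" by (intro vanishes_uminus) (auto simp: seq_rel_def)
  then show "seq_rel (\<lambda>n. - X n) (\<lambda>n. - Y n)" using a by (simp add: seq_rel_def cauchy_uminus algebra_simps)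
qed
lift_definition times_hreal :: "hreal \<Rightarrow> hreal \<Rightarrow> hreal" is "\<lambda>X Y n. X n * Y n"
proof -
  fix X X' Y Y' assume a: "seq_rel X X'" "seq_rel Y Y'"
  then obtain k1 B1 where b1: "\<forall>n\<ge>k1. \<bar>X n\<bar> \<le> B1" using cauchy_bounded seq_rel_def by blast
  from a obtain k2 B2 where b2: "\<forall>n\<ge>k2. \<bar>Y' n\<bar> \<le> B2" using cauchy_bounded seq_rel_def by blast
  have "vanishes (\<lambda>n. X n * (Y n - Y' n) + Y' n * (X n - X' n))"
    using a by (intro vanishes_add vanishes_mult[OF b1] vanishes_mult[OF b2]) (auto simp: seq_rel_def)
  then show "seq_rel (\<lambda>n. X n * Y n) (\<lambda>n. X' n * Y' n)"
    using a by (simp add: seq_rel_def cauchy_mult algebra_simps)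
qed
definition "x - y = x + (- y :: hreal)"
instance
proof
  fix x y z :: hreal
  note [simp] = seq_rel_def cauchy_add cauchy_mult cauchy_uminus
  show "x + y + z = x + (y + z)" by transfer (simp add: add.assoc)
  show "x + y = y + x" by transfer (simp add: add.commute)
  show "0 + x = x" by transfer simp
  show "- x + x = 0" by transfer simp
  show "x * y * z = x * (y * z)" by transfer (simp add: mult.assoc)
  show "x * y = y * x" by transfer (simp add: mult.commute)
  show "1 * x = x" by transfer simp
  show "(x + y) * z = x * z + y * z" by transfer (simp add: distrib_right)
  show "(0::hreal) \<noteq> 1" by transfer simp
qed (simp add: minus_hreal_def)
end

text \<open>A fixed positive rational as lower bound, instead of mere positivity of the terms, is
  what survives a change by a vanishing sequence: half of it remains.\<close>

lift_definition positive :: "hreal \<Rightarrow> bool" is "\<lambda>X. \<exists>r>0. \<exists>k. \<forall>n\<ge>k. r < X n"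
proof -
  have "\<exists>r>0. \<exists>k. \<forall>n\<ge>k. r < Y n" if pos: "\<exists>r>0. \<exists>k. \<forall>n\<ge>k. r < X n" and van: "vanishes (\<lambda>n. X n - Y n)" for X Y :: "hnat \<Rightarrow> hq"
  proof -
    obtain r k where r: "0 < r" "\<forall>n\<ge>k. r < X n" using pos by blast
    obtain j where j: "\<forall>n\<ge>j. \<bar>X n - Y n\<bar> < r / 2" using vanishesD[OF van, of "r/2"] r by auto
    have "r / 2 < Y n" if "max k j \<le> n" for n
    proof -
      have "r < X n" "\<bar>X n - Y n\<bar> < r / 2" using r j that by auto
      moreover have "r / 2 + r / 2 = r" by simp
      ultimately show ?thesis unfolding abs_less_iff by linarith
    qed
    then show ?thesis using r(1) half_gt_zero by blast
  qed
  moreover fix X Y assume "seq_rel X Y"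
  then have "vanishes (\<lambda>n. X n - Y n)" "vanishes (\<lambda>n. Y n - X n)"
    by (auto simp: seq_rel_def vanishes_def abs_minus_commute)
  ultimately show "(\<exists>r>0. \<exists>k. \<forall>n\<ge>k. r < X n) = (\<exists>r>0. \<exists>k. \<forall>n\<ge>k. r < Y n)" by blast
qed

lemma positive_zero: "\<not> positive 0"
  by transfer auto

lemma positive_add: "positive x \<Longrightarrow> positive y \<Longrightarrow> positive (x + y)"
proof transfer
  fix X Y :: "hnat \<Rightarrow> hq" assume "\<exists>r>0. \<exists>k. \<forall>n\<ge>k. r < X n" "\<exists>r>0. \<exists>k. \<forall>n\<ge>k. r < Y n"
  then obtain r k s j where "0 < r" "\<forall>n\<ge>k. r < X n" "0 < s" "\<forall>n\<ge>j. s < Y n" by blast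
  then have "0 < r + s \<and> (\<forall>n\<ge>max k j. r + s < X n + Y n)" by (auto intro: add_strict_mono)
  then show "\<exists>r>0. \<exists>k. \<forall>n\<ge>k. r < X n + Y n" by blast
qed

lemma positive_mult: "positive x \<Longrightarrow> positive y \<Longrightarrow> positive (x * y)"
proof transfer
  fix X Y :: "hnat \<Rightarrow> hq" assume "\<exists>r>0. \<exists>k. \<forall>n\<ge>k. r < X n" "\<exists>r>0. \<exists>k. \<forall>n\<ge>k. r < Y n"
  then obtain r k s j where "0 < r" "\<forall>n\<ge>k. r < X n" "0 < s" "\<forall>n\<ge>j. s < Y n" by blast
  then have "0 < r * s \<and> (\<forall>n\<ge>max k j. r * s < X n * Y n)"
    by (auto intro!: mult_strict_mono intro: less_imp_le order.strict_trans)
  then show "\<exists>r>0. \<exists>k. \<forall>n\<ge>k. r < X n * Y n" by blast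
qed

text \<open>Trichotomy. A sequence that does not vanish has terms of size at least some
  \<open>r\<close> arbitrarily late; from a point on its terms differ by less than
  \<open>r / 2\<close>, so the sign of one such term settles the whole tail.\<close>

lemma positive_minus: "\<not> positive x \<Longrightarrow> x \<noteq> 0 \<Longrightarrow> positive (- x)"
proof transfer
  fix X :: "hnat \<Rightarrow> hq"
  assume a: "seq_rel X X" "\<not> (\<exists>r>0. \<exists>k. \<forall>n\<ge>k. r < X n)" "\<not> seq_rel X (\<lambda>n. 0)"
  then have c: "cauchy X" "\<not> vanishes X" by (auto simp: seq_rel_def)
  obtain r where r: "0 < r" "\<And>k. \<exists>n\<ge>k. r \<le> \<bar>X n\<bar>" using c(2) unfolding vanishes_def not_all not_less by (auto simp: not_less)
  obtain k where k: "\<forall>m\<ge>k. \<forall>n\<ge>k. \<bar>X m - X n\<bar> < r / 2" using cauchyD[OF c(1), of "r/2"] r by auto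
  obtain j where j: "k \<le> j" "r \<le> \<bar>X j\<bar>" using r by blast
  have d: "\<bar>X j - X n\<bar> < r / 2" if "j \<le> n" for n using k j that by (meson order.trans)
  have r2: "r / 2 > 0" "r / 2 + r / 2 = r" using r by simp_all
  show "\<exists>r>0. \<exists>k. \<forall>n\<ge>k. r < - X n"
  proof (cases "0 \<le> X j")
    case True
    have "r / 2 < X n" if "j \<le> n" for n using d[OF that] True j(2) r2 unfolding abs_less_iff by linarith
    then show ?thesis using a(2) r2(1) by blast
  next
    case False
    have "r / 2 < - X n" if "j \<le> n" for n using d[OF that] False j(2) r2 unfolding abs_less_iff by linarith
    then show ?thesis using r2(1) by blast
  qed
qed

instantiation hreal :: linordered_idom begin
definition "x < y \<longleftrightarrow> positive (y - x :: hreal)"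
definition "x \<le> y \<longleftrightarrow> x < y \<or> x = (y :: hreal)"
definition abs_hreal_def2: "\<bar>x\<bar> = (if x < 0 then - x else (x :: hreal))"
definition "sgn x = (if x = 0 then 0 else if 0 < x then 1 else (- 1 :: hreal))"
instance
proof
  fix x y z :: hreal
  have irr: "\<not> x < x" for x :: hreal by (simp add: less_hreal_def positive_zero)
  have tr: "x < y \<Longrightarrow> y < z \<Longrightarrow> x < z" for x y z :: hreal
    using positive_add[of "y - x" "z - y"] by (simp add: less_hreal_def)
  show "x < y \<longleftrightarrow> x \<le> y \<and> \<not> y \<le> x" unfolding less_eq_hreal_def using irr[of x] tr[of x y x] by auto
  show "x \<le> x" by (simp add: less_eq_hreal_def)
  show "x \<le> y \<Longrightarrow> y \<le> z \<Longrightarrow> x \<le> z" unfolding less_eq_hreal_def using tr[of x y z] by auto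
  show "x \<le> y \<Longrightarrow> y \<le> x \<Longrightarrow> x = y" unfolding less_eq_hreal_def using tr[of x y x] irr[of x] by auto
  show "x \<le> y \<Longrightarrow> z + x \<le> z + y" by (auto simp: less_eq_hreal_def less_hreal_def)
  show "x \<le> y \<or> y \<le> x" using positive_minus[of "y - x"] by (auto simp: less_eq_hreal_def less_hreal_def)
  show "x < y \<Longrightarrow> 0 < z \<Longrightarrow> z * x < z * y"
    using positive_mult[of z "y - x"] by (simp add: less_hreal_def right_diff_distrib)
  show "\<bar>x\<bar> = (if x < 0 then - x else x)" by (rule abs_hreal_def2)
  show "sgn x = (if x = 0 then 0 else if 0 < x then 1 else - 1)" by (rule sgn_hreal_def)
qed
end

section \<open>Limits and the embedding of the rationals\<close>

definition lim :: "(hnat \<Rightarrow> hq) \<Rightarrow> hreal" where "lim X = abs_hreal X"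
definition hr :: "hq \<Rightarrow> hreal" where "hr q = lim (\<lambda>n. q)"

lemma lim_eq_iff: "cauchy X \<Longrightarrow> cauchy Y \<Longrightarrow> lim X = lim Y \<longleftrightarrow> vanishes (\<lambda>n. X n - Y n)"
  using Quotient_rel_abs2 Quotient3_rel[OF Quotient3_hreal, of X Y] by (auto simp: lim_def seq_rel_def)

lemma positive_lim: "cauchy X \<Longrightarrow> positive (lim X) \<longleftrightarrow> (\<exists>r>0. \<exists>k. \<forall>n\<ge>k. r < X n)"
  unfolding lim_def by (rule positive.abs_eq) (simp add: seq_rel_def)

lemma lim_add: "cauchy X \<Longrightarrow> cauchy Y \<Longrightarrow> lim X + lim Y = lim (\<lambda>n. X n + Y n)"
  unfolding lim_def by (rule plus_hreal.abs_eq) (simp_all add: seq_rel_def)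
lemma lim_uminus: "cauchy X \<Longrightarrow> - lim X = lim (\<lambda>n. - X n)"
  unfolding lim_def by (rule uminus_hreal.abs_eq) (simp_all add: seq_rel_def)
lemma lim_diff: "cauchy X \<Longrightarrow> cauchy Y \<Longrightarrow> lim X - lim Y = lim (\<lambda>n. X n - Y n)"
  using lim_add[of X "\<lambda>n. - Y n"] by (simp add: minus_hreal_def lim_uminus cauchy_uminus)

lemma cauchy_diff: "cauchy X \<Longrightarrow> cauchy Y \<Longrightarrow> cauchy (\<lambda>n. X n - Y n)"
  using cauchy_add[OF _ cauchy_uminus, of X Y] by simp

lemma lim_less_iff: "cauchy X \<Longrightarrow> cauchy Y \<Longrightarrow> lim X < lim Y \<longleftrightarrow> (\<exists>r>0. \<exists>k. \<forall>n\<ge>k. r < Y n - X n)"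
  by (simp add: less_hreal_def lim_diff positive_lim cauchy_diff)

lemma lim_mono:
  assumes "cauchy X" "cauchy Y" "\<forall>n\<ge>k. X n \<le> Y n" shows "lim X \<le> lim Y"
proof (rule ccontr)
  assume "\<not> lim X \<le> lim Y"
  then have "lim Y < lim X" by simp
  then obtain r j where r: "0 < r" "\<forall>n\<ge>j. r < X n - Y n" using lim_less_iff assms by blast
  then have "r < X (max k j) - Y (max k j)" "X (max k j) \<le> Y (max k j)" using assms by auto
  then show False using r(1) by simp
qed

lemma hr_simps [simp]:
  "hr (p + q) = hr p + hr q" "hr (p - q) = hr p - hr q" "hr (- q) = - hr q" "hr 0 = 0" "hr 1 = 1"
  by (simp_all add: hr_def lim_add lim_diff lim_uminus) (simp_all add: lim_def zero_hreal_def one_hreal_def)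
lemma hr_less [simp]: "hr p < hr q \<longleftrightarrow> p < q"
proof -
  have "(\<exists>r>0. r < q - p) \<longleftrightarrow> p < q" using dense[of 0 "q - p"] by (auto intro: order.strict_trans)
  then show ?thesis by (simp add: hr_def lim_less_iff) (metis order.refl)
qed
lemma hr_le [simp]: "hr p \<le> hr q \<longleftrightarrow> p \<le> q"
  by (simp add: not_less[symmetric])
lemma hr_eq [simp]: "hr p = hr q \<longleftrightarrow> p = q"
  by (simp add: order.eq_iff)
lemma hr_pos [simp]: "0 < hr q \<longleftrightarrow> 0 < q" using hr_less[of 0 q] by (simp del: hr_less)

text \<open>Only the upper bound needs thought, and it goes by the sign of the limit: if the limit
  is not 0, the terms eventually have its sign; if it is 0, vanishing does not depend on
  signs.\<close>

lemma lim_abs: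
  assumes "cauchy X" shows "cauchy (\<lambda>n. \<bar>X n\<bar>)" "\<bar>lim X\<bar> = lim (\<lambda>n. \<bar>X n\<bar>)"
proof -
  show c: "cauchy (\<lambda>n. \<bar>X n\<bar>)" unfolding cauchy_def
  proof (intro allI impI)
    fix r :: hq assume "0 < r"
    then obtain k where "\<forall>m\<ge>k. \<forall>n\<ge>k. \<bar>X m - X n\<bar> < r" using cauchyD assms by blast
    then show "\<exists>k. \<forall>m\<ge>k. \<forall>n\<ge>k. \<bar>\<bar>X m\<bar> - \<bar>X n\<bar>\<bar> < r"
      by (intro exI[of _ k]) (simp add: le_less_trans[OF abs_triangle_ineq3])
  qed
  have z: "0 = lim (\<lambda>n. 0)" using hr_simps(4) by (simp add: hr_def)
  have "lim X \<le> lim (\<lambda>n. \<bar>X n\<bar>)" "- lim X \<le> lim (\<lambda>n. \<bar>X n\<bar>)"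
    using assms c by (auto simp: lim_uminus cauchy_uminus intro!: lim_mono)
  moreover have "lim (\<lambda>n. \<bar>X n\<bar>) \<le> \<bar>lim X\<bar>"
  proof (cases "lim X < 0")
    case True
    then obtain r k where "0 < r" "\<forall>n\<ge>k. r < - X n" using assms unfolding z by (auto simp: lim_less_iff)
    then have "\<bar>X n\<bar> \<le> - X n" if "k \<le> n" for n using order.strict_trans[of 0 r "- X n"] that by simp
    then have "\<forall>n\<ge>k. \<bar>X n\<bar> \<le> - X n" by simp
    then have "lim (\<lambda>n. \<bar>X n\<bar>) \<le> - lim X" using assms c by (auto simp: lim_uminus cauchy_uminus intro!: lim_mono)
    then show ?thesis using True by simp
  next
    case False
    show ?thesis
    proof (cases "0 < lim X")
      case True
      then obtain r k where "0 < r" "\<forall>n\<ge>k. r < X n" using assms unfolding z by (auto simp: lim_less_iff)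
      then have "\<bar>X n\<bar> \<le> X n" if "k \<le> n" for n using order.strict_trans[of 0 r "X n"] that by simp
      then have "\<forall>n\<ge>k. \<bar>X n\<bar> \<le> X n" by simp
      then have "lim (\<lambda>n. \<bar>X n\<bar>) \<le> lim X" using assms c by (auto intro!: lim_mono)
      then show ?thesis using True by simp
    next
      case F: False
      then have l: "lim X = lim (\<lambda>n. 0)" using False z by simp
      then have "vanishes X" using lim_eq_iff[OF assms cauchy_const] by simp
      then have "vanishes (\<lambda>n. \<bar>X n\<bar>)" by (simp add: vanishes_def)
      then show ?thesis using lim_eq_iff[OF c cauchy_const, of 0] z by simp
    qed
  qed
  ultimately show "\<bar>lim X\<bar> = lim (\<lambda>n. \<bar>X n\<bar>)" by (simp add: abs_if split: if_splits)
qed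

lemma hr_abs: "hr \<bar>q\<bar> = \<bar>hr q\<bar>"
  by (simp add: hr_def lim_abs)

lemma lim_dist:
  assumes "cauchy X" "\<forall>n\<ge>m. \<bar>X n - q\<bar> \<le> c" shows "\<bar>lim X - hr q\<bar> \<le> hr c"
  using assms by (auto simp: hr_def lim_diff lim_abs cauchy_diff intro!: lim_mono[where k=m])

lemma hreal_arch: "0 < x \<Longrightarrow> \<exists>n. hr (i2 n) < x"
proof -
  assume x: "0 < x"
  obtain X where X: "cauchy X" "x = lim X"
    by (metis (no_types) Quotient3_abs_rep[OF Quotient3_hreal] Quotient3_rel_rep[OF Quotient3_hreal] lim_def seq_rel_def)
  have z: "0 = lim (\<lambda>n. 0)" using hr_simps(4) by (simp add: hr_def)
  obtain r k where r: "0 < r" "\<forall>n\<ge>k. r < X n" using x X unfolding z by (auto simp: lim_less_iff)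
  obtain n where n: "i2 n < r" using i2_arch r by blast
  then have "hr (i2 n) < hr r" by simp
  also have "hr r \<le> x" unfolding X(2) hr_def using X r by (intro lim_mono[where k=k]) auto
  finally show ?thesis ..
qed

section \<open>Evaluation of the defined terms\<close>

lemma tm_facts6 [simp]:
  "well_typed triangle_tm" "ty_of triangle_tm = TN \<leadsto> TN" "tm_vars triangle_tm = {}" "30 \<le> k \<Longrightarrow> bnd k triangle_tm"
  unfolding triangle_tm_def by auto
lemma tm_facts7 [simp]:
  "well_typed pair_tm" "ty_of pair_tm = TN \<leadsto> TN \<leadsto> TN" "tm_vars pair_tm = {}" "36 \<le> k \<Longrightarrow> bnd k pair_tm"
  unfolding pair_tm_def by auto
lemma tm_facts8 [simp]:
  "well_typed root_tm" "ty_of root_tm = TN \<leadsto> TN" "tm_vars root_tm = {}" "39 \<le> k \<Longrightarrow> bnd k root_tm"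
  unfolding root_tm_def by auto
lemma tm_facts9 [simp]:
  "well_typed fst_tm" "ty_of fst_tm = TN \<leadsto> TN" "tm_vars fst_tm = {}" "42 \<le> k \<Longrightarrow> bnd k fst_tm"
  unfolding fst_tm_def by auto
lemma tm_facts10 [simp]:
  "well_typed snd_tm" "ty_of snd_tm = TN \<leadsto> TN" "tm_vars snd_tm = {}" "45 \<le> k \<Longrightarrow> bnd k snd_tm"
  unfolding snd_tm_def by auto
lemma tm_facts11 [simp]:
  "well_typed qadd_tm" "ty_of qadd_tm = TN \<leadsto> TN \<leadsto> TN" "tm_vars qadd_tm = {}" "51 \<le> k \<Longrightarrow> bnd k qadd_tm"
  unfolding qadd_tm_def by auto
lemma tm_facts12 [simp]:
  "well_typed quminus_tm" "ty_of quminus_tm = TN \<leadsto> TN" "tm_vars quminus_tm = {}" "48 \<le> k \<Longrightarrow> bnd k quminus_tm"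
  unfolding quminus_tm_def by auto
lemma tm_facts13 [simp]:
  "well_typed qabs_tm" "ty_of qabs_tm = TN \<leadsto> TN" "tm_vars qabs_tm = {}" "48 \<le> k \<Longrightarrow> bnd k qabs_tm"
  unfolding qabs_tm_def by auto
lemma tm_facts14 [simp]:
  "well_typed rconst_tm" "ty_of rconst_tm = TN \<leadsto> T1" "tm_vars rconst_tm = {}" "9 \<le> k \<Longrightarrow> bnd k rconst_tm"
  unfolding rconst_tm_def by auto
lemma tm_facts15 [simp]:
  "well_typed rsub_tm" "ty_of rsub_tm = T1 \<leadsto> T1 \<leadsto> T1" "tm_vars rsub_tm = {}" "60 \<le> k \<Longrightarrow> bnd k rsub_tm"
  unfolding rsub_tm_def by auto
lemma tm_facts16 [simp]:
  "well_typed rabs_tm" "ty_of rabs_tm = T1 \<leadsto> T1" "tm_vars rabs_tm = {}" "57 \<le> k \<Longrightarrow> bnd k rabs_tm"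
  unfolding rabs_tm_def by auto

lemma tN_simps2 [simp]:
  "tN (triangle_tm \<cdot> t) \<longleftrightarrow> tN t" "tN (root_tm \<cdot> t) \<longleftrightarrow> tN t" "tN (nfst t) \<longleftrightarrow> tN t" "tN (nsnd t) \<longleftrightarrow> tN t"
  "tN (npair s t) \<longleftrightarrow> tN s \<and> tN t" "tN (qadd s t) \<longleftrightarrow> tN s \<and> tN t" "tN (quminus_tm \<cdot> t) \<longleftrightarrow> tN t"
  "tN (qabs t) \<longleftrightarrow> tN t"
  by (auto simp: tN_def)

definition htri :: "hnat \<Rightarrow> hnat" where "htri = un triangle_tm"
definition hroot :: "hnat \<Rightarrow> hnat" where "hroot = un root_tm"
definition hpair :: "hnat \<Rightarrow> hnat \<Rightarrow> hnat" where "hpair x y = htri (x + y) + x"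
definition hfst :: "hnat \<Rightarrow> hnat" where "hfst c = c - htri (hroot c)"
definition hsnd :: "hnat \<Rightarrow> hnat" where "hsnd c = hroot c - hfst c"

definition qv :: "hnat \<Rightarrow> hq" where
  "qv c = (qn (hfst (hfst c)) - qn (hsnd (hfst c))) / (qn (hsnd c) + 1)"

lemma hpred_eq: "hpred x = x - 1"
  using hnat_op_laws(8)[of x 0] hnat_op_laws(7)[of x] by (simp add: one_hnat_def)

context henkin begin

lemma ev_vq_e_q [simp]: "vq e_q" by (rule vq_e_q)

lemma closed_tms2:
  "closed_tm T1 triangle_tm" "closed_tm T1 root_tm" "closed_tm T1 fst_tm" "closed_tm T1 snd_tm"
  "closed_tm (TN \<leadsto> T1) pair_tm" "closed_tm (TN \<leadsto> T1) qadd_tm" "closed_tm T1 quminus_tm" "closed_tm T1 qabs_tm"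
  by (auto simp: closed_tm_def)

lemma evN_triangle [simp]: "tN t \<Longrightarrow> vq e \<Longrightarrow> evN e (triangle_tm \<cdot> t) = htri (evN e t)"
  by (simp add: htri_def evN_un closed_tms2)
lemma evN_root [simp]: "tN t \<Longrightarrow> vq e \<Longrightarrow> evN e (root_tm \<cdot> t) = hroot (evN e t)"
  by (simp add: hroot_def evN_un closed_tms2)

lemma htri_rec: "htri x = hrec (ev (e_q((0,TN) := no x)) (lamN 1 (lamN 2 (V 1 \<^bold>+ (Succ \<cdot> V 2))))) x 0"
  unfolding htri_def triangle_tm_def
  by (subst un_lam) (simp_all add: evN_rec del: fun_upd_apply, simp)

lemma htri_simps [simp]: "htri 0 = 0" "htri (x + 1) = htri x + (x + 1)"
proof -
  show "htri 0 = 0" by (simp add: htri_rec lam2_Dq del: fun_upd_apply)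
  have "ev (e_q((0,TN) := no x)) (lamN 1 (lamN 2 (V 1 \<^bold>+ (Succ \<cdot> V 2)))) =
     ev (e_q((0,TN) := no (hS x))) (lamN 1 (lamN 2 (V 1 \<^bold>+ (Succ \<cdot> V 2))))" by (rule ev_cong) auto
  then have "htri (hS x) = htri x + hS x"
    unfolding htri_rec[of "hS x"] htri_rec[of x] by (simp add: lam2_Dq del: fun_upd_apply) simp
  then show "htri (x + 1) = htri x + (x + 1)" by (simp add: hS_eq)
qed

lemma hroot_rec: "hroot x = hrec (ev (e_q((0,TN) := no x)) (lamN 1 (lamN 2
     (V 1 \<^bold>+ ((Succ \<cdot> Zero) \<^bold>- ((triangle_tm \<cdot> (Succ \<cdot> V 1)) \<^bold>- (Succ \<cdot> V 2))))))) x 0"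
  unfolding hroot_def root_tm_def
  by (subst un_lam) (simp_all add: evN_rec del: fun_upd_apply, simp)

lemma hroot_simps: "hroot 0 = 0" "hroot (x + 1) = hroot x + (1 - (htri (hroot x + 1) - (x + 1)))"
proof -
  show "hroot 0 = 0" by (simp add: hroot_rec lam2_Dq del: fun_upd_apply)
  let ?t = "V 1 \<^bold>+ ((Succ \<cdot> Zero) \<^bold>- ((triangle_tm \<cdot> (Succ \<cdot> V 1)) \<^bold>- (Succ \<cdot> V 2)))"
  have "ev (e_q((0,TN) := no x)) (lamN 1 (lamN 2 ?t)) = ev (e_q((0,TN) := no (hS x))) (lamN 1 (lamN 2 ?t))"
    by (rule ev_cong) auto
  then have "hroot (hS x) = hroot x + (1 - (htri (hS (hroot x)) - hS x))"
    unfolding hroot_rec[of "hS x"] hroot_rec[of x]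
    by (simp add: lam2_Dq one_hnat_def del: fun_upd_apply) simp
  then show "hroot (x + 1) = hroot x + (1 - (htri (hroot x + 1) - (x + 1)))" by (simp add: hS_eq)
qed

lemma Int1_un: "closed_tm T1 c \<Longrightarrow> Int1 f \<Longrightarrow> Int1 (\<lambda>x. un c (f x))"
proof (rule Int1_intros_ok(6)[of "un c"])
  assume c: "closed_tm T1 c"
  then have "tN (c \<cdot> V 0)" by (simp add: closed_tm_def tN_def)
  from Int1_lam[OF this ev_vq_e_q, of 0] show "Int1 (un c)" using c by (simp add: evN_un)
qed

lemma Int1_tri_root [intro!]: "Int1 f \<Longrightarrow> Int1 (\<lambda>x. htri (f x))" "Int1 f \<Longrightarrow> Int1 (\<lambda>x. hroot (f x))"
  unfolding htri_def hroot_def by (rule Int1_un; simp add: closed_tms2)+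

lemma htri_mono: "x \<le> y \<Longrightarrow> htri x \<le> htri y"
proof -
  have "htri x \<le> htri (x + d)" for d
  proof (induction d rule: hnat_induct)
    case (step d)
    have "htri (x + (d + 1)) = htri (x + d) + (x + d + 1)" by (simp flip: add.assoc)
    then show ?case using step by (simp add: add_increasing2)
  qed auto
  then show "x \<le> y \<Longrightarrow> htri x \<le> htri y" using le_iff_add'[of x y] by auto
qed

text \<open>The invariant of the root recursion. The root rises exactly when \<open>c + 1\<close>
  has reached the next triangular number; it then equals that number, so the bound by the one after
  it holds again.\<close>

lemma hroot_bounds: "htri (hroot c) \<le> c \<and> c < htri (hroot c + 1)"
proof (induction c rule: hnat_induct)
  case zero then show ?case using htri_simps(2)[of 0] by (simp add: hroot_simps)
next
  case (step c)
  show ?case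
  proof (cases "htri (hroot c + 1) \<le> c + 1")
    case True
    then have z: "htri (hroot c + 1) - (c + 1) = 0" by (simp only: monus_eq_0)
    have r: "hroot (c + 1) = hroot c + 1" unfolding hroot_simps(2) z by simp
    have "c + 1 \<le> htri (hroot c + 1)" using step by (simp add: hnat_less_iff)
    then have "htri (hroot c + 1) = c + 1" using True by simp
    then show ?thesis unfolding r htri_simps(2)[of "hroot c + 1"] by (simp add: hnat_less_iff)
  next
    case False
    then have "\<not> htri (hroot c + 1) - (c + 1) = 0" by simp
    then have "1 - (htri (hroot c + 1) - (c + 1)) = 0" by (simp only: monus_eq_0 hnat_one_le simp_thms)
    then have r: "hroot (c + 1) = hroot c" by (simp add: hroot_simps(2))
    have "htri (hroot c) \<le> c + 1" using step by (simp add: add_increasing2)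
    then show ?thesis using False unfolding r by simp
  qed
qed auto

lemma hroot_unique: "htri s \<le> c \<Longrightarrow> c < htri (s + 1) \<Longrightarrow> hroot c = s"
proof (rule ccontr)
  assume a: "htri s \<le> c" "c < htri (s + 1)" and "hroot c \<noteq> s"
  then consider "hroot c + 1 \<le> s" | "s + 1 \<le> hroot c" by (metis hnat_less_iff linorder_neqE)
  then show False
  proof cases
    case 1
    have "c < htri (hroot c + 1)" using hroot_bounds by blast
    also have "\<dots> \<le> htri s" by (rule htri_mono[OF 1])
    also note a(1)
    finally show ?thesis by simp
  next
    case 2
    note a(2)
    also have "htri (s + 1) \<le> htri (hroot c)" by (rule htri_mono[OF 2])
    also have "\<dots> \<le> c" using hroot_bounds by blast
    finally show ?thesis by simp
  qed
qed

lemma hpair_simps [simp]: "hfst (hpair x y) = x" "hsnd (hpair x y) = y"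
proof -
  have "hroot (hpair x y) = x + y"
  proof (rule hroot_unique)
    show "hpair x y < htri (x + y + 1)"
      unfolding htri_simps hpair_def by (simp add: add.assoc hnat_less_iff)
  qed (simp add: hpair_def)
  then show "hfst (hpair x y) = x" by (simp add: hfst_def hpair_def)
  then show "hsnd (hpair x y) = y" using \<open>hroot (hpair x y) = x + y\<close> by (simp add: hsnd_def)
qed

lemma evN_pair [simp]:
  "tN s \<Longrightarrow> tN t \<Longrightarrow> vq e \<Longrightarrow> evN e (npair s t) = hpair (evN e s) (evN e t)"
  "tN t \<Longrightarrow> vq e \<Longrightarrow> evN e (nfst t) = hfst (evN e t)"
  "tN t \<Longrightarrow> vq e \<Longrightarrow> evN e (nsnd t) = hsnd (evN e t)"
proof -
  have p: "bin pair_tm x y = hpair x y" for x y unfolding pair_tm_def hpair_def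
    by (subst bin_lam) (simp_all del: fun_upd_apply, simp)
  have f: "un fst_tm x = hfst x" for x unfolding fst_tm_def hfst_def
    by (subst un_lam) (simp_all del: fun_upd_apply, simp)
  show "tN s \<Longrightarrow> tN t \<Longrightarrow> vq e \<Longrightarrow> evN e (npair s t) = hpair (evN e s) (evN e t)"
    by (simp add: evN_bin closed_tms2 p)
  show f': "tN t \<Longrightarrow> vq e \<Longrightarrow> evN e (nfst t) = hfst (evN e t)" for t e
    by (simp add: evN_un closed_tms2 f)
  have s: "un snd_tm x = hsnd x" for x unfolding snd_tm_def hsnd_def
    by (subst un_lam) (simp_all add: f' del: fun_upd_apply, simp)
  show "tN t \<Longrightarrow> vq e \<Longrightarrow> evN e (nsnd t) = hsnd (evN e t)"
    by (simp add: evN_un closed_tms2 s)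
qed

lemma qv_pair: "qv (hpair (hpair a b) c) = (qn a - qn b) / (qn c + 1)"
  by (simp add: qv_def)

lemma qv_surj: "\<exists>c. qv c = q"
  using hq_cases[of q] qv_pair by metis

lemma qden_pos: "0 < qn c + 1" by (simp add: add_nonneg_pos)

lemma qn_hS: "qn (hS x) = qn x + 1" by (simp add: hS_eq)

lemma qv_add: "tN s \<Longrightarrow> tN t \<Longrightarrow> vq e \<Longrightarrow> qv (evN e (qadd s t)) = qv (evN e s) + qv (evN e t)"
proof -
  assume a: "tN s" "tN t" "vq e"
  have b: "bin qadd_tm x y = hpair (hpair (hfst (hfst x) * hS (hsnd y) + hfst (hfst y) * hS (hsnd x))
     (hsnd (hfst x) * hS (hsnd y) + hsnd (hfst y) * hS (hsnd x))) (hpred (hS (hsnd x) * hS (hsnd y)))" for x y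
    unfolding qadd_tm_def by (subst bin_lam) (simp_all del: fun_upd_apply, simp)
  \<comment> \<open>A code stores the denominator minus one. The product of denominators is at least
    1, so taking the predecessor loses nothing to truncation.\<close>
  have n: "1 \<le> hS (hsnd x) * hS (hsnd y)" for x y by simp
  have d: "qn (hpred (hS (hsnd x) * hS (hsnd y))) + 1 = (qn (hsnd x) + 1) * (qn (hsnd y) + 1)" for x y
    unfolding hpred_eq qn_monus if_P[OF n] by (simp add: qn_hS)
  have *: "qv (bin qadd_tm x y) = qv x + qv y" for x y
  proof -
    have "qn (hsnd x) + 1 \<noteq> 0" "qn (hsnd y) + 1 \<noteq> 0" using qden_pos by (metis less_irrefl)+
    then show ?thesis unfolding b qv_pair d qv_def[of x] qv_def[of y]
      by (simp add: qn_hS add_frac_eq) (simp add: algebra_simps)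
  qed
  show ?thesis using a by (simp add: evN_bin closed_tms2 *)
qed

lemma qv_minus: "tN t \<Longrightarrow> vq e \<Longrightarrow> qv (evN e (quminus_tm \<cdot> t)) = - qv (evN e t)"
proof -
  have b: "un quminus_tm x = hpair (hpair (hsnd (hfst x)) (hfst (hfst x))) (hsnd x)" for x
    unfolding quminus_tm_def by (subst un_lam) (simp_all del: fun_upd_apply, simp)
  have "qv (un quminus_tm x) = - qv x" for x
    unfolding b qv_pair qv_def[of x] by (simp add: minus_divide_left)
  then show "tN t \<Longrightarrow> vq e \<Longrightarrow> qv (evN e (quminus_tm \<cdot> t)) = - qv (evN e t)" by (simp add: evN_un closed_tms2)
qed

lemma qv_abs: "tN t \<Longrightarrow> vq e \<Longrightarrow> qv (evN e (qabs t)) = \<bar>qv (evN e t)\<bar>"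
proof -
  have b: "un qabs_tm x = hpair (hpair ((hfst (hfst x) - hsnd (hfst x)) + (hsnd (hfst x) - hfst (hfst x))) 0) (hsnd x)" for x
    unfolding qabs_tm_def by (subst un_lam) (simp_all del: fun_upd_apply, simp)
  have "qv (un qabs_tm x) = \<bar>qv x\<bar>" for x
    unfolding b qv_pair qv_def[of x] using qden_pos[of "hsnd x"]
    by (cases "hfst (hfst x)" "hsnd (hfst x)" rule: le_cases) (auto simp: qn_monus abs_divide)
  then show "tN t \<Longrightarrow> vq e \<Longrightarrow> qv (evN e (qabs t)) = \<bar>qv (evN e t)\<bar>" by (simp add: evN_un closed_tms2)
qed

lemma sat_Eq: "tN s \<Longrightarrow> tN t \<Longrightarrow> vq e \<Longrightarrow> sat e (Eq s t) \<longleftrightarrow> evN e s = evN e t"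
  using tN_ev[of s e] tN_ev[of t e] by (simp add: Rep_hnat_inject)

lemma sat_le_nat: "tN s \<Longrightarrow> tN t \<Longrightarrow> vq e \<Longrightarrow> sat e (le_nat s t d) \<longleftrightarrow> evN e s \<le> evN e t"
  by (simp add: le_nat_def eq0_def sat_Eq del: sat.simps)
lemma sat_less_nat: "tN s \<Longrightarrow> tN t \<Longrightarrow> vq e \<Longrightarrow> sat e (less_nat s t d) \<longleftrightarrow> evN e s < evN e t"
  by (simp add: less_nat_def eq0_def sat_Eq hnat_less_iff hS_eq del: sat.simps)

lemma frac_le_frac: "(a - b) / (c + 1) \<le> (a' - b') / (c' + 1) \<longleftrightarrow> a * (c' + 1) + b' * (c + 1) \<le> a' * (c + 1) + b * (c' + 1)"
  if "0 < c + 1" "0 < c' + 1" for a b c a' b' c' :: hq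
  using that by (simp only: pos_divide_le_eq times_divide_eq_left pos_le_divide_eq) (simp add: algebra_simps)

lemma frac_less_frac: "(a - b) / (c + 1) < (a' - b') / (c' + 1) \<longleftrightarrow> a * (c' + 1) + b' * (c + 1) < a' * (c + 1) + b * (c' + 1)"
  if "0 < c + 1" "0 < c' + 1" for a b c a' b' c' :: hq
  using that by (simp only: pos_divide_less_eq times_divide_eq_left pos_less_divide_eq) (simp add: algebra_simps)

lemma sat_qle: "tN p \<Longrightarrow> tN q \<Longrightarrow> vq e \<Longrightarrow> sat e (qle p q d) \<longleftrightarrow> qv (evN e p) \<le> qv (evN e q)"
  unfolding qle_def qv_def
  by (simp add: sat_le_nat frac_le_frac qden_pos qn_le[symmetric] qn_hS del: qn_le)
lemma sat_qless: "tN p \<Longrightarrow> tN q \<Longrightarrow> vq e \<Longrightarrow> sat e (qless p q d) \<longleftrightarrow> qv (evN e p) < qv (evN e q)"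
  unfolding qless_def qv_def
  by (simp add: sat_less_nat frac_less_frac qden_pos qn_less[symmetric] qn_hS del: qn_less)

lemma tN_invpow2 [simp]: "tN qzero" "tN (qinvpow2 t) \<longleftrightarrow> tN t" "tN (qtwice_invpow2 t) \<longleftrightarrow> tN t"
  by (simp_all add: qinvpow2_def qtwice_invpow2_def qzero_def)

lemma qv_invpow2: "qv (hpair (hpair a 0) (hpred (hpow2 n))) = qn a * i2 n"
proof -
  have "hpow2 n \<noteq> 0" using hpow2_pos[of n] by (metis less_irrefl)
  then have "1 \<le> hpow2 n" by simp
  then have "qn (hpred (hpow2 n)) + 1 = qn (hpow2 n)" by (simp add: hpred_eq qn_monus)
  then show ?thesis by (simp add: qv_pair i2_def)
qed

lemma qv_pow2_tms:
  "qv (evN e qzero) = 0"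
  "tN t \<Longrightarrow> vq e \<Longrightarrow> qv (evN e (qinvpow2 t)) = i2 (evN e t)"
  "tN t \<Longrightarrow> vq e \<Longrightarrow> qv (evN e (qtwice_invpow2 t)) = 2 * i2 (evN e t)"
proof -
  have "evN e qzero = evN e_q qzero" unfolding evN_def by (intro arg_cong[where f=nv] ev_cong) (simp add: qzero_def)
  then show "qv (evN e qzero) = 0" by (simp add: qzero_def qv_pair)
  show "tN t \<Longrightarrow> vq e \<Longrightarrow> qv (evN e (qinvpow2 t)) = i2 (evN e t)"
    using qv_invpow2[of 1] by (simp add: qinvpow2_def hS_eq)
  show "tN t \<Longrightarrow> vq e \<Longrightarrow> qv (evN e (qtwice_invpow2 t)) = 2 * i2 (evN e t)"
    using qv_invpow2[of "1 + 1"] by (simp add: qtwice_invpow2_def hS_eq)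
qed

end

section \<open>Semantics of the statements\<close>

definition fn :: "tm set \<Rightarrow> hnat \<Rightarrow> hnat" where "fn X n = nv (ap X (no n))"
definition seq :: "tm set \<Rightarrow> hnat \<Rightarrow> hq" where "seq X n = qv (fn X n)"
definition isreal :: "tm set \<Rightarrow> bool" where
  "isreal X \<longleftrightarrow> (\<forall>n i. \<bar>seq X n - seq X (n + i)\<bar> < i2 n)"
definition Reals :: "tm set set" where "Reals = {X \<in> Dq T1. isreal X}"
definition Rl :: "tm set \<Rightarrow> hreal" where "Rl X = lim (seq X)"
definition typd :: "ty \<Rightarrow> tm \<Rightarrow> bool" where "typd \<sigma> x \<longleftrightarrow> well_typed x \<and> ty_of x = \<sigma> \<and> bnd 250 x"
abbreviation t1 :: "tm \<Rightarrow> bool" where "t1 \<equiv> typd T1"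
definition agree :: "nat \<Rightarrow> qenv \<Rightarrow> qenv \<Rightarrow> bool" where "agree d e e' \<longleftrightarrow> (\<forall>v. fst v < d \<longrightarrow> e v = e' v)"

text \<open>A predicate is evaluated at varying depths, below quantifiers that have added variables
  to the environment. Its meaning may depend only on the parameters with names below
  \<open>d0\<close>, so agreement with \<open>e0\<close> is required there and the depth is
  otherwise free.\<close>

definition denotes :: "nat \<Rightarrow> qenv \<Rightarrow> rpred \<Rightarrow> (tm set \<Rightarrow> bool) \<Rightarrow> bool" where
  "denotes d0 e0 P S \<longleftrightarrow> (\<forall>d\<ge>d0. \<forall>e x. vq e \<longrightarrow> agree d0 e e0 \<longrightarrow> t1 x \<longrightarrow> below d x \<longrightarrow> isreal (ev e x) \<longrightarrow>
     sat e (P x d) = S (ev e x))"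

definition isfun :: "tm set \<Rightarrow> bool" where
  "isfun F \<longleftrightarrow> (\<forall>X\<in>Reals. isreal (ap F X)) \<and> (\<forall>X\<in>Reals. \<forall>Y\<in>Reals. Rl X = Rl Y \<longrightarrow> Rl (ap F X) = Rl (ap F Y))"
definition posS :: "tm set \<Rightarrow> tm set \<Rightarrow> bool" where "posS F X \<longleftrightarrow> 0 < Rl (ap F X)"
definition zeroS :: "tm set \<Rightarrow> tm set \<Rightarrow> bool" where "zeroS F X \<longleftrightarrow> Rl (ap F X) = 0"
definition limptS :: "(tm set \<Rightarrow> bool) \<Rightarrow> tm set \<Rightarrow> bool" where
  "limptS S X \<longleftrightarrow> (\<forall>k. \<exists>Y\<in>Reals. \<bar>Rl X - Rl Y\<bar> < hr (i2 k) \<and> Rl Y \<noteq> Rl X \<and> S Y)"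
definition closS :: "(tm set \<Rightarrow> bool) \<Rightarrow> tm set \<Rightarrow> bool" where "closS S X \<longleftrightarrow> S X \<or> limptS S X"
definition ballS :: "(tm set \<Rightarrow> bool) \<Rightarrow> tm set \<Rightarrow> bool" where
  "ballS S X \<longleftrightarrow> (\<exists>k. \<forall>Y\<in>Reals. \<bar>Rl X - Rl Y\<bar> < hr (i2 k) \<longrightarrow> S Y)"
definition intS :: "(tm set \<Rightarrow> bool) \<Rightarrow> tm set \<Rightarrow> bool" where "intS S X \<longleftrightarrow> S X \<and> ballS S X"
definition bdS :: "(tm set \<Rightarrow> bool) \<Rightarrow> tm set \<Rightarrow> bool" where "bdS S X \<longleftrightarrow> closS S X \<and> \<not> intS S X"
definition repS :: "tm set \<Rightarrow> (tm set \<Rightarrow> bool) \<Rightarrow> bool" where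
  "repS G S \<longleftrightarrow> (\<forall>X\<in>Reals. 0 \<le> Rl (ap G X)) \<and> (\<forall>X\<in>Reals. posS G X \<longleftrightarrow> S X)"
definition openF :: "tm set \<Rightarrow> bool" where
  "openF F \<longleftrightarrow> (\<forall>X\<in>Reals. 0 \<le> Rl (ap F X)) \<and> (\<forall>X\<in>Reals. posS F X \<longrightarrow> ballS (posS F) X)"
definition existsS :: "(tm set \<Rightarrow> bool) \<Rightarrow> bool" where "existsS S \<longleftrightarrow> (\<exists>G\<in>Dq TRR. isfun G \<and> repS G S)"
definition RMopenS :: "(tm set \<Rightarrow> bool) \<Rightarrow> bool" where
  "RMopenS S \<longleftrightarrow> (\<exists>a\<in>Dq (TN \<leadsto> T1). \<exists>b\<in>Dq (TN \<leadsto> T1). (\<forall>n. isreal (ap a (no n)) \<and> isreal (ap b (no n))) \<and>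
     (\<forall>X\<in>Reals. S X \<longleftrightarrow> (\<exists>n. Rl (ap a (no n)) < Rl X \<and> Rl X < Rl (ap b (no n)))))"

lemma agree_upd: "agree d0 e e0 \<Longrightarrow> d0 \<le> d \<Longrightarrow> agree d0 (e((d,\<sigma>) := u)) e0"
  by (auto simp: agree_def)

lemma agree_mono: "agree d e e0 \<Longrightarrow> d0 \<le> d \<Longrightarrow> agree d0 e e0"
  by (auto simp: agree_def)

lemma agree_refl [simp]: "agree d e e"
  by (simp add: agree_def)

lemma agree_trans: "agree d e e' \<Longrightarrow> agree d e' e'' \<Longrightarrow> agree d e e''"
  by (simp add: agree_def)

lemma denotesD: "denotes d0 e0 P S \<Longrightarrow> d0 \<le> d \<Longrightarrow> vq e \<Longrightarrow> agree d0 e e0 \<Longrightarrow> t1 x \<Longrightarrow> below d x \<Longrightarrow>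
   isreal (ev e x) \<Longrightarrow> sat e (P x d) = S (ev e x)"
  by (simp add: denotes_def)

lemma ev_upd [simp]: "below d x \<Longrightarrow> d \<le> n \<Longrightarrow> ev (e((n,\<sigma>) := u)) x = ev e x"
  by (rule ev_cong) (auto simp: below_def)

lemma d_simps [simp]:
  "(\<phi> \<^bold>\<and> \<psi>) d = And (\<phi> d) (\<psi> d)" "(\<phi> \<^bold>\<or> \<psi>) d = Or (\<phi> d) (\<psi> d)" "(\<phi> \<^bold>\<longrightarrow> \<psi>) d = Imp (\<phi> d) (\<psi> d)"
  "(\<phi> \<^bold>\<longleftrightarrow> \<psi>) d = Iff (\<phi> d) (\<psi> d)" "(\<^bold>\<not> \<phi>) d = Neg (\<phi> d)"
  "all_ty \<sigma> P d = Forall d \<sigma> (P (Var d \<sigma>) (Suc d))" "ex_ty \<sigma> P d = Exists d \<sigma> (P (Var d \<sigma>) (Suc d))"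
  "all_nat Q d = Forall d TN (Q (V d) (Suc d))" "ex_nat Q d = Exists d TN (Q (V d) (Suc d))"
  by (simp_all add: dfm_defs)

lemma real_simps [simp]:
  "all_real P d = Forall d T1 (Imp (is_real (V1 d) (Suc d)) (P (V1 d) (Suc d)))"
  "ex_real P d = Exists d T1 (And (is_real (V1 d) (Suc d)) (P (V1 d) (Suc d)))"
  "all_real_fun P d = Forall d TRR (Imp (is_real_fun (Var d TRR) (Suc d)) (P (Var d TRR) (Suc d)))"
  "ex_real_fun P d = Exists d TRR (And (is_real_fun (Var d TRR) (Suc d)) (P (Var d TRR) (Suc d)))"
  by (simp_all add: all_real_def ex_real_def all_real_fun_def ex_real_fun_def)

lemma below_closed [simp]:
  "below d pred_tm" "below d add_tm" "below d mult_tm" "below d monus_tm" "below d pow2_tm" "below d triangle_tm"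
  "below d pair_tm" "below d root_tm" "below d fst_tm" "below d snd_tm" "below d qadd_tm" "below d quminus_tm"
  "below d qabs_tm" "below d rconst_tm" "below d rsub_tm" "below d rabs_tm"
  by (simp_all add: below_def)

lemma below_Suc [simp]: "below d x \<Longrightarrow> below (Suc d) x"
  using below_mono[of d x "Suc d"] by simp

lemma below_real [simp]:
  "below d qzero" "below d (qinvpow2 t) \<longleftrightarrow> below d t" "below d (rdist x y) \<longleftrightarrow> below d x \<and> below d y"
  by (simp_all add: qzero_def qinvpow2_def rdist_def)

lemma typd_simps [simp]:
  "arity \<sigma> \<le> 250 \<Longrightarrow> typd \<sigma> (Var n \<sigma>)" "t1 (rconst t) \<longleftrightarrow> tN t" "t1 (rsub x y) \<longleftrightarrow> t1 x \<and> t1 y" "t1 (rabs x) \<longleftrightarrow> t1 x"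
  "t1 (rdist x y) \<longleftrightarrow> t1 x \<and> t1 y"
  by (auto simp: typd_def tN_def rdist_def)

lemma typd_App: "typd (\<sigma> \<leadsto> \<tau>) f \<Longrightarrow> typd \<sigma> x \<Longrightarrow> typd \<tau> (f \<cdot> x)"
  by (auto simp: typd_def)

lemma typd_TN [simp]: "typd TN = tN" by (auto simp: typd_def tN_def)

lemma tN_App [simp]: "t1 x \<Longrightarrow> tN t \<Longrightarrow> tN (x \<cdot> t)"
  using typd_App[of TN TN x t] by simp

lemma isreal_cauchy: "isreal X \<Longrightarrow> cauchy (seq X)"
proof -
  assume r: "isreal X"
  have 1: "\<bar>seq X n - seq X m\<bar> < i2 n" if "n \<le> m" for n m
    using r that le_iff_add'[of n m] by (auto simp: isreal_def)
  show "cauchy (seq X)" unfolding cauchy_def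
  proof (intro allI impI)
    fix s :: hq assume "0 < s"
    then obtain k where k: "i2 k < s" using i2_arch by blast
    \<comment> \<open>Both terms are compared with the one at index \<open>k + 1\<close>; the two
      errors \<open>2^-(k+1)\<close> add up to \<open>2^-k\<close>.\<close>
    have "\<bar>seq X m - seq X n\<bar> < s" if mn: "k + 1 \<le> m" "k + 1 \<le> n" for m n
    proof -
      have "\<bar>seq X (k + 1) - seq X m\<bar> < i2 (k + 1)" "\<bar>seq X (k + 1) - seq X n\<bar> < i2 (k + 1)" using mn by (auto intro: 1)
      moreover have "i2 (k + 1) * 2 = i2 k" by (rule i2_Suc)
      ultimately show ?thesis using k unfolding abs_less_iff by linarith
    qed
    then show "\<exists>k. \<forall>m\<ge>k. \<forall>n\<ge>k. \<bar>seq X m - seq X n\<bar> < s" by blast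
  qed
qed

lemma Rl_approx: "isreal X \<Longrightarrow> \<bar>Rl X - hr (seq X n)\<bar> \<le> hr (i2 n)"
  unfolding Rl_def
proof (rule lim_dist[where m=n])
  assume r: "isreal X"
  show "cauchy (seq X)" using r by (rule isreal_cauchy)
  show "\<forall>m\<ge>n. \<bar>seq X m - seq X n\<bar> \<le> i2 n"
    using r le_iff_add'[of n] by (auto simp: isreal_def abs_minus_commute intro: less_imp_le)
qed

lemma hreal_le_eps: "(\<And>n. x \<le> y + hr (c * i2 n)) \<Longrightarrow> 0 < c \<Longrightarrow> x \<le> y"
proof (rule ccontr)
  assume a: "\<And>n. x \<le> y + hr (c * i2 n)" "0 < c" "\<not> x \<le> y"
  then obtain k where k: "hr (i2 k) < x - y" using hreal_arch[of "x - y"] by auto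
  obtain n where "i2 n < i2 k / c" using i2_arch[of "i2 k / c"] a(2) by auto
  then have "c * i2 n < i2 k" using a(2) by (simp add: pos_less_divide_eq mult.commute)
  then have "hr (c * i2 n) < hr (i2 k)" by simp
  then show False using a(1)[of n] k by linarith
qed

lemma hr_mult2 [simp]: "hr (2 * q) = 2 * hr q" "hr (4 * q) = 4 * hr q"
proof -
  show 2: "hr (2 * q) = 2 * hr q" for q by (simp only: mult_2 hr_simps)
  have "4 * q = 2 * (2 * q)" "4 * hr q = 2 * (2 * hr q)" by simp_all
  then show "hr (4 * q) = 4 * hr q" by (simp only: 2)
qed

text \<open>The approximation with index \<open>n\<close> is within \<open>2^-n\<close> of its
  limit. Two such errors are exactly the slack \<open>2 * 2^-n\<close> of the formula, so the order
  of the limits gives the inequalities. Conversely the inequalities order the limits up to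
  \<open>4 * 2^-n\<close> for every \<open>n\<close>, hence order them.\<close>

lemma RLE_iff:
  assumes "isreal X" "isreal Y"
  shows "(\<forall>n. seq X n \<le> seq Y n + 2 * i2 n) \<longleftrightarrow> Rl X \<le> Rl Y"
proof
  assume l: "\<forall>n. seq X n \<le> seq Y n + 2 * i2 n"
  show "Rl X \<le> Rl Y"
  proof (rule hreal_le_eps[where c=4])
    fix n
    have "hr (seq X n) \<le> hr (seq Y n + 2 * i2 n)" using l by (simp only: hr_le)
    then show "Rl X \<le> Rl Y + hr (4 * i2 n)"
      using Rl_approx[OF assms(1), of n] Rl_approx[OF assms(2), of n] unfolding abs_le_iff by simp
  qed simp
next
  assume l: "Rl X \<le> Rl Y"
  have "hr (seq X n) \<le> hr (seq Y n + 2 * i2 n)" for n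
    using l Rl_approx[OF assms(1), of n] Rl_approx[OF assms(2), of n] unfolding abs_le_iff by simp
  then show "\<forall>n. seq X n \<le> seq Y n + 2 * i2 n" unfolding hr_le by blast
qed

lemma REQ_iff:
  assumes "isreal X" "isreal Y"
  shows "(\<forall>n. \<bar>seq X n - seq Y n\<bar> \<le> 2 * i2 n) \<longleftrightarrow> Rl X = Rl Y"
proof -
  have "\<bar>a - b\<bar> \<le> c \<longleftrightarrow> a \<le> b + c \<and> b \<le> a + c" for a b c :: hq
    unfolding abs_le_iff minus_diff_eq by (simp add: diff_le_eq add.commute)
  moreover have "Rl X = Rl Y \<longleftrightarrow> Rl X \<le> Rl Y \<and> Rl Y \<le> Rl X" by (rule order.eq_iff)
  ultimately show ?thesis using RLE_iff[OF assms] RLE_iff[OF assms(2,1)]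
    by (simp only: all_conj_distrib)
qed

lemma shift_lim: "cauchy X \<Longrightarrow> cauchy (\<lambda>n. X (n + 1)) \<and> lim (\<lambda>n. X (n + 1)) = lim X"
proof -
  assume c: "cauchy X"
  have le: "n \<le> n + 1" for n :: hnat by simp
  have "cauchy (\<lambda>n. X (n + 1))" unfolding cauchy_def
    using cauchyD[OF c] order.trans[OF _ le] by meson
  moreover have "vanishes (\<lambda>n. X (n + 1) - X n)" unfolding vanishes_def
    using cauchyD[OF c] order.trans[OF _ le] by meson
  ultimately show ?thesis using lim_eq_iff[of "\<lambda>n. X (n + 1)" X] c by simp
qed

context henkin begin

lemma typd_Dq: "typd \<sigma> x \<Longrightarrow> vq e \<Longrightarrow> ev e x \<in> Dq \<sigma>"
  using ev_Dq[of x e] bnd_mono[of 250 x 299] by (auto simp: typd_def)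

lemma evN_App: "t1 x \<Longrightarrow> tN t \<Longrightarrow> vq e \<Longrightarrow> evN e (x \<cdot> t) = fn (ev e x) (evN e t)"
  by (simp add: evN_def[of e "x \<cdot> t"] fn_def tN_ev)

lemma qv_App: "t1 x \<Longrightarrow> tN t \<Longrightarrow> vq e \<Longrightarrow> qv (evN e (x \<cdot> t)) = seq (ev e x) (evN e t)"
  by (simp add: evN_App seq_def)

lemmas sat_qs = sat_qle sat_qless qv_add qv_minus qv_abs qv_pow2_tms qv_App

lemma sat_ForallN: "sat e (Forall n TN \<phi>) \<longleftrightarrow> (\<forall>x. sat (e((n,TN) := no x)) \<phi>)"
  by (simp add: Dq_TN_all)
lemma sat_ExistsN: "sat e (Exists n TN \<phi>) \<longleftrightarrow> (\<exists>x. sat (e((n,TN) := no x)) \<phi>)"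
  by (simp add: Exists_def Dq_TN_all del: fun_upd_apply)

lemma sat_is_real: "t1 x \<Longrightarrow> below d x \<Longrightarrow> vq e \<Longrightarrow> sat e (is_real x d) \<longleftrightarrow> isreal (ev e x)"
  by (simp add: is_real_def isreal_def sat_ForallN sat_qs del: sat.simps fun_upd_apply) simp

lemma sat_rle: "t1 x \<Longrightarrow> t1 y \<Longrightarrow> below d x \<Longrightarrow> below d y \<Longrightarrow> vq e \<Longrightarrow> isreal (ev e x) \<Longrightarrow> isreal (ev e y) \<Longrightarrow>
   sat e ((x \<le>\<^sub>R y) d) \<longleftrightarrow> Rl (ev e x) \<le> Rl (ev e y)"
  by (simp add: rle_def RLE_iff[symmetric] sat_ForallN sat_qs del: sat.simps fun_upd_apply) simp
lemma sat_rless: "t1 x \<Longrightarrow> t1 y \<Longrightarrow> below d x \<Longrightarrow> below d y \<Longrightarrow> vq e \<Longrightarrow> isreal (ev e x) \<Longrightarrow> isreal (ev e y) \<Longrightarrow>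
   sat e ((x <\<^sub>R y) d) \<longleftrightarrow> Rl (ev e x) < Rl (ev e y)"
  by (simp add: rless_def sat_rle not_le)
lemma sat_req: "t1 x \<Longrightarrow> t1 y \<Longrightarrow> below d x \<Longrightarrow> below d y \<Longrightarrow> vq e \<Longrightarrow> isreal (ev e x) \<Longrightarrow> isreal (ev e y) \<Longrightarrow>
   sat e ((x =\<^sub>R y) d) \<longleftrightarrow> Rl (ev e x) = Rl (ev e y)"
  by (simp add: req_def REQ_iff[symmetric] sat_ForallN sat_qs del: sat.simps fun_upd_apply) simp

lemma seq_rconst: "tN t \<Longrightarrow> vq e \<Longrightarrow> seq (ev e (rconst t)) n = qv (evN e t)"
proof -
  assume a: "tN t" "vq e"
  have "ap (ap (ev e rconst_tm) (ev e t)) (no n) = ev (e((0,TN) := ev e t, (1,TN) := no n)) (V 0)"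
    unfolding rconst_tm_def using a tN_ev[of t e] by (subst ev_lam2) simp_all
  then show ?thesis using a by (simp add: seq_def fn_def tN_ev)
qed

lemma seq_rsub: "X \<in> Dq T1 \<Longrightarrow> Y \<in> Dq T1 \<Longrightarrow> vq e \<Longrightarrow>
  seq (ap (ap (ev e rsub_tm) X) Y) n = seq X (n + 1) - seq Y (n + 1)"
proof -
  assume a: "X \<in> Dq T1" "Y \<in> Dq T1" "vq e"
  let ?t = "qsub (V1 0 \<cdot> (Succ \<cdot> V 2)) (V1 1 \<cdot> (Succ \<cdot> V 2))"
  let ?e = "e((0,T1) := X, (1,T1) := Y)"
  let ?e' = "?e((2,TN) := no n)"
  have v: "vq ?e" "vq ?e'" using a by (simp_all add: vq_upd del: fun_upd_apply)
  have "ap (ap (ev e rsub_tm) X) Y = ev ?e (lamN 2 ?t)"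
    unfolding rsub_tm_def using a by (subst ev_lam2) simp_all
  then have "fn (ap (ap (ev e rsub_tm) X) Y) n = evN ?e' ?t"
    using v ev_lam[of ?t TN ?e "no n" 2] by (simp add: fn_def evN_def del: fun_upd_apply)
  then show ?thesis unfolding seq_def[of "ap _ _"] using v
    by (simp add: sat_qs hS_eq del: fun_upd_apply) simp
qed

lemma seq_rabs: "X \<in> Dq T1 \<Longrightarrow> vq e \<Longrightarrow> seq (ap (ev e rabs_tm) X) n = \<bar>seq X n\<bar>"
proof -
  assume a: "X \<in> Dq T1" "vq e"
  have "ap (ap (ev e rabs_tm) X) (no n) = ev (e((0,T1) := X, (1,TN) := no n)) (qabs (V1 0 \<cdot> V 1))"
    unfolding rabs_tm_def using a by (subst ev_lam2) simp_all
  then have "fn (ap (ev e rabs_tm) X) n = evN (e((0,T1) := X, (1,TN) := no n)) (qabs (V1 0 \<cdot> V 1))"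
    by (simp add: fn_def evN_def)
  moreover have "vq (e((0,T1) := X, (1,TN) := no n))" using a by (simp add: vq_upd del: fun_upd_apply)
  ultimately show ?thesis unfolding seq_def[of "ap _ _"] by (simp add: sat_qs del: fun_upd_apply) simp
qed

lemma seq_rconst': "tN t \<Longrightarrow> vq e \<Longrightarrow> seq (ev e (rconst t)) = (\<lambda>n. qv (evN e t))"
  by (intro ext) (rule seq_rconst)

lemma real_rconst: "tN t \<Longrightarrow> vq e \<Longrightarrow> isreal (ev e (rconst t))" "tN t \<Longrightarrow> vq e \<Longrightarrow> Rl (ev e (rconst t)) = hr (qv (evN e t))"
  by (simp_all add: isreal_def Rl_def hr_def seq_rconst' del: ev.simps)

text \<open>The index shift pays for the sum of errors: each operand contributes less than
  \<open>2^-(n+1)\<close>.\<close>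

lemma isreal_rsub: "X \<in> Reals \<Longrightarrow> Y \<in> Reals \<Longrightarrow> vq e \<Longrightarrow> isreal (ap (ap (ev e rsub_tm) X) Y)"
  and Rl_rsub: "X \<in> Reals \<Longrightarrow> Y \<in> Reals \<Longrightarrow> vq e \<Longrightarrow> Rl (ap (ap (ev e rsub_tm) X) Y) = Rl X - Rl Y"
proof -
  assume a: "X \<in> Reals" "Y \<in> Reals" "vq e"
  then have s: "seq (ap (ap (ev e rsub_tm) X) Y) = (\<lambda>n. seq X (n + 1) - seq Y (n + 1))"
    by (intro ext) (simp add: Reals_def seq_rsub)
  have c: "cauchy (seq X)" "cauchy (seq Y)" using a isreal_cauchy by (auto simp: Reals_def)
  show "isreal (ap (ap (ev e rsub_tm) X) Y)" unfolding isreal_def s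
  proof (intro allI)
    fix n i
    have "\<bar>seq X (n + 1) - seq X (n + 1 + i)\<bar> < i2 (n + 1)" "\<bar>seq Y (n + 1) - seq Y (n + 1 + i)\<bar> < i2 (n + 1)"
      using a by (auto simp: Reals_def isreal_def)
    moreover have "n + i + 1 = n + 1 + i" by (simp add: ac_simps)
    moreover have "i2 (n + 1) * 2 = i2 n" by (rule i2_Suc)
    ultimately show "\<bar>seq X (n + 1) - seq Y (n + 1) - (seq X (n + i + 1) - seq Y (n + i + 1))\<bar> < i2 n"
      unfolding abs_less_iff by (simp only:) linarith
  qed
  show "Rl (ap (ap (ev e rsub_tm) X) Y) = Rl X - Rl Y"
    unfolding Rl_def s using shift_lim[OF c(1)] shift_lim[OF c(2)] by (simp flip: lim_diff)
qed

lemma isreal_rabs: "X \<in> Reals \<Longrightarrow> vq e \<Longrightarrow> isreal (ap (ev e rabs_tm) X)"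
  and Rl_rabs: "X \<in> Reals \<Longrightarrow> vq e \<Longrightarrow> Rl (ap (ev e rabs_tm) X) = \<bar>Rl X\<bar>"
proof -
  assume a: "X \<in> Reals" "vq e"
  then have s: "seq (ap (ev e rabs_tm) X) = (\<lambda>n. \<bar>seq X n\<bar>)" by (intro ext) (simp add: Reals_def seq_rabs)
  show "Rl (ap (ev e rabs_tm) X) = \<bar>Rl X\<bar>"
    unfolding Rl_def s using a isreal_cauchy by (simp add: Reals_def lim_abs)
  show "isreal (ap (ev e rabs_tm) X)" unfolding isreal_def s
    using a by (auto simp: Reals_def isreal_def intro: le_less_trans[OF abs_triangle_ineq3])
qed

lemma Reals_ap: "F \<in> Dq TRR \<Longrightarrow> X \<in> Dq T1 \<Longrightarrow> ap F X \<in> Dq T1"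
  by (rule ap_Dq[of _ T1 T1]) simp_all

lemma rdist_sem:
  assumes "t1 x" "t1 y" "vq e" "isreal (ev e x)" "isreal (ev e y)"
  shows "isreal (ev e (rdist x y))" "Rl (ev e (rdist x y)) = \<bar>Rl (ev e x) - Rl (ev e y)\<bar>"
proof -
  have r: "ev e x \<in> Reals" "ev e y \<in> Reals" using assms typd_Dq by (auto simp: Reals_def)
  have "ev e (rsub x y) \<in> Dq T1" by (rule typd_Dq) (use assms in simp_all)
  then have s: "ap (ap (ev e rsub_tm) (ev e x)) (ev e y) \<in> Reals" using isreal_rsub r assms by (simp add: Reals_def)
  show "isreal (ev e (rdist x y))" "Rl (ev e (rdist x y)) = \<bar>Rl (ev e x) - Rl (ev e y)\<bar>"
    using isreal_rabs[OF s assms(3)] Rl_rabs[OF s assms(3)] Rl_rsub[OF r assms(3)] by (simp_all add: rdist_def)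
qed

lemma sat_in_ball:
  "t1 x \<Longrightarrow> t1 y \<Longrightarrow> tN k \<Longrightarrow> below d x \<Longrightarrow> below d y \<Longrightarrow> below d k \<Longrightarrow> vq e \<Longrightarrow> isreal (ev e x) \<Longrightarrow> isreal (ev e y) \<Longrightarrow>
   sat e (in_ball x (rinvpow2 k) y d) \<longleftrightarrow> \<bar>Rl (ev e x) - Rl (ev e y)\<bar> < hr (i2 (evN e k))"
  unfolding in_ball_def
  by (subst sat_rless) (simp_all add: rdist_sem real_rconst sat_qs del: ev.simps)

lemma sat_real_quant:
  "vq e \<Longrightarrow> sat e (Forall d T1 (Imp (is_real (V1 d) (Suc d)) \<phi>)) \<longleftrightarrow> (\<forall>X\<in>Reals. sat (e((d,T1) := X)) \<phi>)"
  "vq e \<Longrightarrow> sat e (Exists d T1 (And (is_real (V1 d) (Suc d)) \<phi>)) \<longleftrightarrow> (\<exists>X\<in>Reals. sat (e((d,T1) := X)) \<phi>)"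
  using sat_is_real[of "V1 d" "Suc d"] by (auto simp: Reals_def vq_upd simp del: fun_upd_apply) auto

lemma Reals_vq: "vq e \<Longrightarrow> X \<in> Reals \<Longrightarrow> vq (e((d,T1) := X))"
  by (simp add: Reals_def vq_upd)
lemma Reals_isreal: "X \<in> Reals \<Longrightarrow> isreal X"
  by (simp add: Reals_def)

lemma denotes_limpt: "denotes d0 e0 P S \<Longrightarrow> denotes d0 e0 (limit_point P) (limptS S)"
  unfolding denotes_def
proof (intro allI impI)
  fix d e x assume a: "\<forall>d\<ge>d0. \<forall>e x. vq e \<longrightarrow> agree d0 e e0 \<longrightarrow> t1 x \<longrightarrow> below d x \<longrightarrow> isreal (ev e x) \<longrightarrow> sat e (P x d) = S (ev e x)"
    and b: "d0 \<le> d" "vq e" "agree d0 e e0" "t1 x" "below d x" "isreal (ev e x)"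
  \<comment> \<open>The quantifiers take the names \<open>d\<close> and \<open>Suc d\<close>, both
    above the parameters, so the extended environments still agree with \<open>e0\<close> below
    \<open>d0\<close> and leave the value of \<open>x\<close> unchanged.\<close>
  have *: "vq (e((d,TN) := no k, (Suc d,T1) := Y))" "agree d0 (e((d,TN) := no k, (Suc d,T1) := Y)) e0"
    "ev (e((d,TN) := no k, (Suc d,T1) := Y)) x = ev e x"
    "ev (e((d,TN) := no k, (Suc d,T1) := Y)) (V1 (Suc d)) = Y"
    "evN (e((d,TN) := no k, (Suc d,T1) := Y)) (V d) = k"
    if "Y \<in> Reals" for k Y
    using b that by (simp_all add: Reals_vq agree_upd del: fun_upd_apply) simp_all
  show "sat e (limit_point P x d) = limptS S (ev e x)"
    using a b *
    by (simp add: limit_point_def limptS_def sat_ForallN sat_real_quant sat_in_ball sat_req Reals_isreal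
        del: sat_derived(5) sat.simps(1,2,4) ev.simps evN_Var fun_upd_apply)
qed

lemma denotes_ball: "denotes d0 e0 P S \<Longrightarrow> denotes d0 e0 (ball_inside P) (ballS S)"
  unfolding denotes_def
proof (intro allI impI)
  fix d e x assume a: "\<forall>d\<ge>d0. \<forall>e x. vq e \<longrightarrow> agree d0 e e0 \<longrightarrow> t1 x \<longrightarrow> below d x \<longrightarrow> isreal (ev e x) \<longrightarrow> sat e (P x d) = S (ev e x)"
    and b: "d0 \<le> d" "vq e" "agree d0 e e0" "t1 x" "below d x" "isreal (ev e x)"
  have *: "vq (e((d,TN) := no k, (Suc d,T1) := Y))" "agree d0 (e((d,TN) := no k, (Suc d,T1) := Y)) e0"
    "ev (e((d,TN) := no k, (Suc d,T1) := Y)) x = ev e x"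
    "ev (e((d,TN) := no k, (Suc d,T1) := Y)) (V1 (Suc d)) = Y"
    "evN (e((d,TN) := no k, (Suc d,T1) := Y)) (V d) = k"
    if "Y \<in> Reals" for k Y
    using b that by (simp_all add: Reals_vq agree_upd del: fun_upd_apply) simp_all
  show "sat e (ball_inside P x d) = ballS S (ev e x)"
    using a b *
    by (simp add: ball_inside_def ballS_def sat_ExistsN sat_real_quant sat_in_ball Reals_isreal
        del: sat_derived(5) sat.simps(1,2,4) ev.simps evN_Var fun_upd_apply)
qed

lemma denotes_clos: "denotes d0 e0 P S \<Longrightarrow> denotes d0 e0 (closure_set P) (closS S)"
  using denotes_limpt[of d0 e0 P S] by (simp add: denotes_def closure_set_def closS_def)
lemma denotes_int: "denotes d0 e0 P S \<Longrightarrow> denotes d0 e0 (interior_set P) (intS S)"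
  using denotes_ball[of d0 e0 P S] by (simp add: denotes_def interior_set_def intS_def)
lemma denotes_bd: "denotes d0 e0 P S \<Longrightarrow> denotes d0 e0 (boundary_set P) (bdS S)"
  using denotes_clos[of d0 e0 P S] denotes_int[of d0 e0 P S] by (simp add: denotes_def boundary_set_def bdS_def)
lemma denotes_not: "denotes d0 e0 P S \<Longrightarrow> denotes d0 e0 (\<lambda>x. \<^bold>\<not> P x) (\<lambda>X. \<not> S X)"
  by (simp add: denotes_def)

lemma rzero_sem: "vq e \<Longrightarrow> isreal (ev e rzero)" "vq e \<Longrightarrow> Rl (ev e rzero) = 0"
  by (simp_all add: real_rconst sat_qs del: ev.simps)

lemma denotes_pos_zero:
  assumes F: "typd TRR F" "below d0 F" "isfun (ev e0 F)"
  shows "denotes d0 e0 (pos_set F) (posS (ev e0 F))" "denotes d0 e0 (zero_set F) (zeroS (ev e0 F))"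
proof -
  have "sat e (pos_set F x d) = posS (ev e0 F) (ev e x) \<and> sat e (zero_set F x d) = zeroS (ev e0 F) (ev e x)"
    if b: "d0 \<le> d" "vq e" "agree d0 e e0" "t1 x" "below d x" "isreal (ev e x)" for d e x
  proof -
    have e: "ev e F = ev e0 F" by (rule ev_cong) (use b F in \<open>auto simp: below_def agree_def\<close>)
    have "ev e x \<in> Reals" using b typd_Dq by (simp add: Reals_def)
    then have r: "isreal (ev e (F \<cdot> x))" using F(3) by (simp add: isfun_def e)
    have t: "t1 (F \<cdot> x)" using typd_App F b by blast
    have bl: "below d (F \<cdot> x)" using b F below_mono by auto
    show ?thesis using b r t bl
      by (simp add: pos_set_def zero_set_def sat_rless sat_req rzero_sem posS_def zeroS_def del: ev.simps)
        (simp add: e)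
  qed
  then show "denotes d0 e0 (pos_set F) (posS (ev e0 F))" "denotes d0 e0 (zero_set F) (zeroS (ev e0 F))"
    by (simp_all add: denotes_def)
qed

end

definition infS :: "tm set \<Rightarrow> (tm set \<Rightarrow> bool) \<Rightarrow> tm set \<Rightarrow> bool" where
  "infS X S R \<longleftrightarrow> (\<forall>Y\<in>Reals. S Y \<longrightarrow> Rl R \<le> \<bar>Rl X - Rl Y\<bar>) \<and>
     (\<forall>Z\<in>Reals. (\<forall>Y\<in>Reals. S Y \<longrightarrow> Rl Z \<le> \<bar>Rl X - Rl Y\<bar>) \<longrightarrow> Rl Z \<le> Rl R)"

definition isE :: "tm set \<Rightarrow> bool" where
  "isE E \<longleftrightarrow> (\<forall>f\<in>Dq T1. nv (ap E f) = 0 \<longleftrightarrow> (\<exists>n. fn f n = 0))"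

context henkin begin

lemma sat_is_real_fun:
  assumes "typd TRR F" "below d F" "vq e"
  shows "sat e (is_real_fun F d) \<longleftrightarrow> isfun (ev e F)"
proof -
  have t: "t1 (F \<cdot> V1 n)" for n using typd_App assms by (simp add: typd_App)
  have v: "vq (e((d,T1) := X))" "vq (e((d,T1) := X, (Suc d,T1) := Y))" if "X \<in> Reals" "Y \<in> Reals" for X Y
    using assms that by (simp_all add: Reals_vq del: fun_upd_apply)
  have 1: "sat (e((d,T1) := X)) (is_real (F \<cdot> V1 d) (Suc d)) \<longleftrightarrow> isreal (ap (ev e F) X)" if "X \<in> Reals" for X
    using v[OF that that] t assms(2) by (simp add: sat_is_real del: fun_upd_apply) simp
  have 2: "sat (e((d,T1) := X, (Suc d,T1) := Y)) ((V1 d =\<^sub>R V1 (Suc d)) (Suc (Suc d))) \<longleftrightarrow> Rl X = Rl Y"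
    if "X \<in> Reals" "Y \<in> Reals" for X Y
    using v[OF that] that by (subst sat_req) (simp_all add: Reals_isreal)
  have 3: "sat (e((d,T1) := X, (Suc d,T1) := Y)) ((F \<cdot> V1 d =\<^sub>R F \<cdot> V1 (Suc d)) (Suc (Suc d))) \<longleftrightarrow>
      Rl (ap (ev e F) X) = Rl (ap (ev e F) Y)"
    if "X \<in> Reals" "Y \<in> Reals" "isreal (ap (ev e F) X)" "isreal (ap (ev e F) Y)" for X Y
    using v[OF that(1,2)] that t assms(2) by (subst sat_req) (simp_all del: fun_upd_apply, simp_all)
  have v1: "vq (e((d,T1) := X))" if "X \<in> Reals" for X using v[OF that that] by simp
  show ?thesis
    using assms by (simp add: is_real_fun_def isfun_def sat_real_quant 1 2 v1 del: fun_upd_apply sat.simps(4))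
      (use 3 in blast)
qed

lemma sat_represents:
  assumes G: "typd TRR G" "below d G" "isfun (ev e G)" and P: "denotes d0 e0 P S" "d0 \<le> d" "agree d0 e e0" and e: "vq e"
  shows "sat e (represents G P d) \<longleftrightarrow> repS (ev e G) S"
proof -
  have t: "t1 (G \<cdot> V1 n)" for n using typd_App G by (simp add: typd_App)
  have v: "vq (e((d,T1) := X))" if "X \<in> Reals" for X
    using e that by (simp add: Reals_vq del: fun_upd_apply)
  have r: "isreal (ap (ev e G) X)" if "X \<in> Reals" for X using G that by (simp add: isfun_def)
  have 1: "sat (e((d,T1) := X)) ((rzero \<le>\<^sub>R G \<cdot> V1 d) (Suc d)) \<longleftrightarrow> 0 \<le> Rl (ap (ev e G) X)" if "X \<in> Reals" for X
    using v[OF that] t G(1,2) r[OF that] rzero_sem[OF v[OF that]]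
    by (subst sat_rle) (simp_all del: fun_upd_apply ev.simps, simp_all del: ev.simps add: ev.simps(1,7))
  have 2: "sat (e((d,T1) := X)) (pos_set G (V1 d) (Suc d)) \<longleftrightarrow> posS (ev e G) X" if "X \<in> Reals" for X
    using denotesD[OF denotes_pos_zero(1)[OF G], of "Suc d" "e((d,T1) := X)" "V1 d"] v[OF that] that
    by (simp add: agree_upd Reals_isreal del: fun_upd_apply) (simp add: Reals_isreal)
  have 3: "sat (e((d,T1) := X)) (P (V1 d) (Suc d)) \<longleftrightarrow> S X" if "X \<in> Reals" for X
    using denotesD[OF P(1), of "Suc d" "e((d,T1) := X)" "V1 d"] P v[OF that] that
    by (simp add: agree_upd Reals_isreal del: fun_upd_apply) (simp add: Reals_isreal)
  show ?thesis using e by (simp add: represents_def nonneg_fun_def repS_def sat_real_quant 1 2 3 del: fun_upd_apply sat.simps(4))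
qed

lemma sat_open_rep:
  assumes G: "typd TRR G" "below d G" "isfun (ev e G)" and e: "vq e"
  shows "sat e (open_rep G d) \<longleftrightarrow> openF (ev e G)"
proof -
  have t: "t1 (G \<cdot> V1 n)" for n using typd_App G by (simp add: typd_App)
  have v: "vq (e((d,T1) := X))" if "X \<in> Reals" for X
    using e that by (simp add: Reals_vq del: fun_upd_apply)
  have r: "isreal (ap (ev e G) X)" if "X \<in> Reals" for X using G that by (simp add: isfun_def)
  have 1: "sat (e((d,T1) := X)) ((rzero \<le>\<^sub>R G \<cdot> V1 d) (Suc d)) \<longleftrightarrow> 0 \<le> Rl (ap (ev e G) X)" if "X \<in> Reals" for X
    using v[OF that] t G(1,2) r[OF that] rzero_sem[OF v[OF that]]
    by (subst sat_rle) (simp_all del: fun_upd_apply ev.simps, simp_all del: ev.simps add: ev.simps(1,7))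
  have 3: "sat (e((d,T1) := X)) (P (V1 d) (Suc d)) \<longleftrightarrow> S X" if "X \<in> Reals" "denotes d e P S" for X P S
    using denotesD[OF that(2), of "Suc d" "e((d,T1) := X)" "V1 d"] v[OF that(1)] that
    by (simp add: agree_upd Reals_isreal del: fun_upd_apply) (simp add: Reals_isreal)
  have p: "denotes d e (pos_set G) (posS (ev e G))" by (rule denotes_pos_zero(1)[OF G])
  show ?thesis using e
    by (simp add: open_rep_def nonneg_fun_def is_open_set_def openF_def sat_real_quant 1 3[OF _ p]
        3[OF _ denotes_ball[OF p]] del: fun_upd_apply sat.simps(4))
qed

lemma sat_set_exists:
  assumes "denotes d e P S" "vq e"
  shows "sat e (set_exists P d) \<longleftrightarrow> existsS S"
proof -
  have v: "vq (e((d,TRR) := G))" if "G \<in> Dq TRR" for G using assms that by (simp add: vq_upd del: fun_upd_apply)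
  have 1: "sat (e((d,TRR) := G)) (is_real_fun (Var d TRR) (Suc d)) \<longleftrightarrow> isfun G" if "G \<in> Dq TRR" for G
    using v[OF that] by (subst sat_is_real_fun) simp_all
  have 2: "sat (e((d,TRR) := G)) (represents (Var d TRR) P (Suc d)) \<longleftrightarrow> repS G S" if "G \<in> Dq TRR" "isfun G" for G
    using v[OF that(1)] that assms(1)
    by (subst sat_represents[of _ _ _ d e P S]) (simp_all add: agree_upd del: fun_upd_apply, simp_all)
  show ?thesis using 1 2 by (auto simp: set_exists_def existsS_def simp del: fun_upd_apply)
qed

lemma sat_RM_open:
  assumes "denotes d e P S" "vq e"
  shows "sat e (RM_open P d) \<longleftrightarrow> RMopenS S"
proof -
  let ?ab = "\<lambda>A B. e((d,TN \<leadsto> T1) := A, (Suc d,TN \<leadsto> T1) := B)"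
  have main: "sat (?ab A B) (Forall (Suc (Suc d)) TN (And (is_real (Var d (TN \<leadsto> T1) \<cdot> V (Suc (Suc d))) (Suc (Suc (Suc d))))
       (is_real (Var (Suc d) (TN \<leadsto> T1) \<cdot> V (Suc (Suc d))) (Suc (Suc (Suc d)))))) \<longleftrightarrow>
     (\<forall>n. isreal (ap A (no n)) \<and> isreal (ap B (no n)))"
    "(\<forall>n. isreal (ap A (no n)) \<and> isreal (ap B (no n))) \<Longrightarrow>
     sat (?ab A B) (all_real (\<lambda>x. P x \<^bold>\<longleftrightarrow> (\<^bold>\<exists>n. Var d (TN \<leadsto> T1) \<cdot> n <\<^sub>R x \<^bold>\<and> x <\<^sub>R Var (Suc d) (TN \<leadsto> T1) \<cdot> n)) (Suc (Suc d))) \<longleftrightarrow>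
     (\<forall>X\<in>Reals. S X \<longleftrightarrow> (\<exists>n. Rl (ap A (no n)) < Rl X \<and> Rl X < Rl (ap B (no n))))"
    if AB: "A \<in> Dq (TN \<leadsto> T1)" "B \<in> Dq (TN \<leadsto> T1)" for A B
  proof -
    have v: "vq (?ab A B)" using assms(2) AB by (simp add: vq_upd del: fun_upd_apply)
    have t: "t1 (Var m (TN \<leadsto> T1) \<cdot> V k)" for m k by (rule typd_App[of TN]) simp_all
    show "sat (?ab A B) (Forall (Suc (Suc d)) TN (And (is_real (Var d (TN \<leadsto> T1) \<cdot> V (Suc (Suc d))) (Suc (Suc (Suc d))))
       (is_real (Var (Suc d) (TN \<leadsto> T1) \<cdot> V (Suc (Suc d))) (Suc (Suc (Suc d)))))) \<longleftrightarrow>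
     (\<forall>n. isreal (ap A (no n)) \<and> isreal (ap B (no n)))"
      using v t by (simp add: sat_ForallN sat_is_real del: sat.simps(4) fun_upd_apply) simp
    assume ab: "\<forall>n. isreal (ap A (no n)) \<and> isreal (ap B (no n))"
    let ?e = "\<lambda>X n. (?ab A B)((Suc (Suc d),T1) := X, (Suc (Suc (Suc d)),TN) := no n)"
    have v2: "vq ((?ab A B)((Suc (Suc d),T1) := X))" "vq (?e X n)" if "X \<in> Reals" for X n
      using v that by (simp_all add: Reals_vq del: fun_upd_apply)
    have 1: "sat (?e X n) ((Var d (TN \<leadsto> T1) \<cdot> V (Suc (Suc (Suc d))) <\<^sub>R V1 (Suc (Suc d))) (Suc (Suc (Suc (Suc d))))) \<longleftrightarrow> Rl (ap A (no n)) < Rl X"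
      "sat (?e X n) ((V1 (Suc (Suc d)) <\<^sub>R Var (Suc d) (TN \<leadsto> T1) \<cdot> V (Suc (Suc (Suc d)))) (Suc (Suc (Suc (Suc d))))) \<longleftrightarrow> Rl X < Rl (ap B (no n))"
      if "X \<in> Reals" for X n
      using v2[OF that] t that ab by (subst sat_rless; simp add: Reals_isreal)+
    have 2: "sat ((?ab A B)((Suc (Suc d),T1) := X)) (P (V1 (Suc (Suc d))) (Suc (Suc (Suc d)))) \<longleftrightarrow> S X"
      if "X \<in> Reals" for X
      using denotesD[OF assms(1), of "Suc (Suc (Suc d))" "(?ab A B)((Suc (Suc d),T1) := X)" "V1 (Suc (Suc d))"]
        v2[OF that] that by (simp add: agree_upd Reals_isreal del: fun_upd_apply) (simp add: Reals_isreal)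
    show "sat (?ab A B) (all_real (\<lambda>x. P x \<^bold>\<longleftrightarrow> (\<^bold>\<exists>n. Var d (TN \<leadsto> T1) \<cdot> n <\<^sub>R x \<^bold>\<and> x <\<^sub>R Var (Suc d) (TN \<leadsto> T1) \<cdot> n)) (Suc (Suc d))) \<longleftrightarrow>
     (\<forall>X\<in>Reals. S X \<longleftrightarrow> (\<exists>n. Rl (ap A (no n)) < Rl X \<and> Rl X < Rl (ap B (no n))))"
      using v by (simp add: sat_real_quant sat_ExistsN 1 2 del: sat.simps(4) sat_derived(5) fun_upd_apply)
  qed
  show ?thesis unfolding RM_open_def RMopenS_def
    by (simp del: sat.simps(4) fun_upd_apply real_simps add: main(1) cong: conj_cong)
      (use main(2) in blast)
qed

lemma sat_is_inf_dist:
  assumes "t1 x" "below d x" "isreal (ev e x)" "t1 r" "below d r" "isreal (ev e r)" "denotes d e P S" "vq e"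
  shows "sat e (is_inf_dist x P r d) \<longleftrightarrow> infS (ev e x) S (ev e r)"
proof -
  have v: "vq (e((d,T1) := Y))" "vq (e((d,T1) := Z, (Suc d,T1) := Y))" if "Y \<in> Reals" "Z \<in> Reals" for Y Z
    using assms that by (simp_all add: Reals_vq del: fun_upd_apply)
  have P1: "sat (e((d,T1) := Y)) (P (V1 d) (Suc d)) = S Y" if "Y \<in> Reals" for Y
    using denotesD[OF assms(7), of "Suc d" "e((d,T1) := Y)" "V1 d"] v(1)[OF that that] that
    by (simp add: agree_upd Reals_isreal del: fun_upd_apply) (simp add: Reals_isreal)
  have P2: "sat (e((d,T1) := Z, (Suc d,T1) := Y)) (P (V1 (Suc d)) (Suc (Suc d))) = S Y" if "Y \<in> Reals" "Z \<in> Reals" for Y Z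
    using denotesD[OF assms(7), of "Suc (Suc d)" "e((d,T1) := Z, (Suc d,T1) := Y)" "V1 (Suc d)"] v(2)[OF that] that
    by (simp add: agree_upd Reals_isreal del: fun_upd_apply) (simp add: Reals_isreal)
  have D1: "isreal (ev (e((d,T1) := Y)) (rdist x (V1 d))) \<and> Rl (ev (e((d,T1) := Y)) (rdist x (V1 d))) = \<bar>Rl (ev e x) - Rl Y\<bar>"
    if "Y \<in> Reals" for Y
    using rdist_sem[of x "V1 d" "e((d,T1) := Y)"] v(1)[OF that that] that assms
    by (simp add: Reals_isreal del: fun_upd_apply) (simp add: Reals_isreal)
  have D2: "isreal (ev (e((d,T1) := Z, (Suc d,T1) := Y)) (rdist x (V1 (Suc d)))) \<and>
      Rl (ev (e((d,T1) := Z, (Suc d,T1) := Y)) (rdist x (V1 (Suc d)))) = \<bar>Rl (ev e x) - Rl Y\<bar>"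
    if "Y \<in> Reals" "Z \<in> Reals" for Y Z
    using rdist_sem[of x "V1 (Suc d)" "e((d,T1) := Z, (Suc d,T1) := Y)"] v(2)[OF that] that assms
    by (simp add: Reals_isreal del: fun_upd_apply) (simp add: Reals_isreal)
  have 1: "sat (e((d,T1) := Y)) ((r \<le>\<^sub>R rdist x (V1 d)) (Suc d)) \<longleftrightarrow> Rl (ev e r) \<le> \<bar>Rl (ev e x) - Rl Y\<bar>" if "Y \<in> Reals" for Y
    using v(1)[OF that that] D1[OF that] assms by (subst sat_rle) (simp_all del: fun_upd_apply)
  have 2: "sat (e((d,T1) := Z, (Suc d,T1) := Y)) ((V1 d \<le>\<^sub>R rdist x (V1 (Suc d))) (Suc (Suc d))) \<longleftrightarrow> Rl Z \<le> \<bar>Rl (ev e x) - Rl Y\<bar>"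
    if "Y \<in> Reals" "Z \<in> Reals" for Y Z
  proof -
    have z: "ev (e((d,T1) := Z, (Suc d,T1) := Y)) (V1 d) = Z" by simp
    show ?thesis using v(2)[OF that] D2[OF that] assms that Reals_isreal
      by (subst sat_rle) (simp_all add: z del: fun_upd_apply ev.simps)
  qed
  have 3: "sat (e((d,T1) := Z)) ((V1 d \<le>\<^sub>R r) (Suc d)) \<longleftrightarrow> Rl Z \<le> Rl (ev e r)" if "Z \<in> Reals" for Z
  proof -
    have z: "ev (e((d,T1) := Z)) (V1 d) = Z" by simp
    show ?thesis using v(1)[OF that that] assms that Reals_isreal
      by (subst sat_rle) (simp_all add: z del: fun_upd_apply ev.simps)
  qed
  have v1: "vq (e((d,T1) := Y))" if "Y \<in> Reals" for Y using v(1)[OF that that] .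
  show ?thesis using assms(8)
    by (simp add: is_inf_dist_def infS_def sat_real_quant P1 P2 1 2 3 v1 del: sat.simps(4) fun_upd_apply)
qed

lemma sat_exists_two:
  assumes "vq e"
  shows "sat e (exists_two d) \<longleftrightarrow> (\<exists>E\<in>Dq T2. isE E \<and> (\<forall>f\<in>Dq T1. nv (ap E f) = 0 \<or> nv (ap E f) = 1))"
proof -
  let ?ef = "\<lambda>E f. e((d,T2) := E, (Suc d,T1) := f)"
  have v: "vq (?ef E f)" if "E \<in> Dq T2" "f \<in> Dq T1" for E f using assms that by (simp add: vq_upd del: fun_upd_apply)
  have t: "tN (Var d T2 \<cdot> V1 (Suc d))" by simp
  have 1: "sat (?ef E f) (Eq (Var d T2 \<cdot> V1 (Suc d)) Zero) \<longleftrightarrow> nv (ap E f) = 0"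
     "sat (?ef E f) (Eq (Var d T2 \<cdot> V1 (Suc d)) (Succ \<cdot> Zero)) \<longleftrightarrow> nv (ap E f) = 1"
     "sat (?ef E f) (Exists (Suc (Suc d)) TN (Eq (V1 (Suc d) \<cdot> V (Suc (Suc d))) Zero)) \<longleftrightarrow> (\<exists>n. fn f n = 0)"
    if "E \<in> Dq T2" "f \<in> Dq T1" for E f
    using v[OF that] t
    by (simp_all add: sat_Eq evN_def[of _ "Var d T2 \<cdot> _"] sat_ExistsN evN_App hS_eq del: sat.simps sat_derived(5) fun_upd_apply) simp_all
  show ?thesis unfolding exists_two_def isE_def eq0_def d_simps
    by (simp only: sat_derived(2-4) sat_derived(5)[of e d] sat.simps(4) 1 cong: ball_cong bex_cong) blast
qed

end

section \<open>The statements read in the model\<close>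

definition rc :: "hnat \<Rightarrow> tm set" where "rc c = ap (ev e_q rconst_tm) (no c)"
text \<open>The closure of an open set in arithmetical form: both quantifiers are over numbers, and
  \<open>F\<close> is queried only at rational points.\<close>

definition nearS :: "tm set \<Rightarrow> tm set \<Rightarrow> bool" where
  "nearS F X \<longleftrightarrow> (\<forall>k. \<exists>c. \<bar>Rl X - hr (qv c)\<bar> < hr (i2 k) \<and> posS F (rc c))"

context henkin begin

lemma vq_TRR: "vq e \<Longrightarrow> F \<in> Dq TRR \<Longrightarrow> vq (e((n,TRR) := F))"
  by (simp add: vq_upd del: fun_upd_apply)

lemma sat_for_all_open:
  assumes "vq e" "\<And>F. F \<in> Dq TRR \<Longrightarrow> isfun F \<Longrightarrow> denotes 1 (e((0,TRR) := F)) (pos_set (Var 0 TRR)) (posS F) \<Longrightarrow>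
     sat (e((0,TRR) := F)) (Q (pos_set (Var 0 TRR)) 1) \<longleftrightarrow> R F"
  shows "sat e (for_all_open Q 0) \<longleftrightarrow> (\<forall>F\<in>Dq TRR. isfun F \<longrightarrow> openF F \<longrightarrow> R F)"
proof -
  have "sat (e((0,TRR) := F)) (Imp (is_real_fun (Var 0 TRR) (Suc 0)) (Imp (open_rep (Var 0 TRR) (Suc 0)) (Q (pos_set (Var 0 TRR)) (Suc 0))))
     \<longleftrightarrow> (isfun F \<longrightarrow> openF F \<longrightarrow> R F)" if F: "F \<in> Dq TRR" for F
  proof -
    have v: "vq (e((0,TRR) := F))" using vq_TRR assms(1) F by blast
    have 1: "sat (e((0,TRR) := F)) (is_real_fun (Var 0 TRR) (Suc 0)) \<longleftrightarrow> isfun F"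
      by (subst sat_is_real_fun) (use v in simp_all)
    have 2: "sat (e((0,TRR) := F)) (open_rep (Var 0 TRR) (Suc 0)) \<longleftrightarrow> openF F" if "isfun F"
      by (subst sat_open_rep) (use v that in simp_all)
    have 3: "denotes 1 (e((0,TRR) := F)) (pos_set (Var 0 TRR)) (posS F)" if "isfun F"
      using denotes_pos_zero(1)[of "Var 0 TRR" 1 "e((0,TRR) := F)"] that by simp
    show ?thesis using 1 2 assms(2)[OF F _ 3] by (auto simp del: fun_upd_apply)
  qed
  then show ?thesis by (simp add: for_all_open_def del: fun_upd_apply sat.simps(3))
qed

lemma sat_for_all_closed:
  assumes "vq e" "\<And>F. F \<in> Dq TRR \<Longrightarrow> isfun F \<Longrightarrow> denotes 1 (e((0,TRR) := F)) (zero_set (Var 0 TRR)) (zeroS F) \<Longrightarrow>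
     sat (e((0,TRR) := F)) (Q (zero_set (Var 0 TRR)) 1) \<longleftrightarrow> R F"
  shows "sat e (for_all_closed Q 0) \<longleftrightarrow> (\<forall>F\<in>Dq TRR. isfun F \<longrightarrow> openF F \<longrightarrow> R F)"
proof -
  have "sat (e((0,TRR) := F)) (Imp (is_real_fun (Var 0 TRR) (Suc 0)) (Imp (open_rep (Var 0 TRR) (Suc 0)) (Q (zero_set (Var 0 TRR)) (Suc 0))))
     \<longleftrightarrow> (isfun F \<longrightarrow> openF F \<longrightarrow> R F)" if F: "F \<in> Dq TRR" for F
  proof -
    have v: "vq (e((0,TRR) := F))" using vq_TRR assms(1) F by blast
    have 1: "sat (e((0,TRR) := F)) (is_real_fun (Var 0 TRR) (Suc 0)) \<longleftrightarrow> isfun F"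
      by (subst sat_is_real_fun) (use v in simp_all)
    have 2: "sat (e((0,TRR) := F)) (open_rep (Var 0 TRR) (Suc 0)) \<longleftrightarrow> openF F" if "isfun F"
      by (subst sat_open_rep) (use v that in simp_all)
    have 3: "denotes 1 (e((0,TRR) := F)) (zero_set (Var 0 TRR)) (zeroS F)" if "isfun F"
      using denotes_pos_zero(2)[of "Var 0 TRR" 1 "e((0,TRR) := F)"] that by simp
    show ?thesis using 1 2 assms(2)[OF F _ 3] by (auto simp del: fun_upd_apply)
  qed
  then show ?thesis by (simp add: for_all_closed_def del: fun_upd_apply sat.simps(3))
qed

lemma sat_stmt_a: "vq e \<Longrightarrow> sat e (stmt_a 0) \<longleftrightarrow> (\<forall>F\<in>Dq TRR. isfun F \<longrightarrow> openF F \<longrightarrow> existsS (bdS (zeroS F)))"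
  unfolding stmt_a_def
  by (rule sat_for_all_closed) (simp_all add: sat_set_exists[OF denotes_bd] vq_TRR del: fun_upd_apply)

lemma sat_stmt_b: "vq e \<Longrightarrow> sat e (stmt_b 0) \<longleftrightarrow> (\<forall>F\<in>Dq TRR. isfun F \<longrightarrow> openF F \<longrightarrow> existsS (bdS (posS F)))"
  unfolding stmt_b_def
  by (rule sat_for_all_open) (simp_all add: sat_set_exists[OF denotes_bd] vq_TRR del: fun_upd_apply)

lemma sat_stmt_d: "vq e \<Longrightarrow> sat e (stmt_d 0) \<longleftrightarrow> (\<forall>F\<in>Dq TRR. isfun F \<longrightarrow> openF F \<longrightarrow>
    existsS (closS (posS F)) \<and> RMopenS (\<lambda>X. \<not> closS (posS F) X))"
  unfolding stmt_d_def RM_closed_def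
  by (rule sat_for_all_open) (simp_all add: sat_set_exists[OF denotes_clos] sat_RM_open[OF denotes_not[OF denotes_clos]] vq_TRR del: fun_upd_apply)

lemma sat_stmt_e: "vq e \<Longrightarrow> sat e (stmt_e 0) \<longleftrightarrow> (\<forall>F\<in>Dq TRR. isfun F \<longrightarrow> openF F \<longrightarrow>
    existsS (intS (zeroS F)) \<and> RMopenS (intS (zeroS F)))"
  unfolding stmt_e_def
  by (rule sat_for_all_closed) (simp_all add: sat_set_exists[OF denotes_int] sat_RM_open[OF denotes_int] vq_TRR del: fun_upd_apply)

lemma sat_stmt_f: "vq e \<Longrightarrow> sat e (stmt_f 0) \<longleftrightarrow> (\<forall>F\<in>Dq TRR. isfun F \<longrightarrow> openF F \<longrightarrow>
    (\<exists>Y\<in>Reals. posS F Y) \<longrightarrow> (\<exists>D\<in>Dq TRR. isfun D \<and> (\<forall>X\<in>Reals. infS X (posS F) (ap D X))))"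
  unfolding stmt_f_def
proof (rule sat_for_all_open)
  fix F assume ve: "vq e" and F: "F \<in> Dq TRR" "isfun F" and den: "denotes 1 (e((0,TRR) := F)) (pos_set (Var 0 TRR)) (posS F)"
  let ?P = "pos_set (Var 0 TRR)"
  define e1 where "e1 = e((0,TRR) := F)"
  have e1: "vq e1" unfolding e1_def using vq_TRR ve F by blast
  note den = den[folded e1_def]
  have 1: "sat e1 (ex_real ?P 1) \<longleftrightarrow> (\<exists>Y\<in>Reals. posS F Y)"
  proof -
    have "sat (e1((1,T1) := Y)) (?P (V1 1) 2) = posS F Y" if "Y \<in> Reals" for Y
    proof -
      have "vq (e1((1,T1) := Y))" using Reals_vq e1 that by blast
      then show ?thesis using denotesD[OF den, of 2 "e1((1,T1) := Y)" "V1 1"] that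
        by (simp add: agree_upd Reals_isreal del: fun_upd_apply) (simp add: Reals_isreal)
    qed
    then show ?thesis using e1 by (simp add: sat_real_quant numeral_2_eq_2 del: sat_derived(5) fun_upd_apply)
  qed
  have 2: "sat e1 (ex_real_fun (\<lambda>D. \<^bold>\<forall>\<^sub>Rx. is_inf_dist x ?P (D \<cdot> x)) 1) \<longleftrightarrow>
    (\<exists>D\<in>Dq TRR. isfun D \<and> (\<forall>X\<in>Reals. infS X (posS F) (ap D X)))"
  proof -
    have v: "vq (e1((1,TRR) := D))" if "D \<in> Dq TRR" for D using vq_TRR e1 that by blast
    have i: "sat (e1((1,TRR) := D)) (is_real_fun (Var 1 TRR) 2) \<longleftrightarrow> isfun D" if "D \<in> Dq TRR" for D
      by (subst sat_is_real_fun) (use v[OF that] in simp_all)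
    have j: "sat (e1((1,TRR) := D, (2,T1) := X)) (is_inf_dist (V1 2) ?P (Var 1 TRR \<cdot> V1 2) 3) \<longleftrightarrow> infS X (posS F) (ap D X)"
      if "D \<in> Dq TRR" "isfun D" "X \<in> Reals" for D X
    proof -
      let ?e = "e1((1,TRR) := D, (2,T1) := X)"
      have ve: "vq ?e" using Reals_vq v that by blast
      have ag: "agree 1 ?e e1" by (auto simp: agree_def)
      have "denotes 3 ?e ?P (posS F)" unfolding denotes_def
      proof (intro allI impI)
        fix d e' x assume h: "3 \<le> d" "vq e'" "agree 3 e' ?e" "t1 x" "below d x" "isreal (ev e' x)"
        have "agree 1 e' e1" using agree_trans[OF agree_mono[OF h(3)] ag] by simp
        then show "sat e' (?P x d) = posS F (ev e' x)" using denotesD[OF den] h by simp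
      qed
      moreover have "t1 (Var 1 TRR \<cdot> V1 2)" by (rule typd_App[of T1]) simp_all
      moreover have "isreal (ap D X)" using that by (simp add: isfun_def)
      ultimately show ?thesis using ve that
        by (subst sat_is_inf_dist) (simp_all add: Reals_isreal)
    qed
    have k: "sat (e1((1,TRR) := D)) (all_real (\<lambda>x. is_inf_dist x ?P (Var 1 TRR \<cdot> x)) 2) \<longleftrightarrow> (\<forall>X\<in>Reals. infS X (posS F) (ap D X))"
      if "D \<in> Dq TRR" "isfun D" for D
      using v[OF that(1)] j[OF that] by (simp add: sat_real_quant eval_nat_numeral del: sat.simps(4) fun_upd_apply)
    have n: "Suc 1 = 2" by simp
    show ?thesis unfolding real_simps(4) sat_derived(5)[of e1] sat_derived(2) n
      using i k by (auto simp del: fun_upd_apply real_simps)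
  qed
  show "sat (e((0,TRR) := F)) ((ex_real ?P \<^bold>\<longrightarrow> ex_real_fun (\<lambda>D. \<^bold>\<forall>\<^sub>Rx. is_inf_dist x ?P (D \<cdot> x))) 1) \<longleftrightarrow>
    ((\<exists>Y\<in>Reals. posS F Y) \<longrightarrow> (\<exists>D\<in>Dq TRR. isfun D \<and> (\<forall>X\<in>Reals. infS X (posS F) (ap D X))))"
    using 1 2 unfolding e1_def[symmetric] d_simps(3) sat.simps(3) by simp
qed

lemma sat_stmt_c: "vq e \<Longrightarrow> sat e (stmt_c 0) \<longleftrightarrow> (\<exists>B\<in>Dq (TRR \<leadsto> TRR).
    (\<forall>F\<in>Dq TRR. isfun F \<longrightarrow> isfun (ap B F)) \<and>
    (\<forall>F\<in>Dq TRR. isfun F \<longrightarrow> (\<forall>G\<in>Dq TRR. isfun G \<longrightarrow> (\<forall>X\<in>Reals. Rl (ap F X) = Rl (ap G X)) \<longrightarrow>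
        (\<forall>X\<in>Reals. Rl (ap (ap B F) X) = Rl (ap (ap B G) X)))) \<and>
    (\<forall>F\<in>Dq TRR. isfun F \<longrightarrow> openF F \<longrightarrow> repS (ap B F) (bdS (zeroS F))))"
proof -
  assume ve: "vq e"
  let ?B = "Var 0 (TRR \<leadsto> TRR)"
  let ?e1 = "\<lambda>B F. e((0,TRR \<leadsto> TRR) := B, (1,TRR) := F)"
  let ?e2 = "\<lambda>B F G. (?e1 B F)((2,TRR) := G)"
  have v0: "vq (e((0,TRR \<leadsto> TRR) := B))" if "B \<in> Dq (TRR \<leadsto> TRR)" for B
    using ve that by (simp add: vq_upd del: fun_upd_apply)
  have v1: "vq (?e1 B F)" if "B \<in> Dq (TRR \<leadsto> TRR)" "F \<in> Dq TRR" for B F using v0 vq_TRR that by blast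
  have v2: "vq (?e2 B F G)" if "B \<in> Dq (TRR \<leadsto> TRR)" "F \<in> Dq TRR" "G \<in> Dq TRR" for B F G using v1 vq_TRR that by blast
  have tB: "typd TRR (?B \<cdot> Var n TRR)" for n by (rule typd_App[of TRR]) simp_all
  have f1: "sat (?e1 B F) (is_real_fun (Var 1 TRR) 2) \<longleftrightarrow> isfun F" "sat (?e1 B F) (is_real_fun (?B \<cdot> Var 1 TRR) 2) \<longleftrightarrow> isfun (ap B F)"
    if "B \<in> Dq (TRR \<leadsto> TRR)" "F \<in> Dq TRR" for B F
    by (subst sat_is_real_fun; use v1[OF that] tB in simp)+
  have f2: "sat (?e2 B F G) (is_real_fun (Var 2 TRR) 3) \<longleftrightarrow> isfun G" if "B \<in> Dq (TRR \<leadsto> TRR)" "F \<in> Dq TRR" "G \<in> Dq TRR" for B F G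
    by (subst sat_is_real_fun; use v2[OF that] tB in simp)+
  have eqv: "sat e' (real_fun_eq f g d) \<longleftrightarrow> (\<forall>X\<in>Reals. Rl (ap (ev e' f) X) = Rl (ap (ev e' g) X))"
    if h: "vq e'" "typd TRR f" "typd TRR g" "below d f" "below d g" "isfun (ev e' f)" "isfun (ev e' g)" for e' f g d
  proof -
    have "sat (e'((d,T1) := X)) ((f \<cdot> V1 d =\<^sub>R g \<cdot> V1 d) (Suc d)) \<longleftrightarrow> Rl (ap (ev e' f) X) = Rl (ap (ev e' g) X)"
      if X: "X \<in> Reals" for X
    proof -
      have t: "t1 (f \<cdot> V1 d)" "t1 (g \<cdot> V1 d)" using typd_App[of T1 T1] \<open>typd TRR f\<close> \<open>typd TRR g\<close> by simp_all
      have ee: "ev (e'((d,T1) := X)) (f \<cdot> V1 d) = ap (ev e' f) X" "ev (e'((d,T1) := X)) (g \<cdot> V1 d) = ap (ev e' g) X"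
        using h by simp_all
      have rr: "isreal (ap (ev e' f) X)" "isreal (ap (ev e' g) X)" using h X by (simp_all add: isfun_def)
      show ?thesis using t ee rr h Reals_vq[OF \<open>vq e'\<close> X]
        by (subst sat_req) (simp_all del: ev.simps fun_upd_apply)
    qed
    then show ?thesis using that(1) by (simp add: real_fun_eq_def sat_real_quant del: sat.simps(4) fun_upd_apply)
  qed
  have g1: "sat (?e2 B F G) (real_fun_eq (Var 1 TRR) (Var 2 TRR) 3) \<longleftrightarrow> (\<forall>X\<in>Reals. Rl (ap F X) = Rl (ap G X))"
    if "B \<in> Dq (TRR \<leadsto> TRR)" "F \<in> Dq TRR" "G \<in> Dq TRR" "isfun F" "isfun G" for B F G
    using v2[OF that(1-3)] that(4,5) by (subst eqv) simp_all
  have g2: "sat (?e2 B F G) (real_fun_eq (?B \<cdot> Var 1 TRR) (?B \<cdot> Var 2 TRR) 3) \<longleftrightarrow> (\<forall>X\<in>Reals. Rl (ap (ap B F) X) = Rl (ap (ap B G) X))"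
    if "B \<in> Dq (TRR \<leadsto> TRR)" "F \<in> Dq TRR" "G \<in> Dq TRR" "isfun (ap B F)" "isfun (ap B G)" for B F G
    using v2[OF that(1-3)] tB that(4,5) by (subst eqv) simp_all
  have o: "sat (?e1 B F) (open_rep (Var 1 TRR) 2) \<longleftrightarrow> openF F"
    if "B \<in> Dq (TRR \<leadsto> TRR)" "F \<in> Dq TRR" "isfun F" for B F
    using v1[OF that(1,2)] that(3) by (subst sat_open_rep) simp_all
  have r: "sat (?e1 B F) (represents (?B \<cdot> Var 1 TRR) (boundary_set (zero_set (Var 1 TRR))) 2) \<longleftrightarrow> repS (ap B F) (bdS (zeroS F))"
    if "B \<in> Dq (TRR \<leadsto> TRR)" "F \<in> Dq TRR" "isfun F" "isfun (ap B F)" for B F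
  proof -
    have "denotes 2 (?e1 B F) (zero_set (Var 1 TRR)) (zeroS F)"
      using denotes_pos_zero(2)[of "Var 1 TRR" 2 "?e1 B F"] that by simp
    from denotes_bd[OF this] show ?thesis using v1[OF that(1,2)] tB that(4)
      by (subst sat_represents[where ?d0.0=2 and ?e0.0="?e1 B F"]) simp_all
  qed
  have n: "Suc 0 = 1" "Suc 1 = 2" "Suc 2 = 3" by simp_all
  have i: "sat (e((0,TRR \<leadsto> TRR) := B)) (is_real_functional ?B 1) \<longleftrightarrow> (\<forall>F\<in>Dq TRR. isfun F \<longrightarrow> isfun (ap B F)) \<and>
    (\<forall>F\<in>Dq TRR. isfun F \<longrightarrow> (\<forall>G\<in>Dq TRR. isfun G \<longrightarrow> (\<forall>X\<in>Reals. Rl (ap F X) = Rl (ap G X)) \<longrightarrow>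
        (\<forall>X\<in>Reals. Rl (ap (ap B F) X) = Rl (ap (ap B G) X))))"
    if B: "B \<in> Dq (TRR \<leadsto> TRR)" for B
    unfolding is_real_functional_def d_simps real_simps sat_derived(2) sat.simps(3,4) n
    apply (rule conj_cong)
     apply (intro ball_cong refl imp_cong; simp only: f1[OF B])
    apply (intro ball_cong refl imp_cong)
       apply (simp_all only: f1[OF B] f2[OF B] g1[OF B] g2[OF B])
    done
  have r': "sat (e((0,TRR \<leadsto> TRR) := B)) (all_real_fun (\<lambda>F. open_rep F \<^bold>\<longrightarrow> represents (?B \<cdot> F) (boundary_set (zero_set F))) 1) \<longleftrightarrow>
    (\<forall>F\<in>Dq TRR. isfun F \<longrightarrow> openF F \<longrightarrow> repS (ap B F) (bdS (zeroS F)))"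
    if B: "B \<in> Dq (TRR \<leadsto> TRR)" and "\<forall>F\<in>Dq TRR. isfun F \<longrightarrow> isfun (ap B F)" for B
    unfolding d_simps real_simps sat.simps(3,4) n
    apply (intro ball_cong refl imp_cong)
      apply (simp_all only: f1(1)[OF B] o[OF B] r[OF B] that(2)[rule_format])
    done
  show ?thesis unfolding stmt_c_def d_simps sat_derived(2,5) n
    apply (intro bex_cong refl, subst i, assumption, unfold conj_assoc)
    apply (intro conj_cong refl, rule r'[unfolded d_simps], assumption+)
    done
qed

subsection \<open>Open sets are determined by their rational points\<close>

lemma ev_rconst: "tN t \<Longrightarrow> vq e \<Longrightarrow> ev e (rconst t) = rc (evN e t)"
  using ev_cong[of rconst_tm e e_q] by (simp add: rc_def tN_ev)

lemma rc_real: "rc c \<in> Reals" "Rl (rc c) = hr (qv c)"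
proof -
  have v: "vq (e_q((0,TN) := no c))" by simp
  have r: "rc c = ev (e_q((0,TN) := no c)) (rconst (V 0))" by (subst ev_rconst) simp_all
  show "Rl (rc c) = hr (qv c)" unfolding r by (subst real_rconst(2)) simp_all
  show "rc c \<in> Reals" unfolding r Reals_def using real_rconst(1)[OF _ v, of "V 0"] typd_Dq[OF _ v, of T1 "rconst (V 0)"]
    by simp
qed

lemma rational_approx: "X \<in> Reals \<Longrightarrow> 0 < r \<Longrightarrow> \<exists>c. \<bar>Rl X - hr (qv c)\<bar> < r"
proof -
  assume a: "X \<in> Reals" "0 < r"
  obtain n where n: "hr (i2 n) < r" using hreal_arch a by blast
  have "\<bar>Rl X - hr (qv (fn X n))\<bar> \<le> hr (i2 n)" using Rl_approx[of X n] a by (simp add: Reals_def seq_def)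
  then show ?thesis using n le_less_trans by blast
qed

text \<open>A ball around \<open>Y\<close> lies in the set. A rational closer to \<open>Y\<close>
  than its radius, and than the distance still left to \<open>r\<close>, belongs to the set and
  keeps the bound from \<open>X\<close>.\<close>

lemma open_dense:
  assumes F: "isfun F" "openF F" and Y: "X \<in> Reals" "Y \<in> Reals" "posS F Y" "\<bar>Rl X - Rl Y\<bar> < r"
  shows "\<exists>c. posS F (rc c) \<and> \<bar>Rl X - hr (qv c)\<bar> < r"
proof -
  obtain j where j: "\<forall>Z\<in>Reals. \<bar>Rl Y - Rl Z\<bar> < hr (i2 j) \<longrightarrow> posS F Z" using F Y by (auto simp: openF_def ballS_def)
  define s where "s = min (r - \<bar>Rl X - Rl Y\<bar>) (hr (i2 j))"
  have "0 < s" using Y by (simp add: s_def)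
  then obtain c where c: "\<bar>Rl Y - hr (qv c)\<bar> < s" using rational_approx Y by blast
  then have "posS F (rc c)" using j rc_real[of c] by (auto simp: s_def)
  moreover have "\<bar>Rl X - hr (qv c)\<bar> < r"
    using c abs_triangle_ineq[of "Rl X - Rl Y" "Rl Y - hr (qv c)"] unfolding s_def by simp
  ultimately show ?thesis by blast
qed

lemma posS_cong: "isfun F \<Longrightarrow> X \<in> Reals \<Longrightarrow> Y \<in> Reals \<Longrightarrow> Rl X = Rl Y \<Longrightarrow> posS F X = posS F Y"
  unfolding isfun_def posS_def by metis

text \<open>Points of the set are found at rationals by \<open>open_dense\<close>. Conversely, if
  \<open>X\<close> is outside the set, the rational points near it are different reals since
  \<open>F\<close> respects equality, so they make \<open>X\<close> a limit point.\<close>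

lemma clos_iff:
  assumes F: "isfun F" "openF F" "X \<in> Reals" shows "closS (posS F) X \<longleftrightarrow> nearS F X"
proof
  assume c: "closS (posS F) X"
  show "nearS F X" unfolding nearS_def
  proof
    fix k
    have "\<exists>Y\<in>Reals. \<bar>Rl X - Rl Y\<bar> < hr (i2 k) \<and> posS F Y"
      using c F(3) unfolding closS_def limptS_def by (cases "posS F X") (auto intro: bexI[of _ X])
    then show "\<exists>c. \<bar>Rl X - hr (qv c)\<bar> < hr (i2 k) \<and> posS F (rc c)" using open_dense F by blast
  qed
next
  assume n: "nearS F X"
  show "closS (posS F) X" unfolding closS_def
  proof (intro disjCI)
    assume l: "\<not> limptS (posS F) X"
    show "posS F X"
    proof (rule ccontr)
      assume np: "\<not> posS F X"
      have "limptS (posS F) X" unfolding limptS_def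
      proof
        fix k
        obtain c where c: "\<bar>Rl X - hr (qv c)\<bar> < hr (i2 k)" "posS F (rc c)" using n by (auto simp: nearS_def)
        then have "Rl (rc c) \<noteq> Rl X" using posS_cong[OF F(1) rc_real(1) F(3)] np by blast
        then show "\<exists>Y\<in>Reals. \<bar>Rl X - Rl Y\<bar> < hr (i2 k) \<and> Rl Y \<noteq> Rl X \<and> posS F Y"
          using c rc_real by (intro bexI[of _ "rc c"]) auto
      qed
      then show False using l by blast
    qed
  qed
qed

lemma zeroS_iff: "openF F \<Longrightarrow> X \<in> Reals \<Longrightarrow> zeroS F X \<longleftrightarrow> \<not> posS F X"
  unfolding openF_def zeroS_def posS_def by force

text \<open>The interior of the complement is the complement of the closure. If no rational near
  \<open>X\<close> is in the open set, then by \<open>open_dense\<close> no point near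
  \<open>X\<close> is.\<close>

lemma int_zero_iff:
  assumes F: "isfun F" "openF F" "X \<in> Reals" shows "intS (zeroS F) X \<longleftrightarrow> \<not> nearS F X"
proof
  assume "intS (zeroS F) X"
  then obtain k where k: "\<forall>Y\<in>Reals. \<bar>Rl X - Rl Y\<bar> < hr (i2 k) \<longrightarrow> zeroS F Y" by (auto simp: intS_def ballS_def)
  show "\<not> nearS F X"
  proof
    assume "nearS F X"
    then obtain c where "\<bar>Rl X - hr (qv c)\<bar> < hr (i2 k)" "posS F (rc c)" by (auto simp: nearS_def)
    then show False using k rc_real[of c] zeroS_iff F by metis
  qed
next
  assume "\<not> nearS F X"
  then obtain k where k: "\<And>c. \<bar>Rl X - hr (qv c)\<bar> < hr (i2 k) \<Longrightarrow> \<not> posS F (rc c)" by (auto simp: nearS_def)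
  have b: "zeroS F Y" if "Y \<in> Reals" "\<bar>Rl X - Rl Y\<bar> < hr (i2 k)" for Y
    using zeroS_iff[OF F(2) that(1)] open_dense[OF F that(1) _ that(2)] k by blast
  then show "intS (zeroS F) X" using F(3) by (auto simp: intS_def ballS_def)
qed

text \<open>An open set and its complement have the same boundary, the closure of the open set minus
  the set. On one side the interior of the open set is the set itself, on the other the closed set
  contains its limit points.\<close>

lemma bd_iff:
  assumes F: "isfun F" "openF F" "X \<in> Reals"
  shows "bdS (posS F) X \<longleftrightarrow> nearS F X \<and> \<not> posS F X" "bdS (zeroS F) X \<longleftrightarrow> nearS F X \<and> \<not> posS F X"
proof -
  show "bdS (posS F) X \<longleftrightarrow> nearS F X \<and> \<not> posS F X"
    using clos_iff[OF F] F by (auto simp: bdS_def intS_def openF_def)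
  have "closS (zeroS F) X \<longleftrightarrow> zeroS F X"
  proof
    assume c: "closS (zeroS F) X"
    show "zeroS F X"
    proof (rule ccontr)
      assume "\<not> zeroS F X"
      then have p: "posS F X" "limptS (zeroS F) X" using zeroS_iff F c by (auto simp: closS_def)
      then obtain k where k: "\<forall>Y\<in>Reals. \<bar>Rl X - Rl Y\<bar> < hr (i2 k) \<longrightarrow> posS F Y"
        using F by (auto simp: openF_def ballS_def)
      obtain Y where "Y \<in> Reals" "\<bar>Rl X - Rl Y\<bar> < hr (i2 k)" "zeroS F Y" using p by (auto simp: limptS_def)
      then show False using k zeroS_iff F by blast
    qed
  qed (simp add: closS_def)
  then show "bdS (zeroS F) X \<longleftrightarrow> nearS F X \<and> \<not> posS F X"
    using int_zero_iff[OF F] zeroS_iff F by (auto simp: bdS_def)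
qed

end

subsection \<open>Arithmetical comprehension\<close>

text \<open>Value 0 means truth. For a universal formula the abstraction has a zero exactly at a
  counterexample, so \<open>E\<close> returns 0 if there is one, and the outer subtraction inverts
  the answer.\<close>

primrec char_tm :: "tm \<Rightarrow> fm \<Rightarrow> tm" where
  "char_tm E Bot = Succ \<cdot> Zero"
| "char_tm E (Eq s t) = (s \<^bold>- t) \<^bold>+ (t \<^bold>- s)"
| "char_tm E (Imp \<phi> \<psi>) = (Succ \<cdot> Zero \<^bold>- char_tm E \<phi>) \<^bold>* char_tm E \<psi>"
| "char_tm E (Forall n \<sigma> \<phi>) = Succ \<cdot> Zero \<^bold>- E \<cdot> lamN n (Succ \<cdot> Zero \<^bold>- char_tm E \<phi>)"

text \<open>The bound falls by three at a quantifier because \<open>char_tm\<close> turns it into an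
  abstraction. The floor 30 covers the arithmetical terms that \<open>char_tm\<close> adds, of which
  multiplication needs 27.\<close>

primrec arith :: "fm \<Rightarrow> nat \<Rightarrow> bool" where
  "arith Bot k \<longleftrightarrow> 30 \<le> k"
| "arith (Eq s t) k \<longleftrightarrow> 30 \<le> k \<and> well_typed s \<and> well_typed t \<and> ty_of s = TN \<and> ty_of t = TN \<and> bnd k s \<and> bnd k t"
| "arith (Imp \<phi> \<psi>) k \<longleftrightarrow> arith \<phi> k \<and> arith \<psi> k"
| "arith (Forall n \<sigma> \<phi>) k \<longleftrightarrow> \<sigma> = TN \<and> 3 \<le> k \<and> arith \<phi> (k - 3)"

lemma arith_derived [simp]:
  "arith (Neg \<phi>) k \<longleftrightarrow> arith \<phi> k \<and> 30 \<le> k" "arith (And \<phi> \<psi>) k \<longleftrightarrow> arith \<phi> k \<and> arith \<psi> k \<and> 30 \<le> k"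
  "arith (Or \<phi> \<psi>) k \<longleftrightarrow> arith \<phi> k \<and> arith \<psi> k \<and> 30 \<le> k"
  "arith (Exists n \<sigma> \<phi>) k \<longleftrightarrow> \<sigma> = TN \<and> 33 \<le> k \<and> arith \<phi> (k - 3)"
  by (auto simp: Neg_def And_def Or_def Exists_def)

lemma arith_ge: "arith \<phi> k \<Longrightarrow> 30 \<le> k"
  by (induction \<phi> arbitrary: k) force+

lemma char_typed:
  "arith \<phi> k \<Longrightarrow> well_typed (char_tm (Var m T2) \<phi>) \<and> ty_of (char_tm (Var m T2) \<phi>) = TN \<and> bnd k (char_tm (Var m T2) \<phi>)"
proof (induction \<phi> arbitrary: k)
  case (Imp \<phi> \<psi>)
  then show ?case using Imp.IH(1)[of k] Imp.IH(2)[of k] arith_ge[of \<phi> k] by simp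
next
  case (Forall n \<sigma> \<phi>)
  then show ?case using Forall.IH[of "k - 3"] arith_ge[of \<phi> "k - 3"] by simp
qed simp_all

text \<open>With a characteristic term for \<open>t\<close>, this codes the rational 1 for truth and
  0 for falsity; the constant sequence of that rational is the value of a representation
  function.\<close>

definition code_tm :: "tm \<Rightarrow> tm" where "code_tm t = npair (npair (Succ \<cdot> Zero \<^bold>- t) Zero) Zero"

definition ind_tm :: "fm \<Rightarrow> tm" where
  "ind_tm \<phi> = lam 1 T1 (rconst (code_tm (char_tm (Var 2 T2) \<phi>)))"

text \<open>In the formulas below variable \<open>0\<close> is the representing function, variable \<open>1\<close> the real
  number and variable \<open>2\<close> the functional deciding number quantifiers; bound names start at \<open>10\<close>.\<close>

definition near_fm :: fm where
  "near_fm = (\<^bold>\<forall>k. \<^bold>\<exists>q. in_ball (V1 1) (rinvpow2 k) (rconst q) \<^bold>\<and> pos_set (Var 0 TRR) (rconst q)) 10"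
definition bd_fm :: fm where "bd_fm = And near_fm (Neg (pos_set (Var 0 TRR) (V1 1) 10))"
text \<open>Variable 3 codes the pair of endpoints of a rational interval; the intervals that pass
  this test will exhaust the exterior of the open set.\<close>

definition free_fm :: fm where
  "free_fm = (\<^bold>\<forall>q. qless (nfst (V 3)) q \<^bold>\<and> qless q (nsnd (V 3)) \<^bold>\<longrightarrow> (\<^bold>\<not> pos_set (Var 0 TRR) (rconst q))) 10"

lemmas pred_defs = in_ball_def pos_set_def rless_def rle_def qle_def qless_def le_nat_def less_nat_def eq0_def
  rdist_def qzero_def qinvpow2_def qtwice_invpow2_def

lemma arith_fms: "arith near_fm 200" "arith bd_fm 200" "arith free_fm 200"
  by (simp_all add: near_fm_def bd_fm_def free_fm_def pred_defs)

section \<open>Characteristic terms and indicator functions\<close>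

context henkin begin

lemma tN_char: "arith \<phi> k \<Longrightarrow> k \<le> 250 \<Longrightarrow> tN (char_tm (Var m T2) \<phi>)"
  using char_typed[of \<phi> k m] bnd_mono[of k _ 250] by (simp add: tN_def)

lemma lamN_Dq: "tN t \<Longrightarrow> vq e \<Longrightarrow> ev e (lamN n t) \<in> Dq T1"
  using ev_Dq[of "lamN n t" e] bnd_mono[of 250 t 296] by (simp add: tN_def)

lemma fn_lam: "tN t \<Longrightarrow> vq e \<Longrightarrow> fn (ev e (lamN n t)) x = evN (e((n,TN) := no x)) t"
  using ev_lam[of t TN e "no x" n] bnd_mono[of 250 t 290] by (simp add: fn_def evN_def tN_def)

text \<open>The alternative of a quantifier-free formula is there for the reversal, where a
  characteristic term is needed before any \<open>E\<close> as in \<open>isE\<close> is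
  available.\<close>

lemma sat_char:
  "arith \<phi> k \<Longrightarrow> k \<le> 250 \<Longrightarrow> vq e \<Longrightarrow> isE (e (m,T2)) \<or> quantifier_free \<phi> \<Longrightarrow>
   sat e \<phi> \<longleftrightarrow> evN e (char_tm (Var m T2) \<phi>) = 0"
proof (induction \<phi> arbitrary: k e)
  case Bot then show ?case by (simp add: hS_eq)
next
  case (Eq s t)
  have "tN s" "tN t" using Eq bnd_mono[of k _ 250] by (auto simp: tN_def)
  then have "sat e (Eq s t) \<longleftrightarrow> evN e s = evN e t" using Eq by (simp add: sat_Eq del: sat.simps)
  also have "\<dots> \<longleftrightarrow> (evN e s - evN e t) + (evN e t - evN e s) = 0" by (auto intro: order.antisym)
  finally show ?case using \<open>tN s\<close> \<open>tN t\<close> Eq by (simp del: sat.simps hnat_add_eq_0)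
next
  case (Imp a b)
  have "tN (char_tm (Var m T2) a)" "tN (char_tm (Var m T2) b)" using tN_char Imp.prems by auto
  then show ?case using Imp by (auto simp: hS_eq)
next
  case (Forall n \<sigma> a)
  let ?t = "Succ \<cdot> Zero \<^bold>- char_tm (Var m T2) a"
  have a: "arith a (k - 3)" "k - 3 \<le> 247" "\<sigma> = TN" "30 \<le> k - 3" using Forall.prems arith_ge[of a "k - 3"] by auto
  have t: "tN (char_tm (Var m T2) a)" using tN_char[OF a(1)] a by simp
  then have t': "tN ?t" by simp
  have "bnd 247 ?t" using char_typed[OF a(1), of m] bnd_mono[of "k - 3" _ 247] a by simp
  then have tE: "tN (Var m T2 \<cdot> lamN n ?t)" using t' by (simp add: tN_def)
  have E: "isE (e (m,T2))" using Forall.prems by simp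
  have v: "vq (e((n,TN) := no x))" for x using Forall.prems by simp
  have "sat (e((n,TN) := no x)) a \<longleftrightarrow> evN (e((n,TN) := no x)) (char_tm (Var m T2) a) = 0" for x
  proof (rule Forall.IH[OF a(1) _ v])
    show "k - 3 \<le> 250" "isE ((e((n,TN) := no x)) (m,T2)) \<or> quantifier_free a" using a E by simp_all
  qed
  moreover have "evN e (Var m T2 \<cdot> lamN n ?t) = nv (ap (e (m,T2)) (ev e (lamN n ?t)))" by (simp add: evN_def)
  moreover have "nv (ap (e (m,T2)) (ev e (lamN n ?t))) = 0 \<longleftrightarrow> (\<exists>x. evN (e((n,TN) := no x)) ?t = 0)"
    using E lamN_Dq[OF t'] fn_lam[OF t'] Forall.prems by (simp add: isE_def del: evN_ops)
  ultimately show ?case using t tE v Forall.prems by (simp add: a Dq_TN_all hS_eq del: fun_upd_apply)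
qed

lemma ind_typed: "arith \<phi> 200 \<Longrightarrow> typd TRR (ind_tm \<phi>) \<and> bnd 240 (ind_tm \<phi>)"
  using char_typed[of \<phi> 200 2] bnd_mono[of 200 "char_tm (Var 2 T2) \<phi>" 247] bnd_mono[of 200 "char_tm (Var 2 T2) \<phi>" 237]
  by (simp add: ind_tm_def typd_def code_tm_def)

lemma ind_sem:
  assumes a: "arith \<phi> 200" and e: "vq e" "isE (e (2,T2))" and X: "X \<in> Reals"
  shows "isreal (ap (ev e (ind_tm \<phi>)) X)" "Rl (ap (ev e (ind_tm \<phi>)) X) = (if sat (e((1,T1) := X)) \<phi> then 1 else 0)"
proof -
  let ?e = "e((1,T1) := X)"
  have v: "vq ?e" using Reals_vq e X by blast
  have t: "tN (char_tm (Var 2 T2) \<phi>)" using tN_char a by simp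
  then have c: "tN (code_tm (char_tm (Var 2 T2) \<phi>))" by (simp add: code_tm_def)
  have "X \<in> Dq T1" using X by (simp add: Reals_def)
  then have "ap (ev e (ind_tm \<phi>)) X = ev ?e (rconst (code_tm (char_tm (Var 2 T2) \<phi>)))"
    unfolding ind_tm_def using c e bnd_mono[of 250 _ 290] by (subst ev_lam) (simp_all add: tN_def)
  also have "\<dots> = rc (evN ?e (code_tm (char_tm (Var 2 T2) \<phi>)))" using ev_rconst[OF c v] .
  finally have g: "ap (ev e (ind_tm \<phi>)) X = rc (evN ?e (code_tm (char_tm (Var 2 T2) \<phi>)))" .
  show "isreal (ap (ev e (ind_tm \<phi>)) X)" unfolding g using rc_real Reals_isreal by blast
  have "sat ?e \<phi> \<longleftrightarrow> evN ?e (char_tm (Var 2 T2) \<phi>) = 0" using sat_char[OF a _ v, of 2] e by simp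
  moreover have "1 - x = (if x = 0 then 1 else 0)" for x :: hnat by simp
  ultimately show "Rl (ap (ev e (ind_tm \<phi>)) X) = (if sat ?e \<phi> then 1 else 0)"
    unfolding g rc_real(2) using t v by (simp add: code_tm_def qv_pair hS_eq)
qed

text \<open>An indicator always takes the real values 0 and 1; it is a function on the reals because
  \<open>S\<close> does not distinguish equal reals.\<close>

lemma ind_rep:
  assumes a: "arith \<phi> 200" and e: "vq e" "isE (e (2,T2))"
    and S: "\<And>X. X \<in> Reals \<Longrightarrow> sat (e((1,T1) := X)) \<phi> \<longleftrightarrow> S X"
    and c: "\<And>X Y. X \<in> Reals \<Longrightarrow> Y \<in> Reals \<Longrightarrow> Rl X = Rl Y \<Longrightarrow> S X \<Longrightarrow> S Y"
  shows "ev e (ind_tm \<phi>) \<in> Dq TRR" "isfun (ev e (ind_tm \<phi>))" "repS (ev e (ind_tm \<phi>)) S"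
proof -
  show "ev e (ind_tm \<phi>) \<in> Dq TRR" using ind_typed[OF a] typd_Dq e by blast
  have R: "Rl (ap (ev e (ind_tm \<phi>)) X) = (if S X then 1 else 0)" if "X \<in> Reals" for X
    using ind_sem(2)[OF a e that] S[OF that] by simp
  show "isfun (ev e (ind_tm \<phi>))" unfolding isfun_def using ind_sem(1)[OF a e] R c by (metis (full_types))
  show "repS (ev e (ind_tm \<phi>)) S" unfolding repS_def posS_def using R by simp
qed

lemma sat_pos: "vq e \<Longrightarrow> isfun (e (0,TRR)) \<Longrightarrow> t1 x \<Longrightarrow> below d x \<Longrightarrow> 1 \<le> d \<Longrightarrow> isreal (ev e x) \<Longrightarrow>
   sat e (pos_set (Var 0 TRR) x d) \<longleftrightarrow> posS (e (0,TRR)) (ev e x)"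
  using denotesD[OF denotes_pos_zero(1)[of "Var 0 TRR" 1 e], of d e x] by simp

lemma sat_near:
  assumes e: "vq e" "isfun (e (0,TRR))" "e (1,T1) \<in> Reals"
  shows "sat e near_fm \<longleftrightarrow> nearS (e (0,TRR)) (e (1,T1))"
proof -
  let ?e = "\<lambda>k c. e((10,TN) := no k, (Suc 10,TN) := no c)"
  have v: "vq (?e k c)" for k c using e by simp
  have r: "ev (?e k c) (rconst (V (Suc 10))) = rc c" "ev (?e k c) (V1 1) = e (1,T1)" for k c
    using ev_rconst[of "V (Suc 10)" "?e k c"] v by simp_all
  have i: "isreal (rc c)" for c using rc_real Reals_isreal by blast
  have 1: "sat (?e k c) (in_ball (V1 1) (rinvpow2 (V 10)) (rconst (V (Suc 10))) (Suc (Suc 10))) \<longleftrightarrow>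
      \<bar>Rl (e (1,T1)) - hr (qv c)\<bar> < hr (i2 k)" for k c
    by (subst sat_in_ball) (use v i r e in \<open>simp_all add: Reals_isreal rc_real del: ev.simps\<close>)
  have 2: "sat (?e k c) (pos_set (Var 0 TRR) (rconst (V (Suc 10))) (Suc (Suc 10))) \<longleftrightarrow> posS (e (0,TRR)) (rc c)" for k c
    by (subst sat_pos) (use v i r e in \<open>simp_all add: Reals_isreal del: ev.simps\<close>)
  show ?thesis unfolding near_fm_def d_simps nearS_def sat_ForallN sat_ExistsN sat_derived(2) 1 2 ..
qed

lemma sat_bd:
  assumes e: "vq e" "isfun (e (0,TRR))" "e (1,T1) \<in> Reals"
  shows "sat e bd_fm \<longleftrightarrow> nearS (e (0,TRR)) (e (1,T1)) \<and> \<not> posS (e (0,TRR)) (e (1,T1))"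
  using sat_near[OF e] sat_pos[of e "V1 1" 10] e by (simp add: bd_fm_def Reals_isreal)

lemma nearS_cong: "Rl X = Rl Y \<Longrightarrow> nearS F X \<Longrightarrow> nearS F Y"
  by (simp add: nearS_def)

definition e_FE :: "tm set \<Rightarrow> tm set \<Rightarrow> qenv" where "e_FE F E = e_q((0,TRR) := F, (2,T2) := E)"

lemma vq_FE: "F \<in> Dq TRR \<Longrightarrow> E \<in> Dq T2 \<Longrightarrow> vq (e_FE F E)"
  by (simp add: e_FE_def vq_upd del: fun_upd_apply)

lemma near_rep:
  assumes F: "F \<in> Dq TRR" "isfun F" and E: "E \<in> Dq T2" "isE E"
  shows "\<exists>G\<in>Dq TRR. isfun G \<and> repS G (nearS F)" "\<exists>G\<in>Dq TRR. isfun G \<and> repS G (\<lambda>X. \<not> nearS F X)"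
proof -
  have v: "vq (e_FE F E)" "isE (e_FE F E (2,T2))" using vq_FE F E by (auto simp: e_FE_def)
  have s: "sat ((e_FE F E)((1,T1) := X)) near_fm \<longleftrightarrow> nearS F X" if X: "X \<in> Reals" for X
    using sat_near[of "(e_FE F E)((1,T1) := X)"] Reals_vq[OF v(1) X] F X by (simp add: e_FE_def)
  note r = ind_rep[OF arith_fms(1) v, of "nearS F", OF s nearS_cong]
  show "\<exists>G\<in>Dq TRR. isfun G \<and> repS G (nearS F)"
    by (intro bexI[of _ "ev (e_FE F E) (ind_tm near_fm)"] conjI r)
  have a: "arith (Neg near_fm) 200" using arith_fms by simp
  have s': "sat ((e_FE F E)((1,T1) := X)) (Neg near_fm) \<longleftrightarrow> \<not> nearS F X" if X: "X \<in> Reals" for X using s[OF X] by simp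
  have c: "\<not> nearS F Y" if "Rl X = Rl Y" "\<not> nearS F X" for X Y using nearS_cong[of Y X F] that by auto
  note r' = ind_rep[OF a v, of "\<lambda>X. \<not> nearS F X", OF s' c]
  show "\<exists>G\<in>Dq TRR. isfun G \<and> repS G (\<lambda>X. \<not> nearS F X)"
    by (intro bexI[of _ "ev (e_FE F E) (ind_tm (Neg near_fm))"] conjI r')
qed

lemma repS_cong: "(\<And>X. X \<in> Reals \<Longrightarrow> S X = S' X) \<Longrightarrow> repS G S = repS G S'"
  by (auto simp: repS_def)

lemma bd_rep:
  assumes F: "F \<in> Dq TRR" "isfun F" and E: "E \<in> Dq T2" "isE E"
  shows "ev (e_FE F E) (ind_tm bd_fm) \<in> Dq TRR" "isfun (ev (e_FE F E) (ind_tm bd_fm))"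
    "repS (ev (e_FE F E) (ind_tm bd_fm)) (\<lambda>X. nearS F X \<and> \<not> posS F X)"
proof -
  have v: "vq (e_FE F E)" "isE (e_FE F E (2,T2))" using vq_FE F E by (auto simp: e_FE_def)
  have s: "sat ((e_FE F E)((1,T1) := X)) bd_fm \<longleftrightarrow> nearS F X \<and> \<not> posS F X" if X: "X \<in> Reals" for X
    using sat_bd[of "(e_FE F E)((1,T1) := X)"] Reals_vq[OF v(1) X] F X by (simp add: e_FE_def)
  have c: "nearS F Y \<and> \<not> posS F Y" if "X \<in> Reals" "Y \<in> Reals" "Rl X = Rl Y" "nearS F X \<and> \<not> posS F X" for X Y
    using that nearS_cong[of X Y F] posS_cong[OF F(2), of X Y] by blast
  note i = ind_rep[OF arith_fms(2) v, of "\<lambda>X. nearS F X \<and> \<not> posS F X"]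
  show "ev (e_FE F E) (ind_tm bd_fm) \<in> Dq TRR" by (rule i(1)) (erule s, erule c, assumption+)
  show "isfun (ev (e_FE F E) (ind_tm bd_fm))" by (rule i(2)) (erule s, erule c, assumption+)
  show "repS (ev (e_FE F E) (ind_tm bd_fm)) (\<lambda>X. nearS F X \<and> \<not> posS F X)"
    by (rule i(3)) (erule s, erule c, assumption+)
qed

lemma bd_exists:
  assumes F: "F \<in> Dq TRR" "isfun F" "openF F" and E: "E \<in> Dq T2" "isE E"
  shows "existsS (bdS (zeroS F))" "existsS (bdS (posS F))"
proof -
  have "repS G (bdS (zeroS F)) = repS G (\<lambda>X. nearS F X \<and> \<not> posS F X)"
    "repS G (bdS (posS F)) = repS G (\<lambda>X. nearS F X \<and> \<not> posS F X)" for G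
    by (rule repS_cong, simp add: bd_iff[OF F(2,3)])+
  then show "existsS (bdS (zeroS F))" "existsS (bdS (posS F))"
    unfolding existsS_def using bd_rep[OF F(1,2) E] by auto
qed

text \<open>The indicator of the boundary is one term in which \<open>F\<close> is a variable, so
  abstracting that variable gives the functional. It respects equality of functions because
  \<open>nearS\<close> and \<open>posS\<close> depend only on the real values of \<open>F\<close> at
  reals.\<close>

lemma bd_functional:
  assumes E: "E \<in> Dq T2" "isE E"
  shows "\<exists>B\<in>Dq (TRR \<leadsto> TRR).
    (\<forall>F\<in>Dq TRR. isfun F \<longrightarrow> isfun (ap B F)) \<and>
    (\<forall>F\<in>Dq TRR. isfun F \<longrightarrow> (\<forall>G\<in>Dq TRR. isfun G \<longrightarrow> (\<forall>X\<in>Reals. Rl (ap F X) = Rl (ap G X)) \<longrightarrow>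
        (\<forall>X\<in>Reals. Rl (ap (ap B F) X) = Rl (ap (ap B G) X)))) \<and>
    (\<forall>F\<in>Dq TRR. isfun F \<longrightarrow> openF F \<longrightarrow> repS (ap B F) (bdS (zeroS F)))"
proof -
  define e where "e = e_q((2,T2) := E)"
  have v: "vq e" using E by (simp add: e_def vq_upd del: fun_upd_apply)
  let ?B = "ev e (lam 0 TRR (ind_tm bd_fm))"
  have it: "well_typed (ind_tm bd_fm)" "ty_of (ind_tm bd_fm) = TRR" "bnd 240 (ind_tm bd_fm)"
    using ind_typed[OF arith_fms(2)] by (auto simp: typd_def)
  have "?B \<in> Dq (TRR \<leadsto> TRR)"
    using ev_Dq[of "lam 0 TRR (ind_tm bd_fm)" e] v it bnd_mono[of 240 _ 296] by simp
  moreover have B: "ap ?B F = ev (e_FE F E) (ind_tm bd_fm)" if F: "F \<in> Dq TRR" for F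
  proof -
    have "e((0,TRR) := F) = e_FE F E" by (simp add: e_def e_FE_def fun_upd_twist)
    then show ?thesis using ev_lam[of "ind_tm bd_fm" TRR e F 0] v it F bnd_mono[of 240 _ 290] by simp
  qed
  moreover have R: "Rl (ap (ap ?B F) X) = (if nearS F X \<and> \<not> posS F X then 1 else 0)" if F: "F \<in> Dq TRR" "isfun F" "X \<in> Reals" for F X
  proof -
    have v: "vq (e_FE F E)" "isE (e_FE F E (2,T2))" using vq_FE F E by (auto simp: e_FE_def)
    have "sat ((e_FE F E)((1,T1) := X)) bd_fm \<longleftrightarrow> nearS F X \<and> \<not> posS F X"
      using sat_bd[of "(e_FE F E)((1,T1) := X)"] Reals_vq[OF v(1)] F by (simp add: e_FE_def)
    then show ?thesis unfolding B[OF F(1)] using ind_sem(2)[OF arith_fms(2) v F(3)] by simp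
  qed
  moreover have "Rl (ap (ap ?B F) X) = Rl (ap (ap ?B G) X)"
    if FG: "F \<in> Dq TRR" "isfun F" "G \<in> Dq TRR" "isfun G" "\<forall>X\<in>Reals. Rl (ap F X) = Rl (ap G X)" "X \<in> Reals" for F G X
  proof -
    have "(nearS F X \<and> \<not> posS F X) = (nearS G X \<and> \<not> posS G X)"
      using FG rc_real(1) by (simp add: nearS_def posS_def)
    then show ?thesis using R[OF FG(1,2,6)] R[OF FG(3,4,6)] by simp
  qed
  moreover have "repS (ap ?B F) (bdS (zeroS F))" if F: "F \<in> Dq TRR" "isfun F" "openF F" for F
    unfolding B[OF F(1)] using bd_rep(3)[OF F(1,2) E] repS_cong[of "bdS (zeroS F)" "\<lambda>X. nearS F X \<and> \<not> posS F X"] bd_iff(2)[OF F(2,3)]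
    by simp
  moreover have "isfun (ap ?B F)" if F: "F \<in> Dq TRR" "isfun F" for F
    unfolding B[OF F(1)] using bd_rep(2)[OF F E] .
  ultimately show ?thesis by (intro bexI[of _ ?B] conjI ballI impI) assumption+
qed

lemma sat_free:
  assumes e: "vq e" "isfun (e (0,TRR))"
  shows "sat e free_fm \<longleftrightarrow> (\<forall>c. qv (hfst (nv (e (3,TN)))) < qv c \<and> qv c < qv (hsnd (nv (e (3,TN)))) \<longrightarrow> \<not> posS (e (0,TRR)) (rc c))"
proof -
  let ?e = "\<lambda>c. e((10,TN) := no c)"
  have v: "vq (?e c)" for c using e by simp
  have r: "ev (?e c) (rconst (V 10)) = rc c" for c using ev_rconst[of "V 10" "?e c"] v by simp
  have i: "isreal (rc c)" for c using rc_real Reals_isreal by blast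
  have 1: "sat (?e c) (pos_set (Var 0 TRR) (rconst (V 10)) (Suc 10)) \<longleftrightarrow> posS (e (0,TRR)) (rc c)" for c
    by (subst sat_pos) (use v i r e in \<open>simp_all add: Reals_isreal del: ev.simps\<close>)
  have 2: "sat (?e c) (qless (nfst (V 3)) (V 10) (Suc 10)) \<longleftrightarrow> qv (hfst (nv (e (3,TN)))) < qv c"
    "sat (?e c) (qless (V 10) (nsnd (V 3)) (Suc 10)) \<longleftrightarrow> qv c < qv (hsnd (nv (e (3,TN))))" for c
    using v by (simp_all add: sat_qless del: fun_upd_apply) simp_all
  show ?thesis unfolding free_fm_def d_simps sat_ForallN sat_derived(1,2) sat.simps(3) 1 2 ..
qed

lemma far_interval:
  assumes X: "X \<in> Reals"
  shows "\<not> nearS F X \<longleftrightarrow> (\<exists>a b. (\<forall>c. qv a < qv c \<and> qv c < qv b \<longrightarrow> \<not> posS F (rc c)) \<and> hr (qv a) < Rl X \<and> Rl X < hr (qv b))"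
proof
  assume "\<not> nearS F X"
  then obtain k where k: "\<And>c. \<bar>Rl X - hr (qv c)\<bar> < hr (i2 k) \<Longrightarrow> \<not> posS F (rc c)" by (auto simp: nearS_def)
  \<comment> \<open>A quarter of the radius: \<open>p\<close> is within \<open>s\<close> of
    \<open>X\<close>, so the interval from \<open>p - 2 * s\<close> to \<open>p + 2 * s\<close>
    contains \<open>X\<close> and stays within \<open>3 * s\<close> of it.\<close>
  define s where "s = i2 (k + 1 + 1)"
  have s: "0 < s" "i2 k = s * 2 * 2" by (simp_all only: s_def i2_pos i2_Suc)
  then have s4: "hr (i2 k) = 4 * hr s" by simp
  define p where "p = seq X (k + 1 + 1)"
  have p: "\<bar>Rl X - hr p\<bar> \<le> hr s" using Rl_approx X by (simp add: Reals_def p_def s_def)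
  obtain a b where ab: "qv a = p - 2 * s" "qv b = p + 2 * s" using qv_surj by metis
  have s0: "0 < hr s" using s by simp
  have X1: "hr (qv a) < Rl X" "Rl X < hr (qv b)" using p s0 unfolding ab abs_le_iff hr_simps hr_mult2 by linarith+
  have "\<not> posS F (rc c)" if c: "qv a < qv c \<and> qv c < qv b" for c
  proof (rule k)
    have "hr (qv a) < hr (qv c)" "hr (qv c) < hr (qv b)" using c by simp_all
    then show "\<bar>Rl X - hr (qv c)\<bar> < hr (i2 k)" 
      using p s0 unfolding s4 ab abs_le_iff abs_less_iff hr_simps hr_mult2 by linarith
  qed
  then show "\<exists>a b. (\<forall>c. qv a < qv c \<and> qv c < qv b \<longrightarrow> \<not> posS F (rc c)) \<and> hr (qv a) < Rl X \<and> Rl X < hr (qv b)"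
    using X1 by blast
next
  assume "\<exists>a b. (\<forall>c. qv a < qv c \<and> qv c < qv b \<longrightarrow> \<not> posS F (rc c)) \<and> hr (qv a) < Rl X \<and> Rl X < hr (qv b)"
  then obtain a b where ab: "\<And>c. qv a < qv c \<Longrightarrow> qv c < qv b \<Longrightarrow> \<not> posS F (rc c)" "hr (qv a) < Rl X" "Rl X < hr (qv b)" by blast
  obtain k where k: "hr (i2 k) < min (Rl X - hr (qv a)) (hr (qv b) - Rl X)" using hreal_arch[of "min (Rl X - hr (qv a)) (hr (qv b) - Rl X)"] ab by auto
  show "\<not> nearS F X"
  proof
    assume "nearS F X"
    then obtain c where c: "\<bar>Rl X - hr (qv c)\<bar> < hr (i2 k)" "posS F (rc c)" by (auto simp: nearS_def)
    have "hr (i2 k) < Rl X - hr (qv a)" "hr (i2 k) < hr (qv b) - Rl X" using k by simp_all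
    then have "hr (qv a) < hr (qv c)" "hr (qv c) < hr (qv b)" using c(1) unfolding abs_less_iff by linarith+
    then show False using ab(1)[of c] c by simp
  qed
qed

text \<open>All pairs of rational codes are enumerated, and \<open>free_fm\<close> selects the
  intervals free of rational points of the open set. By \<open>far_interval\<close> their union is
  the exterior.\<close>

lemma far_RM_open:
  assumes F: "F \<in> Dq TRR" "isfun F" and E: "E \<in> Dq T2" "isE E"
  shows "RMopenS (\<lambda>X. \<not> nearS F X)"
proof -
  define e where "e = e_FE F E"
  have v: "vq e" "isE (e (2,T2))" "e (0,TRR) = F" using vq_FE F E by (auto simp: e_def e_FE_def)
  let ?c = "char_tm (Var 2 T2) free_fm"
  define P where "P n \<longleftrightarrow> (\<forall>c. qv (hfst n) < qv c \<and> qv c < qv (hsnd n) \<longrightarrow> \<not> posS F (rc c))" for n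
  have tc: "tN ?c" using tN_char arith_fms(3) by simp
  have c0: "evN (e((3,TN) := no n)) ?c = 0 \<longleftrightarrow> P n" for n
    using sat_char[OF arith_fms(3), of "e((3,TN) := no n)" 2] sat_free[of "e((3,TN) := no n)"] v F by (simp add: P_def)
  \<comment> \<open>The factor is 1 for a selected pair and 0 otherwise. A rejected pair thus gets
    the code 0 for both endpoints, which is an empty interval.\<close>
  let ?t = "\<lambda>f. (f \<cdot> V 3) \<^bold>* (Succ \<cdot> Zero \<^bold>- ?c)"
  have ap: "ap (ev e (lamN 3 (rconst (?t f)))) (no n) = rc (if P n then g n else 0)"
    if f: "tN (f \<cdot> V 3)" "evN (e((3,TN) := no n)) (f \<cdot> V 3) = g n" for f n g
  proof -
    have t: "tN (?t f)" using f tc by simp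
    have "ap (ev e (lamN 3 (rconst (?t f)))) (no n) = ev (e((3,TN) := no n)) (rconst (?t f))"
      using t v bnd_mono[of 250 _ 290] by (subst ev_lam) (simp_all add: tN_def)
    also have "\<dots> = rc (evN (e((3,TN) := no n)) (?t f))" using t v by (subst ev_rconst) simp_all
    also have "evN (e((3,TN) := no n)) (?t f) = g n * (1 - evN (e((3,TN) := no n)) ?c)"
      using f tc v by (simp add: hS_eq del: fun_upd_apply)
    also have "\<dots> = (if P n then g n else 0)"
    proof -
      have "1 - x = 0" if "x \<noteq> 0" for x :: hnat using that by simp
      then show ?thesis using c0[of n] by auto
    qed
    finally show ?thesis .
  qed
  have D: "ev e (lamN 3 (rconst (?t f))) \<in> Dq (TN \<leadsto> T1)" if "tN (f \<cdot> V 3)" for f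
    using ev_Dq[of "lamN 3 (rconst (?t f))" e] that tc v bnd_mono[of 250 _ 296] by (simp add: tN_def)
  let ?a = "ev e (lamN 3 (rconst (?t fst_tm)))" and ?b = "ev e (lamN 3 (rconst (?t snd_tm)))"
  have a: "ap ?a (no n) = rc (if P n then hfst n else 0)" and b: "ap ?b (no n) = rc (if P n then hsnd n else 0)" for n
    using v by (subst ap[where g=hfst]; simp)(use v in \<open>subst ap[where g=hsnd]; simp\<close>)
  show ?thesis unfolding RMopenS_def
  proof (rule bexI[of _ ?a], rule bexI[of _ ?b], intro conjI allI ballI)
    show "?a \<in> Dq (TN \<leadsto> T1)" "?b \<in> Dq (TN \<leadsto> T1)" by (rule D, simp)+
    show "isreal (ap ?a (no n))" "isreal (ap ?b (no n))" for n unfolding a b using rc_real Reals_isreal by blast+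
    fix X assume X: "X \<in> Reals"
    show "(\<not> nearS F X) \<longleftrightarrow> (\<exists>n. Rl (ap ?a (no n)) < Rl X \<and> Rl X < Rl (ap ?b (no n)))"
      unfolding far_interval[OF X] a b rc_real(2)
    proof
      assume "\<exists>a b. (\<forall>c. qv a < qv c \<and> qv c < qv b \<longrightarrow> \<not> posS F (rc c)) \<and> hr (qv a) < Rl X \<and> Rl X < hr (qv b)"
      then obtain a b where "P (hpair a b)" "hr (qv a) < Rl X" "Rl X < hr (qv b)" by (auto simp: P_def)
      then show "\<exists>n. hr (qv (if P n then hfst n else 0)) < Rl X \<and> Rl X < hr (qv (if P n then hsnd n else 0))"
        by (intro exI[of _ "hpair a b"]) simp
    next
      assume "\<exists>n. hr (qv (if P n then hfst n else 0)) < Rl X \<and> Rl X < hr (qv (if P n then hsnd n else 0))"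
      then obtain n where n: "hr (qv (if P n then hfst n else 0)) < Rl X \<and> Rl X < hr (qv (if P n then hsnd n else 0))" by blast
      then have "P n" by (cases "P n") auto
      then show "\<exists>a b. (\<forall>c. qv a < qv c \<and> qv c < qv b \<longrightarrow> \<not> posS F (rc c)) \<and> hr (qv a) < Rl X \<and> Rl X < hr (qv b)"
        using n by (auto simp: P_def)
    qed
  qed
qed

lemma RMopenS_cong: "(\<And>X. X \<in> Reals \<Longrightarrow> S X = S' X) \<Longrightarrow> RMopenS S = RMopenS S'"
  by (auto simp: RMopenS_def)

lemma clos_exists:
  assumes F: "F \<in> Dq TRR" "isfun F" "openF F" and E: "E \<in> Dq T2" "isE E"
  shows "existsS (closS (posS F)) \<and> RMopenS (\<lambda>X. \<not> closS (posS F) X)"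
    "existsS (intS (zeroS F)) \<and> RMopenS (intS (zeroS F))"
proof -
  have "existsS (closS (posS F))" unfolding existsS_def
    using near_rep(1)[OF F(1,2) E] repS_cong[of "closS (posS F)" "nearS F"] clos_iff[OF F(2,3)] by simp
  moreover have "RMopenS (\<lambda>X. \<not> closS (posS F) X)"
    using far_RM_open[OF F(1,2) E] RMopenS_cong[of "\<lambda>X. \<not> closS (posS F) X" "\<lambda>X. \<not> nearS F X"] clos_iff[OF F(2,3)] by simp
  ultimately show "existsS (closS (posS F)) \<and> RMopenS (\<lambda>X. \<not> closS (posS F) X)" ..
  have "existsS (intS (zeroS F))" unfolding existsS_def
    using near_rep(2)[OF F(1,2) E] repS_cong[of "intS (zeroS F)" "\<lambda>X. \<not> nearS F X"] int_zero_iff[OF F(2,3)] by simp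
  moreover have "RMopenS (intS (zeroS F))"
    using far_RM_open[OF F(1,2) E] RMopenS_cong[of "intS (zeroS F)" "\<lambda>X. \<not> nearS F X"] int_zero_iff[OF F(2,3)] by simp
  ultimately show "existsS (intS (zeroS F)) \<and> RMopenS (intS (zeroS F))" ..
qed

end

subsection \<open>The distance function\<close>

text \<open>The rational \<open>m * 2^-(n+2)\<close>, where \<open>n\<close> is variable 3. The grid
  is finer than the accuracy \<open>2^-n\<close> asked of a real, which leaves slack for the rate of
  convergence.\<close>

definition dist_code :: "tm \<Rightarrow> tm" where
  "dist_code m = npair (npair m Zero) (npred (pow2_tm \<cdot> (Succ \<cdot> (Succ \<cdot> V 3))))"

definition close_fm :: "tm \<Rightarrow> fm" where
  "close_fm m = (\<^bold>\<exists>q. pos_set (Var 0 TRR) (rconst q) \<^bold>\<and> rdist (V1 1) (rconst q) <\<^sub>R rconst (dist_code m)) 10"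

text \<open>Locates the distance on the grid: no rational point of the set is closer than
  \<open>V 4\<close> steps, and some is closer than one step more.\<close>

definition step_fm :: fm where "step_fm = And (close_fm (Succ \<cdot> V 4)) (Neg (close_fm (V 4)))"

lemma arith_close: "arith (close_fm (V 4)) 200" "arith step_fm 200"
  by (simp_all add: step_fm_def close_fm_def dist_code_def pred_defs)

text \<open>Variable \<open>5\<close> is a functional that finds a zero of a number function whenever there is one.\<close>

definition dist_tm :: tm where
  "dist_tm = lam 1 T1 (lamN 3 (dist_code (Var 5 T2 \<cdot> lamN 4 (char_tm (Var 2 T2) step_fm))))"

text \<open>The search operator \<mu> of type two; any zero will do, not necessarily the
  least.\<close>

definition isMu :: "tm set \<Rightarrow> bool" where
  "isMu M \<longleftrightarrow> (\<forall>f\<in>Dq T1. (\<exists>n. fn f n = 0) \<longrightarrow> fn f (nv (ap M f)) = 0)"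

context henkin begin

text \<open>With \<open>E\<close> as a parameter, "if \<open>E f\<close> is 0 then
  \<open>f n\<close> is 0" is quantifier-free, and for each \<open>f\<close> some \<open>n\<close>
  satisfies it. A choice functional from \<open>QF_AC_1_0\<close> is therefore a search
  operator.\<close>

lemma mu_exists:
  assumes E: "E \<in> Dq T2" "isE E" shows "\<exists>M\<in>Dq T2. isMu M"
proof -
  define e where "e = e_q((2,T2) := E)"
  have v: "vq e" using E by (simp add: e_def vq_upd del: fun_upd_apply)
  let ?\<phi> = "Imp (Eq (Var 2 T2 \<cdot> V1 0) Zero) (Eq (V1 0 \<cdot> V 1) Zero)"
  let ?ax = "Imp (Forall 0 T1 (Exists 1 TN ?\<phi>)) (Exists 3 T2 (Forall 0 T1 (fm_subst 1 TN (Var 3 T2 \<cdot> Var 0 T1) ?\<phi>)))"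
  have ax: "sat e ?ax"
    by (rule ax_qsat[OF QF_AC_1_0 _ _ _ v]) (simp_all add: low_tm_def low_bound_def)
  have v1: "vq (e((0,T1) := f))" if "f \<in> Dq T1" for f using v that by (simp add: vq_upd del: fun_upd_apply)
  have 1: "sat (e((0,T1) := f, (1,TN) := no n)) ?\<phi> \<longleftrightarrow> (nv (ap E f) = 0 \<longrightarrow> fn f n = 0)" if "f \<in> Dq T1" for f n
    using v1[OF that] by (simp add: sat_Eq evN_App evN_def[of _ "Var 2 T2 \<cdot> _"] del: sat.simps(2) fun_upd_apply) (simp add: e_def)
  have "\<forall>f\<in>Dq T1. \<exists>n. nv (ap E f) = 0 \<longrightarrow> fn f n = 0" using E(2) by (auto simp: isE_def)
  then have "sat e (Forall 0 T1 (Exists 1 TN ?\<phi>))"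
    using 1 by (simp add: sat_ExistsN del: sat.simps(2,3) sat_derived(5) fun_upd_apply)
  then have "sat e (Exists 3 T2 (Forall 0 T1 (fm_subst 1 TN (Var 3 T2 \<cdot> Var 0 T1) ?\<phi>)))" using ax by simp
  then obtain M where M: "M \<in> Dq T2" "\<And>f. f \<in> Dq T1 \<Longrightarrow> sat (e((3,T2) := M, (0,T1) := f)) (fm_subst 1 TN (Var 3 T2 \<cdot> Var 0 T1) ?\<phi>)"
    by (auto simp del: fun_upd_apply sat.simps(2,3) fm_subst.simps)
  have "nv (ap E f) = 0 \<longrightarrow> fn f (nv (ap M f)) = 0" if f: "f \<in> Dq T1" for f
  proof -
    have v2: "vq (e((3,T2) := M, (0,T1) := f))" using v f M by (simp add: vq_upd del: fun_upd_apply)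
    have s: "sat (e((3,T2) := M, (0,T1) := f)) (Imp (Eq (Var 2 T2 \<cdot> V1 0) Zero) (Eq (V1 0 \<cdot> (Var 3 T2 \<cdot> V1 0)) Zero))"
      using M(2)[OF f] by (simp del: fun_upd_apply sat.simps)
    have t: "tN (V1 0 \<cdot> (Var 3 T2 \<cdot> V1 0))" by simp
    show ?thesis using s t v2
      by (simp add: sat_Eq evN_App evN_def[of _ "Var 2 T2 \<cdot> _"] evN_def[of _ "Var 3 T2 \<cdot> _"] del: sat.simps(2) fun_upd_apply)
        (simp add: e_def)
  qed
  then have "isMu M" using E(2) by (auto simp: isMu_def isE_def)
  then show ?thesis using M(1) by blast
qed

definition closeP :: "tm set \<Rightarrow> tm set \<Rightarrow> hnat \<Rightarrow> hnat \<Rightarrow> bool" where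
  "closeP F X n m \<longleftrightarrow> (\<exists>c. posS F (rc c) \<and> \<bar>Rl X - hr (qv c)\<bar> < hr (qn m * i2 (n + 1 + 1)))"

lemma qv_dist_code:
  "tN m \<Longrightarrow> vq e \<Longrightarrow> qv (evN e (dist_code m)) = qn (evN e m) * i2 (nv (e (3,TN)) + 1 + 1)"
  using qv_invpow2[of "evN e m" "nv (e (3,TN)) + 1 + 1"] by (simp add: dist_code_def hS_eq del: qn_simps hpow2_simps)

lemma tN_dist_code: "tN m \<Longrightarrow> tN (dist_code m)"
  by (simp add: dist_code_def)

lemma sat_close:
  assumes e: "vq e" "isfun (e (0,TRR))" "e (1,T1) \<in> Reals" and m: "tN m" "below 10 m"
  shows "sat e (close_fm m) \<longleftrightarrow> closeP (e (0,TRR)) (e (1,T1)) (nv (e (3,TN))) (evN e m)"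
proof -
  let ?e = "\<lambda>c. e((10,TN) := no c)"
  have v: "vq (?e c)" for c using e by simp
  have r: "ev (?e c) (rconst (V 10)) = rc c" "ev (?e c) (V1 1) = e (1,T1)" for c
    using ev_rconst[of "V 10" "?e c"] v by simp_all
  have i: "isreal (rc c)" for c using rc_real Reals_isreal by blast
  have em: "evN (?e c) m = evN e m" for c using m by (simp add: evN_def)
  have 1: "sat (?e c) (pos_set (Var 0 TRR) (rconst (V 10)) (Suc 10)) \<longleftrightarrow> posS (e (0,TRR)) (rc c)" for c
    by (subst sat_pos) (use v i r e in \<open>simp_all add: Reals_isreal del: ev.simps\<close>)
  have b: "below (Suc 10) (rconst (dist_code m))" using below_mono[OF m(2), of "Suc 10"] by (simp add: dist_code_def)
  have q: "Rl (ev (?e c) (rconst (dist_code m))) = hr (qn (evN e m) * i2 (nv (e (3,TN)) + 1 + 1))" for c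
    using real_rconst(2)[OF tN_dist_code[OF m(1)] v[of c]] qv_dist_code[OF m(1) v[of c]] em by simp
  have 2: "sat (?e c) ((rdist (V1 1) (rconst (V 10)) <\<^sub>R rconst (dist_code m)) (Suc 10)) \<longleftrightarrow>
     \<bar>Rl (e (1,T1)) - hr (qv c)\<bar> < hr (qn (evN e m) * i2 (nv (e (3,TN)) + 1 + 1))" for c
  proof -
    have d: "isreal (ev (?e c) (rdist (V1 1) (rconst (V 10))))" "Rl (ev (?e c) (rdist (V1 1) (rconst (V 10)))) = \<bar>Rl (e (1,T1)) - hr (qv c)\<bar>"
    proof -
      have t: "t1 (V1 1)" "t1 (rconst (V 10))" by simp_all
      have ir: "isreal (ev (?e c) (V1 1))" "isreal (ev (?e c) (rconst (V 10)))"
        unfolding r using i e Reals_isreal by blast+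
      note rd = rdist_sem[OF t v[of c] ir]
      show "isreal (ev (?e c) (rdist (V1 1) (rconst (V 10))))" by (rule rd(1))
      show "Rl (ev (?e c) (rdist (V1 1) (rconst (V 10)))) = \<bar>Rl (e (1,T1)) - hr (qv c)\<bar>"
        using rd(2) by (simp only: r rc_real)
    qed
    show ?thesis
      by (subst sat_rless) (use d q b v m tN_dist_code real_rconst(1) in \<open>simp_all del: ev.simps fun_upd_apply\<close>)
  qed
  show ?thesis unfolding close_fm_def d_simps closeP_def sat_ExistsN sat_derived(2) 1 2 ..
qed

text \<open>The predicate fails at 0, as no distance is negative, and holds for a large
  \<open>m\<close>, as the set is nonempty. Without a crossing it would fail everywhere by
  induction; the induction is legitimate because \<open>E\<close> makes the predicate
  internal.\<close>

lemma closeP_exists: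
  assumes F: "F \<in> Dq TRR" "isfun F" "openF F" "Y \<in> Reals" "posS F Y" and X: "X \<in> Reals" and E: "E \<in> Dq T2" "isE E"
  shows "\<exists>m. closeP F X n (m + 1) \<and> \<not> closeP F X n m"
proof (rule ccontr)
  assume no: "\<nexists>m. closeP F X n (m + 1) \<and> \<not> closeP F X n m"
  define e where "e = e_q((0,TRR) := F, (1,T1) := X, (2,T2) := E, (3,TN) := no n)"
  have v: "vq e" using F X E by (simp add: e_def Reals_def vq_upd del: fun_upd_apply)
  have s: "sat (e((4,TN) := no m)) (close_fm (V 4)) \<longleftrightarrow> closeP F X n m" for m
    using sat_close[of "e((4,TN) := no m)" "V 4"] v F X by (simp add: e_def)
  have "evN (e((4,TN) := no m)) (char_tm (Var 2 T2) (close_fm (V 4))) = 0 \<longleftrightarrow> closeP F X n m" for m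
    using sat_char[OF arith_close(1), of "e((4,TN) := no m)" 2] s[of m] v E by (simp add: e_def)
  moreover have "Int1 (\<lambda>m. evN (e((4,TN) := no m)) (char_tm (Var 2 T2) (close_fm (V 4))))"
    using Int1_lam[OF tN_char[OF arith_close(1)] v, of 4 2] by simp
  ultimately have I: "IntP (closeP F X n)" unfolding IntP_def by (intro exI conjI) auto
  have nc: "\<not> closeP F X n m" for m
  proof (induction m rule: hnat_induct)
    case internal then show ?case using I by auto
  next
    case zero
    have "\<not> \<bar>z\<bar> < 0" for z :: hreal using abs_ge_zero[of z] by (simp add: not_less)
    then show ?case by (simp add: closeP_def)
  next
    case (step m) then show ?case using no by blast
  qed
  obtain k where "\<forall>Z\<in>Reals. \<bar>Rl Y - Rl Z\<bar> < hr (i2 k) \<longrightarrow> posS F Z" using F by (auto simp: openF_def ballS_def)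
  \<comment> \<open>Here \<open>Y\<close> serves both as centre and as point of the set, with radius
    1; the result is some rational point of the set.\<close>
  then obtain c where c: "posS F (rc c)" using open_dense[OF F(2,3,4,4,5), of "hr (i2 0)"] by auto
  obtain q where q: "\<bar>Rl X - hr (qv q)\<bar> < hr 1" using rational_approx[OF X, of "hr 1"] by auto
  define B where "B = \<bar>qv q - qv c\<bar> + 1"
  have "\<bar>Rl X - hr (qv c)\<bar> \<le> \<bar>Rl X - hr (qv q)\<bar> + \<bar>hr (qv q) - hr (qv c)\<bar>"
    using abs_triangle_ineq[of "Rl X - hr (qv q)" "hr (qv q) - hr (qv c)"] by simp
  also have "\<dots> < hr B" using q by (simp add: B_def hr_abs)
  finally have B: "\<bar>Rl X - hr (qv c)\<bar> < hr B" .
  obtain m where m: "B / i2 (n + 1 + 1) < qn m" using hq_arch by blast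
  then have "B < qn m * i2 (n + 1 + 1)" by (simp add: pos_divide_less_eq)
  then have "\<bar>Rl X - hr (qv c)\<bar> < hr (qn m * i2 (n + 1 + 1))" using B hr_less order.strict_trans by blast
  then show False using nc[of m] c by (auto simp: closeP_def)
qed

text \<open>The search operator finds, for each \<open>n\<close>, a grid point that bounds the
  distance from \<open>X\<close> to all rational points of the set from below and is within one grid
  step of the distance to one of them. Playing these two properties at different indices against
  each other gives the Cauchy rate; with \<open>open_dense\<close> they give the infimum over all
  points of the set.\<close>

lemma dist_exists:
  assumes F: "F \<in> Dq TRR" "isfun F" "openF F" and Y: "Y0 \<in> Reals" "posS F Y0" and E: "E \<in> Dq T2" "isE E"
  shows "\<exists>D\<in>Dq TRR. isfun D \<and> (\<forall>X\<in>Reals. infS X (posS F) (ap D X))"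
proof -
  obtain M where M: "M \<in> Dq T2" "isMu M" using mu_exists[OF E] by blast
  define e where "e = e_q((0,TRR) := F, (2,T2) := E, (5,T2) := M)"
  have v: "vq e" using F E M by (simp add: e_def vq_upd del: fun_upd_apply)
  let ?c = "char_tm (Var 2 T2) step_fm"
  let ?m = "Var 5 T2 \<cdot> lamN 4 ?c"
  have ct: "well_typed ?c" "ty_of ?c = TN" "bnd 200 ?c" using char_typed[OF arith_close(2), of 2] by auto
  have tc: "tN ?c" using tN_char[OF arith_close(2)] by simp
  have tm: "tN ?m" using ct bnd_mono[of 200 ?c 247] by (simp add: tN_def)
  have td: "tN (dist_code ?m)" using tN_dist_code tm by blast
  have td2: "bnd 240 (dist_code ?m)" using ct bnd_mono[of 200 ?c 237] by (simp add: dist_code_def)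
  have wd: "well_typed (dist_code ?m)" "ty_of (dist_code ?m) = TN" using td by (auto simp: tN_def)
  define D where "D = ev e dist_tm"
  have D: "D \<in> Dq TRR" unfolding D_def dist_tm_def
    using ev_Dq[of "lam 1 T1 (lamN 3 (dist_code ?m))" e] v wd bnd_mono[OF td2, of 293] by simp
  have val: "\<exists>m. seq (ap D X) n = qn m * i2 (n + 1 + 1) \<and> closeP F X n (m + 1) \<and> \<not> closeP F X n m" if X: "X \<in> Reals" for X n
  proof -
    let ?e = "e((1,T1) := X, (3,TN) := no n)"
    have ve: "vq ?e" using Reals_vq[OF v X] by simp
    have "ap (ap D X) (no n) = ev ?e (dist_code ?m)"
      unfolding D_def dist_tm_def using wd bnd_mono[OF td2, of 250] v X by (subst ev_lam2) (simp_all add: Reals_def)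
    then have s: "seq (ap D X) n = qn (evN ?e ?m) * i2 (n + 1 + 1)"
      using qv_dist_code[OF tm ve] by (simp add: seq_def fn_def evN_def)
    let ?f = "ev ?e (lamN 4 ?c)"
    have f: "?f \<in> Dq T1" using lamN_Dq[OF tc ve] .
    have fm: "fn ?f m = 0 \<longleftrightarrow> closeP F X n (m + 1) \<and> \<not> closeP F X n m" for m
    proof -
      have v4: "vq (?e((4,TN) := no m))" using ve by simp
      have "fn ?f m = 0 \<longleftrightarrow> sat (?e((4,TN) := no m)) step_fm"
        unfolding fn_lam[OF tc ve] using sat_char[OF arith_close(2) _ v4, of 2] E by (simp add: e_def)
      also have "\<dots> \<longleftrightarrow> closeP F X n (m + 1) \<and> \<not> closeP F X n m"
        using sat_close[OF v4, of "V 4"] sat_close[OF v4, of "Succ \<cdot> V 4"] v4 F X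
        by (simp add: step_fm_def hS_eq del: fun_upd_apply) (simp add: e_def)
      finally show ?thesis .
    qed
    have "evN ?e ?m = nv (ap M ?f)" by (simp add: evN_def) (simp add: e_def)
    moreover have "fn ?f (nv (ap M ?f)) = 0"
    proof -
      have "\<exists>m. fn ?f m = 0" unfolding fm by (rule closeP_exists[OF F Y X E])
      then show ?thesis using M(2) f unfolding isMu_def by blast
    qed
    ultimately show ?thesis using s fm[of "nv (ap M ?f)"] by (intro exI[of _ "nv (ap M ?f)"]) simp
  qed
  have up: "closeP F X n (m + 1) \<Longrightarrow> \<exists>c. posS F (rc c) \<and> \<bar>Rl X - hr (qv c)\<bar> < hr (qn m * i2 (n + 1 + 1)) + hr (i2 (n + 1 + 1))" for X n m
    by (simp add: closeP_def distrib_right)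
  have lo: "\<not> closeP F X n m \<Longrightarrow> posS F (rc c) \<Longrightarrow> hr (qn m * i2 (n + 1 + 1)) \<le> \<bar>Rl X - hr (qv c)\<bar>" for X n m c
    by (auto simp: closeP_def not_less)
  have A: "\<exists>c. posS F (rc c) \<and> \<bar>Rl X - hr (qv c)\<bar> < hr (seq (ap D X) n) + hr (i2 (n + 1 + 1))"
    "posS F (rc c) \<Longrightarrow> hr (seq (ap D X) n) \<le> \<bar>Rl X - hr (qv c)\<bar>" if X: "X \<in> Reals" for X n c
  proof -
    obtain m where m: "seq (ap D X) n = qn m * i2 (n + 1 + 1)" "closeP F X n (m + 1)" "\<not> closeP F X n m" using val[OF X] by blast
    show "\<exists>c. posS F (rc c) \<and> \<bar>Rl X - hr (qv c)\<bar> < hr (seq (ap D X) n) + hr (i2 (n + 1 + 1))"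
      unfolding m(1) by (rule up[OF m(2)])
    show "posS F (rc c) \<Longrightarrow> hr (seq (ap D X) n) \<le> \<bar>Rl X - hr (qv c)\<bar>" unfolding m(1) by (rule lo[OF m(3)])
  qed
  have i4: "i2 (n + 1 + 1) * 2 * 2 = i2 n" for n by (simp only: i2_Suc)
  have real: "isreal (ap D X)" if X: "X \<in> Reals" for X
    unfolding isreal_def
  proof (intro allI)
    fix n i
    have m: "i2 (n + i + 1 + 1) \<le> i2 (n + 1 + 1)"
      by (rule i2_mono, unfold le_iff_add', rule exI[of _ i]) (simp add: ac_simps)
    obtain c where c: "posS F (rc c)" "\<bar>Rl X - hr (qv c)\<bar> < hr (seq (ap D X) n) + hr (i2 (n + 1 + 1))" using A(1)[OF X] by blast
    obtain c' where c': "posS F (rc c')" "\<bar>Rl X - hr (qv c')\<bar> < hr (seq (ap D X) (n + i)) + hr (i2 (n + i + 1 + 1))" using A(1)[OF X] by blast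
    have "hr (seq (ap D X) (n + i)) < hr (seq (ap D X) n + i2 (n + 1 + 1))" "hr (seq (ap D X) n) < hr (seq (ap D X) (n + i) + i2 (n + i + 1 + 1))"
      using A(2)[OF X c(1), of "n + i"] A(2)[OF X c'(1), of n] c(2) c'(2) by simp_all
    then have "seq (ap D X) (n + i) < seq (ap D X) n + i2 (n + 1 + 1)" "seq (ap D X) n < seq (ap D X) (n + i) + i2 (n + i + 1 + 1)"
      by (simp_all only: hr_less)
    then show "\<bar>seq (ap D X) n - seq (ap D X) (n + i)\<bar> < i2 n"
      using m i4[of n] i2_pos[of "n + 1 + 1"] unfolding abs_less_iff by linarith
  qed
  have ap: "\<bar>Rl (ap D X) - hr (seq (ap D X) n)\<bar> \<le> hr (i2 n)" if "X \<in> Reals" for X n using Rl_approx[OF real[OF that]] .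
  have inf: "infS X (posS F) (ap D X)" if X: "X \<in> Reals" for X
    unfolding infS_def
  proof (intro conjI ballI impI)
    fix Y assume Y: "Y \<in> Reals" "posS F Y"
    show "Rl (ap D X) \<le> \<bar>Rl X - Rl Y\<bar>"
    proof (rule hreal_le_eps[where c=2])
      fix n
      have "\<bar>Rl X - Rl Y\<bar> < \<bar>Rl X - Rl Y\<bar> + hr (i2 n)" by simp
      then obtain c where c: "posS F (rc c)" "\<bar>Rl X - hr (qv c)\<bar> < \<bar>Rl X - Rl Y\<bar> + hr (i2 n)"
        using open_dense[OF F(2,3) X Y] by blast
      then show "Rl (ap D X) \<le> \<bar>Rl X - Rl Y\<bar> + hr (2 * i2 n)"
        using A(2)[OF X c(1), of n] ap[OF X, of n] unfolding abs_le_iff[of "Rl (ap D X) - _"] hr_mult2 by linarith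
    qed simp
  next
    fix Z assume Z: "Z \<in> Reals" "\<forall>Y\<in>Reals. posS F Y \<longrightarrow> Rl Z \<le> \<bar>Rl X - Rl Y\<bar>"
    show "Rl Z \<le> Rl (ap D X)"
    proof (rule hreal_le_eps[where c=2])
      fix n
      obtain c where c: "posS F (rc c)" "\<bar>Rl X - hr (qv c)\<bar> < hr (seq (ap D X) n) + hr (i2 (n + 1 + 1))" using A(1)[OF X] by blast
      have "Rl Z \<le> \<bar>Rl X - hr (qv c)\<bar>" using Z(2) c(1) rc_real[of c] by auto
      moreover have "hr (i2 (n + 1 + 1)) \<le> hr (i2 n)" using i2_mono[of n "n + 1 + 1"] by (simp add: add.assoc)
      ultimately show "Rl Z \<le> Rl (ap D X) + hr (2 * i2 n)"
        using c(2) ap[OF X, of n] unfolding abs_le_iff[of "Rl (ap D X) - _"] hr_mult2 by linarith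
    qed simp
  qed
  have apR: "ap D X \<in> Reals" if "X \<in> Reals" for X
    using real[OF that] Reals_ap[OF D] that by (simp add: Reals_def)
  \<comment> \<open>The approximations may differ for different names of one real, but the value is
    an infimum that depends only on the real, so it is unique.\<close>
  have le: "Rl (ap D X) \<le> Rl (ap D Y)" if XY: "X \<in> Reals" "Y \<in> Reals" "Rl X = Rl Y" for X Y
    using inf[OF XY(1)] inf[OF XY(2)] apR[OF XY(1)] unfolding infS_def XY(3) by blast
  have "Rl (ap D X) = Rl (ap D Y)" if XY: "X \<in> Reals" "Y \<in> Reals" "Rl X = Rl Y" for X Y
    using le[OF XY] le[OF XY(2,1) XY(3)[symmetric]] by (rule order.antisym)
  then have "isfun D" using real unfolding isfun_def by blast
  then show ?thesis using D inf by blast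
qed

end

subsection \<open>The reversal\<close>

text \<open>With a number function as variable \<open>0\<close>, the count term at \<open>n\<close> computes the minimum of \<open>n\<close> and the
  first zero of the function.\<close>

definition count_step :: tm where
  "count_step = V 4 \<^bold>+ (Succ \<cdot> Zero \<^bold>- ((V 5 \<^bold>- V 4) \<^bold>+ (Succ \<cdot> Zero \<^bold>- V1 0 \<cdot> V 5)))"
definition count_tm :: "tm \<Rightarrow> tm" where
  "count_tm n = Rec \<cdot> n \<cdot> Zero \<cdot> lamN 4 (lamN 5 count_step)"
text \<open>Variables 2 and 3 hold the representation \<open>G\<close> and the precision
  \<open>k\<close>. The inner abstraction is the sequence of the real built from \<open>f\<close>,
  with the count taken at \<open>n + 1\<close> to meet the strict rate of convergence.\<close>

definition test_fm :: fm where
  "test_fm = qle (Var 2 TRR \<cdot> lamN 1 (qinvpow2 (count_tm (Succ \<cdot> V 1))) \<cdot> V 3) (qtwice_invpow2 (V 3)) 0"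
text \<open>The double subtraction normalises the characteristic value to 0 or 1.\<close>

definition test_tm :: tm where
  "test_tm = lam 0 T1 (Succ \<cdot> Zero \<^bold>- (Succ \<cdot> Zero \<^bold>- char_tm (Var 9 T2) test_fm))"

lemma arith_test: "arith test_fm 200" "quantifier_free test_fm"
  by (simp_all add: test_fm_def qle_def le_nat_def eq0_def qinvpow2_def qtwice_invpow2_def count_tm_def count_step_def)

context henkin begin

definition cc :: "tm set \<Rightarrow> hnat \<Rightarrow> hnat" where
  "cc f n = hrec (ev (e_q((0,T1) := f)) (lamN 4 (lamN 5 count_step))) n 0"

lemma tN_count: "tN count_step" "tN n \<Longrightarrow> tN (count_tm n)"
  by (simp_all add: count_step_def count_tm_def)

lemma evN_count: "vq e \<Longrightarrow> tN n \<Longrightarrow> evN e (count_tm n) = cc (e (0,T1)) (evN e n)"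
proof -
  assume a: "vq e" "tN n"
  have "ev e (lamN 4 (lamN 5 count_step)) = ev (e_q((0,T1) := e (0,T1))) (lamN 4 (lamN 5 count_step))"
    by (rule ev_cong) (auto simp: count_step_def)
  then show ?thesis unfolding count_tm_def cc_def using a by (simp add: evN_rec)
qed

lemma Int1_fn: "f \<in> Dq T1 \<Longrightarrow> Int1 (fn f)"
  unfolding Int1_def fn_def by blast

context
  fixes f assumes f: "f \<in> Dq T1"
begin

lemma vf: "vq (e_q((0,T1) := f))"
  using f by (simp add: vq_upd del: fun_upd_apply)

lemma Int1_cc: "Int1 (cc f)"
  using Int1_lam[OF tN_count(2)[of "V 1"] vf, of 1] evN_count[OF vq_updN[OF vf], of "V 1"] by simp

lemma cc_rec: "cc f 0 = 0" "cc f (n + 1) = cc f n + (1 - ((n - cc f n) + (1 - fn f n)))"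
proof -
  let ?e = "e_q((0,T1) := f)"
  have z: "ev ?e (lamN 4 (lamN 5 count_step)) \<in> Dq (TN \<leadsto> T1)" using lam2_Dq[OF tN_count(1) vf] .
  show "cc f 0 = 0" using z by (simp add: cc_def del: fun_upd_apply)
  have "vq (?e((4,TN) := no x, (5,TN) := no y))" for x y using vf by (simp del: fun_upd_apply)
  then have "evN (?e((4,TN) := no x, (5,TN) := no y)) count_step = x + (1 - ((y - x) + (1 - fn f y)))" for x y
    unfolding count_step_def by (simp add: evN_App hS_eq del: fun_upd_apply) simp
  then have "cc f (hS n) = cc f n + (1 - ((n - cc f n) + (1 - fn f n)))"
    using z step_lam[OF tN_count(1) vf] by (simp add: cc_def del: fun_upd_apply)
  then show "cc f (n + 1) = cc f n + (1 - ((n - cc f n) + (1 - fn f n)))" by (simp add: hS_eq)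
qed

text \<open>The increment is 1 just when both truncated terms vanish, that is, when the count has
  kept up with \<open>n\<close> and \<open>f\<close> is not 0 at \<open>n\<close>.\<close>

lemma cc_step: "cc f n \<le> n \<Longrightarrow> cc f (n + 1) = (if cc f n = n \<and> fn f n \<noteq> 0 then n + 1 else cc f n)"
proof -
  assume le: "cc f n \<le> n"
  have 0: "1 - x = (if x = 0 then 1 else 0)" for x :: hnat by simp
  have "(n - cc f n) + (1 - fn f n) = 0 \<longleftrightarrow> cc f n = n \<and> fn f n \<noteq> 0"
    using le by (auto simp: 0)
  then show ?thesis unfolding cc_rec 0[of "_ + _"] by auto
qed

text \<open>A count can fall behind only by stopping, and it stops only at a zero of
  \<open>f\<close>. Together with \<open>cc_zero\<close> this makes it the minimum of
  \<open>n\<close> and the first zero.\<close>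

lemma cc_inv: "cc f n \<le> n \<and> (cc f n < n \<longrightarrow> fn f (cc f n) = 0)"
proof (induction n rule: hnat_induct)
  case internal
  have "Int1 (\<lambda>n. fn f (cc f n))" using Int1_intros_ok(6)[OF Int1_fn[OF f] Int1_cc] .
  then show ?case by (intro IntP_intros Int1_intros Int1_cc)
next
  case zero show ?case by (simp add: cc_rec)
next
  case (step n)
  have lt: "x \<le> n \<Longrightarrow> x \<le> n + 1" for x by (simp add: add_increasing2)
  show ?case using step unfolding cc_step[OF conjunct1[OF step]]
    by (cases "cc f n = n") (auto simp: lt)
qed

lemma cc_zero: "fn f i = 0 \<Longrightarrow> cc f n \<le> i"
proof (induction n rule: hnat_induct)
  case internal show ?case by (intro IntP_intros Int1_intros Int1_cc)
next
  case zero show ?case by (simp add: cc_rec)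
next
  case (step n)
  then have le: "cc f n \<le> i" by blast
  show ?case
  proof (cases "cc f n = n \<and> fn f n \<noteq> 0")
    case True
    then have "n \<noteq> i" using step by auto
    then have "n < i" using True le by auto
    then show ?thesis using True cc_inv[of n] by (simp add: cc_step hnat_less_iff)
  next
    case False show ?thesis unfolding cc_step[OF conjunct1[OF cc_inv]] if_not_P[OF False] by (rule le)
  qed
qed

lemma cc_mono: "cc f n \<le> cc f (n + i)"
proof (induction i rule: hnat_induct)
  case internal
  have "Int1 (\<lambda>i. n + i)" by (intro Int1_intros)
  from Int1_intros_ok(6)[OF Int1_cc this] show ?case by (intro IntP_intros Int1_intros)
next
  case (step i)
  have "cc f (n + i) \<le> cc f (n + i + 1)" using cc_inv[of "n + i"] by (simp add: cc_step)
  then show ?case using step by (simp add: add.assoc)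
qed simp

lemma cc_stable: "cc f n < n \<Longrightarrow> cc f (n + i) = cc f n"
proof (induction i rule: hnat_induct)
  case internal
  have "Int1 (\<lambda>i. n + i)" by (intro Int1_intros)
  from Int1_intros_ok(6)[OF Int1_cc this] show ?case by (intro IntP_intros Int1_intros)
next
  case (step i)
  then have "cc f (n + i) = cc f n" by blast
  moreover have "cc f n < n + i" using step.prems by (rule order.strict_trans2) simp
  ultimately have e: "cc f (n + i) = cc f n" and ne: "\<not> (cc f (n + i) = n + i \<and> fn f (n + i) \<noteq> 0)"
    by auto
  have "cc f (n + i + 1) = cc f n" unfolding cc_step[OF conjunct1[OF cc_inv]] if_not_P[OF ne] by (rule e)
  then show ?case by (simp add: add.assoc)
qed simp

definition xf :: "tm set" where "xf = ev (e_q((0,T1) := f)) (lamN 1 (qinvpow2 (count_tm (Succ \<cdot> V 1))))"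

lemma seq_xf: "seq xf n = i2 (cc f (n + 1))"
proof -
  have t: "tN (count_tm (Succ \<cdot> V 1))" by (rule tN_count) simp
  then have "fn xf n = evN ((e_q((0,T1) := f))((1,TN) := no n)) (qinvpow2 (count_tm (Succ \<cdot> V 1)))"
    unfolding xf_def using vf by (subst fn_lam) simp_all
  then show ?thesis unfolding seq_def using t vq_updN[OF vf]
    by (simp add: qv_pow2_tms evN_count hS_eq del: fun_upd_apply) simp
qed

lemma xf_real: "xf \<in> Reals"
proof -
  have t: "tN (count_tm (Succ \<cdot> V 1))" by (rule tN_count) simp
  have "xf \<in> Dq T1" unfolding xf_def using t vf by (intro lamN_Dq) simp_all
  moreover have "\<bar>i2 (cc f (n + 1)) - i2 (cc f (n + i + 1))\<bar> < i2 n" for n i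
  proof (cases "cc f (n + 1) < n + 1")
    case True
    have "n + i + 1 = (n + 1) + i" by (simp add: ac_simps)
    then show ?thesis using cc_stable[OF True, of i] by simp
  next
    \<comment> \<open>The count has not stopped before \<open>n + 1\<close>, so both terms lie
      between 0, exclusively, and \<open>2^-(n+1)\<close>. This is where the index
      \<open>n + 1\<close> gives a difference strictly below \<open>2^-n\<close>.\<close>
    case False
    then have e: "cc f (n + 1) = n + 1" using cc_inv[of "n + 1"] by auto
    have "n + 1 \<le> cc f (n + i + 1)" using cc_mono[of "n + 1" i] e by (simp add: ac_simps)
    then have "i2 (cc f (n + i + 1)) \<le> i2 (n + 1)" by (rule i2_mono)
    then show ?thesis unfolding e abs_less_iff
      using i2_pos[of "cc f (n + i + 1)"] i2_pos[of "n + 1"] i2_Suc[of n] by linarith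
  qed
  ultimately show ?thesis by (simp add: Reals_def isreal_def seq_xf)
qed

text \<open>A zero at \<open>i\<close> keeps the whole sequence at or above \<open>2^-i\<close>.
  Without a zero the count never stops, and the sequence is \<open>2^-(n+1)\<close>.\<close>

lemma Rl_xf: "Rl xf = 0 \<longleftrightarrow> \<not> (\<exists>n. fn f n = 0)"
proof
  assume r: "Rl xf = 0"
  show "\<not> (\<exists>n. fn f n = 0)"
  proof
    assume "\<exists>n. fn f n = 0"
    then obtain i where "fn f i = 0" ..
    then have "i2 i \<le> seq xf n" for n unfolding seq_xf by (intro i2_mono cc_zero)
    then have "hr (i2 i) \<le> Rl xf" unfolding hr_def Rl_def
      using isreal_cauchy[OF Reals_isreal[OF xf_real]] by (intro lim_mono) auto
    moreover have "0 < hr (i2 i)" by simp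
    ultimately show False using r by linarith
  qed
next
  assume n: "\<not> (\<exists>n. fn f n = 0)"
  then have c: "cc f n = n" for n using cc_inv[of n] by auto
  have "\<bar>Rl xf\<bar> \<le> 0"
  proof (rule hreal_le_eps[where c=2])
    fix n
    have "seq xf n \<le> i2 n" unfolding seq_xf c by (rule i2_mono) simp
    then have "hr (seq xf n) \<le> hr (i2 n)" "0 \<le> hr (seq xf n)" using hr_le[of 0 "seq xf n"] by (simp_all add: seq_xf less_imp_le)
    then show "\<bar>Rl xf\<bar> \<le> 0 + hr (2 * i2 n)"
      using Rl_approx[OF Reals_isreal[OF xf_real], of n] unfolding abs_le_iff hr_mult2 by linarith
  qed simp
  then show "Rl xf = 0" by simp
qed

end

text \<open>The precision is chosen with \<open>4 * 2^-k\<close> below the value of \<open>G\<close>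
  at 0. Approximation \<open>k\<close> errs by at most \<open>2^-k\<close>, so it is at most
  \<open>2^-k\<close> where \<open>G\<close> vanishes and above \<open>3 * 2^-k\<close> at the real
  0; the threshold \<open>2 * 2^-k\<close> separates the two cases.\<close>

lemma exists_two_if_zero_set:
  assumes G: "G \<in> Dq TRR" "isfun G" "repS G (\<lambda>X. Rl X = 0)"
  shows "\<exists>E\<in>Dq T2. isE E \<and> (\<forall>f\<in>Dq T1. nv (ap E f) = 0 \<or> nv (ap E f) = 1)"
proof -
  obtain z where z: "qv z = 0" using qv_surj by blast
  have rz: "rc z \<in> Reals" "Rl (rc z) = 0" using rc_real z by simp_all
  have "0 < Rl (ap G (rc z))" using G(3) rz by (auto simp: repS_def posS_def)
  then obtain j where j: "hr (i2 j) < Rl (ap G (rc z))" using hreal_arch by blast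
  define k where "k = j + 1 + 1"
  have k: "4 * hr (i2 k) < Rl (ap G (rc z))"
  proof -
    have "i2 j = i2 k * 2 * 2" unfolding k_def by (simp only: i2_Suc)
    then have "4 * i2 k = i2 j" by simp
    then show ?thesis using j unfolding hr_mult2(2)[symmetric] by (simp only:)
  qed
  define e where "e = e_q((2,TRR) := G, (3,TN) := no k)"
  have v: "vq e" using G by (simp add: e_def vq_upd del: fun_upd_apply)
  let ?c = "char_tm (Var 9 T2) test_fm"
  let ?t = "Succ \<cdot> Zero \<^bold>- (Succ \<cdot> Zero \<^bold>- ?c)"
  have tc: "tN ?c" using tN_char[OF arith_test(1)] by simp
  have ct: "well_typed ?t" "ty_of ?t = TN" "bnd 240 ?t"
    using char_typed[OF arith_test(1), of 9] bnd_mono[of 200 ?c 240] by simp_all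
  define E where "E = ev e test_tm"
  have E: "E \<in> Dq T2" unfolding E_def test_tm_def
    using ev_Dq[of "lam 0 T1 ?t" e] v ct bnd_mono[OF ct(3), of 296] by simp
  have val: "nv (ap E f) = (if \<exists>n. fn f n = 0 then 0 else 1)" if f: "f \<in> Dq T1" for f
  proof -
    let ?e = "e((0,T1) := f)"
    have ve: "vq ?e" using v f by (simp add: vq_upd del: fun_upd_apply)
    have "ap E f = ev ?e ?t" unfolding E_def test_tm_def
      using v f ct bnd_mono[OF ct(3), of 290] by (subst ev_lam) simp_all
    then have "nv (ap E f) = evN ?e ?t" by (simp add: evN_def)
    also have "\<dots> = 1 - (1 - evN ?e ?c)" using tc ve by (simp add: hS_eq del: fun_upd_apply)
    also have "\<dots> = (if evN ?e ?c = 0 then 0 else 1)"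
    proof -
      have "1 - x = (if x = 0 then 1 else 0)" for x :: hnat by simp
      then show ?thesis by simp
    qed
    also have "evN ?e ?c = 0 \<longleftrightarrow> sat ?e test_fm" using sat_char[OF arith_test(1) _ ve] arith_test(2) by simp
    finally have 1: "nv (ap E f) = (if sat ?e test_fm then 0 else 1)" .
    have tcn: "tN (count_tm (Succ \<cdot> V 1))" by (rule tN_count) simp
    define xt where "xt = lamN 1 (qinvpow2 (count_tm (Succ \<cdot> V 1)))"
    have tl: "t1 xt"
      by (simp add: xt_def typd_def qinvpow2_def count_tm_def count_step_def)
    have tG: "t1 (Var 2 TRR \<cdot> xt)" by (rule typd_App[OF _ tl]) simp
    have x: "ev ?e xt = xf f"
      unfolding xf_def[OF f] xt_def by (rule ev_cong) (auto simp: qinvpow2_def count_tm_def count_step_def)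
    have g: "?e (2,TRR) = G" "nv (?e (3,TN)) = k" by (simp_all add: e_def)
    have "ev ?e (Var 2 TRR \<cdot> xt) = ap G (xf f)" by (simp only: ev.simps x g)
    then have "sat ?e test_fm \<longleftrightarrow> seq (ap G (xf f)) k \<le> 2 * i2 k"
      unfolding test_fm_def xt_def[symmetric] using ve tG g(2)
      by (simp add: sat_qs del: fun_upd_apply sat.simps ev.simps)
    also have "\<dots> \<longleftrightarrow> (\<exists>n. fn f n = 0)"
    proof -
      have xr: "xf f \<in> Reals" using xf_real[OF f] .
      then have "isreal (ap G (xf f))" using G(2) by (simp add: isfun_def)
      note a = Rl_approx[OF this, of k]
      show ?thesis
      proof (cases "\<exists>n. fn f n = 0")
        case True
        then have "Rl (xf f) \<noteq> 0" using Rl_xf[OF f] by blast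
        then have "0 \<le> Rl (ap G (xf f))" "\<not> 0 < Rl (ap G (xf f))"
          using G(3) xr unfolding repS_def posS_def by blast+
        then have "Rl (ap G (xf f)) = 0" by simp
        then have "hr (seq (ap G (xf f)) k) \<le> hr (2 * i2 k)"
          using a hr_pos[of "i2 k"] i2_pos[of k] unfolding abs_le_iff hr_mult2 by linarith
        then have "seq (ap G (xf f)) k \<le> 2 * i2 k" by (simp only: hr_le)
        then show ?thesis using True by blast
      next
        case False
        then have "Rl (xf f) = Rl (rc z)" using Rl_xf[OF f] rz by simp
        then have "Rl (ap G (xf f)) = Rl (ap G (rc z))" using G(2) xr rz(1) unfolding isfun_def by blast
        then have "hr (2 * i2 k) < hr (seq (ap G (xf f)) k)"
          using a k hr_pos[of "i2 k"] i2_pos[of k] unfolding abs_le_iff hr_mult2 by linarith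
        then have "2 * i2 k < seq (ap G (xf f)) k" by (simp only: hr_less)
        then show ?thesis using False by (simp add: not_le)
      qed
    qed
    finally show ?thesis using 1 by simp
  qed
  show ?thesis
  proof (rule bexI[OF _ E], intro conjI ballI)
    show "isE E" using val by (auto simp: isE_def)
    show "nv (ap E f) = 0 \<or> nv (ap E f) = 1" if "f \<in> Dq T1" for f using val[OF that] by auto
  qed
qed

text \<open>The absolute value represents the open set of nonzero reals, whose complement is
  \<open>{0}\<close>; both have boundary \<open>{0}\<close>, so this one function serves the
  reversals of all three equivalences.\<close>

lemma abs_fun:
  shows "ev e_q rabs_tm \<in> Dq TRR" "isfun (ev e_q rabs_tm)" "openF (ev e_q rabs_tm)"
    "X \<in> Reals \<Longrightarrow> nearS (ev e_q rabs_tm) X \<and> \<not> posS (ev e_q rabs_tm) X \<longleftrightarrow> Rl X = 0"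
proof -
  let ?F = "ev e_q rabs_tm"
  have R: "Rl (ap ?F X) = \<bar>Rl X\<bar>" "isreal (ap ?F X)" if "X \<in> Reals" for X
    using Rl_rabs isreal_rabs that by simp_all
  have pos: "posS ?F X \<longleftrightarrow> Rl X \<noteq> 0" if "X \<in> Reals" for X using R(1)[OF that] by (simp add: posS_def)
  show "?F \<in> Dq TRR" by (rule typd_Dq) (simp_all add: typd_def)
  show "isfun ?F" using R by (simp add: isfun_def)
  show "openF ?F" unfolding openF_def
  proof (intro conjI ballI impI)
    show "0 \<le> Rl (ap ?F X)" if "X \<in> Reals" for X using R that by simp
    fix X assume X: "X \<in> Reals" "posS ?F X"
    then have "0 < \<bar>Rl X\<bar>" using pos by simp
    then obtain k where k: "hr (i2 k) < \<bar>Rl X\<bar>" using hreal_arch by blast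
    have "posS ?F Y" if "Y \<in> Reals" "\<bar>Rl X - Rl Y\<bar> < hr (i2 k)" for Y
      using that k pos by (cases "Rl Y = 0") auto
    then show "ballS (posS ?F) X" by (auto simp: ballS_def)
  qed
  assume X: "X \<in> Reals"
  show "nearS ?F X \<and> \<not> posS ?F X \<longleftrightarrow> Rl X = 0"
  proof
    assume x: "Rl X = 0"
    have "\<exists>c. \<bar>Rl X - hr (qv c)\<bar> < hr (i2 k) \<and> posS ?F (rc c)" for k
    proof -
      \<comment> \<open>The rational \<open>2^-(k+1)\<close> is nonzero and inside the ball of
        radius \<open>2^-k\<close> around 0.\<close>
      obtain c where c: "qv c = i2 (k + 1)" using qv_surj by blast
      have "i2 (k + 1) < i2 k" using i2_Suc[of k] i2_pos[of "k + 1"] by linarith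
      then have "hr (i2 (k + 1)) < hr (i2 k)" "0 < hr (i2 (k + 1))" by simp_all
      moreover have "i2 (k + 1) \<noteq> 0" using i2_pos[of "k + 1"] by (metis less_irrefl)
      then have "posS ?F (rc c)" using pos[OF rc_real(1), of c] rc_real(2)[of c] c hr_eq[of "i2 (k + 1)" 0]
        by (simp del: hr_eq)
      moreover have "\<bar>Rl X - hr (qv c)\<bar> = hr (i2 (k + 1))" using x c i2_pos[of "k + 1"]
        by (simp add: hr_abs[symmetric] abs_of_pos)
      ultimately show ?thesis by (intro exI[of _ c]) simp
    qed
    then show "nearS ?F X \<and> \<not> posS ?F X" using x X pos by (simp add: nearS_def)
  qed (use pos[OF X] in auto)
qed

lemma reversal:
  assumes "existsS (bdS (zeroS (ev e_q rabs_tm))) \<or> existsS (bdS (posS (ev e_q rabs_tm)))"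
  shows "\<exists>E\<in>Dq T2. isE E \<and> (\<forall>f\<in>Dq T1. nv (ap E f) = 0 \<or> nv (ap E f) = 1)"
proof -
  have "repS G (bdS (zeroS (ev e_q rabs_tm))) = repS G (\<lambda>X. Rl X = 0)"
    "repS G (bdS (posS (ev e_q rabs_tm))) = repS G (\<lambda>X. Rl X = 0)" for G
    by (rule repS_cong, simp only: bd_iff[OF abs_fun(2,3)] abs_fun(4))+
  then obtain G where "G \<in> Dq TRR" "isfun G" "repS G (\<lambda>X. Rl X = 0)" using assms by (auto simp: existsS_def)
  then show ?thesis by (rule exists_two_if_zero_set)
qed

theorem targets_sat: "\<phi> \<in> targets \<Longrightarrow> sat e_q \<phi>"
proof -
  define E2 where "E2 \<longleftrightarrow> (\<exists>E\<in>Dq T2. isE E \<and> (\<forall>f\<in>Dq T1. nv (ap E f) = 0 \<or> nv (ap E f) = 1))"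
  note v = vq_e_q
  have two: "sat e_q (exists_two 0) \<longleftrightarrow> E2" unfolding E2_def by (rule sat_exists_two[OF v])
  have a: "sat e_q (stmt_a 0) \<longleftrightarrow> E2"
    unfolding sat_stmt_a[OF v] E2_def using reversal abs_fun(1-3) bd_exists(1) by blast
  have b: "sat e_q (stmt_b 0) \<longleftrightarrow> E2"
    unfolding sat_stmt_b[OF v] E2_def using reversal abs_fun(1-3) bd_exists(2) by blast
  have c: "sat e_q (stmt_c 0) \<longleftrightarrow> E2"
  proof
    assume "sat e_q (stmt_c 0)"
    then obtain B where B: "B \<in> Dq (TRR \<leadsto> TRR)" "\<forall>F\<in>Dq TRR. isfun F \<longrightarrow> isfun (ap B F)"
      "\<forall>F\<in>Dq TRR. isfun F \<longrightarrow> openF F \<longrightarrow> repS (ap B F) (bdS (zeroS F))"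
      unfolding sat_stmt_c[OF v] by blast
    have "ap B (ev e_q rabs_tm) \<in> Dq TRR" by (rule ap_Dq[OF B(1) abs_fun(1)]) simp_all
    then have "existsS (bdS (zeroS (ev e_q rabs_tm)))" unfolding existsS_def using B abs_fun(1-3) by blast
    then show E2 unfolding E2_def using reversal by blast
  next
    assume E2
    then show "sat e_q (stmt_c 0)" unfolding sat_stmt_c[OF v] E2_def using bd_functional by blast
  qed
  have d: "E2 \<Longrightarrow> sat e_q (stmt_d 0)" unfolding sat_stmt_d[OF v] E2_def using clos_exists(1) by blast
  have e: "E2 \<Longrightarrow> sat e_q (stmt_e 0)" unfolding sat_stmt_e[OF v] E2_def using clos_exists(2) by blast
  have f: "E2 \<Longrightarrow> sat e_q (stmt_f 0)" unfolding sat_stmt_f[OF v] E2_def using dist_exists by blast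
  assume "\<phi> \<in> targets"
  then show ?thesis unfolding targets_def sentence_def
    by (elim insertE emptyE; hypsubst; simp add: two a b c d e f)
qed

end

subsection \<open>From the countermodel to provability\<close>

definition ctm :: "(nat \<times> ty) set \<Rightarrow> ty \<Rightarrow> tm \<Rightarrow> bool" where
  "ctm W \<sigma> t \<longleftrightarrow> well_typed t \<and> ty_of t = \<sigma> \<and> bnd 290 t \<and> tm_vars t \<subseteq> W"

text \<open>Collects in one recursive check what the transfer to provability asks of a sentence:
  well-formedness, low names, bounded arities and, with an empty \<open>W\<close>, no free
  variables. It can then be settled by simplification along the definitions.\<close>

primrec chk :: "fm \<Rightarrow> (nat \<times> ty) set \<Rightarrow> bool" where
  "chk Bot W \<longleftrightarrow> True"
| "chk (Eq s t) W \<longleftrightarrow> ctm W TN s \<and> ctm W TN t"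
| "chk (Imp \<phi> \<psi>) W \<longleftrightarrow> chk \<phi> W \<and> chk \<psi> W"
| "chk (Forall n \<sigma> \<phi>) W \<longleftrightarrow> n < low_bound \<and> chk \<phi> (insert (n,\<sigma>) W)"

lemma chk_derived [simp]:
  "chk (Neg \<phi>) W \<longleftrightarrow> chk \<phi> W" "chk (And \<phi> \<psi>) W \<longleftrightarrow> chk \<phi> W \<and> chk \<psi> W" "chk (Or \<phi> \<psi>) W \<longleftrightarrow> chk \<phi> W \<and> chk \<psi> W"
  "chk (Iff \<phi> \<psi>) W \<longleftrightarrow> chk \<phi> W \<and> chk \<psi> W" "chk (Exists n \<sigma> \<phi>) W \<longleftrightarrow> n < low_bound \<and> chk \<phi> (insert (n,\<sigma>) W)"
  by (auto simp: Neg_def And_def Or_def Iff_def Exists_def)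

lemma chk_sound:
  "chk \<phi> W \<Longrightarrow> \<forall>v\<in>W. fst v < low_bound \<Longrightarrow> wf_fm \<phi> \<and> low_fm \<phi> \<and> bfm \<phi> \<and> free_vars \<phi> \<subseteq> W"
proof (induction \<phi> arbitrary: W)
  case (Eq s t) then show ?case by (auto simp: ctm_def low_tm_def)
next
  case (Imp a b)
  then show ?case using Imp.IH(1)[of W] Imp.IH(2)[of W] by auto
next
  case (Forall n \<sigma> a)
  then have "chk a (insert (n,\<sigma>) W)" "\<forall>v\<in>insert (n,\<sigma>) W. fst v < low_bound" "n < low_bound" by auto
  with Forall.IH[OF this(1,2)] show ?case by auto
qed simp

lemma ctm_simps [simp]:
  "ctm W \<sigma> (Var n \<tau>) \<longleftrightarrow> \<sigma> = \<tau> \<and> arity \<tau> \<le> 290 \<and> (n,\<tau>) \<in> W" "ctm W T1 (rconst q) \<longleftrightarrow> ctm W TN q"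
  "ctm W T1 (rdist x y) \<longleftrightarrow> ctm W T1 x \<and> ctm W T1 y" "ctm W TN (qinvpow2 q) \<longleftrightarrow> ctm W TN q" "ctm W TN qzero" "ctm W TN Zero"
  "ctm W TN (Succ \<cdot> t) \<longleftrightarrow> ctm W TN t"
  by (auto simp: ctm_def rdist_def qinvpow2_def qzero_def)

lemma ctm_App_simps [simp]:
  "ctm W T1 (Var n TRR \<cdot> x) \<longleftrightarrow> (n,TRR) \<in> W \<and> ctm W T1 x"
  "ctm W T1 (Var n (TN \<leadsto> T1) \<cdot> k) \<longleftrightarrow> (n,TN \<leadsto> T1) \<in> W \<and> ctm W TN k"
  "ctm W TN (V1 n \<cdot> k) \<longleftrightarrow> (n,T1) \<in> W \<and> ctm W TN k"
  "ctm W TN (Var n T2 \<cdot> x) \<longleftrightarrow> (n,T2) \<in> W \<and> ctm W T1 x"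
  "ctm W TRR (Var n (TRR \<leadsto> TRR) \<cdot> x) \<longleftrightarrow> (n,TRR \<leadsto> TRR) \<in> W \<and> ctm W TRR x"
  "ctm W T1 (Var n (TRR \<leadsto> TRR) \<cdot> y \<cdot> x) \<longleftrightarrow> (n,TRR \<leadsto> TRR) \<in> W \<and> ctm W TRR y \<and> ctm W T1 x"
  by (auto simp: ctm_def)

lemma chk_real:
  "ctm W T1 x \<Longrightarrow> d < 300 \<Longrightarrow> chk (is_real x d) W"
  "ctm W T1 x \<Longrightarrow> ctm W T1 y \<Longrightarrow> d < 300 \<Longrightarrow> chk ((x \<le>\<^sub>R y) d) W"
  "ctm W T1 x \<Longrightarrow> ctm W T1 y \<Longrightarrow> d < 300 \<Longrightarrow> chk ((x =\<^sub>R y) d) W"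
  "ctm W T1 x \<Longrightarrow> ctm W T1 y \<Longrightarrow> d < 300 \<Longrightarrow> chk ((x <\<^sub>R y) d) W"
  by (auto simp: is_real_def rle_def req_def rless_def qle_def qless_def le_nat_def less_nat_def eq0_def
      qinvpow2_def qtwice_invpow2_def low_bound_def ctm_def)

lemma targets_chk: "\<phi> \<in> targets \<Longrightarrow> chk \<phi> {}"
  unfolding targets_def sentence_def stmt_a_def stmt_b_def stmt_c_def stmt_d_def stmt_e_def stmt_f_def
    exists_two_def for_all_open_def for_all_closed_def
  by (elim insertE emptyE; hypsubst; simp add: chk_real low_bound_def eq0_def set_exists_def represents_def nonneg_fun_def
    is_real_fun_def open_rep_def is_open_set_def pos_set_def zero_set_def boundary_set_def closure_set_def
    limit_point_def interior_set_def ball_inside_def in_ball_def RM_open_def RM_closed_def is_inf_dist_def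
    is_real_functional_def real_fun_eq_def)

lemma targets_provable: "\<phi> \<in> targets \<Longrightarrow> RCA0_omega \<turnstile> \<phi>"
proof (rule ccontr)
  assume t: "\<phi> \<in> targets" and np: "\<not> RCA0_omega \<turnstile> \<phi>"
  have c: "wf_fm \<psi> \<and> low_fm \<psi> \<and> bfm \<psi> \<and> free_vars \<psi> \<subseteq> {}" if "\<psi> \<in> targets" for \<psi>
    using chk_sound[OF targets_chk[OF that]] by simp
  obtain R where "model R" "\<forall>e. valn e \<longrightarrow> \<not> tsat R e \<phi>"
    using henkin_model[OF np] c[OF t] unfolding model_def by blast
  then have "\<exists>R. model R \<and> (\<exists>\<phi>\<in>targets. \<forall>e. valn e \<longrightarrow> \<not> tsat R e \<phi>)" using t by blast
  \<comment> \<open>The model fixed by choice refutes some target, perhaps another one than \<phi>.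
    That suffices, because all targets are true in it by \<open>targets_sat\<close>.\<close>
  then have M: "model M0 \<and> (\<exists>\<phi>\<in>targets. \<forall>e. valn e \<longrightarrow> \<not> tsat M0 e \<phi>)"
    unfolding M0_def by (rule someI_ex)
  then interpret henkin by unfold_locales (simp add: ok_model_def)
  obtain \<psi> where \<psi>: "\<psi> \<in> targets" "\<not> tsat M0 e_high \<psi>" using M valn_e_high by blast
  have "sat (\<lambda>v. cl (e_high v)) \<psi>" using targets_sat[OF \<psi>(1)] by (simp add: e_q_def[abs_def])
  then show False using sat_cl[of \<psi> e_high] c[OF \<psi>(1)] valn_e_high \<psi>(2) by blast
qed

lemma derives_mono: "derives T \<Gamma> \<phi> \<Longrightarrow> T \<subseteq> T' \<Longrightarrow> derives T' \<Gamma> \<phi>"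
  by (induction rule: derives.induct) (blast intro: derives.intros)+

lemma provable_insert: "T \<turnstile> Imp \<chi> \<phi> \<Longrightarrow> insert \<chi> T \<turnstile> \<phi>"
  unfolding provable_def
  by (rule derives.ImpE[OF derives_mono[of T _ _ "insert \<chi> T"]]) (auto intro: derives.Axiom)

theorem theorem2p3:
  shows "RCA0_omega \<turnstile> sentence (stmt_a \<^bold>\<longleftrightarrow> exists_two)
       \<and> RCA0_omega \<turnstile> sentence (stmt_b \<^bold>\<longleftrightarrow> exists_two)
       \<and> RCA0_omega \<turnstile> sentence (stmt_c \<^bold>\<longleftrightarrow> exists_two)
       \<and> insert (sentence exists_two) RCA0_omega \<turnstile> sentence stmt_d
       \<and> insert (sentence exists_two) RCA0_omega \<turnstile> sentence stmt_e
       \<and> insert (sentence exists_two) RCA0_omega \<turnstile> sentence stmt_f"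
proof -
  have "RCA0_omega \<turnstile> Imp (sentence exists_two) (sentence s)" if "s \<in> {stmt_d, stmt_e, stmt_f}" for s
    using targets_provable[of "sentence (exists_two \<^bold>\<longrightarrow> s)"] that by (auto simp: targets_def sentence_def)
  then have "insert (sentence exists_two) RCA0_omega \<turnstile> sentence s" if "s \<in> {stmt_d, stmt_e, stmt_f}" for s
    using provable_insert that by blast
  moreover have "RCA0_omega \<turnstile> \<phi>" if "\<phi> \<in> targets" for \<phi> using that by (rule targets_provable)
  ultimately show ?thesis by (simp add: targets_def)
qed

end
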